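(* Let $\sigma>0$ and let $\mathbf{\Xi}_N$ be a (normalized) periodically banded GUE matrix of band width $b_N$, where $(b_N)$ is a sequence of nonnegative integers with $b_N/\sqrt N\to\infty$; that is, $\mathbf{\Xi}_N(j,k)=\frac{1}{\sqrt{\xi_N}}\mathbf{1}\{|j-k|_N\le b_N\}\mathbf{X}_N(j,k)$ with $\mathbf{X}_N\sim\mathrm{GUE}(N,\sigma^2)$, $|j-k|_N=\min(|j-k|,N-|j-k|)$ and $\xi_N=\min(2b_N+1,N)$. Fix $N_0\in\mathbb{N}$ and $\theta_1,\dots,\theta_{N_0+1}\in\mathbb{R}$. Let $\mathbf{E}_N^{(j,j)}$ be the matrix unit with a $1$ in coordinate $(j,j)$ and $\mathbf{J}_N$ the all-ones $N\times N$ matrix. Then the type $B$ distribution of the deformed random band matrix $$\mathbf{\Xi}_N+\sum_{j=1}^{N_0}\theta_j\mathbf{E}_N^{(j,j)}+\frac{\theta_{N_0+1}}{N}\mathbf{J}_N$$ is given by $$\Big(\tfrac{1}{2\pi\sigma^2}\sqrt{4\sigma^2-t^2}\,dt,\ 0\Big)\boxplus_B\Big(\delta_0,\ \sum_{j=1}^{N_0}\delta_{\theta_j}-N_0\delta_0\Big)\boxplus_B\big(\delta_0,\ \delta_{\theta_{N_0+1}}-\delta_0\big)$$ $$=\Big(\tfrac{1}{2\pi\sigma^2}\sqrt{4\sigma^2-t^2}\,dt,\ \ \sum_{j\in[N_0+1]:\,|\theta_j|\ge\sigma}\delta_{\theta_j+\sigma^2/\theta_j}-\sum_{j\in[N_0+1]}\nu_j\Big),$$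 where $$\nu_j=\frac{\theta_j(t-2\theta_j)}{2\pi(\theta_j(t-\theta_j)-\sigma^2)\sqrt{4\sigma^2-t^2}}\,dt$$ is a probability measure if $|\theta_j|\ge\sigma$; otherwise, $\nu_j$ is a signed measure of total mass zero with Jordan decomposition $\nu_j=\nu_j^+-\nu_j^-$, where $\nu_j^+$ has density $\mathbf{1}\{t\in[-2\sigma,2\theta_j]\}\frac{d\nu_j}{dt}$ if $\theta_j>0$ and $\mathbf{1}\{t\in[2\theta_j,2\sigma]\}\frac{d\nu_j}{dt}$ if $\theta_j<0$.
   Context: $[N]=\{1,\dots,N\}$. $\mathrm{GUE}(N,\sigma^2)$ is the law of a self-adjoint $N\times N$ complex Gaussian matrix, with entries on and above the diagonal independent and centered, real diagonal entries of variance $\sigma^2$, and off-diagonal entries with independent real and imaginary parts of variance $\sigma^2/2$ each. For a sequence of self-adjoint random $N\times N$ matrices $\mathbf{A}_N$ with entries having all moments, let $\mu_{\mathbf{A}_N}(P)=\frac1N\mathbb{E}[\mathrm{Tr}\,P(\mathbf{A}_N)]$ for $P\in\mathbb{C}[x]$. If $\mu(P)=\lim_N\mu_{\mathbf{A}_N}(P)$ and $\nu(P)=\lim_N N(\mu_{\mathbf{A}_N}(P)-\mu(P))$ exist for all $P$, then $(\mu,\nu)$ is the type $B$ distribution of $\mathbf{A}_N$. These functionals are identified with the compactly supported probability measure, respectively finite signed measure of total mass zero, having those moments. Measures given by a density involving $\sqrt{4\sigma^2-t^2}$ are supported on $[-2\sigma,2\sigma]$. For a finite signed measure $\mu$, $G_\mu(z)=\int\frac{1}{z-t}\mu(dt)$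 on $\mathbb{C}^+$, and for a probability measure $F_\mu=1/G_\mu$. For probability measures $\mu_1,\mu_2$ on $\mathbb{R}$ there are unique analytic $\omega_1,\omega_2:\mathbb{C}^+\to\mathbb{C}^+$ with $G_{\mu_1}(\omega_1(z))=G_{\mu_2}(\omega_2(z))$ and $\omega_1(z)+\omega_2(z)=z+F_{\mu_1}(\omega_1(z))$; the free convolution $\mu_1\boxplus\mu_2$ is the probability measure with $G_{\mu_1\boxplus\mu_2}=G_{\mu_1}\circ\omega_1$. For compactly supported probability measures $\mu_1,\mu_2$ and compactly supported finite signed measures $\nu_1,\nu_2$ of total mass zero, the type $B$ convolution is $(\mu_1,\nu_1)\boxplus_B(\mu_2,\nu_2)=(\mu_1\boxplus\mu_2,\nu)$, where $\nu$ is determined by $G_\nu(z)=G_{\nu_1}(\omega_1(z))\omega_1'(z)+G_{\nu_2}(\omega_2(z))\omega_2'(z)$.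
   Formalization: In the critical case |θ_j| = σ, where the printed ν_j has mass 1/2 and the claim fails, the formal statement gives the atom at θ_j + σ²/θ_j weight 1/2 and asserts that ν_j is 1/2 times a probability measure; for |θ_j| ≠ σ it is as printed. *)

theory Defs
  imports
    "HOL-Probability.Probability"
    "HOL-Complex_Analysis.Complex_Analysis"
    "Jordan_Normal_Form.Schur_Decomposition"
begin

section \<open>Finite signed measures on the real line\<close>

text \<open>A signed measure is a real-valued set function. As for \<^const>\<open>measure\<close>, its value
  outside the Borel sets is fixed to be 0, so that equal signed measures are equal functions.\<close>

definition finite_signed_measure :: "(real set \<Rightarrow> real) \<Rightarrow> bool" where
  "finite_signed_measure \<nu> \<longleftrightarrow>
     (\<forall>A. A \<notin> sets borel \<longrightarrow> \<nu> A = 0) \<and> \<nu> {} = 0 \<and>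
     (\<forall>A. range A \<subseteq> sets borel \<longrightarrow> disjoint_family A \<longrightarrow> (\<lambda>i::nat. \<nu> (A i)) sums \<nu> (\<Union>i. A i))"

definition jordan_decomposition ::
  "(real set \<Rightarrow> real) \<Rightarrow> real measure \<Rightarrow> real measure \<Rightarrow> bool" where
  "jordan_decomposition \<nu> P Q \<longleftrightarrow>
     finite_measure P \<and> sets P = sets borel \<and> finite_measure Q \<and> sets Q = sets borel \<and>
     (\<exists>D\<in>sets borel. measure P (- D) = 0 \<and> measure Q D = 0) \<and>
     (\<forall>A\<in>sets borel. \<nu> A = measure P A - measure Q A)"

text \<open>The Jordan decomposition exists and is unique for every finite signed measure, so the
  choice below is harmless.\<close>

definition signed_integral :: "(real set \<Rightarrow> real) \<Rightarrow> (real \<Rightarrow> complex) \<Rightarrow> complex" where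
  "signed_integral \<nu> f =
     (case (SOME (P, Q). jordan_decomposition \<nu> P Q) of (P, Q) \<Rightarrow> (LINT t|P. f t) - (LINT t|Q. f t))"

definition signed_density :: "(real \<Rightarrow> real) \<Rightarrow> real set \<Rightarrow> real" where
  "signed_density f A = (if A \<in> sets borel then (LINT t:A|lborel. f t) else 0)"

abbreviation dirac :: "real \<Rightarrow> real set \<Rightarrow> real" where
  "dirac x \<equiv> measure (return borel x)"

definition borel_prob :: "real measure \<Rightarrow> bool" where
  "borel_prob \<mu> \<longleftrightarrow> prob_space \<mu> \<and> sets \<mu> = sets borel"

definition compactly_supported :: "real measure \<Rightarrow> bool" where
  "compactly_supported \<mu> \<longleftrightarrow> (\<exists>K. compact K \<and> emeasure \<mu> (- K) = 0)"

definition signed_compactly_supported :: "(real set \<Rightarrow> real) \<Rightarrow> bool" where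
  "signed_compactly_supported \<nu> \<longleftrightarrow>
     (\<exists>K. compact K \<and> (\<forall>A\<in>sets borel. A \<inter> K = {} \<longrightarrow> \<nu> A = 0))"


section \<open>Free convolution and type B convolution\<close>

definition upper_half_plane :: "complex set" where
  "upper_half_plane = {z. Im z > 0}"

definition cauchy_transform :: "real measure \<Rightarrow> complex \<Rightarrow> complex" where
  "cauchy_transform \<mu> z = (LINT t|\<mu>. 1 / (z - complex_of_real t))"

definition signed_cauchy_transform :: "(real set \<Rightarrow> real) \<Rightarrow> complex \<Rightarrow> complex" where
  "signed_cauchy_transform \<nu> z = signed_integral \<nu> (\<lambda>t. 1 / (z - complex_of_real t))"

definition reciprocal_cauchy_transform :: "real measure \<Rightarrow> complex \<Rightarrow> complex" where
  "reciprocal_cauchy_transform \<mu> z = 1 / cauchy_transform \<mu> z"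

text \<open>Subordination functions are unique on the upper half-plane; their values elsewhere are
  irrelevant.\<close>

definition subordination_functions ::
  "real measure \<Rightarrow> real measure \<Rightarrow> (complex \<Rightarrow> complex) \<Rightarrow> (complex \<Rightarrow> complex) \<Rightarrow> bool" where
  "subordination_functions \<mu>1 \<mu>2 \<omega>1 \<omega>2 \<longleftrightarrow>
     \<omega>1 analytic_on upper_half_plane \<and> \<omega>1 ` upper_half_plane \<subseteq> upper_half_plane \<and>
     \<omega>2 analytic_on upper_half_plane \<and> \<omega>2 ` upper_half_plane \<subseteq> upper_half_plane \<and>
     (\<forall>z\<in>upper_half_plane.
        cauchy_transform \<mu>1 (\<omega>1 z) = cauchy_transform \<mu>2 (\<omega>2 z) \<and>
        \<omega>1 z + \<omega>2 z = z + reciprocal_cauchy_transform \<mu>1 (\<omega>1 z))"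

definition free_convolution :: "real measure \<Rightarrow> real measure \<Rightarrow> real measure" (infixl "\<boxplus>" 65) where
  "\<mu>1 \<boxplus> \<mu>2 = (THE \<mu>. borel_prob \<mu> \<and>
     (\<exists>\<omega>1 \<omega>2. subordination_functions \<mu>1 \<mu>2 \<omega>1 \<omega>2 \<and>
        (\<forall>z\<in>upper_half_plane. cauchy_transform \<mu> z = cauchy_transform \<mu>1 (\<omega>1 z))))"

type_synonym type_B_pair = "real measure \<times> (real set \<Rightarrow> real)"

definition type_B_convolution :: "type_B_pair \<Rightarrow> type_B_pair \<Rightarrow> type_B_pair" (infixl "\<boxplus>\<^sub>B" 65) where
  "D1 \<boxplus>\<^sub>B D2 = (case (D1, D2) of ((\<mu>1, \<nu>1), (\<mu>2, \<nu>2)) \<Rightarrow>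
     (\<mu>1 \<boxplus> \<mu>2,
      THE \<nu>. finite_signed_measure \<nu> \<and>
        (\<exists>\<omega>1 \<omega>2. subordination_functions \<mu>1 \<mu>2 \<omega>1 \<omega>2 \<and>
           (\<forall>z\<in>upper_half_plane. signed_cauchy_transform \<nu> z =
              signed_cauchy_transform \<nu>1 (\<omega>1 z) * deriv \<omega>1 z +
              signed_cauchy_transform \<nu>2 (\<omega>2 z) * deriv \<omega>2 z))))"


section \<open>Random matrices and their type B distribution\<close>

definition mat_trace :: "complex mat \<Rightarrow> complex" where
  "mat_trace A = (\<Sum>i<dim_row A. A $$ (i, i))"

definition mat_poly :: "complex poly \<Rightarrow> complex mat \<Rightarrow> complex mat" where
  "mat_poly P A =
     mat (dim_row A) (dim_row A) (\<lambda>(i, j). \<Sum>k\<le>degree P. coeff P k * (A ^\<^sub>m k) $$ (i, j))"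

definition random_selfadjoint_matrix :: "'a measure \<Rightarrow> nat \<Rightarrow> ('a \<Rightarrow> complex mat) \<Rightarrow> bool" where
  "random_selfadjoint_matrix M N A \<longleftrightarrow>
     prob_space M \<and>
     (\<forall>\<omega>\<in>space M. A \<omega> \<in> carrier_mat N N \<and> mat_adjoint (A \<omega>) = A \<omega>) \<and>
     (\<forall>i<N. \<forall>j<N. (\<lambda>\<omega>. A \<omega> $$ (i, j)) \<in> borel_measurable M)"

definition entries_have_all_moments :: "'a measure \<Rightarrow> nat \<Rightarrow> ('a \<Rightarrow> complex mat) \<Rightarrow> bool" where
  "entries_have_all_moments M N A \<longleftrightarrow>
     (\<forall>i<N. \<forall>j<N. \<forall>k::nat. integrable M (\<lambda>\<omega>. norm (A \<omega> $$ (i, j)) ^ k))"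

definition GUE :: "'a measure \<Rightarrow> nat \<Rightarrow> real \<Rightarrow> ('a \<Rightarrow> complex mat) \<Rightarrow> bool" where
  "GUE M N v X \<longleftrightarrow>
     random_selfadjoint_matrix M N X \<and>
     prob_space.indep_vars M (\<lambda>_. borel) (\<lambda>(i, j) \<omega>. X \<omega> $$ (i, j)) {(i, j). i \<le> j \<and> j < N} \<and>
     (\<forall>i<N. distributed M lborel (\<lambda>\<omega>. Re (X \<omega> $$ (i, i))) (normal_density 0 (sqrt v))) \<and>
     (\<forall>i j. i < j \<and> j < N \<longrightarrow>
        distributed M lborel (\<lambda>\<omega>. Re (X \<omega> $$ (i, j))) (normal_density 0 (sqrt (v / 2))) \<and>
        distributed M lborel (\<lambda>\<omega>. Im (X \<omega> $$ (i, j))) (normal_density 0 (sqrt (v / 2))) \<and>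
        prob_space.indep_var M borel (\<lambda>\<omega>. Re (X \<omega> $$ (i, j))) borel (\<lambda>\<omega>. Im (X \<omega> $$ (i, j))))"

definition mean_distribution :: "'a measure \<Rightarrow> nat \<Rightarrow> ('a \<Rightarrow> complex mat) \<Rightarrow> complex poly \<Rightarrow> complex" where
  "mean_distribution M N A P = 1 / of_nat N * (LINT \<omega>|M. mat_trace (mat_poly P (A \<omega>)))"

text \<open>The matrices of different sizes may live on different probability spaces \<open>M N\<close>.\<close>

definition type_B_functionals ::
  "(nat \<Rightarrow> 'a measure) \<Rightarrow> (nat \<Rightarrow> 'a \<Rightarrow> complex mat) \<Rightarrow>
   (complex poly \<Rightarrow> complex) \<Rightarrow> (complex poly \<Rightarrow> complex) \<Rightarrow> bool" where
  "type_B_functionals M A \<phi> \<psi> \<longleftrightarrow>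
     (\<forall>N\<ge>1. random_selfadjoint_matrix (M N) N (A N) \<and> entries_have_all_moments (M N) N (A N)) \<and>
     (\<forall>P. (\<lambda>N. mean_distribution (M N) N (A N) P) \<longlonglongrightarrow> \<phi> P) \<and>
     (\<forall>P. (\<lambda>N. of_nat N * (mean_distribution (M N) N (A N) P - \<phi> P)) \<longlonglongrightarrow> \<psi> P)"

definition has_type_B_distribution ::
  "(nat \<Rightarrow> 'a measure) \<Rightarrow> (nat \<Rightarrow> 'a \<Rightarrow> complex mat) \<Rightarrow> type_B_pair \<Rightarrow> bool" where
  "has_type_B_distribution M A D \<longleftrightarrow> (case D of (\<mu>, \<nu>) \<Rightarrow>
     borel_prob \<mu> \<and> compactly_supported \<mu> \<and>
     finite_signed_measure \<nu> \<and> signed_compactly_supported \<nu> \<and> \<nu> UNIV = 0 \<and>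
     type_B_functionals M A
       (\<lambda>P. LINT t|\<mu>. poly P (complex_of_real t))
       (\<lambda>P. signed_integral \<nu> (\<lambda>t. poly P (complex_of_real t))))"


section \<open>The deformed periodically banded GUE\<close>

text \<open>Matrix indices start at 0; the distance below only depends on differences of indices.\<close>

definition periodic_dist :: "nat \<Rightarrow> nat \<Rightarrow> nat \<Rightarrow> int" where
  "periodic_dist N j k = min \<bar>int j - int k\<bar> (int N - \<bar>int j - int k\<bar>)"

definition band_matrix :: "nat \<Rightarrow> nat \<Rightarrow> complex mat \<Rightarrow> complex mat" where
  "band_matrix N b X = mat N N (\<lambda>(j, k).
     complex_of_real (1 / sqrt (real (min (2 * b + 1) N))) *
     (if periodic_dist N j k \<le> int b then X $$ (j, k) else 0))"

definition mat_unit :: "nat \<Rightarrow> nat \<Rightarrow> nat \<Rightarrow> complex mat" where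
  "mat_unit N i j = mat N N (\<lambda>(k, l). if k = i \<and> l = j then 1 else 0)"

definition all_ones_mat :: "nat \<Rightarrow> complex mat" where
  "all_ones_mat N = mat N N (\<lambda>_. 1)"

text \<open>Because of the index shift, coordinate \<open>(j, j)\<close> of the mathematical text
  is entry \<open>(j - 1, j - 1)\<close>. For \<open>N < N0\<close>, units outside the matrix are zero.\<close>

definition deformation :: "nat \<Rightarrow> (nat \<Rightarrow> real) \<Rightarrow> nat \<Rightarrow> complex mat" where
  "deformation N0 \<theta> N =
     mat N N (\<lambda>(k, l). \<Sum>j=1..N0. (complex_of_real (\<theta> j) \<cdot>\<^sub>m mat_unit N (j - 1) (j - 1)) $$ (k, l)) +
     complex_of_real (\<theta> (N0 + 1) / real N) \<cdot>\<^sub>m all_ones_mat N"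

text \<open>The indicators are needed because \<open>sqrt\<close> of a negative number is negative, not undefined.\<close>

definition semicircle :: "real \<Rightarrow> real measure" where
  "semicircle \<sigma> = density lborel
     (\<lambda>t. ennreal (indicator {-2*\<sigma>..2*\<sigma>} t * (1 / (2 * pi * \<sigma>\<^sup>2) * sqrt (4 * \<sigma>\<^sup>2 - t\<^sup>2))))"

definition nu_density :: "real \<Rightarrow> real \<Rightarrow> real \<Rightarrow> real" where
  "nu_density \<sigma> \<theta> t = indicator {-2*\<sigma>..2*\<sigma>} t *
     (\<theta> * (t - 2 * \<theta>) / (2 * pi * (\<theta> * (t - \<theta>) - \<sigma>\<^sup>2) * sqrt (4 * \<sigma>\<^sup>2 - t\<^sup>2)))"

definition nu :: "real \<Rightarrow> real \<Rightarrow> real set \<Rightarrow> real" where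
  "nu \<sigma> \<theta> = signed_density (nu_density \<sigma> \<theta>)"

text \<open>Mass of the outlier atom at \<open>\<theta> + \<sigma>\<^sup>2 / \<theta>\<close> for \<open>\<bar>\<theta>\<bar> \<ge> \<sigma>\<close>. It is 1 except in the critical case
  \<open>\<bar>\<theta>\<bar> = \<sigma>\<close>: there \<^const>\<open>nu_density\<close> reduces to \<open>1 / (2 * pi * sqrt (4 * \<sigma>\<^sup>2 - t\<^sup>2))\<close>, half the
  arcsine density, so \<^const>\<open>nu\<close> has mass 1/2, and total mass zero forces the atom at the spectral
  edge to have mass 1/2 as well.\<close>

definition outlier_weight :: "real \<Rightarrow> real \<Rightarrow> real" where
  "outlier_weight \<sigma> \<theta> = (if \<bar>\<theta>\<bar> = \<sigma> then 1/2 else 1)"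

end

theory Submission
  imports Defs "HOL-Real_Asymp.Real_Asymp"
begin

text \<open>The random band matrix \<open>X\<close> has a Gaussian integration by parts formula, from which the moments of
  \<open>\<langle>u, X\<^sup>k v\<rangle>\<close> and of normalised traces follow recursively; the condition \<open>b\<^sub>N / sqrt N \<longlonglongrightarrow> \<infinity>\<close> makes the
  moments of the undeformed matrix agree with the semicircle moments \<open>m\<^sub>k\<close> up to \<open>o(1/N)\<close>. Expanding the trace of
  \<open>(X + D)\<^sup>k\<close> in the finite rank deformation \<open>D\<close> leaves, to order \<open>1/N\<close>, a sum over the unit vectors
  \<open>u\<close> whose projections make up \<open>D\<close> of products of \<open>\<langle>u, X\<^sup>k u\<rangle>\<close>, which concentrate at \<open>m\<^sub>k\<close>.

  On the analytic side one factor of each convolution is a point mass at 0, so the subordination functions are explicit: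
  \<open>\<omega>\<^sub>1 = id\<close> and \<open>\<omega>\<^sub>2 = F\<close>, the reciprocal Cauchy transform of the semicircle law. In the coordinate
  \<open>z = \<sigma> (w + 1 / w)\<close> all Cauchy transforms are rational functions of \<open>w\<close>, and Stieltjes inversion identifies the measures.
  Both sides meet because the generating functions of the moments satisfy the same recursion.\<close>

section \<open>Gaussian integration by parts\<close>

text \<open>Two sizes control the random matrix side: each row of variances sums to
  \<open>v\<close>, while a single variance is at most \<open>\<kappa>\<close>, which is of order
  one over the band width. A Gaussian pairing inside one word leaves a loop at its summation index
  and costs \<open>v\<close>. A pairing between two words costs a factor \<open>\<kappa>\<close>,
  because the unweighted sum over the index merely glues the words together. Hence covariances are
  O(\<open>\<kappa>\<close>), and a diagonal entry of a power deviates from \<open>m\<^sub>k\<close>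
  only by O(\<open>\<kappa>\<^sup>2\<close>): the deviation is driven by a covariance with a trace,
  taken with weights at most \<open>\<kappa>\<close>. Summed over the diagonal this gives
  \<open>N * \<kappa>\<^sup>2\<close>, which is where the lower bound on the band width enters. The
  all-ones vector is delocalised, so entrywise bounds do not suffice for it; invariance under
  diagonal unitaries restricts the index sums instead. On the analytic side the case
  \<open>\<bar>\<theta>\<bar> = \<sigma>\<close> stands apart, since the outlier then sits at the
  spectral edge.\<close>

inductive rv_poly :: "('e \<Rightarrow> 'a \<Rightarrow> complex) \<Rightarrow> real set \<Rightarrow> ('a \<Rightarrow> complex) \<Rightarrow> bool"
  for x :: "'e \<Rightarrow> 'a \<Rightarrow> complex" and C :: "real set" where
  poly_const: "c \<in> C \<Longrightarrow> rv_poly x C (\<lambda>_. of_real c)"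
| poly_add: "rv_poly x C F \<Longrightarrow> rv_poly x C G \<Longrightarrow> rv_poly x C (\<lambda>\<omega>. F \<omega> + G \<omega>)"
| poly_var: "rv_poly x C F \<Longrightarrow> rv_poly x C (\<lambda>\<omega>. x e \<omega> * F \<omega>)"

text \<open>A relation rather than a function: distinct polynomials may be equal as random variables
  (some entries vanish identically), so a random variable does not determine its formal
  derivative.\<close>

inductive deriv_rel :: "('e \<Rightarrow> 'a \<Rightarrow> complex) \<Rightarrow> 'e \<Rightarrow> ('a \<Rightarrow> complex) \<Rightarrow> ('a \<Rightarrow> complex) \<Rightarrow> bool"
  for x :: "'e \<Rightarrow> 'a \<Rightarrow> complex" and e :: 'e where
  der_const: "deriv_rel x e (\<lambda>_. of_real c) (\<lambda>_. 0)"
| der_add: "deriv_rel x e F F' \<Longrightarrow> deriv_rel x e G G' \<Longrightarrow>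
    deriv_rel x e (\<lambda>\<omega>. F \<omega> + G \<omega>) (\<lambda>\<omega>. F' \<omega> + G' \<omega>)"
| der_var: "deriv_rel x e F F' \<Longrightarrow>
    deriv_rel x e (\<lambda>\<omega>. x f \<omega> * F \<omega>) (\<lambda>\<omega>. of_bool (f = e) * F \<omega> + x f \<omega> * F' \<omega>)"

definition mono_val :: "('e \<Rightarrow> 'a \<Rightarrow> complex) \<Rightarrow> 'e list \<Rightarrow> 'a \<Rightarrow> complex" where
  "mono_val x L \<omega> = (\<Prod>e\<leftarrow>L. x e \<omega>)"

text \<open>Occurrences are removed one at a time and listed with repetition, so that summing over
  the results is the Leibniz rule for a word. Every result is shorter, which drives the inductions
  on length.\<close>

fun mono_removals :: "'e \<Rightarrow> 'e list \<Rightarrow> 'e list list" where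
  "mono_removals e [] = []"
| "mono_removals e (f # L) = (if f = e then [L] else []) @ map ((#) f) (mono_removals e L)"

definition mono_deriv :: "('e \<Rightarrow> 'a \<Rightarrow> complex) \<Rightarrow> 'e \<Rightarrow> 'e list \<Rightarrow> 'a \<Rightarrow> complex" where
  "mono_deriv x e L \<omega> = (\<Sum>P\<leftarrow>mono_removals e L. mono_val x P \<omega>)"

lemma mono_val_simps [simp]:
  "mono_val x [] \<omega> = 1" "mono_val x (e # L) \<omega> = x e \<omega> * mono_val x L \<omega>"
  by (simp_all add: mono_val_def)

lemma mono_deriv_simps [simp]:
  "mono_deriv x e [] \<omega> = 0"
  "mono_deriv x e (f # L) \<omega> = of_bool (f = e) * mono_val x L \<omega> + x f \<omega> * mono_deriv x e L \<omega>"
  by (simp_all add: mono_deriv_def o_def sum_list_const_mult)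

lemma length_mono_removals: "P \<in> set (mono_removals e L) \<Longrightarrow> length P < length L"
  by (induction L arbitrary: P) (auto split: if_splits)

lemma poly_mono: "rv_poly x C F \<Longrightarrow> C \<subseteq> C' \<Longrightarrow> rv_poly x C' F"
  by (induction rule: rv_poly.induct) (auto intro: rv_poly.intros)

lemma poly_mono_val: "1 \<in> C \<Longrightarrow> rv_poly x C (mono_val x L)"
proof (induction L)
  case Nil
  then show ?case using poly_const[of 1 C x] by (simp add: mono_val_def)
next
  case (Cons e L)
  then have "rv_poly x C (\<lambda>\<omega>. x e \<omega> * mono_val x L \<omega>)" by (intro poly_var) auto
  then show ?case by (simp add: mono_val_def[abs_def])
qed

lemma poly_cmult:
  assumes "rv_poly x C F" "\<And>a b. a \<in> C \<Longrightarrow> b \<in> C \<Longrightarrow> a * b \<in> C" "c \<in> C"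
  shows "rv_poly x C (\<lambda>\<omega>. of_real c * F \<omega>)"
  using assms(1)
proof (induction rule: rv_poly.induct)
  case (poly_const d)
  then have "rv_poly x C (\<lambda>_. of_real (c * d))" using assms by (intro rv_poly.poly_const) auto
  then show ?case by simp
next
  case (poly_add F G)
  then show ?case using rv_poly.poly_add[OF poly_add.IH] by (simp add: distrib_left)
next
  case (poly_var F e)
  then show ?case using rv_poly.poly_var[OF poly_var.IH, of e] by (simp add: mult_ac)
qed

lemma poly_mult:
  assumes "rv_poly x C F" "rv_poly x C G" "\<And>a b. a \<in> C \<Longrightarrow> b \<in> C \<Longrightarrow> a * b \<in> C"
  shows "rv_poly x C (\<lambda>\<omega>. F \<omega> * G \<omega>)"
  using assms(1)
proof (induction rule: rv_poly.induct)
  case (poly_const d)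
  then show ?case using poly_cmult[OF assms(2,3)] by simp
next
  case (poly_add F1 F2)
  then show ?case using rv_poly.poly_add[OF poly_add.IH] by (simp add: distrib_right)
next
  case (poly_var F e)
  then show ?case using rv_poly.poly_var[OF poly_var.IH, of e] by (simp add: mult_ac)
qed

lemma poly_of_bool:
  assumes "0 \<in> C" "rv_poly x C F"
  shows "rv_poly x C (\<lambda>\<omega>. of_bool b * F \<omega>)"
  using poly_const[OF assms(1), of x] assms(2) by (cases b) auto

lemma poly_sum:
  assumes "0 \<in> C" "\<And>i. i \<in> I \<Longrightarrow> rv_poly x C (F i)"
  shows "rv_poly x C (\<lambda>\<omega>. \<Sum>i\<in>I. F i \<omega>)"
proof -
  have z: "rv_poly x C (\<lambda>_. 0)" using poly_const[OF assms(1), of x] by simp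
  show ?thesis using assms(2)
    by (induction I rule: infinite_finite_induct) (auto intro: poly_add z)
qed

lemma poly_sum_list:
  assumes "0 \<in> C" "\<And>P. P \<in> set Ps \<Longrightarrow> rv_poly x C (F P)"
  shows "rv_poly x C (\<lambda>\<omega>. \<Sum>P\<leftarrow>Ps. F P \<omega>)"
proof -
  have z: "rv_poly x C (\<lambda>_. 0)" using poly_const[OF assms(1), of x] by simp
  show ?thesis using assms(2)
    by (induction Ps) (auto intro: poly_add z)
qed

lemma poly_prod_list:
  assumes "1 \<in> C" "\<And>a b. a \<in> C \<Longrightarrow> b \<in> C \<Longrightarrow> a * b \<in> C" "\<And>P. P \<in> set Ps \<Longrightarrow> rv_poly x C (F P)"
  shows "rv_poly x C (\<lambda>\<omega>. \<Prod>P\<leftarrow>Ps. F P \<omega>)"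
proof -
  have z: "rv_poly x C (\<lambda>_. 1)" using poly_const[OF assms(1), of x] by simp
  show ?thesis using assms(3)
    by (induction Ps) (auto intro: poly_mult z assms(2))
qed

lemma der_cmult: "deriv_rel x e F F' \<Longrightarrow> deriv_rel x e (\<lambda>\<omega>. of_real c * F \<omega>) (\<lambda>\<omega>. of_real c * F' \<omega>)"
proof (induction rule: deriv_rel.induct)
  case (der_const d)
  then show ?case using deriv_rel.der_const[of x e "c * d"] by simp
next
  case (der_add F F' G G')
  then show ?case using deriv_rel.der_add[OF der_add.IH] by (simp add: distrib_left)
next
  case (der_var F F' f)
  then show ?case using deriv_rel.der_var[OF der_var.IH, of f] by (simp add: algebra_simps)
qed

lemma der_mult:
  assumes "deriv_rel x e F F'" "deriv_rel x e G G'"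
  shows "deriv_rel x e (\<lambda>\<omega>. F \<omega> * G \<omega>) (\<lambda>\<omega>. F' \<omega> * G \<omega> + F \<omega> * G' \<omega>)"
  using assms(1)
proof (induction rule: deriv_rel.induct)
  case (der_const d)
  then show ?case using der_cmult[OF assms(2)] by simp
next
  case (der_add F1 F1' F2 F2')
  then show ?case using deriv_rel.der_add[OF der_add.IH] by (simp add: algebra_simps)
next
  case (der_var F F' f)
  then show ?case using deriv_rel.der_var[OF der_var.IH, of f] by (simp add: algebra_simps)
qed

lemma der_zero: "deriv_rel x e (\<lambda>_. 0) (\<lambda>_. 0)"
  using der_const[of x e 0] by simp

lemma der_sum:
  assumes "\<And>i. i \<in> I \<Longrightarrow> deriv_rel x e (F i) (F' i)"
  shows "deriv_rel x e (\<lambda>\<omega>. \<Sum>i\<in>I. F i \<omega>) (\<lambda>\<omega>. \<Sum>i\<in>I. F' i \<omega>)"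
  using assms
  by (induction I rule: infinite_finite_induct) (auto intro: der_add der_zero)

text \<open>A grading: \<open>d u\<close> is the excess of \<open>u\<close> among the row indices
  over the column indices, the same for all monomials of \<open>F\<close>. Conjugation by a diagonal
  unitary multiplies \<open>F\<close> by a character of weight \<open>d\<close>; invariance of the
  Gaussian law thus suggests that only \<open>d = 0\<close> admits a nonzero mean, and integration
  by parts proves it.\<close>

inductive balance :: "(nat \<times> nat \<Rightarrow> 'a \<Rightarrow> complex) \<Rightarrow> (nat \<Rightarrow> int) \<Rightarrow> ('a \<Rightarrow> complex) \<Rightarrow> bool"
  for x :: "nat \<times> nat \<Rightarrow> 'a \<Rightarrow> complex" where
  bal_zero: "balance x d (\<lambda>_. 0)"
| bal_one: "balance x (\<lambda>_. 0) (\<lambda>_. 1)"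
| bal_add: "balance x d F \<Longrightarrow> balance x d G \<Longrightarrow> balance x d (\<lambda>\<omega>. F \<omega> + G \<omega>)"
| bal_var: "balance x d F \<Longrightarrow>
    balance x (\<lambda>v. d v + of_bool (v = i) - of_bool (v = j)) (\<lambda>\<omega>. x (i, j) \<omega> * F \<omega>)"

lemma bal_sum:
  assumes "\<And>i. i \<in> I \<Longrightarrow> balance x d (F i)"
  shows "balance x d (\<lambda>\<omega>. \<Sum>i\<in>I. F i \<omega>)"
  using assms
  by (induction I rule: infinite_finite_induct) (auto intro: bal_add bal_zero)

text \<open>Nonnegative coefficients are tracked because all moments of the entries are nonnegative;
  for such polynomials, terms of a pairing expansion may be dropped to obtain one-sided
  bounds.\<close>

abbreviation Pos :: "real set" where "Pos \<equiv> {0..}"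

text \<open>\<open>x (i, j)\<close> are the entries of a random matrix, extended by 0 outside of the index range
  \<open>{..<N}\<close>. The assumption \<open>wick\<close> is Gaussian integration by parts.\<close>

locale wick_matrix = prob_space M for M :: "'a measure" +
  fixes x :: "nat \<times> nat \<Rightarrow> 'a \<Rightarrow> complex" and s :: "nat \<Rightarrow> nat \<Rightarrow> real"
    and N :: nat and v \<kappa> :: real
  assumes integrable_mono: "integrable M (mono_val x L)"
    \<comment> \<open>The derivative is in the transposed letter: a complex Gaussian entry pairs
      only with its conjugate, which by self-adjointness is the entry \<open>(l, i)\<close>.\<close>
    and wick: "(LINT \<omega>|M. mono_val x ((i, l) # L) \<omega>) = s i l * (LINT \<omega>|M. mono_deriv x (l, i) L \<omega>)"
    and s_nonneg: "0 \<le> s i l"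
    and s_le: "s i l \<le> \<kappa>"
    and s_out: "i \<ge> N \<or> l \<ge> N \<Longrightarrow> s i l = 0"
    and s_sum: "i < N \<Longrightarrow> (\<Sum>l<N. s i l) = v"
    and v_nonneg: "0 \<le> v"
    and \<kappa>_le: "\<kappa> \<le> v"
    and x_out: "i \<ge> N \<or> l \<ge> N \<Longrightarrow> x (i, l) \<omega> = 0"
begin

lemma \<kappa>_nonneg: "0 \<le> \<kappa>"
  using s_nonneg[of 0 0] s_le[of 0 0] by linarith

text \<open>The real part loses nothing, since the expectations of these polynomials are real by
  \<open>integral_eq_ev\<close>; a real-valued functional allows inequalities.\<close>

definition ev :: "('a \<Rightarrow> complex) \<Rightarrow> real" where
  "ev F = Re (LINT \<omega>|M. F \<omega>)"

text \<open>The word \<open>L\<close> is a generalisation for the induction on \<open>F\<close>: a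
  letter split off by \<open>poly_var\<close> is moved into \<open>L\<close>. The same device recurs
  in the expectation lemmas that follow.\<close>

lemma integrable_mono_mult: "rv_poly x UNIV F \<Longrightarrow> integrable M (\<lambda>\<omega>. mono_val x L \<omega> * F \<omega>)"
proof (induction arbitrary: L rule: rv_poly.induct)
  case (poly_const c)
  then show ?case using integrable_mono by auto
next
  case (poly_add F G)
  then show ?case by (auto simp: distrib_left)
next
  case (poly_var F e)
  then show ?case using poly_var.IH[of "e # L"] by (simp add: mult_ac)
qed

lemma integrable_poly: "rv_poly x UNIV F \<Longrightarrow> integrable M F"
  using integrable_mono_mult[of F "[]"] by simp

lemma ev_add: "rv_poly x UNIV F \<Longrightarrow> rv_poly x UNIV G \<Longrightarrow> ev (\<lambda>\<omega>. F \<omega> + G \<omega>) = ev F + ev G"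
  by (simp add: ev_def integrable_poly)

lemma ev_cmult: "ev (\<lambda>\<omega>. of_real c * F \<omega>) = c * ev F"
  by (simp add: ev_def)

lemma ev_const: "ev (\<lambda>_. of_real c) = c"
  by (simp add: ev_def prob_space)

lemma ev_zero [simp]: "ev (\<lambda>_. 0) = 0"
  by (simp add: ev_def)

lemma ev_sum:
  "(\<And>i. i \<in> I \<Longrightarrow> rv_poly x UNIV (F i)) \<Longrightarrow> ev (\<lambda>\<omega>. \<Sum>i\<in>I. F i \<omega>) = (\<Sum>i\<in>I. ev (F i))"
  by (simp add: ev_def integrable_poly)

lemma ev_sum_list:
  "(\<And>i. i \<in> set I \<Longrightarrow> rv_poly x UNIV (F i)) \<Longrightarrow> ev (\<lambda>\<omega>. \<Sum>i\<leftarrow>I. F i \<omega>) = (\<Sum>i\<leftarrow>I. ev (F i))"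
proof (induction I)
  case (Cons a I)
  then have "rv_poly x UNIV (\<lambda>\<omega>. \<Sum>i\<leftarrow>I. F i \<omega>)" by (intro poly_sum_list) auto
  with Cons show ?case by (simp add: ev_add)
qed simp

lemma poly_mono_deriv: "rv_poly x UNIV (mono_deriv x e L)"
  unfolding mono_deriv_def[abs_def] by (intro poly_sum_list) (auto intro: poly_mono_val)

lemma deriv_rel_poly:
  assumes "deriv_rel x e F F'"
  shows "rv_poly x UNIV F \<and> rv_poly x UNIV F'"
  using assms
proof (induction rule: deriv_rel.induct)
  case (der_const c)
  show ?case using poly_const[of 0 UNIV x] poly_const[of c UNIV x] by simp
next
  case (der_add F F' G G')
  then show ?case by (auto intro: poly_add)
next
  case (der_var F F' f)
  have "rv_poly x UNIV (\<lambda>\<omega>. of_bool (f = e) * F \<omega>)"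
    using der_var by (intro poly_of_bool) auto
  with der_var show ?case by (auto intro: poly_add poly_var)
qed

text \<open>Carries the \<open>wick\<close> identity from words to polynomials. A letter split off
  from \<open>F\<close> joins the word, and the Leibniz rule built into \<open>mono_deriv\<close>
  accounts for its derivative.\<close>

lemma integral_by_parts_mono:
  assumes "deriv_rel x (l, i) F F'"
  shows "(LINT \<omega>|M. x (i, l) \<omega> * (mono_val x L \<omega> * F \<omega>)) =
    s i l * (LINT \<omega>|M. mono_deriv x (l, i) L \<omega> * F \<omega> + mono_val x L \<omega> * F' \<omega>)"
  using assms
proof (induction arbitrary: L rule: deriv_rel.induct)
  case (der_const c)
  have "(LINT \<omega>|M. x (i, l) \<omega> * (mono_val x L \<omega> * of_real c)) = (LINT \<omega>|M. mono_val x ((i,l)#L) \<omega>) * of_real c"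
    by (simp add: mult.assoc flip: integral_mult_left_zero)
  then show ?case by (simp only: wick) simp
next
  case (der_add F F' G G')
  note sp = der_add.hyps[THEN deriv_rel_poly]
  have md: "rv_poly x UNIV (mono_deriv x (l,i) L)" by (rule poly_mono_deriv)
  have ml: "rv_poly x UNIV (mono_val x L)" by (rule poly_mono_val) simp
  have I: "integrable M (\<lambda>\<omega>. x (i,l) \<omega> * (mono_val x L \<omega> * H \<omega>))"
    "integrable M (\<lambda>\<omega>. mono_deriv x (l,i) L \<omega> * H \<omega>)" "integrable M (\<lambda>\<omega>. mono_val x L \<omega> * H \<omega>)"
    if "rv_poly x UNIV H" for H
    using that md ml by (auto intro!: integrable_poly poly_var poly_mult)
  show ?case using der_add.IH[of L] I sp by (simp add: distrib_left algebra_simps)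
next
  case (der_var F F' f)
  have "(LINT \<omega>|M. x (i, l) \<omega> * (mono_val x L \<omega> * (x f \<omega> * F \<omega>)))
     = (LINT \<omega>|M. x (i, l) \<omega> * (mono_val x (f # L) \<omega> * F \<omega>))" by (simp add: mult_ac)
  also have "\<dots> = s i l * (LINT \<omega>|M. mono_deriv x (l, i) (f # L) \<omega> * F \<omega> + mono_val x (f # L) \<omega> * F' \<omega>)"
    by (rule der_var.IH)
  also have "(LINT \<omega>|M. mono_deriv x (l, i) (f # L) \<omega> * F \<omega> + mono_val x (f # L) \<omega> * F' \<omega>) =
    (LINT \<omega>|M. mono_deriv x (l, i) L \<omega> * (x f \<omega> * F \<omega>) +
           mono_val x L \<omega> * (of_bool (f = (l, i)) * F \<omega> + x f \<omega> * F' \<omega>))"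
    by (intro Bochner_Integration.integral_cong) (auto simp: algebra_simps)
  finally show ?case .
qed

lemma ev_by_parts:
  assumes "deriv_rel x (l, i) F F'"
  shows "ev (\<lambda>\<omega>. x (i, l) \<omega> * F \<omega>) = s i l * ev F'"
  using integral_by_parts_mono[OF assms, of "[]"] by (simp add: ev_def)

lemma deriv_rel_mono_val: "deriv_rel x e (mono_val x L) (mono_deriv x e L)"
proof (induction L)
  case Nil
  then show ?case using der_const[of x e 1] by (simp add: mono_val_def[abs_def] mono_deriv_def[abs_def])
next
  case (Cons f L)
  then show ?case using der_var[OF Cons, of f] by simp
qed

lemma deriv_rel_exists:
  assumes "rv_poly x Pos F"
  shows "\<exists>F'. deriv_rel x e F F' \<and> rv_poly x Pos F'"
  using assms
proof (induction rule: rv_poly.induct)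
  case (poly_const c)
  show ?case using rv_poly.poly_const[of 0 Pos x] by (intro exI[of _ "\<lambda>_. 0"]) (auto intro: der_const)
next
  case (poly_add F G)
  then show ?case by (blast intro: der_add rv_poly.poly_add)
next
  case (poly_var F f)
  then obtain F' where F': "deriv_rel x e F F'" "rv_poly x Pos F'" by auto
  have "rv_poly x Pos (\<lambda>\<omega>. of_bool (f = e) * F \<omega>)"
    using poly_var by (intro poly_of_bool) auto
  then have "rv_poly x Pos (\<lambda>\<omega>. of_bool (f = e) * F \<omega> + x f \<omega> * F' \<omega>)"
    by (intro poly_add rv_poly.poly_var F'(2))
  then show ?case using der_var[OF F'(1), of f] by blast
qed

text \<open>Integration by parts consumes two letters and leaves a sum of shorter moments with the
  nonnegative weight \<open>s i l\<close>; the empty word has mean 1.\<close>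

lemma integral_mono_real_nonneg:
  "\<exists>r\<ge>0. (LINT \<omega>|M. mono_val x L \<omega>) = of_real r"
proof (induction L rule: length_induct)
  case (1 L)
  show ?case
  proof (cases L)
    case Nil
    then show ?thesis by (intro exI[of _ 1]) (simp add: prob_space)
  next
    case (Cons e L')
    obtain i l where e: "e = (i, l)" by (cases e)
    have "\<exists>r\<ge>0. (\<Sum>P\<leftarrow>Ps. (LINT \<omega>|M. mono_val x P \<omega>)) = of_real r"
      if "set Ps \<subseteq> set (mono_removals (l,i) L')" for Ps
      using that
    proof (induction Ps)
      case (Cons P Ps)
      then have "length P < length L" using length_mono_removals[of P "(l,i)" L'] \<open>L = e # L'\<close> by auto
      with 1 obtain r where r: "r \<ge> 0" "(LINT \<omega>|M. mono_val x P \<omega>) = of_real r" by auto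
      from Cons obtain r' where r': "r' \<ge> 0" "(\<Sum>P\<leftarrow>Ps. (LINT \<omega>|M. mono_val x P \<omega>)) = of_real r'" by auto
      from r r' show ?case by (intro exI[of _ "r + r'"]) auto
    qed auto
    then obtain r where r: "r \<ge> 0" "(\<Sum>P\<leftarrow>mono_removals (l,i) L'. (LINT \<omega>|M. mono_val x P \<omega>)) = of_real r"
      by blast
    have "(LINT \<omega>|M. (\<Sum>P\<leftarrow>Ps. mono_val x P \<omega>)) = (\<Sum>P\<leftarrow>Ps. (LINT \<omega>|M. mono_val x P \<omega>))" for Ps
    proof (induction Ps)
      case (Cons P Ps)
      have "integrable M (\<lambda>\<omega>. \<Sum>P\<leftarrow>Ps. mono_val x P \<omega>)"
        by (intro integrable_poly poly_sum_list) (auto intro: poly_mono_val)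
      with Cons show ?case by (simp add: integrable_mono)
    qed simp
    then have "(LINT \<omega>|M. mono_val x L \<omega>) = of_real (s i l * r)"
      using wick[of i l L'] r by (simp add: Cons e mono_deriv_def)
    with r s_nonneg show ?thesis by (metis mult_nonneg_nonneg)
  qed
qed

lemma integral_real_mono:
  assumes "rv_poly x UNIV F"
  shows "(LINT \<omega>|M. mono_val x L \<omega> * F \<omega>) \<in> \<real>"
  using assms
proof (induction arbitrary: L rule: rv_poly.induct)
  case (poly_const c)
  show ?case using integral_mono_real_nonneg[of L] by auto
next
  case (poly_add F G)
  then show ?case by (auto simp: distrib_left integrable_mono_mult)
next
  case (poly_var F e)
  then show ?case using poly_var.IH[of "e # L"] by (simp add: mult_ac)
qed

lemma integral_eq_ev: "rv_poly x UNIV F \<Longrightarrow> (LINT \<omega>|M. F \<omega>) = of_real (ev F)"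
  using integral_real_mono[of F "[]"] by (auto simp: ev_def elim: Reals_cases)

lemma ev_nonneg_mono:
  assumes "rv_poly x Pos F"
  shows "0 \<le> ev (\<lambda>\<omega>. mono_val x L \<omega> * F \<omega>)"
  using assms
proof (induction arbitrary: L rule: rv_poly.induct)
  case (poly_const c)
  show ?case using integral_mono_real_nonneg[of L] poly_const by (auto simp: ev_def)
next
  case (poly_add F G)
  have "rv_poly x UNIV F" "rv_poly x UNIV G" using poly_add by (auto intro: poly_mono)
  then show ?case using poly_add.IH[of L] by (simp add: distrib_left ev_def integrable_mono_mult)
next
  case (poly_var F e)
  then show ?case using poly_var.IH[of "e # L"] by (simp add: mult_ac)
qed

lemma ev_nonneg: "rv_poly x Pos F \<Longrightarrow> 0 \<le> ev F"
  using ev_nonneg_mono[of F "[]"] by simp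

text \<open>Every pairing inside the two factors is also a pairing of their product.\<close>

lemma ev_mono_mult_ge:
  assumes "rv_poly x Pos H"
  shows "ev (mono_val x L) * ev H \<le> ev (\<lambda>\<omega>. mono_val x L \<omega> * H \<omega>)"
  using assms
proof (induction L arbitrary: H rule: length_induct)
  case (1 L)
  have spH: "rv_poly x UNIV H" using 1(2) by (auto intro: poly_mono)
  show ?case
  proof (cases L)
    case Nil
    then show ?thesis using ev_const[of 1] by simp
  next
    case (Cons e L')
    obtain i l where e: "e = (i, l)" by (cases e)
    obtain H' where H': "deriv_rel x (l,i) H H'" "rv_poly x Pos H'"
      using deriv_rel_exists[OF 1(2)] by blast
    have spH': "rv_poly x UNIV H'" using H' by (auto intro: poly_mono)
    have A: "ev (mono_deriv x (l,i) L') * ev H \<le> ev (\<lambda>\<omega>. mono_deriv x (l,i) L' \<omega> * H \<omega>)"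
    proof -
      have "ev (mono_deriv x (l,i) L') * ev H = (\<Sum>P\<leftarrow>mono_removals (l,i) L'. ev (mono_val x P) * ev H)"
        unfolding mono_deriv_def[abs_def]
        by (subst ev_sum_list) (auto intro: poly_mono_val simp: sum_list_mult_const)
      also have "\<dots> \<le> (\<Sum>P\<leftarrow>mono_removals (l,i) L'. ev (\<lambda>\<omega>. mono_val x P \<omega> * H \<omega>))"
      proof (intro sum_list_mono)
        fix P assume "P \<in> set (mono_removals (l,i) L')"
        then have "length P < length L" using length_mono_removals[of P "(l,i)" L'] Cons by auto
        then show "ev (mono_val x P) * ev H \<le> ev (\<lambda>\<omega>. mono_val x P \<omega> * H \<omega>)" using 1 by blast
      qed
      also have "\<dots> = ev (\<lambda>\<omega>. mono_deriv x (l,i) L' \<omega> * H \<omega>)"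
        unfolding mono_deriv_def
        by (subst ev_sum_list[symmetric])
           (auto intro: poly_mono_val poly_mult spH simp: sum_list_mult_const)
      finally show ?thesis .
    qed
    have "ev (\<lambda>\<omega>. x (i,l) \<omega> * (mono_val x L' \<omega> * H \<omega>)) =
        s i l * ev (\<lambda>\<omega>. mono_deriv x (l,i) L' \<omega> * H \<omega> + mono_val x L' \<omega> * H' \<omega>)"
      by (intro ev_by_parts der_mult deriv_rel_mono_val H')
    also have "\<dots> = s i l * (ev (\<lambda>\<omega>. mono_deriv x (l,i) L' \<omega> * H \<omega>) + ev (\<lambda>\<omega>. mono_val x L' \<omega> * H' \<omega>))"
      by (subst ev_add) (auto intro!: poly_mult poly_mono_deriv poly_mono_val spH spH')
    \<comment> \<open>The discarded part pairs the first letter with a letter of \<open>H\<close>;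
      it is nonnegative.\<close>
    also have "\<dots> \<ge> s i l * (ev (mono_deriv x (l,i) L') * ev H)"
      using A ev_nonneg_mono[OF H'(2), of L'] s_nonneg by (intro mult_left_mono) auto
    also have "s i l * (ev (mono_deriv x (l,i) L') * ev H) = ev (mono_val x L) * ev H"
      using ev_by_parts[OF deriv_rel_mono_val, of i l L'] by (simp add: Cons e mono_val_def[abs_def])
    finally show ?thesis by (simp add: Cons e mult.assoc mono_val_def[abs_def])
  qed
qed

text \<open>Positive association. It makes the covariances below nonnegative, so that only upper
  bounds are required for them.\<close>

lemma ev_mult_ge:
  assumes F: "rv_poly x Pos F" and H: "rv_poly x Pos H"
  shows "ev F * ev H \<le> ev (\<lambda>\<omega>. F \<omega> * H \<omega>)"
proof -
  have spH: "rv_poly x UNIV H" using H by (auto intro: poly_mono)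
  have "ev (\<lambda>\<omega>. mono_val x L \<omega> * F \<omega>) * ev H \<le> ev (\<lambda>\<omega>. mono_val x L \<omega> * F \<omega> * H \<omega>)" for L
    using F
  proof (induction arbitrary: L rule: rv_poly.induct)
    case (poly_const c)
    have "ev (\<lambda>\<omega>. of_real c * mono_val x L \<omega>) * ev H \<le> ev (\<lambda>\<omega>. of_real c * (mono_val x L \<omega> * H \<omega>))"
      using ev_mono_mult_ge[OF H, of L] poly_const
      by (simp add: ev_cmult mult.assoc mult_left_mono)
    then show ?case by (simp add: mult_ac)
  next
    case (poly_add F G)
    have sp: "rv_poly x UNIV F" "rv_poly x UNIV G" using poly_add by (auto intro: poly_mono)
    have m: "rv_poly x UNIV (mono_val x L)" by (rule poly_mono_val) simp
    have "ev (\<lambda>\<omega>. mono_val x L \<omega> * (F \<omega> + G \<omega>)) = ev (\<lambda>\<omega>. mono_val x L \<omega> * F \<omega>) + ev (\<lambda>\<omega>. mono_val x L \<omega> * G \<omega>)"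
      by (simp add: distrib_left ev_add poly_mult sp m)
    moreover have "ev (\<lambda>\<omega>. mono_val x L \<omega> * (F \<omega> + G \<omega>) * H \<omega>) =
        ev (\<lambda>\<omega>. mono_val x L \<omega> * F \<omega> * H \<omega>) + ev (\<lambda>\<omega>. mono_val x L \<omega> * G \<omega> * H \<omega>)"
      by (simp add: distrib_left distrib_right ev_add poly_mult sp m spH)
    ultimately show ?case using poly_add.IH[of L] by (simp add: algebra_simps)
  next
    case (poly_var F e)
    then show ?case using poly_var.IH[of "e # L"] by (simp add: mult_ac)
  qed
  from this[of "[]"] show ?thesis by simp
qed

text \<open>A letter \<open>(i, l)\<close> and its partner \<open>(l, i)\<close> contribute opposite
  excesses, so deleting the pair leaves the excess of the word \<open>(i, l) # L\<close>
  unchanged.\<close>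

lemma mono_removals_balance:
  assumes "P \<in> set (mono_removals (l, i) L)"
  shows "(\<Sum>(p, q)\<leftarrow>P. of_bool (u = p) - of_bool (u = q) :: int)
    = (\<Sum>(p, q)\<leftarrow>L. of_bool (u = p) - of_bool (u = q)) + of_bool (u = i) - of_bool (u = l)"
  using assms
  by (induction L arbitrary: P) (auto split: if_splits)

text \<open>Each integration by parts preserves the nonzero excess, so the reduction never ends in
  the empty word.\<close>

lemma ev_mono_unbalanced:
  assumes "(\<Sum>(p, q)\<leftarrow>L. of_bool (u = p) - of_bool (u = q) :: int) \<noteq> 0"
  shows "ev (mono_val x L) = 0"
  using assms
proof (induction L rule: length_induct)
  case (1 L)
  show ?case
  proof (cases L)
    case Nil
    then show ?thesis using 1 by simp
  next
    case (Cons e L')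
    obtain i l where e: "e = (i, l)" by (cases e)
    have "ev (mono_val x P) = 0" if "P \<in> set (mono_removals (l,i) L')" for P
      using 1 length_mono_removals[OF that] mono_removals_balance[OF that, of u]
      by (auto simp: Cons e)
    then have "ev (mono_deriv x (l,i) L') = 0"
      unfolding mono_deriv_def[abs_def]
      by (subst ev_sum_list) (auto intro!: poly_mono_val simp: \<open>\<And>P. P \<in> set (mono_removals (l,i) L') \<Longrightarrow> ev (mono_val x P) = 0\<close> cong: map_cong)
    then show ?thesis
      using ev_by_parts[OF deriv_rel_mono_val, of i l L'] by (simp add: Cons e mono_val_def)
  qed
qed

lemma balance_poly: "balance x d F \<Longrightarrow> rv_poly x UNIV F"
proof (induction rule: balance.induct)
  case (bal_zero d) then show ?case using poly_const[of 0 UNIV x] by simp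
next
  case bal_one then show ?case using poly_const[of 1 UNIV x] by simp
qed (auto intro: rv_poly.intros)

lemma ev_unbalanced:
  assumes "balance x d F" "d u \<noteq> 0"
  shows "ev F = 0"
proof -
  have "d u + (\<Sum>(p, q)\<leftarrow>L. of_bool (u = p) - of_bool (u = q) :: int) \<noteq> 0 \<Longrightarrow>
      ev (\<lambda>\<omega>. mono_val x L \<omega> * F \<omega>) = 0" for L
    using assms(1)
  proof (induction arbitrary: L rule: balance.induct)
    case (bal_zero d)
    then show ?case by simp
  next
    case bal_one
    then show ?case using ev_mono_unbalanced[of u L] by simp
  next
    case (bal_add d F G)
    have m: "rv_poly x UNIV (mono_val x L)" by (rule poly_mono_val) simp
    have "ev (\<lambda>\<omega>. mono_val x L \<omega> * F \<omega>) = 0" "ev (\<lambda>\<omega>. mono_val x L \<omega> * G \<omega>) = 0"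
      using bal_add by auto
    then show ?case using bal_add.hyps[THEN balance_poly] m by (simp add: distrib_left ev_add poly_mult)
  next
    case (bal_var d F i j)
    have "ev (\<lambda>\<omega>. mono_val x ((i,j) # L) \<omega> * F \<omega>) = 0"
      using bal_var.prems by (intro bal_var.IH) (auto simp: algebra_simps)
    then show ?case by (simp add: mult_ac)
  qed
  from this[of "[]"] assms(2) show ?thesis by simp
qed

end

section \<open>Bounds obtained by counting pairings\<close>

fun moment_bound :: "real \<Rightarrow> nat \<Rightarrow> real" where
  "moment_bound v 0 = 1"
| "moment_bound v (Suc 0) = 0"
| "moment_bound v (Suc (Suc d)) = v * real (d + 1) * moment_bound v d"

text \<open>\<open>moment_bound v d\<close> is the number of pairings of \<open>d\<close> letters
  times \<open>v\<close> to the power \<open>d / 2\<close>. In a covariance with a fixed factor of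
  degree \<open>m\<close>, the first of \<open>d + 2\<close> letters is paired either with another
  of them, or with one of the \<open>m\<close> letters of the fixed factor; in the latter case a
  plain moment of the remaining \<open>d + m\<close> letters is left. A common factor
  \<open>\<kappa>\<close> is taken out.\<close>

fun covariance_bound :: "real \<Rightarrow> nat \<Rightarrow> nat \<Rightarrow> real" where
  "covariance_bound v m 0 = 0"
| "covariance_bound v m (Suc 0) = real m * moment_bound v (m - 1)"
| "covariance_bound v m (Suc (Suc d)) =
     v * real (d + 1) * covariance_bound v m d + real m * moment_bound v (d + m)"

text \<open>Error of a diagonal moment in units of \<open>\<kappa>\<^sup>2\<close>: the errors
  inherited by the two factors of \<open>m c * m (k - 1 - c)\<close>, and the covariance between the
  corresponding random factors.\<close>

fun mean_bound :: "real \<Rightarrow> (nat \<Rightarrow> real) \<Rightarrow> nat \<Rightarrow> real" where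
  "mean_bound v m 0 = 0"
| "mean_bound v m (Suc k) = (\<Sum>c<k. v * (mean_bound v m c * moment_bound v (k - 1 - c)
       + \<bar>m c\<bar> * mean_bound v m (k - 1 - c)) + covariance_bound v c (k - 1 - c))"

text \<open>Cost, in units of \<open>\<kappa>\<close>, of splitting off the expectations of the
  factors of a product one after the other.\<close>

fun product_bound :: "real \<Rightarrow> nat list \<Rightarrow> real" where
  "product_bound v [] = 0"
| "product_bound v (k # ks) = covariance_bound v k (sum_list ks) + moment_bound v k * product_bound v ks"

lemma moment_bound_nonneg: "0 \<le> v \<Longrightarrow> 0 \<le> moment_bound v d"
  by (induction v d rule: moment_bound.induct) auto

lemma covariance_bound_nonneg: "0 \<le> v \<Longrightarrow> 0 \<le> covariance_bound v m d"
  by (induction v m d rule: covariance_bound.induct) (auto simp: moment_bound_nonneg)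

lemma mean_bound_nonneg: "0 \<le> v \<Longrightarrow> 0 \<le> mean_bound v m k"
proof (induction k rule: less_induct)
  case (less k)
  then show ?case
    by (cases k) (auto intro!: sum_nonneg add_nonneg_nonneg mult_nonneg_nonneg moment_bound_nonneg covariance_bound_nonneg)
qed

lemma product_bound_nonneg: "0 \<le> v \<Longrightarrow> 0 \<le> product_bound v ks"
  by (induction ks) (auto simp: moment_bound_nonneg covariance_bound_nonneg)

abbreviation total_degree :: "(nat \<times> nat \<times> nat) list \<Rightarrow> nat" where
  "total_degree zs \<equiv> sum_list (map fst zs)"

text \<open>A triple \<open>(k, i, j)\<close> stands for the entry \<open>(i, j)\<close> of the
  \<open>k\<close>-th matrix power. If a letter \<open>(i, l)\<close> in front of the word from
  \<open>l\<close> to \<open>j\<close> is paired with a letter inside the word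
  \<open>(k', i', j')\<close>, then summing over \<open>l\<close> glues the initial piece of that
  word to the word ending in \<open>j\<close>, and the final piece now starts at \<open>i\<close>.
  The list runs through all letters of all words of \<open>zs\<close>.\<close>

fun reductions :: "nat \<Rightarrow> nat \<Rightarrow> nat \<Rightarrow> (nat \<times> nat \<times> nat) list \<Rightarrow> (nat \<times> nat \<times> nat) list list" where
  "reductions k j i [] = []"
| "reductions k j i ((k', i', j') # zs) =
     map (\<lambda>c. (c + k, i', j) # (k' - 1 - c, i, j') # zs) [0..<k'] @ map ((#) (k', i', j')) (reductions k j i zs)"

lemma total_degree_reductions:
  "P \<in> set (reductions k j i zs) \<Longrightarrow> Suc (total_degree P) = total_degree zs + k"
  by (induction k j i zs arbitrary: P rule: reductions.induct) auto

lemma length_reductions: "length (reductions k j i zs) = total_degree zs"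
  by (induction k j i zs rule: reductions.induct) auto

lemma length_in_reductions:
  "P \<in> set (reductions k j i zs) \<Longrightarrow> length P = Suc (length zs)"
  by (induction k j i zs arbitrary: P rule: reductions.induct) auto

context wick_matrix
begin

primrec pw :: "nat \<Rightarrow> nat \<Rightarrow> nat \<Rightarrow> 'a \<Rightarrow> complex" where
  "pw 0 i j \<omega> = of_bool (i = j)"
| "pw (Suc k) i j \<omega> = (\<Sum>l<N. x (i, l) \<omega> * pw k l j \<omega>)"

definition pp :: "(nat \<times> nat \<times> nat) list \<Rightarrow> 'a \<Rightarrow> complex" where
  "pp zs \<omega> = (\<Prod>(k, i, j)\<leftarrow>zs. pw k i j \<omega>)"

lemma pp_simps [simp]:
  "pp [] \<omega> = 1" "pp ((k, i, j) # zs) \<omega> = pw k i j \<omega> * pp zs \<omega>"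
  by (simp_all add: pp_def)

text \<open>The zeroth power has diagonal entry 1 even at indices outside the matrix, where the
  gluing rule \<open>pw_add\<close> would fail.\<close>

definition in_range :: "(nat \<times> nat \<times> nat) list \<Rightarrow> bool" where
  "in_range zs \<longleftrightarrow> (\<forall>(k, i, j)\<in>set zs. i < N \<and> j < N)"

lemma in_range_simps [simp]:
  "in_range []" "in_range ((k, i, j) # zs) \<longleftrightarrow> i < N \<and> j < N \<and> in_range zs"
  by (auto simp: in_range_def)

lemma in_range_reductions:
  "P \<in> set (reductions k j i zs) \<Longrightarrow> i < N \<Longrightarrow> j < N \<Longrightarrow> in_range zs \<Longrightarrow> in_range P"
  by (induction k j i zs arbitrary: P rule: reductions.induct) auto

lemma poly_pw: "rv_poly x Pos (pw k i j)"
proof (induction k arbitrary: i j)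
  case 0
  show ?case using poly_const[of 0 Pos x] poly_const[of 1 Pos x]
    by (cases "i = j") (simp_all add: pw.simps(1)[abs_def])
next
  case (Suc k)
  then show ?case by (auto simp: pw.simps(2)[abs_def] intro!: poly_sum poly_var)
qed

lemma poly_pp: "rv_poly x Pos (pp zs)"
  unfolding pp_def[abs_def] case_prod_unfold by (intro poly_prod_list poly_pw) auto

lemma poly_Pos_UNIV: "rv_poly x Pos F \<Longrightarrow> rv_poly x UNIV F"
  by (erule poly_mono) simp

lemma poly_pw_UNIV: "rv_poly x UNIV (pw k i j)"
  using poly_pw by (rule poly_mono) auto

lemma poly_pp_UNIV: "rv_poly x UNIV (pp zs)"
  using poly_pp by (rule poly_mono) auto

definition dpw :: "nat \<Rightarrow> nat \<Rightarrow> nat \<Rightarrow> nat \<Rightarrow> nat \<Rightarrow> 'a \<Rightarrow> complex" where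
  "dpw a b k i j \<omega> = (\<Sum>c<k. pw c i a \<omega> * pw (k - 1 - c) b j \<omega>)"

lemma dpw_Suc:
  "dpw a b (Suc k) i j \<omega> = of_bool (i = a) * pw k b j \<omega> + (\<Sum>l<N. x (i, l) \<omega> * dpw a b k l j \<omega>)"
proof -
  have "dpw a b (Suc k) i j \<omega> = of_bool (i = a) * pw k b j \<omega> +
      (\<Sum>c<k. (\<Sum>l<N. x (i, l) \<omega> * pw c l a \<omega>) * pw (k - 1 - c) b j \<omega>)"
    unfolding dpw_def by (subst sum.lessThan_Suc_shift) (simp add: sum_distrib_right)
  also have "(\<Sum>c<k. (\<Sum>l<N. x (i, l) \<omega> * pw c l a \<omega>) * pw (k - 1 - c) b j \<omega>) =
      (\<Sum>l<N. x (i, l) \<omega> * dpw a b k l j \<omega>)"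
    unfolding dpw_def sum_distrib_left sum_distrib_right
    by (subst sum.swap) (simp add: mult.assoc)
  finally show ?thesis .
qed

lemma der_pw:
  assumes "b < N"
  shows "deriv_rel x (a, b) (pw k i j) (dpw a b k i j)"
proof (induction k arbitrary: i)
  case 0
  show ?case using der_const[of x "(a, b)" 1] der_zero[of x "(a, b)"]
    by (cases "i = j") (simp_all add: pw.simps(1)[abs_def] dpw_def[abs_def])
next
  case (Suc k)
  have *: "deriv_rel x (a, b) (\<lambda>\<omega>. \<Sum>l<N. x (i, l) \<omega> * pw k l j \<omega>)
    (\<lambda>\<omega>. \<Sum>l<N. of_bool ((i, l) = (a, b)) * pw k l j \<omega> + x (i, l) \<omega> * dpw a b k l j \<omega>)"
    by (intro der_sum der_var Suc)
  have "(\<Sum>l<N. of_bool ((i, l) = (a, b)) * pw k l j \<omega> + x (i, l) \<omega> * dpw a b k l j \<omega>) =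
      dpw a b (Suc k) i j \<omega>" for \<omega>
  proof -
    have "(\<Sum>l<N. of_bool ((i, l) = (a, b)) * pw k l j \<omega>) = (\<Sum>l<N. if l = b then of_bool (i = a) * pw k b j \<omega> else 0)"
      by (intro sum.cong) auto
    then show ?thesis using assms by (simp add: dpw_Suc sum.distrib)
  qed
  with * show ?case by (simp add: pw.simps(2)[abs_def])
qed

fun dpp :: "nat \<Rightarrow> nat \<Rightarrow> (nat \<times> nat \<times> nat) list \<Rightarrow> 'a \<Rightarrow> complex" where
  "dpp a b [] \<omega> = 0"
| "dpp a b ((k, i, j) # zs) \<omega> = dpw a b k i j \<omega> * pp zs \<omega> + pw k i j \<omega> * dpp a b zs \<omega>"

lemma der_pp:
  assumes "b < N"
  shows "deriv_rel x (a, b) (pp zs) (dpp a b zs)"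
proof (induction zs)
  case Nil
  show ?case using der_const[of x "(a, b)" 1] by (simp add: pp_def[abs_def] dpp.simps(1)[abs_def])
next
  case (Cons z zs)
  obtain k i j where z: "z = (k, i, j)" by (cases z) auto
  show ?case using der_mult[OF der_pw[OF assms, of a k i j] Cons]
    by (simp add: z pp_def[abs_def] dpp.simps(2)[abs_def])
qed

lemma poly_dpw: "rv_poly x Pos (dpw a b k i j)"
  unfolding dpw_def[abs_def] by (intro poly_sum poly_mult poly_pw) auto

lemma poly_dpp: "rv_poly x Pos (dpp a b zs)"
proof (induction zs)
  case Nil
  show ?case using poly_const[of 0 Pos x] by (simp add: dpp.simps(1)[abs_def])
next
  case (Cons z zs)
  then show ?case by (cases z) (auto simp: dpp.simps(2)[abs_def] intro!: poly_add poly_mult poly_dpw poly_pp poly_pw)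
qed

lemma pw_add:
  assumes "i < N"
  shows "(\<Sum>l<N. pw c i l \<omega> * pw k l j \<omega>) = pw (c + k) i j \<omega>"
  using assms
proof (induction c arbitrary: i)
  case 0
  have "(\<Sum>l<N. of_bool (i = l) * pw k l j \<omega>) = (\<Sum>l<N. if l = i then pw k i j \<omega> else 0)"
    by (intro sum.cong) auto
  then show ?case using 0 by simp
next
  case (Suc c)
  have "(\<Sum>l<N. pw (Suc c) i l \<omega> * pw k l j \<omega>) = (\<Sum>l<N. \<Sum>m<N. x (i,m) \<omega> * (pw c m l \<omega> * pw k l j \<omega>))"
    by (simp add: sum_distrib_right mult.assoc)
  also have "\<dots> = (\<Sum>m<N. x (i,m) \<omega> * (\<Sum>l<N. pw c m l \<omega> * pw k l j \<omega>))"
    by (subst sum.swap) (simp add: sum_distrib_left)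
  also have "\<dots> = pw (Suc c + k) i j \<omega>" using Suc.IH by (simp add: mult.assoc)
  finally show ?case .
qed

lemma sum_pw_dpw:
  assumes "i' < N"
  shows "(\<Sum>l<N. pw k l j \<omega> * dpw l i k' i' j' \<omega>) = (\<Sum>c<k'. pw (c + k) i' j \<omega> * pw (k' - 1 - c) i j' \<omega>)"
proof -
  have "(\<Sum>l<N. pw k l j \<omega> * dpw l i k' i' j' \<omega>) =
     (\<Sum>c<k'. (\<Sum>l<N. pw c i' l \<omega> * pw k l j \<omega>) * pw (k' - 1 - c) i j' \<omega>)"
    unfolding dpw_def sum_distrib_left sum_distrib_right
    by (subst sum.swap) (simp add: mult_ac)
  also have "\<dots> = (\<Sum>c<k'. pw (c + k) i' j \<omega> * pw (k' - 1 - c) i j' \<omega>)"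
    by (simp add: pw_add assms)
  finally show ?thesis .
qed

text \<open>Pairing with a different word: the free sum over \<open>l\<close> is absorbed into a
  matrix product, so it produces no factor \<open>N\<close>. This is the mechanism behind every gain
  of a \<open>\<kappa>\<close>.\<close>

lemma sum_pw_dpp:
  assumes "in_range zs"
  shows "(\<Sum>l<N. pw k l j \<omega> * dpp l i zs \<omega>) = (\<Sum>P\<leftarrow>reductions k j i zs. pp P \<omega>)"
  using assms
proof (induction zs)
  case Nil
  then show ?case by simp
next
  case (Cons z zs)
  obtain k' i' j' where z: "z = (k', i', j')" by (cases z) auto
  have "(\<Sum>l<N. pw k l j \<omega> * dpp l i (z # zs) \<omega>) =
      (\<Sum>l<N. pw k l j \<omega> * dpw l i k' i' j' \<omega>) * pp zs \<omega> + pw k' i' j' \<omega> * (\<Sum>l<N. pw k l j \<omega> * dpp l i zs \<omega>)"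
    by (simp add: z sum_distrib_left sum_distrib_right distrib_left sum.distrib mult_ac)
  also have "\<dots> = (\<Sum>P\<leftarrow>reductions k j i (z # zs). pp P \<omega>)"
    using Cons by (simp add: z sum_pw_dpw o_def sum_list_const_mult atLeast0LessThan
        sum_distrib_right mult.assoc flip: sum_set_upt_conv_sum_list_nat)
  finally show ?case .
qed

text \<open>The bounds on moments and on covariances are instances of one induction, in which
  \<open>\<phi>\<close> is the expectation respectively the covariance with a fixed random variable.\<close>

lemma functional_bound:
  assumes sum: "\<And>F I. (\<And>i::nat. i \<in> I \<Longrightarrow> rv_poly x Pos (F i)) \<Longrightarrow> \<phi> (\<lambda>\<omega>. \<Sum>i\<in>I. F i \<omega>) = (\<Sum>i\<in>I. \<phi> (F i))"
    and nonneg: "\<And>F. rv_poly x Pos F \<Longrightarrow> 0 \<le> \<phi> F"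
    and parts: "\<And>i l F F'. i < N \<Longrightarrow> l < N \<Longrightarrow> deriv_rel x (l, i) F F' \<Longrightarrow> rv_poly x Pos F \<Longrightarrow> rv_poly x Pos F' \<Longrightarrow>
       \<phi> (\<lambda>\<omega>. x (i, l) \<omega> * F \<omega>) = s i l * (\<phi> F' + R i l F)"
    and rest: "\<And>k i j zs. i < N \<Longrightarrow> j < N \<Longrightarrow> in_range zs \<Longrightarrow>
       (\<Sum>l<N. s i l * R i l (\<lambda>\<omega>. pw k l j \<omega> * pp zs \<omega>)) \<le> r (Suc (k + total_degree zs))"
    and B0: "\<phi> (\<lambda>_. 1) \<le> B 0" and B_nonneg: "\<And>d. 0 \<le> B d"
    and B: "\<And>d. v * real d * B (d - 1) + r (Suc d) \<le> B (Suc d)"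
    and zs: "in_range zs"
  shows "\<phi> (pp zs) \<le> B (total_degree zs)"
  using zs
\<comment> \<open>A zero power is dropped without lowering the degree, whereas splitting a word
  lowers the degree by two and adds a word; the weight 2 on the degree covers both.\<close>
proof (induction zs rule: measure_induct_rule[of "\<lambda>zs. 2 * total_degree zs + length zs"])
  case (less zs)
  have add: "\<phi> (\<lambda>\<omega>. F \<omega> + G \<omega>) = \<phi> F + \<phi> G" if "rv_poly x Pos F" "rv_poly x Pos G" for F G
    using sum[of "{0, 1}" "\<lambda>i. if i = 0 then F else G"] that by simp
  have zero: "\<phi> (\<lambda>_. 0) = 0" using sum[of "{}"] by simp
  have sum_list: "\<phi> (\<lambda>\<omega>. \<Sum>P\<leftarrow>Ps. pp P \<omega>) = (\<Sum>P\<leftarrow>Ps. \<phi> (pp P))" for Ps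
    by (induction Ps) (auto simp: zero add poly_pp poly_sum_list)
  show ?case
  proof (cases zs)
    case Nil
    then show ?thesis using B0 by (simp add: pp_def[abs_def])
  next
    case (Cons z zs')
    obtain k i j where z: "z = (k, i, j)" by (cases z) auto
    have rng: "i < N" "j < N" "in_range zs'" using less.prems by (auto simp: Cons z)
    show ?thesis
    proof (cases k)
      case 0
      have "\<phi> (pp zs) \<le> \<phi> (pp zs')"
        using nonneg[OF poly_pp, of zs'] by (cases "i = j") (simp_all add: Cons z 0 pp_def[abs_def] zero)
      also have "\<dots> \<le> B (total_degree zs')" by (rule less.IH) (auto simp: Cons z rng)
      also have "total_degree zs' = total_degree zs" by (simp add: Cons z 0)
      finally show ?thesis .
    next
      case (Suc k')
      let ?F = "\<lambda>l \<omega>. pw k' l j \<omega> * pp zs' \<omega>"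
      let ?F1 = "\<lambda>l \<omega>. dpw l i k' l j \<omega> * pp zs' \<omega>"
      let ?F2 = "\<lambda>l \<omega>. pw k' l j \<omega> * dpp l i zs' \<omega>"
      note pol = poly_mult poly_pw poly_pp poly_dpw poly_dpp
      have pF: "rv_poly x Pos (?F l)" "rv_poly x Pos (?F1 l)" "rv_poly x Pos (?F2 l)" for l
        by (intro pol; simp)+
      have D: "deriv_rel x (l, i) (?F l) (\<lambda>\<omega>. ?F1 l \<omega> + ?F2 l \<omega>)" for l
        by (intro der_mult der_pw der_pp rng)
      let ?d = "k' + total_degree zs'"
      have "\<phi> (pp zs) = \<phi> (\<lambda>\<omega>. \<Sum>l<N. x (i, l) \<omega> * ?F l \<omega>)"
        by (simp add: Cons z Suc pp_def[abs_def] sum_distrib_right mult.assoc)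
      also have "\<dots> = (\<Sum>l<N. \<phi> (\<lambda>\<omega>. x (i, l) \<omega> * ?F l \<omega>))"
        by (intro sum poly_var pF)
      also have "\<dots> = (\<Sum>l<N. s i l * (\<phi> (?F1 l) + \<phi> (?F2 l) + R i l (?F l)))"
        using parts[OF rng(1) _ D] pF by (intro sum.cong) (auto simp: add poly_add)
      also have "\<dots> = (\<Sum>l<N. s i l * \<phi> (?F1 l)) + (\<Sum>l<N. s i l * \<phi> (?F2 l)) + (\<Sum>l<N. s i l * R i l (?F l))"
        by (simp add: distrib_left sum.distrib)
      \<comment> \<open>A pairing inside the first word leaves a loop at \<open>l\<close>. The
        inductive bound does not depend on \<open>l\<close>, so the variances sum to
        \<open>v\<close>.\<close>
      also have "(\<Sum>l<N. s i l * \<phi> (?F1 l)) \<le> (\<Sum>l<N. s i l * (real k' * B (?d - 1)))"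
      proof (intro sum_mono mult_left_mono s_nonneg)
        fix l assume l: "l \<in> {..<N}"
        have "\<phi> (?F1 l) = \<phi> (\<lambda>\<omega>. \<Sum>c<k'. pp ((c, l, l) # (k' - 1 - c, i, j) # zs') \<omega>)"
          by (simp add: dpw_def sum_distrib_right mult.assoc)
        also have "\<dots> = (\<Sum>c<k'. \<phi> (pp ((c, l, l) # (k' - 1 - c, i, j) # zs')))"
          by (intro sum poly_pp)
        also have "\<dots> \<le> (\<Sum>c<k'. B (?d - 1))"
        proof (intro sum_mono)
          fix c assume c: "c \<in> {..<k'}"
          let ?zs = "(c, l, l) # (k' - 1 - c, i, j) # zs'"
          have "\<phi> (pp ?zs) \<le> B (total_degree ?zs)"
            using c l rng by (intro less.IH) (auto simp: Cons z Suc)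
          also have "total_degree ?zs = ?d - 1" using c by auto
          finally show "\<phi> (pp ?zs) \<le> B (?d - 1)" .
        qed
        finally show "\<phi> (?F1 l) \<le> real k' * B (?d - 1)" by simp
      qed
      also have "\<dots> = v * (real k' * B (?d - 1))" by (simp add: s_sum rng flip: sum_distrib_right)
      \<comment> \<open>A pairing with another word leaves no loop: each variance is bounded by
        \<open>v\<close> separately, and the sum over \<open>l\<close> is absorbed by
        gluing.\<close>
      also have "(\<Sum>l<N. s i l * \<phi> (?F2 l)) \<le> (\<Sum>l<N. v * \<phi> (?F2 l))"
        using s_le \<kappa>_le nonneg[OF pF(3)] by (intro sum_mono mult_right_mono) (auto intro: order_trans)
      also have "\<dots> = v * \<phi> (\<lambda>\<omega>. \<Sum>l<N. ?F2 l \<omega>)"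
        by (subst sum) (auto intro!: pF simp: sum_distrib_left)
      also have "\<phi> (\<lambda>\<omega>. \<Sum>l<N. ?F2 l \<omega>) = (\<Sum>P\<leftarrow>reductions k' j i zs'. \<phi> (pp P))"
        by (simp add: sum_pw_dpp rng sum_list)
      also have "\<dots> \<le> (\<Sum>P\<leftarrow>reductions k' j i zs'. B (?d - 1))"
      proof (intro sum_list_mono)
        fix P assume P: "P \<in> set (reductions k' j i zs')"
        have "\<phi> (pp P) \<le> B (total_degree P)"
          using P total_degree_reductions[OF P] length_in_reductions[OF P]
          by (intro less.IH in_range_reductions[OF P] rng) (auto simp: Cons z Suc)
        also have "total_degree P = ?d - 1" using total_degree_reductions[OF P] by simp
        finally show "\<phi> (pp P) \<le> B (?d - 1)" .
      qed
      also have "\<dots> = real (total_degree zs') * B (?d - 1)"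
        by (simp add: sum_list_triv length_reductions)
      also have "(\<Sum>l<N. s i l * R i l (?F l)) \<le> r (Suc ?d)"
        by (intro rest rng)
      finally have "\<phi> (pp zs) \<le> v * (real k' * B (?d - 1)) + v * (real (total_degree zs') * B (?d - 1)) + r (Suc ?d)"
        using v_nonneg by (simp add: mult_left_mono)
      also have "\<dots> = v * real ?d * B (?d - 1) + r (Suc ?d)" by (simp add: algebra_simps)
      also have "\<dots> \<le> B (Suc ?d)" by (rule B)
      also have "Suc ?d = total_degree zs" by (simp add: Cons z Suc)
      finally show ?thesis .
    qed
  qed
qed

lemma ev_pp_le:
  assumes "in_range zs"
  shows "ev (pp zs) \<le> moment_bound v (total_degree zs)"
proof (rule functional_bound[where \<phi> = ev and R = "\<lambda>_ _ _. 0" and r = "\<lambda>_. 0" and B = "moment_bound v"])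
  fix F :: "nat \<Rightarrow> 'a \<Rightarrow> complex" and I assume "\<And>i. i \<in> I \<Longrightarrow> rv_poly x Pos (F i)"
  then show "ev (\<lambda>\<omega>. \<Sum>i\<in>I. F i \<omega>) = (\<Sum>i\<in>I. ev (F i))"
    by (intro ev_sum poly_Pos_UNIV)
next
  fix d show "v * real d * moment_bound v (d - 1) + 0 \<le> moment_bound v (Suc d)"
    by (cases d) auto
next
  fix i l F F' assume "deriv_rel x (l, i) F F'"
  then show "ev (\<lambda>\<omega>. x (i, l) \<omega> * F \<omega>) = s i l * (ev F' + 0)" by (simp add: ev_by_parts)
next
  show "ev (\<lambda>_. 1) \<le> moment_bound v 0" using ev_const[of 1] by simp
qed (simp_all add: ev_nonneg moment_bound_nonneg v_nonneg assms)

definition cov :: "('a \<Rightarrow> complex) \<Rightarrow> ('a \<Rightarrow> complex) \<Rightarrow> real" where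
  "cov f F = ev (\<lambda>\<omega>. F \<omega> * f \<omega>) - ev F * ev f"

lemma cov_nonneg: "rv_poly x Pos f \<Longrightarrow> rv_poly x Pos F \<Longrightarrow> 0 \<le> cov f F"
  using ev_mult_ge[of F f] by (simp add: cov_def)

lemma cov_sum:
  assumes "rv_poly x UNIV f" "\<And>i. i \<in> I \<Longrightarrow> rv_poly x UNIV (F i)"
  shows "cov f (\<lambda>\<omega>. \<Sum>i\<in>I. F i \<omega>) = (\<Sum>i\<in>I. cov f (F i))"
  unfolding cov_def sum_distrib_right
  by (subst (1 2) ev_sum) (auto intro: assms poly_mult simp: sum_subtractf sum_distrib_right)

text \<open>Compared with the recursion for moments there is one source term, in which the head
  letter is paired with a letter of \<open>f\<close>. There the variances are bounded by
  \<open>\<kappa>\<close>, and the sum over \<open>l\<close> glues the head word to a piece of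
  \<open>f\<close>; the assumption \<open>rest\<close> bounds the outcome.\<close>

lemma cov_pp_le:
  assumes f: "rv_poly x Pos f"
    and D: "\<And>i l. i < N \<Longrightarrow> l < N \<Longrightarrow> deriv_rel x (l, i) f (D i l)" "\<And>i l. rv_poly x Pos (D i l)"
    and rest: "\<And>k i j zs. i < N \<Longrightarrow> j < N \<Longrightarrow> in_range zs \<Longrightarrow>
       ev (\<lambda>\<omega>. (\<Sum>l<N. pw k l j \<omega> * D i l \<omega>) * pp zs \<omega>) \<le> real m * moment_bound v (k + total_degree zs + m - 1)"
    and zs: "in_range zs"
  shows "cov f (pp zs) \<le> \<kappa> * covariance_bound v m (total_degree zs)"
proof (rule functional_bound[where \<phi> = "cov f" and R = "\<lambda>i l F. ev (\<lambda>\<omega>. F \<omega> * D i l \<omega>)"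
      and r = "\<lambda>d. \<kappa> * real m * moment_bound v (d + m - 2)" and B = "\<lambda>d. \<kappa> * covariance_bound v m d"])
  have fU: "rv_poly x UNIV f" using f by (rule poly_mono) auto
  show "cov f (\<lambda>\<omega>. \<Sum>i\<in>I. F i \<omega>) = (\<Sum>i\<in>I. cov f (F i))"
    if "\<And>i::nat. i \<in> I \<Longrightarrow> rv_poly x Pos (F i)" for F I
    using that by (intro cov_sum fU poly_Pos_UNIV)
  show "cov f (\<lambda>\<omega>. x (i, l) \<omega> * F \<omega>) = s i l * (cov f F' + ev (\<lambda>\<omega>. F \<omega> * D i l \<omega>))"
    if "i < N" "l < N" "deriv_rel x (l, i) F F'" "rv_poly x Pos F" "rv_poly x Pos F'" for i l F F'
  proof -
    have U: "rv_poly x UNIV F" "rv_poly x UNIV F'" "rv_poly x UNIV (D i l)"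
      using that D by (auto intro: poly_Pos_UNIV)
    have "ev (\<lambda>\<omega>. x (i, l) \<omega> * (F \<omega> * f \<omega>)) = s i l * ev (\<lambda>\<omega>. F' \<omega> * f \<omega> + F \<omega> * D i l \<omega>)"
      using that by (intro ev_by_parts der_mult D)
    also have "\<dots> = s i l * (ev (\<lambda>\<omega>. F' \<omega> * f \<omega>) + ev (\<lambda>\<omega>. F \<omega> * D i l \<omega>))"
      by (subst ev_add) (auto intro!: poly_mult U fU)
    finally show ?thesis using ev_by_parts[OF that(3)]
      by (simp add: cov_def algebra_simps)
  qed
  show "(\<Sum>l<N. s i l * ev (\<lambda>\<omega>. pw k l j \<omega> * pp zs \<omega> * D i l \<omega>))
      \<le> \<kappa> * real m * moment_bound v (Suc (k + total_degree zs) + m - 2)"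
    if "i < N" "j < N" "in_range zs" for k i j zs
  proof -
    have P: "rv_poly x Pos (\<lambda>\<omega>. pw k l j \<omega> * pp zs \<omega> * D i l \<omega>)" for l
      by (intro poly_mult poly_pw poly_pp D(2)) auto
    have "(\<Sum>l<N. s i l * ev (\<lambda>\<omega>. pw k l j \<omega> * pp zs \<omega> * D i l \<omega>)) \<le>
        (\<Sum>l<N. \<kappa> * ev (\<lambda>\<omega>. pw k l j \<omega> * pp zs \<omega> * D i l \<omega>))"
      by (intro sum_mono mult_right_mono s_le ev_nonneg P)
    also have "\<dots> = \<kappa> * ev (\<lambda>\<omega>. \<Sum>l<N. pw k l j \<omega> * pp zs \<omega> * D i l \<omega>)"
      by (subst ev_sum) (auto intro: poly_Pos_UNIV[OF P] simp: sum_distrib_left)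
    also have "(\<lambda>\<omega>. \<Sum>l<N. pw k l j \<omega> * pp zs \<omega> * D i l \<omega>) = (\<lambda>\<omega>. (\<Sum>l<N. pw k l j \<omega> * D i l \<omega>) * pp zs \<omega>)"
      by (simp add: sum_distrib_left sum_distrib_right mult_ac)
    also have "\<kappa> * ev \<dots> \<le> \<kappa> * (real m * moment_bound v (k + total_degree zs + m - 1))"
      by (intro mult_left_mono rest that \<kappa>_nonneg)
    finally show ?thesis by (simp add: mult.assoc)
  qed
  show "v * real d * (\<kappa> * covariance_bound v m (d - 1)) + \<kappa> * real m * moment_bound v (Suc d + m - 2)
      \<le> \<kappa> * covariance_bound v m (Suc d)" for d
    by (cases d) (auto simp: algebra_simps)
  show "cov f (\<lambda>_. 1) \<le> \<kappa> * covariance_bound v m 0"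
    using ev_const[of 1] by (simp add: cov_def)
qed (simp_all add: cov_nonneg f \<kappa>_nonneg covariance_bound_nonneg v_nonneg zs)

lemma cov_pw_pp_le:
  assumes "u < N" "w < N" "in_range zs"
  shows "cov (pw m u w) (pp zs) \<le> \<kappa> * covariance_bound v m (total_degree zs)"
proof (rule cov_pp_le[where D = "\<lambda>i l. dpw l i m u w"])
  fix k i j zs assume a: "i < N" "j < N" "in_range zs"
  have "ev (\<lambda>\<omega>. (\<Sum>l<N. pw k l j \<omega> * dpw l i m u w \<omega>) * pp zs \<omega>) =
      ev (\<lambda>\<omega>. \<Sum>c<m. pp ((c + k, u, j) # (m - 1 - c, i, w) # zs) \<omega>)"
    by (simp add: sum_pw_dpw assms sum_distrib_right mult.assoc)
  also have "\<dots> = (\<Sum>c<m. ev (pp ((c + k, u, j) # (m - 1 - c, i, w) # zs)))"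
    by (intro ev_sum poly_pp_UNIV)
  also have "\<dots> \<le> (\<Sum>c<m. moment_bound v (k + total_degree zs + m - 1))"
  proof (intro sum_mono)
    fix c assume c: "c \<in> {..<m}"
    let ?zs = "(c + k, u, j) # (m - 1 - c, i, w) # zs"
    have "ev (pp ?zs) \<le> moment_bound v (total_degree ?zs)"
      using a assms by (intro ev_pp_le) auto
    also have "total_degree ?zs = k + total_degree zs + m - 1" using c by auto
    finally show "ev (pp ?zs) \<le> moment_bound v (k + total_degree zs + m - 1)" .
  qed
  finally show "ev (\<lambda>\<omega>. (\<Sum>l<N. pw k l j \<omega> * dpw l i m u w \<omega>) * pp zs \<omega>)
      \<le> real m * moment_bound v (k + total_degree zs + m - 1)" by simp
qed (auto intro: assms poly_pw poly_dpw der_pw)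

text \<open>A trace has \<open>N\<close> summands, yet the bound is that of a single entry: cutting
  the cyclic word of the trace at a letter and gluing it to another word yields one word, because
  the sum over \<open>u\<close> is a matrix product as well.\<close>

lemma cov_trace_pp_le:
  assumes "in_range zs"
  shows "cov (\<lambda>\<omega>. \<Sum>u<N. pw m u u \<omega>) (pp zs) \<le> \<kappa> * covariance_bound v m (total_degree zs)"
proof (rule cov_pp_le[where D = "\<lambda>i l \<omega>. \<Sum>u<N. dpw l i m u u \<omega>"])
  fix k i j zs assume a: "i < N" "j < N" "in_range zs"
  have "(\<Sum>l<N. pw k l j \<omega> * (\<Sum>u<N. dpw l i m u u \<omega>)) = (\<Sum>c<m. pw (m - 1 + k) i j \<omega>)" for \<omega>
  proof -
    have "(\<Sum>l<N. pw k l j \<omega> * (\<Sum>u<N. dpw l i m u u \<omega>)) = (\<Sum>u<N. \<Sum>l<N. pw k l j \<omega> * dpw l i m u u \<omega>)"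
      unfolding sum_distrib_left by (rule sum.swap)
    also have "\<dots> = (\<Sum>u<N. \<Sum>c<m. pw (c + k) u j \<omega> * pw (m - 1 - c) i u \<omega>)"
      by (simp add: sum_pw_dpw)
    also have "\<dots> = (\<Sum>c<m. \<Sum>u<N. pw (m - 1 - c) i u \<omega> * pw (c + k) u j \<omega>)"
      by (subst sum.swap) (simp add: mult.commute)
    also have "\<dots> = (\<Sum>c<m. pw (m - 1 - c + (c + k)) i j \<omega>)"
      by (simp add: pw_add a)
    also have "\<dots> = (\<Sum>c<m. pw (m - 1 + k) i j \<omega>)"
    proof (intro sum.cong refl)
      fix c assume "c \<in> {..<m}"
      then have "m - 1 - c + (c + k) = m - 1 + k" by auto
      then show "pw (m - 1 - c + (c + k)) i j \<omega> = pw (m - 1 + k) i j \<omega>" by (simp only:)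
    qed
    finally show ?thesis .
  qed
  then have "(\<lambda>\<omega>. (\<Sum>l<N. pw k l j \<omega> * (\<Sum>u<N. dpw l i m u u \<omega>)) * pp zs \<omega>) =
      (\<lambda>\<omega>. of_real (real m) * pp ((m - 1 + k, i, j) # zs) \<omega>)"
    by (simp only: sum_constant card_lessThan pp_simps of_real_of_nat_eq mult.assoc)
  then have "ev (\<lambda>\<omega>. (\<Sum>l<N. pw k l j \<omega> * (\<Sum>u<N. dpw l i m u u \<omega>)) * pp zs \<omega>) =
      ev (\<lambda>\<omega>. of_real (real m) * pp ((m - 1 + k, i, j) # zs) \<omega>)"
    by (simp only:)
  also have "\<dots> = real m * ev (pp ((m - 1 + k, i, j) # zs))" by (rule ev_cmult)
  also have "\<dots> \<le> real m * moment_bound v (k + total_degree zs + m - 1)"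
  proof (cases "m = 0")
    case False
    have "ev (pp ((m - 1 + k, i, j) # zs)) \<le> moment_bound v (total_degree ((m - 1 + k, i, j) # zs))"
      using a assms by (intro ev_pp_le) auto
    also have "total_degree ((m - 1 + k, i, j) # zs) = k + total_degree zs + m - 1" using False by auto
    finally show ?thesis by (intro mult_left_mono) (auto simp: pp_def[abs_def])
  qed auto
  finally show "ev (\<lambda>\<omega>. (\<Sum>l<N. pw k l j \<omega> * (\<Sum>u<N. dpw l i m u u \<omega>)) * pp zs \<omega>)
      \<le> real m * moment_bound v (k + total_degree zs + m - 1)" .
qed (auto intro!: assms poly_sum poly_pw poly_dpw der_sum der_pw)

text \<open>The Schwinger-Dyson equation: the head letter is paired with a later letter, and the
  piece in between closes to a loop at \<open>l\<close>.\<close>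

lemma ev_pw_Suc:
  assumes "i < N"
  shows "ev (pw (Suc k) i j) = (\<Sum>l<N. s i l * (\<Sum>c<k. ev (\<lambda>\<omega>. pw c l l \<omega> * pw (k - 1 - c) i j \<omega>)))"
proof -
  have "ev (pw (Suc k) i j) = (\<Sum>l<N. ev (\<lambda>\<omega>. x (i, l) \<omega> * pw k l j \<omega>))"
    unfolding pw.simps(2)[abs_def] by (intro ev_sum poly_var poly_pw_UNIV)
  also have "\<dots> = (\<Sum>l<N. s i l * ev (dpw l i k l j))"
    by (intro sum.cong ev_by_parts der_pw refl assms)
  also have "\<dots> = (\<Sum>l<N. s i l * (\<Sum>c<k. ev (\<lambda>\<omega>. pw c l l \<omega> * pw (k - 1 - c) i j \<omega>)))"
    unfolding dpw_def[abs_def] by (subst ev_sum) (auto intro!: poly_mult poly_pw_UNIV)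
  finally show ?thesis .
qed

lemma ev_pw_le: "i < N \<Longrightarrow> j < N \<Longrightarrow> ev (pw k i j) \<le> moment_bound v k"
  using ev_pp_le[of "[(k, i, j)]"] by (simp add: pp_def[abs_def])

lemma ev_pw_nonneg: "0 \<le> ev (pw k i j)"
  by (intro ev_nonneg poly_pw)

text \<open>The assumption on \<open>m\<close> is the recursion of the semicircle moments,
  reproduced exactly by the row sum \<open>v\<close>. The remaining terms are the errors of the two
  factors, handled by induction, and the covariance between the loop and the rest, which yields two
  factors \<open>\<kappa>\<close>.\<close>

lemma ev_pw_diag:
  assumes m: "m 0 = 1" "\<And>k. m (Suc k) = v * (\<Sum>c<k. m c * m (k - 1 - c))" and i: "i < N"
  shows "\<bar>ev (pw k i i) - m k\<bar> \<le> mean_bound v m k * \<kappa>\<^sup>2"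
  using i
proof (induction k arbitrary: i rule: less_induct)
  case (less k)
  show ?case
  proof (cases k)
    case 0
    then show ?thesis using m(1) ev_const[of 1] by (simp add: pw.simps(1)[abs_def])
  next
    case (Suc k')
    let ?q = "\<lambda>c. k' - 1 - c"
    let ?C = "\<lambda>l c. cov (pw c l l) (pw (?q c) i i)"
    let ?e = "\<lambda>l c. ev (pw c l l) * ev (pw (?q c) i i) - m c * m (?q c)"
    let ?A = "\<lambda>c. mean_bound v m c * moment_bound v (?q c) + \<bar>m c\<bar> * mean_bound v m (?q c)"
    have U: "rv_poly x UNIV (pw k i j)" for k i j by (rule poly_pw_UNIV)
    have e: "ev (\<lambda>\<omega>. pw c l l \<omega> * pw (?q c) i i \<omega>) = m c * m (?q c) + ?e l c + ?C l c" for l c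
      by (simp add: cov_def mult.commute)
    have "ev (pw k i i) = (\<Sum>l<N. s i l * (\<Sum>c<k'. m c * m (?q c))) + (\<Sum>l<N. s i l * (\<Sum>c<k'. ?e l c + ?C l c))"
      unfolding Suc ev_pw_Suc[OF less.prems] e by (simp only: sum.distrib distrib_left add.assoc)
    also have "(\<Sum>l<N. s i l * (\<Sum>c<k'. m c * m (?q c))) = m k"
      by (simp only: sum_distrib_right[symmetric] s_sum[OF less.prems] Suc m(2))
    finally have "\<bar>ev (pw k i i) - m k\<bar> = \<bar>\<Sum>l<N. s i l * (\<Sum>c<k'. ?e l c + ?C l c)\<bar>" by (simp only: add_diff_cancel_left')
    also have "\<dots> \<le> (\<Sum>l<N. s i l * (\<Sum>c<k'. ?A c * \<kappa>\<^sup>2 + ?C l c))"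
    proof (intro order_trans[OF sum_abs] sum_mono)
      fix l assume l: "l \<in> {..<N}"
      have "\<bar>s i l * (\<Sum>c<k'. ?e l c + ?C l c)\<bar> = s i l * \<bar>\<Sum>c<k'. ?e l c + ?C l c\<bar>"
        by (simp add: abs_mult s_nonneg)
      also have "\<dots> \<le> s i l * (\<Sum>c<k'. \<bar>?e l c + ?C l c\<bar>)"
        by (intro mult_left_mono sum_abs s_nonneg)
      also have "\<dots> \<le> s i l * (\<Sum>c<k'. ?A c * \<kappa>\<^sup>2 + ?C l c)"
      proof (intro mult_left_mono sum_mono s_nonneg)
        fix c assume c: "c \<in> {..<k'}"
        have "?e l c = (ev (pw c l l) - m c) * ev (pw (?q c) i i) + m c * (ev (pw (?q c) i i) - m (?q c))"
          by (simp add: algebra_simps)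
        then have "\<bar>?e l c\<bar> \<le> \<bar>ev (pw c l l) - m c\<bar> * ev (pw (?q c) i i) + \<bar>m c\<bar> * \<bar>ev (pw (?q c) i i) - m (?q c)\<bar>"
          by (metis abs_mult abs_of_nonneg abs_triangle_ineq ev_pw_nonneg)
        also have "\<dots> \<le> (mean_bound v m c * \<kappa>\<^sup>2) * moment_bound v (?q c) + \<bar>m c\<bar> * (mean_bound v m (?q c) * \<kappa>\<^sup>2)"
          using c l less by (intro add_mono mult_mono less.IH ev_pw_le ev_pw_nonneg mult_nonneg_nonneg mean_bound_nonneg v_nonneg) (auto simp: Suc)
        also have "\<dots> = ?A c * \<kappa>\<^sup>2" by (simp add: algebra_simps)
        finally show "\<bar>?e l c + ?C l c\<bar> \<le> ?A c * \<kappa>\<^sup>2 + ?C l c"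
          using cov_nonneg[OF poly_pw poly_pw, of c l l "?q c" i i] by linarith
      qed
      finally show "\<bar>s i l * (\<Sum>c<k'. ?e l c + ?C l c)\<bar> \<le> s i l * (\<Sum>c<k'. ?A c * \<kappa>\<^sup>2 + ?C l c)" .
    qed
    also have "\<dots> = (\<Sum>l<N. s i l * (\<Sum>c<k'. ?A c * \<kappa>\<^sup>2)) + (\<Sum>l<N. s i l * (\<Sum>c<k'. ?C l c))"
      by (simp only: sum.distrib distrib_left)
    also have "(\<Sum>l<N. s i l * (\<Sum>c<k'. ?A c * \<kappa>\<^sup>2)) = v * (\<Sum>c<k'. ?A c * \<kappa>\<^sup>2)"
      by (simp only: sum_distrib_right[symmetric] s_sum[OF less.prems])
    \<comment> \<open>Since the covariances are nonnegative, the weights may be replaced by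
      \<open>\<kappa>\<close>; the sum over \<open>l\<close> is then a full trace, and its
      covariance supplies the second \<open>\<kappa>\<close>.\<close>
    also have "(\<Sum>l<N. s i l * (\<Sum>c<k'. ?C l c)) \<le> (\<Sum>l<N. \<kappa> * (\<Sum>c<k'. ?C l c))"
      by (intro sum_mono mult_right_mono s_le sum_nonneg cov_nonneg poly_pw)
    also have "\<dots> = \<kappa> * (\<Sum>c<k'. \<Sum>l<N. ?C l c)"
      by (subst sum.swap) (simp add: sum_distrib_left)
    also have "(\<Sum>c<k'. \<Sum>l<N. ?C l c) = (\<Sum>c<k'. cov (\<lambda>\<omega>. \<Sum>l<N. pw c l l \<omega>) (pw (?q c) i i))"
    proof (intro sum.cong refl)
      fix c
      have "cov (\<lambda>\<omega>. \<Sum>l<N. pw c l l \<omega>) (pw (?q c) i i) = cov (pw (?q c) i i) (\<lambda>\<omega>. \<Sum>l<N. pw c l l \<omega>)"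
        by (simp add: cov_def mult.commute)
      also have "\<dots> = (\<Sum>l<N. cov (pw (?q c) i i) (pw c l l))" by (intro cov_sum U)
      finally show "(\<Sum>l<N. ?C l c) = cov (\<lambda>\<omega>. \<Sum>l<N. pw c l l \<omega>) (pw (?q c) i i)"
        by (simp add: cov_def mult.commute)
    qed
    also have "\<dots> \<le> (\<Sum>c<k'. \<kappa> * covariance_bound v c (?q c))"
      using cov_trace_pp_le[of "[(q, i, i)]" for q] less.prems
      by (intro sum_mono) (simp add: pp_def[abs_def])
    finally have "\<bar>ev (pw k i i) - m k\<bar> \<le> v * (\<Sum>c<k'. ?A c * \<kappa>\<^sup>2) + \<kappa> * (\<Sum>c<k'. \<kappa> * covariance_bound v c (?q c))"
      using \<kappa>_nonneg by (simp add: mult_left_mono)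
    also have "\<dots> = mean_bound v m k * \<kappa>\<^sup>2"
      by (simp add: Suc sum_distrib_left sum_distrib_right algebra_simps power2_eq_square sum.distrib)
    finally show ?thesis .
  qed
qed

lemma ev_pp_product:
  assumes "in_range zs"
  shows "\<bar>ev (pp zs) - (\<Prod>(k, i, j)\<leftarrow>zs. ev (pw k i j))\<bar> \<le> \<kappa> * product_bound v (map fst zs)"
  using assms
proof (induction zs)
  case Nil
  then show ?case using ev_const[of 1] by (simp add: pp_def[abs_def])
next
  case (Cons z zs)
  obtain k i j where z: "z = (k, i, j)" by (cases z) auto
  let ?P = "\<Prod>(k, i, j)\<leftarrow>zs. ev (pw k i j)"
  have rng: "i < N" "j < N" "in_range zs" using Cons.prems by (auto simp: z)
  have "ev (pp (z # zs)) - ev (pw k i j) * ?P = cov (pw k i j) (pp zs) + ev (pw k i j) * (ev (pp zs) - ?P)"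
    by (simp add: cov_def z pp_def[abs_def] mult.commute algebra_simps)
  then have "\<bar>ev (pp (z # zs)) - ev (pw k i j) * ?P\<bar> \<le> cov (pw k i j) (pp zs) + ev (pw k i j) * \<bar>ev (pp zs) - ?P\<bar>"
    using abs_triangle_ineq[of "cov (pw k i j) (pp zs)" "ev (pw k i j) * (ev (pp zs) - ?P)"]
      cov_nonneg[OF poly_pw poly_pp, of k i j zs] ev_pw_nonneg[of k i j] by (simp add: abs_mult)
  also have "\<dots> \<le> \<kappa> * covariance_bound v k (total_degree zs) + moment_bound v k * (\<kappa> * product_bound v (map fst zs))"
    using Cons rng
    by (intro add_mono mult_mono cov_pw_pp_le ev_pw_le moment_bound_nonneg v_nonneg) (auto simp: z)
  finally show ?case by (simp add: z pp_def[abs_def] algebra_simps)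
qed

text \<open>Each summation index of a matrix power occurs once as a column and once as a row index,
  so only the endpoints count.\<close>

lemma balance_pw_mult:
  "balance x d F \<Longrightarrow>
    balance x (\<lambda>u. d u + of_bool (u = i) - of_bool (u = j)) (\<lambda>\<omega>. pw k i j \<omega> * F \<omega>)"
proof (induction k arbitrary: i)
  case 0
  then show ?case by (cases "i = j") (auto intro: bal_zero)
next
  case (Suc k)
  have "balance x (\<lambda>u. d u + of_bool (u = i) - of_bool (u = j)) (\<lambda>\<omega>. x (i, l) \<omega> * (pw k l j \<omega> * F \<omega>))" for l
    using bal_var[OF Suc.IH[OF Suc.prems, of l], of i l] by (simp add: algebra_simps)
  then have "balance x (\<lambda>u. d u + of_bool (u = i) - of_bool (u = j)) (\<lambda>\<omega>. \<Sum>l<N. x (i, l) \<omega> * (pw k l j \<omega> * F \<omega>))"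
    by (intro bal_sum)
  then show ?case by (simp add: sum_distrib_right mult.assoc)
qed

lemma ev_pp_unbalanced:
  assumes "mset (map (\<lambda>(k, i, j). i) zs) \<noteq> mset (map (\<lambda>(k, i, j). j) zs)"
  shows "ev (pp zs) = 0"
proof -
  have b: "balance x (\<lambda>u. int (count (mset (map (\<lambda>(k, i, j). i) zs)) u) - int (count (mset (map (\<lambda>(k, i, j). j) zs)) u)) (pp zs)"
  proof (induction zs)
    case Nil
    then show ?case using bal_one[of x] by (simp add: pp_def[abs_def])
  next
    case (Cons z zs)
    obtain k i j where z: "z = (k, i, j)" by (cases z) auto
    have "(\<lambda>u. int (count (mset (map (\<lambda>(k, i, j). i) (z # zs))) u) - int (count (mset (map (\<lambda>(k, i, j). j) (z # zs))) u))
        = (\<lambda>u. int (count (mset (map (\<lambda>(k, i, j). i) zs)) u) - int (count (mset (map (\<lambda>(k, i, j). j) zs)) u)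
            + of_bool (u = i) - of_bool (u = j))"
      by (auto simp: z fun_eq_iff)
    then show ?case using balance_pw_mult[OF Cons, of i j k] by (simp add: z pp_def[abs_def])
  qed
  from assms obtain u where "count (mset (map (\<lambda>(k, i, j). i) zs)) u \<noteq> count (mset (map (\<lambda>(k, i, j). j) zs)) u"
    by (metis multiset_eqI)
  then show ?thesis by (intro ev_unbalanced[OF b, of u]) auto
qed

lemma ev_pw_offdiag: "i \<noteq> j \<Longrightarrow> ev (pw k i j) = 0"
  using ev_pp_unbalanced[of "[(k, i, j)]"] by (simp add: pp_def[abs_def])

end

section \<open>Bilinear forms in vectors of norm at most 1\<close>

lemma sum_mult_le_1:
  fixes u w :: "nat \<Rightarrow> real"
  assumes "(\<Sum>i<N. (u i)\<^sup>2) \<le> 1" "(\<Sum>i<N. (w i)\<^sup>2) \<le> 1"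
  shows "(\<Sum>i<N. u i * w i) \<le> 1"
proof -
  have "(\<Sum>i<N. u i * w i) \<le> (\<Sum>i<N. ((u i)\<^sup>2 + (w i)\<^sup>2) / 2)"
    using sum_squares_bound[of "u i" "w i" for i] by (intro sum_mono) (simp add: field_simps)
  also have "\<dots> = ((\<Sum>i<N. (u i)\<^sup>2) + (\<Sum>i<N. (w i)\<^sup>2)) / 2"
    by (simp add: sum.distrib flip: sum_divide_distrib)
  finally show ?thesis using assms by simp
qed

text \<open>The permutation ties each second index to a first index, so the sum runs over the first
  indices alone and factors into inner products, each at most 1. The bound does not depend on
  \<open>N\<close>, even for delocalised vectors, whose entries have absolute sum of order sqrt
  N.\<close>

lemma sum_matched_indices_le_1:
  fixes u w :: "nat \<Rightarrow> nat \<Rightarrow> real"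
  assumes nonneg: "\<And>a i. a < n \<Longrightarrow> 0 \<le> u a i" "\<And>a i. a < n \<Longrightarrow> 0 \<le> w a i"
    and norm: "\<And>a. a < n \<Longrightarrow> (\<Sum>i<N. (u a i)\<^sup>2) \<le> 1" "\<And>a. a < n \<Longrightarrow> (\<Sum>i<N. (w a i)\<^sup>2) \<le> 1"
    and \<pi>: "\<pi> permutes {..<n}"
  shows "(\<Sum>g | g \<in> PiE {..<n} (\<lambda>_. {..<N} \<times> {..<N}) \<and> (\<forall>a<n. fst (g a) = snd (g (\<pi> a))).
            \<Prod>a<n. u a (fst (g a)) * w a (snd (g a))) \<le> 1"
proof -
  let ?S = "{g. g \<in> PiE {..<n} (\<lambda>_. {..<N} \<times> {..<N}) \<and> (\<forall>a<n. fst (g a) = snd (g (\<pi> a)))}"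
  let ?h = "\<lambda>g. restrict (fst \<circ> g) {..<n}"
  have \<pi>n: "\<pi> a < n" if "a < n" for a using permutes_in_image[OF \<pi>, of a] that by simp
  have inj: "inj_on ?h ?S"
  proof (rule inj_onI)
    fix g g' assume g: "g \<in> ?S" "g' \<in> ?S" and h: "?h g = ?h g'"
    have eq: "fst (g a) = fst (g' a)" if "a < n" for a
      using fun_cong[OF h, of a] that by simp
    show "g = g'"
    proof
      fix a
      show "g a = g' a"
      proof (cases "a < n")
        case True
        \<comment> \<open>Every position has the form \<open>\<pi> b\<close>, so the second
          components are determined by the first ones too.\<close>
        obtain b where b: "b < n" "a = \<pi> b"
          using permutes_image[OF \<pi>] True by (metis image_iff lessThan_iff)
        have "snd (g a) = snd (g' a)" using g eq[OF b(1)] b by auto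
        with eq[OF True] show ?thesis by (simp add: prod_eq_iff)
      next
        case False
        then show ?thesis using g by (auto simp: PiE_def extensional_def)
      qed
    qed
  qed
  have "(\<Prod>a<n. u a (fst (g a)) * w a (snd (g a))) = (\<Prod>a<n. u a (?h g a) * w (\<pi> a) (?h g a))" if "g \<in> ?S" for g
  proof -
    have "(\<Prod>a<n. w a (snd (g a))) = (\<Prod>a<n. w (\<pi> a) (snd (g (\<pi> a))))"
      using prod.permute[OF \<pi>, of "\<lambda>a. w a (snd (g a))"] by (simp add: o_def)
    then show ?thesis using that by (simp add: prod.distrib)
  qed
  then have "(\<Sum>g\<in>?S. \<Prod>a<n. u a (fst (g a)) * w a (snd (g a))) = (\<Sum>g\<in>?S. \<Prod>a<n. u a (?h g a) * w (\<pi> a) (?h g a))"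
    by (intro sum.cong) auto
  also have "\<dots> = (\<Sum>h\<in>?h ` ?S. \<Prod>a<n. u a (h a) * w (\<pi> a) (h a))"
    by (subst sum.reindex[OF inj]) simp
  also have "\<dots> \<le> (\<Sum>h\<in>PiE {..<n} (\<lambda>_. {..<N}). \<Prod>a<n. u a (h a) * w (\<pi> a) (h a))"
  proof (intro sum_mono2)
    show "?h ` ?S \<subseteq> PiE {..<n} (\<lambda>_. {..<N})"
    proof (intro image_subsetI restrict_PiE_iff[THEN iffD2] ballI)
      fix g a assume "g \<in> ?S" "a \<in> {..<n}"
      then have "g a \<in> {..<N} \<times> {..<N}" by (blast dest: PiE_mem)
      then show "(fst \<circ> g) a \<in> {..<N}" by (auto simp: mem_Times_iff)
    qed
  qed (auto intro!: mult_nonneg_nonneg prod_nonneg finite_PiE simp: nonneg \<pi>n)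
  also have "\<dots> = (\<Prod>a<n. \<Sum>i<N. u a i * w (\<pi> a) i)"
    by (subst prod_sum_PiE) auto
  also have "\<dots> \<le> (\<Prod>a<n. 1)"
    by (intro prod_mono conjI sum_nonneg sum_mult_le_1) (auto simp: nonneg norm \<pi>n)
  finally show ?thesis by simp
qed

context wick_matrix
begin

text \<open>The bilinear form of the \<open>k\<close>-th power at \<open>u\<close> and
  \<open>w\<close>. Summing over pairs lets a product of such forms expand as one sum over functions
  into pairs.\<close>

definition yv :: "(nat \<Rightarrow> real) \<Rightarrow> nat \<Rightarrow> (nat \<Rightarrow> real) \<Rightarrow> 'a \<Rightarrow> complex" where
  "yv u k w \<omega> = (\<Sum>p\<in>{..<N} \<times> {..<N}. of_real (u (fst p) * w (snd p)) * pw k (fst p) (snd p) \<omega>)"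

lemma poly_yv: "rv_poly x UNIV (yv u k w)"
  unfolding yv_def[abs_def] by (intro poly_sum poly_cmult poly_pw_UNIV) auto

lemma ev_yv:
  "ev (yv u k w) = (\<Sum>p\<in>{..<N} \<times> {..<N}. u (fst p) * w (snd p) * ev (pw k (fst p) (snd p)))"
  unfolding yv_def[abs_def]
  by (subst ev_sum) (auto intro!: poly_cmult poly_pw_UNIV simp: ev_cmult simp del: of_real_mult)

lemma ev_yv_diag: "ev (yv u k w) = (\<Sum>i<N. u i * w i * ev (pw k i i))"
proof -
  have "ev (yv u k w) = (\<Sum>i<N. \<Sum>j<N. u i * w j * ev (pw k i j))"
    unfolding ev_yv by (simp add: sum.cartesian_product case_prod_unfold)
  also have "\<dots> = (\<Sum>i<N. \<Sum>j<N. if j = i then u i * w i * ev (pw k i i) else 0)"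
    by (intro sum.cong) (auto simp: ev_pw_offdiag)
  finally show ?thesis by simp
qed

text \<open>An index tuple contributes only if its row and column indices agree as multisets, that
  is, if some permutation matches them. For each of the \<open>fact n\<close> permutations the
  matched weights sum to at most 1, and a single product of entries has error
  \<open>\<kappa> * product_bound\<close>.\<close>

lemma ev_prod_yv:
  fixes u w :: "nat \<Rightarrow> nat \<Rightarrow> real" and k :: "nat \<Rightarrow> nat"
  assumes nonneg: "\<And>a i. a < n \<Longrightarrow> 0 \<le> u a i" "\<And>a i. a < n \<Longrightarrow> 0 \<le> w a i"
    and norm: "\<And>a. a < n \<Longrightarrow> (\<Sum>i<N. (u a i)\<^sup>2) \<le> 1" "\<And>a. a < n \<Longrightarrow> (\<Sum>i<N. (w a i)\<^sup>2) \<le> 1"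
  shows "\<bar>ev (\<lambda>\<omega>. \<Prod>a<n. yv (u a) (k a) (w a) \<omega>) - (\<Prod>a<n. ev (yv (u a) (k a) (w a)))\<bar>
    \<le> \<kappa> * product_bound v (map k [0..<n]) * fact n"
proof -
  let ?G = "PiE {..<n} (\<lambda>_. {..<N} \<times> {..<N})"
  let ?K = "\<kappa> * product_bound v (map k [0..<n])"
  let ?c = "\<lambda>g. \<Prod>a<n. u a (fst (g a)) * w a (snd (g a))"
  let ?zs = "\<lambda>g. map (\<lambda>a. (k a, fst (g a), snd (g a))) [0..<n]"
  let ?E = "\<lambda>g. \<Prod>a<n. ev (pw (k a) (fst (g a)) (snd (g a)))"
  let ?P = "{\<pi>. \<pi> permutes {..<n}}"
  let ?B = "\<lambda>\<pi> g. \<forall>a<n. fst (g a) = snd (g (\<pi> a))"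
  have K: "0 \<le> ?K" by (intro mult_nonneg_nonneg \<kappa>_nonneg product_bound_nonneg v_nonneg)
  have finG: "finite ?G" by (intro finite_PiE) auto
  have finP: "finite ?P" by (intro finite_permutations) auto
  have c: "0 \<le> ?c g" for g by (intro prod_nonneg) (auto simp: nonneg)
  have pp: "pp (?zs g) \<omega> = (\<Prod>a<n. pw (k a) (fst (g a)) (snd (g a)) \<omega>)" for g \<omega>
    by (simp add: pp_def o_def case_prod_unfold atLeast0LessThan prod.distinct_set_conv_list[symmetric])
  have "(\<lambda>\<omega>. \<Prod>a<n. yv (u a) (k a) (w a) \<omega>) = (\<lambda>\<omega>. \<Sum>g\<in>?G. of_real (?c g) * pp (?zs g) \<omega>)"
    unfolding yv_def pp by (subst prod_sum_PiE) (auto simp: prod.distrib)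
  then have "ev (\<lambda>\<omega>. \<Prod>a<n. yv (u a) (k a) (w a) \<omega>) = (\<Sum>g\<in>?G. ev (\<lambda>\<omega>. of_real (?c g) * pp (?zs g) \<omega>))"
    by (simp only:) (intro ev_sum poly_cmult poly_pp_UNIV; simp)
  then have 1: "ev (\<lambda>\<omega>. \<Prod>a<n. yv (u a) (k a) (w a) \<omega>) = (\<Sum>g\<in>?G. ?c g * ev (pp (?zs g)))"
    by (simp only: ev_cmult)
  have 2: "(\<Prod>a<n. ev (yv (u a) (k a) (w a))) = (\<Sum>g\<in>?G. ?c g * ?E g)"
    unfolding ev_yv by (subst prod_sum_PiE) (auto simp: prod.distrib)
  \<comment> \<open>A tuple may be matched by several permutations; summing over all of them
    overestimates.\<close>
  have diff: "\<bar>ev (pp (?zs g)) - ?E g\<bar> \<le> (\<Sum>\<pi>\<in>?P. if ?B \<pi> g then ?K else 0)" if g: "g \<in> ?G" for g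
  proof (cases "\<exists>\<pi>\<in>?P. ?B \<pi> g")
    case True
    then obtain \<pi> where \<pi>: "\<pi> \<in> ?P" "?B \<pi> g" by blast
    have "in_range (?zs g)"
      unfolding in_range_def using g by (auto simp: PiE_def Pi_def mem_Times_iff)
    from ev_pp_product[OF this] have "\<bar>ev (pp (?zs g)) - ?E g\<bar> \<le> ?K"
      by (simp add: o_def case_prod_unfold atLeast0LessThan prod.distinct_set_conv_list[symmetric])
    also have "?K = (if ?B \<pi> g then ?K else 0)" using \<pi> by simp
    also have "\<dots> \<le> (\<Sum>\<pi>\<in>?P. if ?B \<pi> g then ?K else 0)"
      using K by (intro member_le_sum[OF \<pi>(1)] finP) auto
    finally show ?thesis .
  next
    case False
    have "mset (map (\<lambda>(k, i, j). i) (?zs g)) \<noteq> mset (map (\<lambda>(k, i, j). j) (?zs g))"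
    proof
      assume "mset (map (\<lambda>(k, i, j). i) (?zs g)) = mset (map (\<lambda>(k, i, j). j) (?zs g))"
      then have eq: "image_mset (\<lambda>a. fst (g a)) (mset_set {..<n}) = image_mset (\<lambda>a. snd (g a)) (mset_set {..<n})"
        by (simp add: o_def case_prod_unfold atLeast0LessThan)
      obtain \<pi> where "\<pi> permutes {..<n}" "\<forall>a\<in>{..<n}. fst (g a) = snd (g (\<pi> a))"
        by (rule image_mset_eq_implies_permutes[OF finite_lessThan eq])
      with False show False by blast
    qed
    then have "ev (pp (?zs g)) = 0" by (rule ev_pp_unbalanced)
    \<comment> \<open>The identity is no match either, so one of the factors is the mean of an
      off-diagonal entry.\<close>
    moreover have "?E g = 0"
    proof -
      have "\<not> ?B id g" using False permutes_id[of "{..<n}"] by blast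
      then obtain a where "a < n" "fst (g a) \<noteq> snd (g a)" by auto
      then show ?thesis by (intro prod_zero bexI[of _ a]) (auto simp: ev_pw_offdiag)
    qed
    ultimately have "\<bar>ev (pp (?zs g)) - ?E g\<bar> = 0" by (simp only: diff_self abs_zero)
    also have "0 \<le> (\<Sum>\<pi>\<in>?P. if ?B \<pi> g then ?K else 0)" using K by (intro sum_nonneg) auto
    finally show ?thesis .
  qed
  have "\<bar>(\<Sum>g\<in>?G. ?c g * ev (pp (?zs g))) - (\<Sum>g\<in>?G. ?c g * ?E g)\<bar> = \<bar>\<Sum>g\<in>?G. ?c g * (ev (pp (?zs g)) - ?E g)\<bar>"
    by (simp add: sum_subtractf right_diff_distrib)
  also have "\<dots> \<le> (\<Sum>g\<in>?G. ?c g * \<bar>ev (pp (?zs g)) - ?E g\<bar>)"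
    by (intro order_trans[OF sum_abs] eq_refl sum.cong refl) (simp only: abs_mult abs_of_nonneg[OF c])
  also have "\<dots> \<le> (\<Sum>g\<in>?G. ?c g * (\<Sum>\<pi>\<in>?P. if ?B \<pi> g then ?K else 0))"
    by (intro sum_mono mult_left_mono diff c)
  also have "\<dots> = (\<Sum>\<pi>\<in>?P. \<Sum>g\<in>?G. if ?B \<pi> g then ?c g * ?K else 0)"
  proof -
    have "c * (if B then y else 0) = (if B then c * y else 0)" for c y :: real and B by simp
    then show ?thesis unfolding sum_distrib_left by (subst sum.swap) (simp only:)
  qed
  also have "\<dots> = (\<Sum>\<pi>\<in>?P. (\<Sum>g | g \<in> ?G \<and> ?B \<pi> g. ?c g) * ?K)"
    by (intro sum.cong refl) (simp only: sum_distrib_right sum.inter_filter[OF finG] if_distrib[of "\<lambda>z. z * ?K"] mult_zero_left)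
  also have "\<dots> \<le> (\<Sum>\<pi>\<in>?P. 1 * ?K)"
    using K nonneg norm by (intro sum_mono mult_right_mono sum_matched_indices_le_1) auto
  also have "\<dots> = ?K * fact n" by (simp add: card_permutations)
  finally show ?thesis unfolding 1 2 .
qed

end

section \<open>Perturbations of finite rank\<close>

text \<open>Operators act on functions on all naturals and read only the values below
  \<open>N\<close>, which keeps the expansions free of dimension conditions.\<close>

definition mat_op :: "nat \<Rightarrow> (nat \<Rightarrow> nat \<Rightarrow> complex) \<Rightarrow> (nat \<Rightarrow> complex) \<Rightarrow> nat \<Rightarrow> complex" where
  "mat_op N a f i = (\<Sum>l<N. a i l * f l)"

definition pairing :: "nat \<Rightarrow> (nat \<Rightarrow> real) \<Rightarrow> (nat \<Rightarrow> complex) \<Rightarrow> complex" where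
  "pairing N u f = (\<Sum>i<N. of_real (u i) * f i)"

lemma mat_op_sum: "mat_op N a (\<lambda>i. \<Sum>j\<in>J. c j * f j i) = (\<lambda>i. \<Sum>j\<in>J. c j * mat_op N a (f j) i)"
proof
  fix i
  have "mat_op N a (\<lambda>i. \<Sum>j\<in>J. c j * f j i) i = (\<Sum>l<N. \<Sum>j\<in>J. c j * (a i l * f j l))"
    by (simp add: mat_op_def sum_distrib_left mult_ac)
  also have "\<dots> = (\<Sum>j\<in>J. c j * mat_op N a (f j) i)"
    by (subst sum.swap) (simp add: mat_op_def sum_distrib_left)
  finally show "mat_op N a (\<lambda>i. \<Sum>j\<in>J. c j * f j i) i = (\<Sum>j\<in>J. c j * mat_op N a (f j) i)" .
qed

lemma mat_op_add: "mat_op N a (\<lambda>i. f i + g i) = (\<lambda>i. mat_op N a f i + mat_op N a g i)"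
  by (simp add: mat_op_def distrib_left sum.distrib fun_eq_iff)

lemma mat_op_pow_sum:
  "(mat_op N a ^^ k) (\<lambda>i. \<Sum>j\<in>J. c j * f j i) = (\<lambda>i. \<Sum>j\<in>J. c j * (mat_op N a ^^ k) (f j) i)"
  by (induction k) (simp_all add: mat_op_sum)

lemma pairing_sum: "pairing N u (\<lambda>i. \<Sum>j\<in>J. c j * f j i) = (\<Sum>j\<in>J. c j * pairing N u (f j))"
proof -
  have "pairing N u (\<lambda>i. \<Sum>j\<in>J. c j * f j i) = (\<Sum>l<N. \<Sum>j\<in>J. c j * (of_real (u l) * f j l))"
    by (simp add: pairing_def sum_distrib_left mult_ac)
  also have "\<dots> = (\<Sum>j\<in>J. c j * pairing N u (f j))"
    by (subst sum.swap) (simp add: pairing_def sum_distrib_left)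
  finally show ?thesis .
qed

lemma pairing_add: "pairing N u (\<lambda>i. f i + g i) = pairing N u f + pairing N u g"
  by (simp add: pairing_def distrib_left sum.distrib)

text \<open>The expansion of \<open>\<langle>u c, (X + D)\<^sup>p X\<^sup>t u d\<rangle>\<close> in the quantities \<open>Y c k d = \<langle>u c, X\<^sup>k u d\<rangle>\<close>, where \<open>D\<close> is the
  sum of the rank one matrices \<open>h e * u e (u e)\<^sup>T\<close> with \<open>e \<le> n\<close>.\<close>

fun perturbed :: "(nat \<Rightarrow> nat \<Rightarrow> nat \<Rightarrow> 'b::comm_ring_1) \<Rightarrow> (nat \<Rightarrow> 'b) \<Rightarrow> nat \<Rightarrow> nat \<Rightarrow> nat \<Rightarrow> nat \<Rightarrow> nat \<Rightarrow> 'b" where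
  "perturbed Y h n c p t d =
     Y c (p + t) d + (\<Sum>q<p. \<Sum>e\<le>n. h e * (Y c q e * perturbed Y h n e (p - 1 - q) t d))"

declare perturbed.simps [simp del]

text \<open>Sorts the words of A = X + D by their leftmost factor \<open>D\<close>: A^p is X^p plus
  the sum over \<open>q < p\<close> of X^q D A^(p-1-q), where A is \<open>A\<close> and X is
  \<open>mat_op N x\<close>.\<close>

lemma perturbed_pow:
  fixes x :: "nat \<Rightarrow> nat \<Rightarrow> complex" and u :: "nat \<Rightarrow> nat \<Rightarrow> real" and h :: "nat \<Rightarrow> real" and N n :: nat
  defines "A \<equiv> mat_op N (\<lambda>i j. x i j + (\<Sum>e\<le>n. of_real (h e) * (of_real (u e i) * of_real (u e j))))"
  shows "(A ^^ p) f = (\<lambda>i. (mat_op N x ^^ p) f i +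
    (\<Sum>(q, e)\<in>{..<p} \<times> {..n}. (of_real (h e) * pairing N (u e) ((A ^^ (p - 1 - q)) f)) *
         (mat_op N x ^^ q) (\<lambda>i. of_real (u e i)) i))"
proof (induction p)
  case 0
  then show ?case by simp
next
  case (Suc p)
  let ?X = "mat_op N x" and ?u = "\<lambda>e i. complex_of_real (u e i)"
  let ?c = "\<lambda>p e q. of_real (h e) * pairing N (u e) ((A ^^ (p - 1 - q)) f)"
  have A: "A g = (\<lambda>i. ?X g i + (\<Sum>e\<le>n. of_real (h e) * pairing N (u e) g * ?u e i))" for g
  proof
    fix i
    have "(\<Sum>l<N. (\<Sum>e\<le>n. of_real (h e) * (of_real (u e i) * of_real (u e l))) * g l)
        = (\<Sum>e\<le>n. of_real (h e) * pairing N (u e) g * ?u e i)"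
      unfolding sum_distrib_right pairing_def sum_distrib_left
      by (subst sum.swap) (simp add: mult_ac)
    then show "A g i = ?X g i + (\<Sum>e\<le>n. of_real (h e) * pairing N (u e) g * ?u e i)"
      by (simp add: A_def mat_op_def distrib_right sum.distrib)
  qed
  have "?X ((A ^^ p) f) = (\<lambda>i. (?X ^^ Suc p) f i + (\<Sum>(q, e)\<in>{..<p} \<times> {..n}. ?c p e q * (?X ^^ Suc q) (?u e) i))"
    unfolding Suc case_prod_unfold mat_op_add mat_op_sum by simp
  then have "(A ^^ Suc p) f = (\<lambda>i. (?X ^^ Suc p) f i + (\<Sum>(q, e)\<in>{..<p} \<times> {..n}. ?c p e q * (?X ^^ Suc q) (?u e) i)
      + (\<Sum>e\<le>n. of_real (h e) * pairing N (u e) ((A ^^ p) f) * ?u e i))"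
    by (simp add: A)
  also have "\<dots> = (\<lambda>i. (?X ^^ Suc p) f i + (\<Sum>(q, e)\<in>{..<Suc p} \<times> {..n}. ?c (Suc p) e q * (?X ^^ q) (?u e) i))"
    by (simp add: sum.cartesian_product[symmetric] sum.lessThan_Suc_shift add_ac del: sum.lessThan_Suc)
  finally show ?case .
qed

lemma pairing_perturbed:
  fixes x :: "nat \<Rightarrow> nat \<Rightarrow> complex" and u :: "nat \<Rightarrow> nat \<Rightarrow> real" and h :: "nat \<Rightarrow> real" and N n :: nat
  defines "A \<equiv> mat_op N (\<lambda>i j. x i j + (\<Sum>e\<le>n. of_real (h e) * (of_real (u e i) * of_real (u e j))))"
  defines "Y \<equiv> (\<lambda>c k d. pairing N (u c) ((mat_op N x ^^ k) (\<lambda>i. of_real (u d i))))"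
  shows "pairing N (u c) ((A ^^ p) ((mat_op N x ^^ t) (\<lambda>i. of_real (u d i)))) =
    perturbed Y (\<lambda>e. of_real (h e)) n c p t d"
proof (induction p arbitrary: c rule: less_induct)
  case (less p)
  let ?X = "mat_op N x" and ?u = "\<lambda>e i. complex_of_real (u e i)"
  let ?f = "(?X ^^ t) (?u d)"
  have "pairing N (u c) ((A ^^ p) ?f) = pairing N (u c) ((?X ^^ p) ?f) +
      (\<Sum>(q, e)\<in>{..<p} \<times> {..n}. (of_real (h e) * pairing N (u e) ((A ^^ (p - 1 - q)) ?f)) * pairing N (u c) ((?X ^^ q) (?u e)))"
    unfolding A_def by (subst perturbed_pow) (simp only: pairing_add case_prod_unfold pairing_sum)
  also have "(\<Sum>(q, e)\<in>{..<p} \<times> {..n}. (of_real (h e) * pairing N (u e) ((A ^^ (p - 1 - q)) ?f)) * pairing N (u c) ((?X ^^ q) (?u e)))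
     = (\<Sum>q<p. \<Sum>e\<le>n. of_real (h e) * (Y c q e * perturbed Y (\<lambda>e. of_real (h e)) n e (p - 1 - q) t d))"
    by (simp add: sum.cartesian_product[symmetric] less Y_def mult_ac)
  also have "pairing N (u c) ((?X ^^ p) ?f) = Y c (p + t) d" by (simp add: Y_def funpow_add)
  finally show ?case by (subst perturbed.simps) simp
qed

text \<open>Cyclicity of the trace moves the power of \<open>X\<close> standing to the left of the
  first \<open>D\<close> behind everything else; this is why \<open>perturbed\<close> carries the
  extra exponent \<open>t\<close>. The assumptions \<open>out\<close> allow a vector to be expanded
  in the unit vectors below \<open>N\<close>.\<close>

lemma trace_perturbed:
  fixes x :: "nat \<Rightarrow> nat \<Rightarrow> complex" and u :: "nat \<Rightarrow> nat \<Rightarrow> real" and h :: "nat \<Rightarrow> real" and N n :: nat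
  defines "A \<equiv> mat_op N (\<lambda>i j. x i j + (\<Sum>e\<le>n. of_real (h e) * (of_real (u e i) * of_real (u e j))))"
  defines "Y \<equiv> (\<lambda>c k d. pairing N (u c) ((mat_op N x ^^ k) (\<lambda>i. of_real (u d i))))"
  assumes out: "\<And>i j. i \<ge> N \<Longrightarrow> x i j = 0" "\<And>e i. i \<ge> N \<Longrightarrow> u e i = 0"
  shows "(\<Sum>i<N. (A ^^ k) (\<lambda>j. of_bool (j = i)) i) =
    (\<Sum>i<N. (mat_op N x ^^ k) (\<lambda>j. of_bool (j = i)) i) +
    (\<Sum>q<k. \<Sum>e\<le>n. of_real (h e) * perturbed Y (\<lambda>e. of_real (h e)) n e (k - 1 - q) q e)"
proof -
  let ?X = "mat_op N x" and ?u = "\<lambda>e i. complex_of_real (u e i)" and ?e = "\<lambda>i j. of_bool (j = i) :: complex"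
  have "(?X ^^ q) (?u e) i = 0" if "i \<ge> N" for q e i
    using that out by (cases q) (auto simp: mat_op_def)
  then have expand: "(?X ^^ q) (?u e) = (\<lambda>j. \<Sum>i<N. (?X ^^ q) (?u e) i * ?e i j)" for q e
    by (intro ext) (auto simp: if_distrib not_less of_bool_def cong: if_cong)
  have P: "(\<Sum>i<N. (?X ^^ q) (?u e) i * pairing N (u e) ((A ^^ r) (?e i))) = pairing N (u e) ((A ^^ r) ((?X ^^ q) (?u e)))" for q e r
    by (subst (2) expand) (simp only: A_def mat_op_pow_sum pairing_sum)
  have "(\<Sum>i<N. (A ^^ k) (?e i) i) = (\<Sum>i<N. (?X ^^ k) (?e i) i) +
     (\<Sum>i<N. \<Sum>(q, e)\<in>{..<k} \<times> {..n}. (of_real (h e) * pairing N (u e) ((A ^^ (k - 1 - q)) (?e i))) * (?X ^^ q) (?u e) i)"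
    unfolding A_def by (subst perturbed_pow) (simp only: sum.distrib)
  also have "(\<Sum>i<N. \<Sum>(q, e)\<in>{..<k} \<times> {..n}. (of_real (h e) * pairing N (u e) ((A ^^ (k - 1 - q)) (?e i))) * (?X ^^ q) (?u e) i)
     = (\<Sum>(q, e)\<in>{..<k} \<times> {..n}. of_real (h e) * (\<Sum>i<N. (?X ^^ q) (?u e) i * pairing N (u e) ((A ^^ (k - 1 - q)) (?e i))))"
    by (subst sum.swap) (simp add: case_prod_unfold sum_distrib_left mult_ac)
  also have "\<dots> = (\<Sum>q<k. \<Sum>e\<le>n. of_real (h e) * perturbed Y (\<lambda>e. of_real (h e)) n e (k - 1 - q) q e)"
    unfolding P sum.cartesian_product[symmetric] unfolding A_def Y_def pairing_perturbed ..
  finally show ?thesis .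
qed

lemma mat_pow_mat_op:
  assumes "A \<in> carrier_mat N N" "i < N" "j < N"
  shows "(A ^\<^sub>m k) $$ (i, j) = (mat_op N (\<lambda>i j. A $$ (i, j)) ^^ k) (\<lambda>l. of_bool (l = j)) i"
  using assms(2,3)
proof (induction k arbitrary: i j)
  case 0
  then show ?case using assms by auto
next
  case (Suc k)
  let ?A = "mat_op N (\<lambda>i j. A $$ (i, j))" and ?e = "\<lambda>j l. of_bool (l = j) :: complex"
  have cong: "(?A ^^ k) f i = (?A ^^ k) g i" if "\<And>l. l < N \<Longrightarrow> f l = g l" "i < N" for f g i
    using that by (induction k arbitrary: i) (auto simp: mat_op_def intro!: sum.cong)
  have "(A ^\<^sub>m Suc k) $$ (i, j) = (\<Sum>l<N. A $$ (l, j) * (A ^\<^sub>m k) $$ (i, l))"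
    using assms Suc.prems pow_carrier_mat[OF assms(1), of k]
    by (auto simp: scalar_prod_def mult.commute atLeast0LessThan intro!: sum.cong)
  also have "\<dots> = (\<Sum>l<N. A $$ (l, j) * (?A ^^ k) (?e l) i)"
    using Suc by (intro sum.cong) auto
  also have "\<dots> = (?A ^^ k) (\<lambda>i. \<Sum>l<N. A $$ (l, j) * ?e l i) i"
    by (simp only: mat_op_pow_sum)
  also have "\<dots> = (?A ^^ k) (?A (?e j)) i"
    using Suc.prems by (intro cong) (auto simp: mat_op_def of_bool_def if_distrib cong: if_cong)
  finally show ?case by (simp add: funpow_swap1)
qed

context wick_matrix
begin

lemma mat_op_pow_pw:
  "(mat_op N (\<lambda>i l. x (i, l) \<omega>) ^^ k) (\<lambda>l. of_bool (l = j)) i = pw k i j \<omega>"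
  by (induction k arbitrary: i) (simp_all add: mat_op_def)

lemma mat_op_pow_of_real:
  assumes "\<And>i. i \<ge> N \<Longrightarrow> w i = 0"
  shows "(mat_op N (\<lambda>i l. x (i, l) \<omega>) ^^ k) (\<lambda>i. of_real (w i)) i = (\<Sum>j<N. of_real (w j) * pw k i j \<omega>)"
proof -
  have "(\<lambda>i. complex_of_real (w i)) = (\<lambda>i. \<Sum>j<N. of_real (w j) * of_bool (i = j))"
    using assms by (intro ext) (auto simp: if_distrib not_less of_bool_def cong: if_cong)
  then show ?thesis by (simp only: mat_op_pow_sum mat_op_pow_pw)
qed

lemma yv_pairing:
  assumes "\<And>i. i \<ge> N \<Longrightarrow> w i = 0"
  shows "yv u k w \<omega> = pairing N u ((mat_op N (\<lambda>i l. x (i, l) \<omega>) ^^ k) (\<lambda>i. of_real (w i)))"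
  by (simp add: pairing_def mat_op_pow_of_real[OF assms] yv_def sum_distrib_left
     sum.cartesian_product case_prod_unfold mult_ac)

end

section \<open>Limits of traces\<close>

text \<open>The unit vectors of the deformation: a coordinate vector for \<open>e < n\<close>, and
  at \<open>e = n\<close> the normalised all-ones vector, whose projection is the all-ones matrix
  divided by \<open>N\<close>.\<close>

definition uvec :: "nat \<Rightarrow> nat \<Rightarrow> nat \<Rightarrow> nat \<Rightarrow> real" where
  "uvec n N e i = (if i < N then if e < n then of_bool (i = e) else 1 / sqrt (real N) else 0)"

lemma uvec_nonneg: "0 \<le> uvec n N e i"
  by (simp add: uvec_def)

lemma uvec_norm: "(\<Sum>i<N. (uvec n N e i)\<^sup>2) \<le> 1"
proof (cases "e < n")
  case True
  then have "(\<Sum>i<N. (uvec n N e i)\<^sup>2) = (\<Sum>i<N. if i = e then 1 else 0)"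
    by (intro sum.cong) (auto simp: uvec_def)
  then show ?thesis by simp
next
  case False
  then have "(\<Sum>i<N. (uvec n N e i)\<^sup>2) = (\<Sum>i<N. 1 / real N)"
    by (intro sum.cong) (auto simp: uvec_def power_divide)
  then show ?thesis by simp
qed

text \<open>Orthonormality holds only in the limit: the all-ones vector has inner product
  \<open>1 / sqrt N\<close> with a coordinate vector, and a coordinate vector is zero until
  \<open>N\<close> exceeds its index.\<close>

lemma uvec_inner_tendsto:
  assumes "c \<le> n" "d \<le> n"
  shows "(\<lambda>N. \<Sum>i<N. uvec n N c i * uvec n N d i) \<longlonglongrightarrow> of_bool (c = d)"
proof -
  have 1: "(\<lambda>N. \<Sum>i<N. uvec n N c i * uvec n N d i) \<longlonglongrightarrow> of_bool (c = d)" if "c < n" "d \<le> n" for c d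
  proof (cases "d < n")
    case True
    have "eventually (\<lambda>N. (\<Sum>i<N. uvec n N c i * uvec n N d i) = of_bool (c = d)) sequentially"
      using eventually_gt_at_top[of c]
    proof eventually_elim
      case (elim N)
      have "(\<Sum>i<N. uvec n N c i * uvec n N d i) = (\<Sum>i<N. if i = c then of_bool (c = d) else 0)"
        using that True by (intro sum.cong) (auto simp: uvec_def)
      then show ?case using elim by simp
    qed
    then show ?thesis by (rule tendsto_eventually)
  next
    case False
    with that have "c \<noteq> d" by auto
    have ev: "eventually (\<lambda>N. 1 / sqrt (real N) = (\<Sum>i<N. uvec n N c i * uvec n N d i)) sequentially"
      using eventually_gt_at_top[of c]
    proof eventually_elim
      case (elim N)
      have "(\<Sum>i<N. uvec n N c i * uvec n N d i) = (\<Sum>i<N. if i = c then 1 / sqrt (real N) else 0)"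
        using that False by (intro sum.cong) (auto simp: uvec_def)
      then show ?case using elim by simp
    qed
    have "(\<lambda>N. 1 / sqrt (real N)) \<longlonglongrightarrow> 0"
      by real_asymp
    from Lim_transform_eventually[OF this ev] show ?thesis using \<open>c \<noteq> d\<close> by simp
  qed
  show ?thesis
  proof (cases "c < n \<or> d < n")
    case True
    have "(d = c) = (c = d)" by auto
    with True show ?thesis
      using 1[of c d] 1[of d c] assms by (simp only: mult.commute[of "uvec n _ d _"]) blast
  next
    case False
    then have cd: "c = d" using assms by simp
    have "eventually (\<lambda>N. (\<Sum>i<N. uvec n N c i * uvec n N d i) = of_bool (c = d)) sequentially"
      using eventually_gt_at_top[of 0]
    proof eventually_elim
      case (elim N)
      have "(\<Sum>i<N. uvec n N c i * uvec n N d i) = (\<Sum>i<N. 1 / real N)"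
        using False by (intro sum.cong) (auto simp: uvec_def)
      then show ?case using elim cd by simp
    qed
    then show ?thesis by (rule tendsto_eventually)
  qed
qed

text \<open>The first limit of \<open>\<kappa>\<close> makes bilinear forms concentrate; the second
  makes the \<open>N\<close> diagonal errors of the undeformed trace sum to o(1). The recursion for
  \<open>m\<close> is that of the semicircle moments of variance \<open>v\<close>.\<close>

locale wick_sequence =
  fixes M :: "nat \<Rightarrow> 'a measure" and x :: "nat \<Rightarrow> nat \<times> nat \<Rightarrow> 'a \<Rightarrow> complex"
    and s :: "nat \<Rightarrow> nat \<Rightarrow> nat \<Rightarrow> real" and v :: real and \<kappa> m :: "nat \<Rightarrow> real"
  assumes ensemble: "N \<ge> 1 \<Longrightarrow> wick_matrix (M N) (x N) (s N) N v (\<kappa> N)"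
    and \<kappa>_tendsto: "\<kappa> \<longlonglongrightarrow> 0" "(\<lambda>N. real N * (\<kappa> N)\<^sup>2) \<longlonglongrightarrow> 0"
    and m_0: "m 0 = 1" and m_Suc: "m (Suc k) = v * (\<Sum>c<k. m c * m (k - 1 - c))"
begin

abbreviation E :: "nat \<Rightarrow> ('a \<Rightarrow> complex) \<Rightarrow> real" where
  "E N \<equiv> wick_matrix.ev (M N)"

abbreviation Y :: "nat \<Rightarrow> nat \<Rightarrow> nat \<Rightarrow> nat \<Rightarrow> nat \<Rightarrow> 'a \<Rightarrow> complex" where
  "Y n N c k d \<equiv> wick_matrix.yv (x N) N (uvec n N c) k (uvec n N d)"

definition Y_lim :: "nat \<Rightarrow> nat \<Rightarrow> nat \<Rightarrow> real" where
  "Y_lim c k d = of_bool (c = d) * m k"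

lemma v_nonneg: "0 \<le> v"
  using wick_matrix.v_nonneg[OF ensemble[of 1]] by simp

lemma E_pw_diag:
  "N \<ge> 1 \<Longrightarrow> i < N \<Longrightarrow> \<bar>E N (wick_matrix.pw (x N) N k i i) - m k\<bar> \<le> mean_bound v m k * (\<kappa> N)\<^sup>2"
  using wick_matrix.ev_pw_diag[OF ensemble m_0 m_Suc] by blast

text \<open>Off-diagonal entries have mean 0 and diagonal ones have mean close to \<open>m k\<close>
  uniformly, so the mean is \<open>m k\<close> times the inner product of the two vectors, up to a
  vanishing error.\<close>

lemma E_Y_tendsto:
  assumes "c \<le> n" "d \<le> n"
  shows "(\<lambda>N. E N (Y n N c k d)) \<longlonglongrightarrow> Y_lim c k d"
proof -
  let ?g = "\<lambda>N. \<Sum>i<N. uvec n N c i * uvec n N d i"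
  have "eventually (\<lambda>N. norm (E N (Y n N c k d) - ?g N * m k) \<le> mean_bound v m k * (\<kappa> N)\<^sup>2) sequentially"
    using eventually_ge_at_top[of 1]
  proof eventually_elim
    case (elim N)
    interpret wick_matrix "M N" "x N" "s N" N v "\<kappa> N" using elim by (rule ensemble)
    have "\<bar>ev (Y n N c k d) - ?g N * m k\<bar> = \<bar>\<Sum>i<N. uvec n N c i * uvec n N d i * (ev (pw k i i) - m k)\<bar>"
      by (simp add: ev_yv_diag sum_distrib_right right_diff_distrib sum_subtractf)
    also have "\<dots> \<le> (\<Sum>i<N. uvec n N c i * uvec n N d i * (mean_bound v m k * (\<kappa> N)\<^sup>2))"
      using E_pw_diag[OF elim]
      by (intro order_trans[OF sum_abs] sum_mono) (auto simp: abs_mult uvec_nonneg intro!: mult_left_mono)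
    also have "\<dots> = ?g N * (mean_bound v m k * (\<kappa> N)\<^sup>2)" by (simp add: sum_distrib_right)
    also have "\<dots> \<le> 1 * (mean_bound v m k * (\<kappa> N)\<^sup>2)"
      by (intro mult_right_mono sum_mult_le_1 uvec_norm mult_nonneg_nonneg mean_bound_nonneg v_nonneg) auto
    finally show ?case by simp
  qed
  moreover have "(\<lambda>N. mean_bound v m k * (\<kappa> N)\<^sup>2) \<longlonglongrightarrow> 0"
    using tendsto_mult_left[OF tendsto_power[OF \<kappa>_tendsto(1), of 2], of "mean_bound v m k"] by simp
  ultimately have "(\<lambda>N. E N (Y n N c k d) - ?g N * m k) \<longlonglongrightarrow> 0"
    by (rule Lim_null_comparison)
  from tendsto_add[OF this tendsto_mult_right[OF uvec_inner_tendsto[OF assms], of "m k"]] show ?thesis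
    by (simp add: Y_lim_def mult.commute)
qed

definition Y_mono :: "nat \<Rightarrow> nat \<Rightarrow> (nat \<times> nat \<times> nat) list \<Rightarrow> 'a \<Rightarrow> complex" where
  "Y_mono n N ys \<omega> = (\<Prod>(c, k, d)\<leftarrow>ys. Y n N c k d \<omega>)"

lemma E_Y_mono_tendsto:
  assumes "\<And>c k d. (c, k, d) \<in> set ys \<Longrightarrow> c \<le> n \<and> d \<le> n"
  shows "(\<lambda>N. E N (Y_mono n N ys)) \<longlonglongrightarrow> (\<Prod>(c, k, d)\<leftarrow>ys. Y_lim c k d)"
proof -
  let ?l = "length ys"
  let ?c = "\<lambda>a. fst (ys ! a)" and ?k = "\<lambda>a. fst (snd (ys ! a))" and ?d = "\<lambda>a. snd (snd (ys ! a))"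
  let ?K = "product_bound v (map ?k [0..<?l]) * fact ?l"
  have in_set: "?c a \<le> n" "?d a \<le> n" if "a < ?l" for a
    using assms[of "?c a" "?k a" "?d a"] that by auto
  have Ym: "Y_mono n N ys = (\<lambda>\<omega>. \<Prod>a<?l. Y n N (?c a) (?k a) (?d a) \<omega>)" for N
    by (simp add: Y_mono_def[abs_def] prod.list_conv_set_nth case_prod_unfold atLeast0LessThan)
  have "eventually (\<lambda>N. norm (E N (Y_mono n N ys) - (\<Prod>a<?l. E N (Y n N (?c a) (?k a) (?d a)))) \<le> \<kappa> N * ?K) sequentially"
    using eventually_ge_at_top[of 1]
  proof eventually_elim
    case (elim N)
    interpret wick_matrix "M N" "x N" "s N" N v "\<kappa> N" using elim by (rule ensemble)
    show ?case
      using ev_prod_yv[of ?l "\<lambda>a. uvec n N (?c a)" "\<lambda>a. uvec n N (?d a)" ?k]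
      by (simp add: Ym uvec_nonneg uvec_norm mult.assoc)
  qed
  moreover have "(\<lambda>N. \<kappa> N * ?K) \<longlonglongrightarrow> 0"
    using tendsto_mult_right[OF \<kappa>_tendsto(1), of ?K] by (simp add: mult.commute)
  ultimately have "(\<lambda>N. E N (Y_mono n N ys) - (\<Prod>a<?l. E N (Y n N (?c a) (?k a) (?d a)))) \<longlonglongrightarrow> 0"
    by (rule Lim_null_comparison)
  moreover have "(\<lambda>N. \<Prod>a<?l. E N (Y n N (?c a) (?k a) (?d a))) \<longlonglongrightarrow> (\<Prod>a<?l. Y_lim (?c a) (?k a) (?d a))"
    by (intro tendsto_prod E_Y_tendsto in_set) auto
  ultimately have "(\<lambda>N. E N (Y_mono n N ys)) \<longlonglongrightarrow> (\<Prod>a<?l. Y_lim (?c a) (?k a) (?d a))"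
    using tendsto_add by fastforce
  then show ?thesis by (simp add: prod.list_conv_set_nth case_prod_unfold atLeast0LessThan)
qed

abbreviation W :: "nat \<Rightarrow> (nat \<Rightarrow> real) \<Rightarrow> nat \<Rightarrow> nat \<Rightarrow> nat \<Rightarrow> nat \<Rightarrow> nat \<Rightarrow> 'a \<Rightarrow> complex" where
  "W n h N c p t d \<omega> \<equiv> perturbed (\<lambda>c k d. Y n N c k d \<omega>) (\<lambda>e. of_real (h e)) n c p t d"

lemma poly_Y_mono:
  assumes "N \<ge> 1"
  shows "rv_poly (x N) UNIV (Y_mono n N ys)"
proof -
  interpret wick_matrix "M N" "x N" "s N" N v "\<kappa> N" using assms by (rule ensemble)
  show ?thesis unfolding Y_mono_def[abs_def] case_prod_unfold by (intro poly_prod_list poly_yv) auto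
qed

lemma poly_W:
  assumes "N \<ge> 1"
  shows "rv_poly (x N) UNIV (W n h N c p t d)"
proof (induction p arbitrary: c rule: less_induct)
  case (less p)
  interpret wick_matrix "M N" "x N" "s N" N v "\<kappa> N" using assms by (rule ensemble)
  show ?case
    by (subst perturbed.simps) (intro poly_add poly_sum poly_cmult poly_mult poly_yv less; simp)
qed

text \<open>Expectations are not multiplicative at finite \<open>N\<close>, so the factors
  \<open>Y\<close> released by unfolding \<open>perturbed\<close> are collected in the prefix
  \<open>ys\<close>, and the limit is taken only for complete monomials.\<close>

lemma E_mono_W_tendsto:
  assumes "\<And>c k d. (c, k, d) \<in> set ys \<Longrightarrow> c \<le> n \<and> d \<le> n" "c \<le> n" "d \<le> n"
  shows "(\<lambda>N. E N (\<lambda>\<omega>. Y_mono n N ys \<omega> * W n h N c p t d \<omega>)) \<longlonglongrightarrow>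
    (\<Prod>(c, k, d)\<leftarrow>ys. Y_lim c k d) * perturbed Y_lim h n c p t d"
  using assms
proof (induction p arbitrary: c ys rule: less_induct)
  case (less p)
  let ?F = "\<lambda>N q e \<omega>. Y_mono n N ((c, q, e) # ys) \<omega> * W n h N e (p - 1 - q) t d \<omega>"
  let ?P = "\<lambda>ys. \<Prod>(c, k, d)\<leftarrow>ys. Y_lim c k d"
  have "eventually (\<lambda>N. E N (Y_mono n N ((c, p + t, d) # ys)) + (\<Sum>q<p. \<Sum>e\<le>n. h e * E N (?F N q e))
        = E N (\<lambda>\<omega>. Y_mono n N ys \<omega> * W n h N c p t d \<omega>)) sequentially"
    using eventually_ge_at_top[of 1]
  proof eventually_elim
    case (elim N)
    interpret wick_matrix "M N" "x N" "s N" N v "\<kappa> N" using elim by (rule ensemble)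
    have pF: "rv_poly (x N) UNIV (\<lambda>\<omega>. of_real (h e) * ?F N q e \<omega>)" for q e
      by (intro poly_cmult poly_mult poly_Y_mono poly_W elim) auto
    have "(\<lambda>\<omega>. Y_mono n N ys \<omega> * W n h N c p t d \<omega>) =
       (\<lambda>\<omega>. Y_mono n N ((c, p + t, d) # ys) \<omega> + (\<Sum>q<p. \<Sum>e\<le>n. of_real (h e) * ?F N q e \<omega>))"
      by (subst perturbed.simps) (simp add: Y_mono_def distrib_left sum_distrib_left mult_ac)
    then have "ev (\<lambda>\<omega>. Y_mono n N ys \<omega> * W n h N c p t d \<omega>) =
      ev (Y_mono n N ((c, p + t, d) # ys)) + ev (\<lambda>\<omega>. \<Sum>q<p. \<Sum>e\<le>n. of_real (h e) * ?F N q e \<omega>)"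
      by (simp only:) (intro ev_add poly_Y_mono elim poly_sum pF; simp)
    also have "ev (\<lambda>\<omega>. \<Sum>q<p. \<Sum>e\<le>n. of_real (h e) * ?F N q e \<omega>) =
        (\<Sum>q<p. ev (\<lambda>\<omega>. \<Sum>e\<le>n. of_real (h e) * ?F N q e \<omega>))"
      by (intro ev_sum poly_sum pF) simp
    also have "\<dots> = (\<Sum>q<p. \<Sum>e\<le>n. ev (\<lambda>\<omega>. of_real (h e) * ?F N q e \<omega>))"
      by (intro sum.cong refl ev_sum pF)
    finally show ?case by (simp only: ev_cmult)
  qed
  moreover have "(\<lambda>N. E N (Y_mono n N ((c, p + t, d) # ys)) + (\<Sum>q<p. \<Sum>e\<le>n. h e * E N (?F N q e))) \<longlonglongrightarrow>
     ?P ((c, p + t, d) # ys) + (\<Sum>q<p. \<Sum>e\<le>n. h e * (?P ((c, q, e) # ys) * perturbed Y_lim h n e (p - 1 - q) t d))"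
    using less.prems
    by (intro tendsto_add E_Y_mono_tendsto tendsto_sum tendsto_mult_left less.IH) auto
  moreover have "?P ((c, p + t, d) # ys) + (\<Sum>q<p. \<Sum>e\<le>n. h e * (?P ((c, q, e) # ys) * perturbed Y_lim h n e (p - 1 - q) t d))
     = ?P ys * perturbed Y_lim h n c p t d"
    by (subst (2) perturbed.simps) (simp add: distrib_left sum_distrib_left mult_ac)
  ultimately show ?case by (simp add: Lim_transform_eventually)
qed

lemma E_W_tendsto:
  assumes "c \<le> n" "d \<le> n"
  shows "(\<lambda>N. E N (W n h N c p t d)) \<longlonglongrightarrow> perturbed Y_lim h n c p t d"
  using E_mono_W_tendsto[of "[]" n c d h p t] assms by (simp add: Y_mono_def)

definition deformed_op :: "nat \<Rightarrow> (nat \<Rightarrow> real) \<Rightarrow> nat \<Rightarrow> 'a \<Rightarrow> (nat \<Rightarrow> complex) \<Rightarrow> nat \<Rightarrow> complex" where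
  "deformed_op n h N \<omega> = mat_op N (\<lambda>i j. x N (i, j) \<omega> +
     (\<Sum>e\<le>n. of_real (h e) * (of_real (uvec n N e i) * of_real (uvec n N e j))))"

definition deformed_trace :: "nat \<Rightarrow> (nat \<Rightarrow> real) \<Rightarrow> nat \<Rightarrow> nat \<Rightarrow> 'a \<Rightarrow> complex" where
  "deformed_trace n h N k \<omega> = (\<Sum>i<N. (deformed_op n h N \<omega> ^^ k) (\<lambda>j. of_bool (j = i)) i)"

lemma deformed_trace_expansion:
  assumes "N \<ge> 1"
  shows "deformed_trace n h N k \<omega> = (\<Sum>i<N. wick_matrix.pw (x N) N k i i \<omega>) +
    (\<Sum>q<k. \<Sum>e\<le>n. of_real (h e) * W n h N e (k - 1 - q) q e \<omega>)"
proof -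
  interpret wick_matrix "M N" "x N" "s N" N v "\<kappa> N" using assms by (rule ensemble)
  have out: "i \<ge> N \<Longrightarrow> uvec n N e i = 0" for e i by (simp add: uvec_def)
  have Y: "(\<lambda>c k d. Y n N c k d \<omega>) =
     (\<lambda>c k d. pairing N (uvec n N c) ((mat_op N (\<lambda>i j. x N (i, j) \<omega>) ^^ k) (\<lambda>i. of_real (uvec n N d i))))"
    by (intro ext yv_pairing out)
  show ?thesis
    unfolding deformed_trace_def deformed_op_def Y
    by (subst trace_perturbed) (simp_all add: out x_out mat_op_pow_pw)
qed

lemma poly_deformed_trace:
  assumes "N \<ge> 1"
  shows "rv_poly (x N) UNIV (deformed_trace n h N k)"
proof -
  interpret wick_matrix "M N" "x N" "s N" N v "\<kappa> N" using assms by (rule ensemble)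
  show ?thesis
    unfolding deformed_trace_expansion[OF assms, abs_def]
    by (intro poly_add poly_sum poly_pw_UNIV poly_cmult poly_W assms; simp)
qed

lemma deformed_trace_tendsto:
  "(\<lambda>N. E N (deformed_trace n h N k) - real N * m k) \<longlonglongrightarrow>
    (\<Sum>q<k. \<Sum>e\<le>n. h e * perturbed Y_lim h n e (k - 1 - q) q e)"
proof -
  let ?t = "\<lambda>N. \<Sum>i<N. E N (wick_matrix.pw (x N) N k i i) - m k"
  \<comment> \<open>The undeformed trace: \<open>N\<close> errors of size
    \<open>\<kappa>\<^sup>2\<close> each.\<close>
  have "eventually (\<lambda>N. norm (?t N) \<le> mean_bound v m k * (real N * (\<kappa> N)\<^sup>2)) sequentially"
    using eventually_ge_at_top[of 1]
  proof eventually_elim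
    case (elim N)
    have "\<bar>?t N\<bar> \<le> (\<Sum>i<N. mean_bound v m k * (\<kappa> N)\<^sup>2)"
      using E_pw_diag[OF elim] by (intro order_trans[OF sum_abs] sum_mono) auto
    then show ?case by (simp add: mult_ac)
  qed
  moreover have "(\<lambda>N. mean_bound v m k * (real N * (\<kappa> N)\<^sup>2)) \<longlonglongrightarrow> 0"
    using tendsto_mult_left[OF \<kappa>_tendsto(2), of "mean_bound v m k"] by simp
  ultimately have t: "?t \<longlonglongrightarrow> 0" by (rule Lim_null_comparison)
  have "(\<lambda>N. ?t N + (\<Sum>q<k. \<Sum>e\<le>n. h e * E N (W n h N e (k - 1 - q) q e))) \<longlonglongrightarrow>
     0 + (\<Sum>q<k. \<Sum>e\<le>n. h e * perturbed Y_lim h n e (k - 1 - q) q e)"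
    by (intro tendsto_add t tendsto_sum tendsto_mult_left E_W_tendsto) auto
  moreover have "eventually (\<lambda>N. ?t N + (\<Sum>q<k. \<Sum>e\<le>n. h e * E N (W n h N e (k - 1 - q) q e))
      = E N (deformed_trace n h N k) - real N * m k) sequentially"
    using eventually_ge_at_top[of 1]
  proof eventually_elim
    case (elim N)
    interpret wick_matrix "M N" "x N" "s N" N v "\<kappa> N" using elim by (rule ensemble)
    have pW: "rv_poly (x N) UNIV (\<lambda>\<omega>. of_real (h e) * W n h N e (k - 1 - q) q e \<omega>)" for q e
      by (intro poly_cmult poly_W elim) auto
    have "ev (deformed_trace n h N k) = ev (\<lambda>\<omega>. \<Sum>i<N. pw k i i \<omega>) +
        ev (\<lambda>\<omega>. \<Sum>q<k. \<Sum>e\<le>n. of_real (h e) * W n h N e (k - 1 - q) q e \<omega>)"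
      unfolding deformed_trace_expansion[OF elim, abs_def]
      by (intro ev_add poly_sum poly_pw_UNIV pW; simp)
    also have "ev (\<lambda>\<omega>. \<Sum>i<N. pw k i i \<omega>) = (\<Sum>i<N. ev (pw k i i))"
      by (intro ev_sum poly_pw_UNIV)
    also have "ev (\<lambda>\<omega>. \<Sum>q<k. \<Sum>e\<le>n. of_real (h e) * W n h N e (k - 1 - q) q e \<omega>) =
        (\<Sum>q<k. ev (\<lambda>\<omega>. \<Sum>e\<le>n. of_real (h e) * W n h N e (k - 1 - q) q e \<omega>))"
      by (intro ev_sum poly_sum pW) simp
    also have "\<dots> = (\<Sum>q<k. \<Sum>e\<le>n. ev (\<lambda>\<omega>. of_real (h e) * W n h N e (k - 1 - q) q e \<omega>))"
      by (intro sum.cong refl ev_sum pW)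
    finally show ?case by (simp add: ev_cmult sum_subtractf)
  qed
  ultimately show ?thesis by (simp add: Lim_transform_eventually)
qed

end

section \<open>The Gaussian unitary ensemble\<close>

text \<open>The identity of Stein for monomials, read off from the closed form of the even moments
  and the vanishing of the odd ones.\<close>

lemma (in prob_space) normal_moment_recursion:
  assumes D: "distributed M lborel U (normal_density 0 \<tau>)" and \<tau>: "0 < \<tau>"
  shows "integrable M (\<lambda>\<omega>. U \<omega> ^ k)"
    and "(LINT \<omega>|M. U \<omega> ^ Suc k) = \<tau>\<^sup>2 * real k * (LINT \<omega>|M. U \<omega> ^ (k - 1))"
proof -
  show "integrable M (\<lambda>\<omega>. U \<omega> ^ k)" for k
    using distributed_integrable[OF D, of "\<lambda>x. x ^ k"] integrable_normal_moment[OF \<tau>, of 0 k] by simp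
  have E: "(LINT \<omega>|M. U \<omega> ^ k) = (LINT x|lborel. normal_density 0 \<tau> x * x ^ k)" for k
    using distributed_integral[OF D, of "\<lambda>x. x ^ k"] by simp
  have even: "(LINT \<omega>|M. U \<omega> ^ (2 * j)) = fact (2 * j) / ((2 / \<tau>\<^sup>2) ^ j * fact j)" for j
    using integral_normal_moment_even[OF \<tau>, of 0 j] by (simp add: E)
  have odd: "(LINT \<omega>|M. U \<omega> ^ (2 * j + 1)) = 0" for j
    unfolding E using integral_normal_moment_odd[OF \<tau>, of 0 j] by (simp only: diff_zero)
  show "(LINT \<omega>|M. U \<omega> ^ Suc k) = \<tau>\<^sup>2 * real k * (LINT \<omega>|M. U \<omega> ^ (k - 1))"
  proof (cases "even k")
    case True
    then obtain j where j: "k = 2 * j" by (elim evenE)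
    have "real k * (LINT \<omega>|M. U \<omega> ^ (k - 1)) = 0"
    proof (cases j)
      case (Suc j')
      then show ?thesis using odd[of j'] by (simp add: j)
    qed (simp add: j)
    then show ?thesis using odd[of j] by (simp add: j)
  next
    case False
    then obtain j where j: "k = 2 * j + 1" by (elim oddE)
    have "(LINT \<omega>|M. U \<omega> ^ Suc k) = fact (2 * Suc j) / ((2 / \<tau>\<^sup>2) ^ Suc j * fact (Suc j))"
      using even[of "Suc j"] by (simp only: j) simp
    also have "\<dots> = \<tau>\<^sup>2 * real (2 * j + 1) * (fact (2 * j) / ((2 / \<tau>\<^sup>2) ^ j * fact j))"
    proof -
      have "2 * k * q * A / (2 / t * B * (k * C)) = t * q * (A / (B * C))"
        if "k \<noteq> 0" "t \<noteq> 0" "B \<noteq> 0" "C \<noteq> 0" for k q t A B C :: real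
        using that by (simp add: field_simps)
      from this[of "real j + 1" "\<tau>\<^sup>2" "(2 / \<tau>\<^sup>2) ^ j" "fact j" "real (2 * j + 1)" "fact (2 * j)"] show ?thesis
        using \<tau> by (simp add: algebra_simps)
    qed
    finally show ?thesis using even[of j] by (simp add: j)
  qed
qed

text \<open>Writing Z = U + iV, integration by parts is applied to U and V, both of variance
  \<open>v / 2\<close>. In E(U F) + i E(V F) the holomorphic derivative cancels and the
  antiholomorphic one doubles, so only the factors \<open>cnj Z\<close> get differentiated.\<close>

lemma (in prob_space) complex_normal_moment_recursion:
  fixes U V :: "'a \<Rightarrow> real" and Z :: "'a \<Rightarrow> complex"
  assumes D: "distributed M lborel U (normal_density 0 (sqrt (v / 2)))"
      "distributed M lborel V (normal_density 0 (sqrt (v / 2)))"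
    and indep: "indep_var borel U borel V" and v: "0 < v"
  defines "Z \<equiv> \<lambda>\<omega>. Complex (U \<omega>) (V \<omega>)"
  shows "integrable M (\<lambda>\<omega>. Z \<omega> ^ a * cnj (Z \<omega>) ^ b)"
    and "(LINT \<omega>|M. Z \<omega> ^ Suc a * cnj (Z \<omega>) ^ b) = of_real v * of_nat b * (LINT \<omega>|M. Z \<omega> ^ a * cnj (Z \<omega>) ^ (b - 1))"
proof -
  let ?c = "complex_of_real (v / 2)"
  define mon where "mon m n \<omega> = complex_of_real (U \<omega> ^ m * V \<omega> ^ n)" for m n \<omega>
  let ?I = "\<lambda>m n F. LINT \<omega>|M. mon m n \<omega> * F \<omega>"
  \<comment> \<open>\<open>F1\<close> and \<open>F2\<close> act as the partial derivatives of
    \<open>F\<close> in \<open>U\<close> and \<open>V\<close>. Testing against all monomials makes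
    the property stable under multiplication by linear forms.\<close>
  define ibp where "ibp F F1 F2 \<longleftrightarrow> (\<forall>m n. integrable M (\<lambda>\<omega>. mon m n \<omega> * F \<omega>) \<and>
      integrable M (\<lambda>\<omega>. mon m n \<omega> * F1 \<omega>) \<and> integrable M (\<lambda>\<omega>. mon m n \<omega> * F2 \<omega>) \<and>
      ?I (Suc m) n F = ?c * (of_nat m * ?I (m - 1) n F + ?I m n F1) \<and>
      ?I m (Suc n) F = ?c * (of_nat n * ?I m (n - 1) F + ?I m n F2))" for F F1 F2
  have pos: "0 < sqrt (v / 2)" "(sqrt (v / 2))\<^sup>2 = v / 2" using v by auto
  note U = normal_moment_recursion[OF D(1) pos(1), unfolded pos(2)]
  note V = normal_moment_recursion[OF D(2) pos(1), unfolded pos(2)]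
  have ind: "indep_var borel (\<lambda>\<omega>. U \<omega> ^ m) borel (\<lambda>\<omega>. V \<omega> ^ n)" for m n
    using indep_var_compose[OF indep, of "\<lambda>x. x ^ m" borel "\<lambda>x. x ^ n" borel] by (simp add: o_def)
  have "integrable M (\<lambda>\<omega>. U \<omega> ^ m * V \<omega> ^ n)" for m n
    by (rule indep_var_integrable[OF ind U(1) V(1)])
  then have int: "integrable M (mon m n)" for m n
    unfolding mon_def[abs_def] by (rule integrable_of_real)
  have E: "(LINT \<omega>|M. mon m n \<omega>) = of_real ((LINT \<omega>|M. U \<omega> ^ m) * (LINT \<omega>|M. V \<omega> ^ n))" for m n
    unfolding mon_def integral_complex_of_real indep_var_lebesgue_integral[OF ind U(1) V(1)] ..
  have ibp_1: "ibp (\<lambda>_. 1) (\<lambda>_. 0) (\<lambda>_. 0)"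
    unfolding ibp_def
  proof (intro allI conjI)
    fix m n
    show "?I (Suc m) n (\<lambda>_. 1) = ?c * (of_nat m * ?I (m - 1) n (\<lambda>_. 1) + ?I m n (\<lambda>_. 0))"
      by (simp only: mult_1_right E U(2)) simp
    show "?I m (Suc n) (\<lambda>_. 1) = ?c * (of_nat n * ?I m (n - 1) (\<lambda>_. 1) + ?I m n (\<lambda>_. 0))"
      by (simp only: mult_1_right E V(2)) simp
  qed (simp_all add: int)
  \<comment> \<open>\<open>\<alpha> = \<i>\<close> adds a factor \<open>Z\<close>, and
    \<open>\<alpha> = - \<i>\<close> a factor \<open>cnj Z\<close>.\<close>
  have ibp_mult: "ibp (\<lambda>\<omega>. (of_real (U \<omega>) + \<alpha> * of_real (V \<omega>)) * F \<omega>)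
      (\<lambda>\<omega>. F \<omega> + (of_real (U \<omega>) + \<alpha> * of_real (V \<omega>)) * F1 \<omega>)
      (\<lambda>\<omega>. \<alpha> * F \<omega> + (of_real (U \<omega>) + \<alpha> * of_real (V \<omega>)) * F2 \<omega>)"
    if F: "ibp F F1 F2" for F F1 F2 \<alpha>
  proof -
    let ?w = "\<lambda>\<omega>. of_real (U \<omega>) + \<alpha> * complex_of_real (V \<omega>)"
    have w: "mon m n \<omega> * (?w \<omega> * G \<omega>) = mon (Suc m) n \<omega> * G \<omega> + \<alpha> * (mon m (Suc n) \<omega> * G \<omega>)" for m n \<omega> G
      by (simp add: mon_def algebra_simps)
    have i: "integrable M (\<lambda>\<omega>. mon m n \<omega> * F \<omega>)" "integrable M (\<lambda>\<omega>. mon m n \<omega> * F1 \<omega>)"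
        "integrable M (\<lambda>\<omega>. mon m n \<omega> * F2 \<omega>)" for m n
      using F by (auto simp: ibp_def)
    have p: "?I (Suc m) n F = ?c * (of_nat m * ?I (m - 1) n F + ?I m n F1)"
        "?I m (Suc n) F = ?c * (of_nat n * ?I m (n - 1) F + ?I m n F2)" for m n
      using F unfolding ibp_def by blast+
    have Iw: "?I m n (\<lambda>\<omega>. ?w \<omega> * G \<omega>) = ?I (Suc m) n G + \<alpha> * ?I m (Suc n) G"
      if "\<And>m n. integrable M (\<lambda>\<omega>. mon m n \<omega> * G \<omega>)" for m n G
      unfolding w using that by simp
    have iw: "integrable M (\<lambda>\<omega>. mon m n \<omega> * (?w \<omega> * G \<omega>))"
      if "\<And>m n. integrable M (\<lambda>\<omega>. mon m n \<omega> * G \<omega>)" for m n G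
      unfolding w using that by simp
    have I1: "?I m n (\<lambda>\<omega>. F \<omega> + ?w \<omega> * F1 \<omega>) = ?I m n F + (?I (Suc m) n F1 + \<alpha> * ?I m (Suc n) F1)" for m n
      unfolding Iw[OF i(2), symmetric] using i iw[OF i(2)] by (simp add: distrib_left)
    have I2: "?I m n (\<lambda>\<omega>. \<alpha> * F \<omega> + ?w \<omega> * F2 \<omega>) = \<alpha> * ?I m n F + (?I (Suc m) n F2 + \<alpha> * ?I m (Suc n) F2)" for m n
    proof -
      have "?I m n (\<lambda>\<omega>. \<alpha> * F \<omega> + ?w \<omega> * F2 \<omega>) = (LINT \<omega>|M. \<alpha> * (mon m n \<omega> * F \<omega>) + mon m n \<omega> * (?w \<omega> * F2 \<omega>))"
        by (simp add: algebra_simps)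
      then show ?thesis unfolding Iw[OF i(3), symmetric] using i iw[OF i(3)] by simp
    qed
    have eq1: "?I (Suc m) n (\<lambda>\<omega>. ?w \<omega> * F \<omega>) =
        ?c * (of_nat m * ?I (m - 1) n (\<lambda>\<omega>. ?w \<omega> * F \<omega>) + ?I m n (\<lambda>\<omega>. F \<omega> + ?w \<omega> * F1 \<omega>))" for m n
      unfolding Iw[OF i(1)] I1 p(1)[of "Suc m" n] p(1)[of m "Suc n"]
      by (cases m) (simp_all add: algebra_simps)
    have eq2: "?I m (Suc n) (\<lambda>\<omega>. ?w \<omega> * F \<omega>) =
        ?c * (of_nat n * ?I m (n - 1) (\<lambda>\<omega>. ?w \<omega> * F \<omega>) + ?I m n (\<lambda>\<omega>. \<alpha> * F \<omega> + ?w \<omega> * F2 \<omega>))" for m n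
      unfolding Iw[OF i(1)] I2 p(2)[of m "Suc n"] p(2)[of "Suc m" n]
      by (cases n) (simp_all add: algebra_simps)
    have "integrable M (\<lambda>\<omega>. mon m n \<omega> * (F \<omega> + ?w \<omega> * F1 \<omega>))" for m n
      unfolding distrib_left[of "mon m n _"] by (intro Bochner_Integration.integrable_add i iw)
    moreover have "integrable M (\<lambda>\<omega>. mon m n \<omega> * (\<alpha> * F \<omega> + ?w \<omega> * F2 \<omega>))" for m n
      unfolding distrib_left[of "mon m n _"] mult.left_commute[of "mon m n _" \<alpha>]
      by (intro Bochner_Integration.integrable_add i iw integrable_mult_right)
    ultimately show ?thesis unfolding ibp_def using eq1 eq2 iw[OF i(1)] by blast
  qed
  have Z: "Z \<omega> = of_real (U \<omega>) + \<i> * of_real (V \<omega>)" "cnj (Z \<omega>) = of_real (U \<omega>) + (- \<i>) * of_real (V \<omega>)" for \<omega>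
    by (simp_all add: Z_def complex_eq_iff)
  have ibp_cong: "ibp F G H \<Longrightarrow> F = F' \<Longrightarrow> G = G' \<Longrightarrow> H = H' \<Longrightarrow> ibp F' G' H'" for F G H F' G' H'
    by simp
  have ibp_Z: "ibp (\<lambda>\<omega>. Z \<omega> ^ a * cnj (Z \<omega>) ^ b)
      (\<lambda>\<omega>. of_nat a * (Z \<omega> ^ (a - 1) * cnj (Z \<omega>) ^ b) + of_nat b * (Z \<omega> ^ a * cnj (Z \<omega>) ^ (b - 1)))
      (\<lambda>\<omega>. \<i> * (of_nat a * (Z \<omega> ^ (a - 1) * cnj (Z \<omega>) ^ b)) - \<i> * (of_nat b * (Z \<omega> ^ a * cnj (Z \<omega>) ^ (b - 1))))" for a b
  proof (induction a)
    case 0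
    show ?case
    proof (induction b)
      case 0
      then show ?case using ibp_1 by simp
    next
      case (Suc b)
      show ?case
        by (rule ibp_cong[OF ibp_mult[OF Suc, of "- \<i>", folded Z(2)]])
          (cases b; simp add: fun_eq_iff algebra_simps)+
    qed
  next
    case (Suc a)
    show ?case
      by (rule ibp_cong[OF ibp_mult[OF Suc, of \<i>, folded Z(1)]])
        (cases a; simp add: fun_eq_iff algebra_simps)+
  qed
  have mon0: "mon 0 0 = (\<lambda>_. 1)" by (simp add: mon_def fun_eq_iff)
  show i: "integrable M (\<lambda>\<omega>. Z \<omega> ^ a * cnj (Z \<omega>) ^ b)" for a b
    using ibp_Z[of a b] unfolding ibp_def by (auto dest!: spec[of _ 0] simp: mon0)
  let ?F = "\<lambda>\<omega>. Z \<omega> ^ a * cnj (Z \<omega>) ^ b"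
  let ?A = "LINT \<omega>|M. of_nat a * (Z \<omega> ^ (a - 1) * cnj (Z \<omega>) ^ b)"
  let ?B = "LINT \<omega>|M. of_nat b * (Z \<omega> ^ a * cnj (Z \<omega>) ^ (b - 1))"
  have iF: "integrable M (\<lambda>\<omega>. mon (Suc 0) 0 \<omega> * ?F \<omega>)" "integrable M (\<lambda>\<omega>. mon 0 (Suc 0) \<omega> * ?F \<omega>)"
    using ibp_Z[of a b] unfolding ibp_def by blast+
  have "?I (Suc 0) 0 ?F = ?c * (?A + ?B)" "?I 0 (Suc 0) ?F = ?c * (\<i> * ?A - \<i> * ?B)"
    using ibp_Z[of a b] i unfolding ibp_def by (auto dest!: spec[of _ 0] simp: mon0)
  moreover have "(LINT \<omega>|M. Z \<omega> ^ Suc a * cnj (Z \<omega>) ^ b) = ?I (Suc 0) 0 ?F + \<i> * ?I 0 (Suc 0) ?F"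
  proof -
    have "(LINT \<omega>|M. Z \<omega> ^ Suc a * cnj (Z \<omega>) ^ b) = (LINT \<omega>|M. mon (Suc 0) 0 \<omega> * ?F \<omega> + \<i> * (mon 0 (Suc 0) \<omega> * ?F \<omega>))"
      by (intro Bochner_Integration.integral_cong refl) (simp add: Z(1) mon_def algebra_simps)
    then show ?thesis using iF by simp
  qed
  moreover have "c * (A + B) + \<i> * (c * (\<i> * A - \<i> * B)) = c * (2 * B)" for c A B :: complex
    by (simp add: algebra_simps)
  ultimately have "(LINT \<omega>|M. Z \<omega> ^ Suc a * cnj (Z \<omega>) ^ b) = ?c * (2 * ?B)"
    by (simp only:)
  then show "(LINT \<omega>|M. Z \<omega> ^ Suc a * cnj (Z \<omega>) ^ b) = of_real v * of_nat b * (LINT \<omega>|M. Z \<omega> ^ a * cnj (Z \<omega>) ^ (b - 1))"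
    by simp
qed

text \<open>The values of the letters commute, so all removals of \<open>e\<close> have the same
  value and only their number matters.\<close>

lemma mono_deriv_remove1:
  "mono_deriv x e L \<omega> = of_nat (count_list L e) * mono_val x (remove1 e L) \<omega>"
proof (induction L)
  case (Cons f L)
  show ?case
  proof (cases "e \<in> set L")
    case True
    then have "mono_val x L \<omega> = x e \<omega> * mono_val x (remove1 e L) \<omega>"
      by (induction L) (auto simp: mult_ac)
    then show ?thesis using Cons by (simp add: algebra_simps)
  next
    case False
    then show ?thesis using Cons by (auto simp: count_list_0_iff)
  qed
qed simp

definition gue_entry :: "nat \<Rightarrow> ('a \<Rightarrow> complex mat) \<Rightarrow> nat \<times> nat \<Rightarrow> 'a \<Rightarrow> complex" where
  "gue_entry N X p \<omega> = (if fst p < N \<and> snd p < N then X \<omega> $$ p else 0)"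

lemma mat_adjoint_entry:
  assumes "A \<in> carrier_mat N N" "mat_adjoint A = A" "i < N" "j < N"
  shows "cnj (A $$ (i, j)) = A $$ (j, i)"
proof -
  have "A $$ (j, i) = mat_adjoint A $$ (j, i)" using assms by simp
  also have "\<dots> = cnj (A $$ (i, j))"
    using assms(1,3,4) by (simp add: mat_adjoint_def mat_of_rows_def)
  finally show ?thesis by simp
qed

text \<open>A word is regrouped by the independent entries on and above the diagonal: the entry at
  \<open>p\<close> occurs to the power \<open>cA\<close>, its conjugate, standing for the transposed
  letter, to the power \<open>cB\<close>. Adding \<open>(i, l)\<close> or deleting
  \<open>(l, i)\<close> changes only the factor of one unordered pair, to which the recursion for a
  single Gaussian applies.\<close>

lemma GUE_wick:
  fixes X :: "'a \<Rightarrow> complex mat"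
  assumes GUE: "GUE M N v X" and v: "0 < v"
  defines "x \<equiv> gue_entry N X"
  shows "integrable M (mono_val x L)"
    and "(LINT \<omega>|M. mono_val x ((i, l) # L) \<omega>) =
      of_real (if i < N \<and> l < N then v else 0) * (LINT \<omega>|M. mono_deriv x (l, i) L \<omega>)"
proof -
  have rs: "random_selfadjoint_matrix M N X" using GUE by (simp add: GUE_def)
  interpret prob_space M using rs by (simp add: random_selfadjoint_matrix_def)
  define I where "I = {(i, j). i \<le> j \<and> j < N}"
  have finI: "finite I" by (rule finite_subset[of _ "{..N} \<times> {..N}"]) (auto simp: I_def)
  have indep: "indep_vars (\<lambda>_. borel) (\<lambda>p \<omega>. X \<omega> $$ p) I"
    using GUE by (simp add: GUE_def I_def case_prod_unfold)
  have carr: "X \<omega> \<in> carrier_mat N N" "mat_adjoint (X \<omega>) = X \<omega>" if "\<omega> \<in> space M" for \<omega>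
    using rs that by (auto simp: random_selfadjoint_matrix_def)
  have cnj_X: "cnj (X \<omega> $$ (i, j)) = X \<omega> $$ (j, i)" if "\<omega> \<in> space M" "i < N" "j < N" for \<omega> i j
    using mat_adjoint_entry carr that by blast
  define f where "f a b z = z ^ a * cnj z ^ b" for a b :: nat and z :: complex
  define \<mu> where "\<mu> p a b = (LINT \<omega>|M. f a b (X \<omega> $$ p))" for p a b
  have off: "integrable M (\<lambda>\<omega>. f a b (X \<omega> $$ (i, j)))" (is ?int)
      "\<mu> (i, j) (Suc a) b = of_real v * of_nat b * \<mu> (i, j) a (b - 1)" (is ?rec) if "i < j" "j < N" for i j a b
  proof -
    have "distributed M lborel (\<lambda>\<omega>. Re (X \<omega> $$ (i, j))) (normal_density 0 (sqrt (v / 2)))"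
        "distributed M lborel (\<lambda>\<omega>. Im (X \<omega> $$ (i, j))) (normal_density 0 (sqrt (v / 2)))"
        "indep_var borel (\<lambda>\<omega>. Re (X \<omega> $$ (i, j))) borel (\<lambda>\<omega>. Im (X \<omega> $$ (i, j)))"
      using GUE that by (auto simp: GUE_def)
    from complex_normal_moment_recursion[OF this v] show ?int ?rec
      by (simp_all add: f_def \<mu>_def)
  qed
  \<comment> \<open>Conjugation exchanges the two exponents and so gives the recursion in the second
    one.\<close>
  have off': "\<mu> (i, j) a (Suc b) = of_real v * of_nat a * \<mu> (i, j) (a - 1) b" if "i < j" "j < N" for i j a b
  proof -
    have c: "\<mu> p a b = cnj (\<mu> p b a)" for p a b
    proof -
      have "cnj (\<mu> p b a) = (LINT \<omega>|M. cnj (f b a (X \<omega> $$ p)))" by (simp add: \<mu>_def)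
      then show ?thesis by (simp add: \<mu>_def f_def mult.commute)
    qed
    show ?thesis
      by (subst (1 2) c) (simp add: off(2)[OF that])
  qed
  have real_diag: "X \<omega> $$ (i, i) = of_real (Re (X \<omega> $$ (i, i)))" if "\<omega> \<in> space M" "i < N" for \<omega> i
    using cnj_X[OF that that(2)] by (simp add: complex_eq_iff)
  have diag: "integrable M (\<lambda>\<omega>. f a 0 (X \<omega> $$ (i, i)))" (is ?int)
      "\<mu> (i, i) (Suc a) 0 = of_real v * of_nat a * \<mu> (i, i) (a - 1) 0" (is ?rec) if "i < N" for i a
  proof -
    let ?U = "\<lambda>\<omega>. Re (X \<omega> $$ (i, i))"
    have "distributed M lborel ?U (normal_density 0 (sqrt v))"
      using GUE that by (auto simp: GUE_def)
    note U = normal_moment_recursion[OF this]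
    have eq: "f a 0 (X \<omega> $$ (i, i)) = of_real (?U \<omega> ^ a)" if "\<omega> \<in> space M" for a \<omega>
      using real_diag[OF that \<open>i < N\<close>] by (metis f_def mult.right_neutral of_real_power power_0)
    have "integrable M (\<lambda>\<omega>. complex_of_real (?U \<omega> ^ a))" using U(1) v by (intro integrable_of_real) auto
    then show ?int using eq by (simp cong: Bochner_Integration.integrable_cong)
    have "\<mu> (i, i) a 0 = of_real (LINT \<omega>|M. ?U \<omega> ^ a)" for a
    proof -
      have "\<mu> (i, i) a 0 = (LINT \<omega>|M. of_real (?U \<omega> ^ a))"
        unfolding \<mu>_def by (intro Bochner_Integration.integral_cong refl eq)
      then show ?thesis by (simp only: integral_complex_of_real)
    qed
    then show ?rec using U(2) v by (simp del: power_Suc)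
  qed
  define cA where "cA L p = count_list L p" for L and p :: "nat \<times> nat"
  \<comment> \<open>On the diagonal a letter is its own transpose, so \<open>cA\<close> counts all
    occurrences and \<open>cB\<close> must be 0.\<close>
  define cB where "cB L p = (if fst p < snd p then count_list L (snd p, fst p) else 0)" for L and p :: "nat \<times> nat"
  have int_f: "integrable M (\<lambda>\<omega>. f (cA L p) (cB L p) (X \<omega> $$ p))" if "p \<in> I" for L p
  proof (cases p)
    case (Pair i j)
    then show ?thesis using that off(1) diag(1) by (cases "i = j") (auto simp: I_def cB_def)
  qed
  have mono: "mono_val x L \<omega> = (\<Prod>p\<in>I. f (cA L p) (cB L p) (X \<omega> $$ p))"
    if "set L \<subseteq> {..<N} \<times> {..<N}" "\<omega> \<in> space M" for L \<omega>
    using that(1)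
  proof (induction L)
    case Nil
    then show ?case by (simp add: f_def cA_def cB_def)
  next
    case (Cons e L)
    obtain p q where e: "e = (p, q)" by (cases e)
    let ?p0 = "(min p q, max p q)"
    have rng: "p < N" "q < N" using Cons.prems by (auto simp: e)
    have p0: "?p0 \<in> I" using rng by (auto simp: I_def)
    have "(\<Prod>r\<in>I. f (cA (e # L) r) (cB (e # L) r) (X \<omega> $$ r)) =
       f (cA (e # L) ?p0) (cB (e # L) ?p0) (X \<omega> $$ ?p0) * (\<Prod>r\<in>I - {?p0}. f (cA (e # L) r) (cB (e # L) r) (X \<omega> $$ r))"
      by (rule prod.remove[OF finI p0])
    also have "(\<Prod>r\<in>I - {?p0}. f (cA (e # L) r) (cB (e # L) r) (X \<omega> $$ r)) = (\<Prod>r\<in>I - {?p0}. f (cA L r) (cB L r) (X \<omega> $$ r))"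
      by (intro prod.cong refl) (auto simp: cA_def cB_def e I_def min_def max_def split: if_splits)
    also have "f (cA (e # L) ?p0) (cB (e # L) ?p0) (X \<omega> $$ ?p0) = x e \<omega> * f (cA L ?p0) (cB L ?p0) (X \<omega> $$ ?p0)"
      using cnj_X[OF that(2), of q p] rng
      by (auto simp: cA_def cB_def e f_def x_def gue_entry_def min_def max_def)
    also have "\<dots> * (\<Prod>r\<in>I - {?p0}. f (cA L r) (cB L r) (X \<omega> $$ r)) = x e \<omega> * mono_val x L \<omega>"
      using Cons by (simp add: prod.remove[OF finI p0] mult.assoc)
    finally show ?case by simp
  qed
  have indep_f: "indep_vars (\<lambda>_. borel) (\<lambda>p \<omega>. f (cA L p) (cB L p) (X \<omega> $$ p)) I" for L
    by (rule indep_vars_compose2[OF indep])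
      (auto simp: f_def intro!: borel_measurable_continuous_onI continuous_intros)
  have zero: "mono_val x L \<omega> = 0" if "\<not> set L \<subseteq> {..<N} \<times> {..<N}" for L \<omega>
    using that by (induction L) (auto simp: x_def gue_entry_def)
  show int: "integrable M (mono_val x L)" for L
  proof (cases "set L \<subseteq> {..<N} \<times> {..<N}")
    case True
    have "integrable M (\<lambda>\<omega>. \<Prod>p\<in>I. f (cA L p) (cB L p) (X \<omega> $$ p))"
      by (intro indep_vars_integrable finI indep_f int_f)
    then show ?thesis using mono[OF True] by (simp cong: Bochner_Integration.integrable_cong)
  next
    case False
    then have "mono_val x L = (\<lambda>_. 0)" by (simp add: zero fun_eq_iff)
    then show ?thesis by simp
  qed
  have E: "(LINT \<omega>|M. mono_val x L \<omega>) = (\<Prod>p\<in>I. \<mu> p (cA L p) (cB L p))"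
    if "set L \<subseteq> {..<N} \<times> {..<N}" for L
  proof -
    have "(LINT \<omega>|M. mono_val x L \<omega>) = (LINT \<omega>|M. (\<Prod>p\<in>I. f (cA L p) (cB L p) (X \<omega> $$ p)))"
      by (intro Bochner_Integration.integral_cong refl mono that)
    also have "\<dots> = (\<Prod>p\<in>I. \<mu> p (cA L p) (cB L p))"
      unfolding \<mu>_def by (intro indep_vars_lebesgue_integral finI indep_f int_f)
    finally show ?thesis .
  qed
  show "(LINT \<omega>|M. mono_val x ((i, l) # L) \<omega>) =
      of_real (if i < N \<and> l < N then v else 0) * (LINT \<omega>|M. mono_deriv x (l, i) L \<omega>)"
  proof (cases "i < N \<and> l < N")
    case False
    then show ?thesis by (auto simp: x_def gue_entry_def)
  next
    case True
    have D: "(LINT \<omega>|M. mono_deriv x (l, i) L \<omega>) = of_nat (count_list L (l, i)) * (LINT \<omega>|M. mono_val x (remove1 (l, i) L) \<omega>)"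
      by (simp add: mono_deriv_remove1)
    show ?thesis
    proof (cases "set L \<subseteq> {..<N} \<times> {..<N}")
      case False
      \<comment> \<open>A letter outside the matrix differs from \<open>(l, i)\<close> and survives
        its removal, so both sides vanish.\<close>
      then obtain g where "g \<in> set L" "g \<notin> {..<N} \<times> {..<N}" by auto
      moreover from this True have "g \<in> set (remove1 (l, i) L)" by (subst in_set_remove1) auto
      ultimately have "\<not> set (remove1 (l, i) L) \<subseteq> {..<N} \<times> {..<N}" by blast
      then have "mono_val x (remove1 (l, i) L) = (\<lambda>_. 0)" by (simp add: fun_eq_iff zero)
      moreover have "mono_val x ((i, l) # L) = (\<lambda>_. 0)"
        using zero[of "(i, l) # L"] False by (simp add: fun_eq_iff)
      ultimately show ?thesis unfolding D by (simp only:) simp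
    next
      case rng: True
      let ?p0 = "(min i l, max i l)"
      let ?R = "\<lambda>L. \<Prod>p\<in>I - {?p0}. \<mu> p (cA L p) (cB L p)"
      have p0: "?p0 \<in> I" using True by (auto simp: I_def)
      have R1: "?R ((i, l) # L) = ?R L"
        by (intro prod.cong refl) (auto simp: cA_def cB_def I_def min_def max_def split: if_splits)
      have cr: "count_list (remove1 e L) g = count_list L g - (if e = g then 1 else 0)" for e g
        by (induction L) (auto simp: count_list_0_iff)
      have R2: "?R (remove1 (l, i) L) = ?R L"
        by (intro prod.cong refl) (auto simp: cA_def cB_def cr I_def min_def max_def split: if_splits)
      have rng': "set ((i, l) # L) \<subseteq> {..<N} \<times> {..<N}" "set (remove1 (l, i) L) \<subseteq> {..<N} \<times> {..<N}"
        using True rng set_remove1_subset[of "(l, i)" L] by auto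
      have "\<mu> ?p0 (cA ((i, l) # L) ?p0) (cB ((i, l) # L) ?p0) =
          of_real v * of_nat (count_list L (l, i)) * \<mu> ?p0 (cA (remove1 (l, i) L) ?p0) (cB (remove1 (l, i) L) ?p0)"
        using True off(2)[of i l "cA L (i, l)" "count_list L (l, i)"] off'[of l i "count_list L (l, i)" "count_list L (i, l)"]
          diag(2)[of i "count_list L (i, i)"]
        by (cases i l rule: linorder_cases) (simp_all add: cA_def cB_def cr)
      then show ?thesis
        unfolding D E[OF rng'(1)] E[OF rng'(2)] prod.remove[OF finI p0] R1 R2 using True by simp
    qed
  qed
qed

section \<open>The periodic band and its variance profile\<close>

lemma card_periodic_band:
  assumes i: "i < N"
  shows "card {l \<in> {..<N}. periodic_dist N i l \<le> int b} = min (2 * b + 1) N"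
proof (cases "2 * b + 1 < N")
  case False
  then have "{l \<in> {..<N}. periodic_dist N i l \<le> int b} = {..<N}"
    by (auto simp: periodic_dist_def)
  then show ?thesis using False by (auto simp: min_def)
next
  case True
  \<comment> \<open>Measured cyclically from \<open>i\<close>, the band consists of the offsets at
    most \<open>b\<close> and those at least \<open>N - b\<close>.\<close>
  let ?f = "\<lambda>l. if i \<le> l then l - i else l + N - i"
  let ?g = "\<lambda>d. if d < N - i then d + i else d + i - N"
  have "bij_betw ?f {l \<in> {..<N}. periodic_dist N i l \<le> int b} ({..b} \<union> {N - b..<N})"
    by (rule bij_betw_byWitness[where f' = ?g]) (use i True in \<open>auto simp: periodic_dist_def min_def split: if_splits\<close>)
  then have "card {l \<in> {..<N}. periodic_dist N i l \<le> int b} = card ({..b} \<union> {N - b..<N})"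
    by (rule bij_betw_same_card)
  also have "\<dots> = card {..b} + card {N - b..<N}"
    using True by (intro card_Un_disjoint) auto
  finally show ?thesis using True by (simp add: min_def)
qed

lemma periodic_dist_commute: "periodic_dist N i j = periodic_dist N j i"
  by (simp add: periodic_dist_def abs_minus_commute)

lemma mono_val_weighted:
  "mono_val (\<lambda>p \<omega>. of_real (c p) * x p \<omega>) L \<omega> = of_real (\<Prod>p\<leftarrow>L. c p) * mono_val x L \<omega>"
  by (induction L) (simp_all add: mult_ac)

text \<open>Each removal misses the weight of the removed letter; the factor \<open>c e\<close> on
  the left restores it, so that every term carries the weight of the full word.\<close>

lemma mono_deriv_weighted:
  "of_real (c e) * mono_deriv (\<lambda>p \<omega>. of_real (c p) * x p \<omega>) e L \<omega> = of_real (\<Prod>p\<leftarrow>L. c p) * mono_deriv x e L \<omega>"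
proof (induction L)
  case (Cons f L)
  let ?x = "\<lambda>p \<omega>. complex_of_real (c p) * x p \<omega>"
  have "of_real (c e) * mono_deriv ?x e (f # L) \<omega> =
      of_real (c f) * (of_bool (f = e) * mono_val ?x L \<omega>) + of_real (c f) * x f \<omega> * (of_real (c e) * mono_deriv ?x e L \<omega>)"
    by (cases "f = e") (simp_all add: algebra_simps)
  also have "\<dots> = of_real (\<Prod>p\<leftarrow>f # L. c p) * mono_deriv x e (f # L) \<omega>"
    unfolding Cons mono_val_weighted by (simp add: algebra_simps)
  finally show ?case .
qed simp

definition band_weight :: "nat \<Rightarrow> nat \<Rightarrow> nat \<times> nat \<Rightarrow> real" where
  "band_weight N b p = (if fst p < N \<and> snd p < N \<and> periodic_dist N (fst p) (snd p) \<le> int b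
     then 1 / sqrt (real (min (2 * b + 1) N)) else 0)"

definition band_entry :: "nat \<Rightarrow> nat \<Rightarrow> ('a \<Rightarrow> complex mat) \<Rightarrow> nat \<times> nat \<Rightarrow> 'a \<Rightarrow> complex" where
  "band_entry N b X p \<omega> = of_real (band_weight N b p) * gue_entry N X p \<omega>"

definition band_variance :: "real \<Rightarrow> nat \<Rightarrow> nat \<Rightarrow> real" where
  "band_variance v N b = v / real (min (2 * b + 1) N)"

text \<open>\<open>min (2 * b + 1) N\<close> is the exact number of band entries in each row, so the
  row sums of the variances are exactly \<open>v\<close>. The weight is symmetric, so a letter and
  its transpose together contribute its square.\<close>

lemma band_wick_matrix:
  fixes X :: "'a \<Rightarrow> complex mat"
  assumes GUE: "GUE M N v X" and v: "0 < v" and N: "1 \<le> N"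
  shows "wick_matrix M (band_entry N b X)
     (\<lambda>i l. if i < N \<and> l < N \<and> periodic_dist N i l \<le> int b then band_variance v N b else 0) N v (band_variance v N b)"
proof -
  let ?x = "gue_entry N X" and ?c = "band_weight N b" and ?\<kappa> = "band_variance v N b"
  let ?s = "\<lambda>i l. if i < N \<and> l < N \<and> periodic_dist N i l \<le> int b then ?\<kappa> else 0"
  let ?\<xi> = "real (min (2 * b + 1) N)"
  have \<xi>: "1 \<le> ?\<xi>" using N by simp
  have \<kappa>: "0 \<le> ?\<kappa>" "?\<kappa> \<le> v"
    using v \<xi> by (simp_all add: band_variance_def field_simps)
  interpret prob_space M
    using GUE by (simp add: GUE_def random_selfadjoint_matrix_def)
  have be: "band_entry N b X = (\<lambda>p \<omega>. of_real (?c p) * ?x p \<omega>)"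
    by (simp add: band_entry_def fun_eq_iff)
  have s: "?s i l = ?c (i, l) * ?c (i, l) * (if i < N \<and> l < N then v else 0)" for i l
    using \<xi> by (simp add: band_weight_def band_variance_def)
  have c_sym: "?c (l, i) = ?c (i, l)" for i l
    by (simp add: band_weight_def periodic_dist_commute)
  show ?thesis
  proof
    show "integrable M (mono_val (band_entry N b X) L)" for L
      unfolding be mono_val_weighted[abs_def] using GUE_wick(1)[OF GUE v] by (intro integrable_mult_right) auto
    show "(LINT \<omega>|M. mono_val (band_entry N b X) ((i, l) # L) \<omega>) =
        of_real (?s i l) * (LINT \<omega>|M. mono_deriv (band_entry N b X) (l, i) L \<omega>)" for i l L
    proof -
      have "(LINT \<omega>|M. mono_val (band_entry N b X) ((i, l) # L) \<omega>) =
          of_real (\<Prod>p\<leftarrow>(i, l) # L. ?c p) * (LINT \<omega>|M. mono_val ?x ((i, l) # L) \<omega>)"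
        unfolding be mono_val_weighted by (rule integral_mult_right_zero)
      also have "\<dots> = of_real (?c (i, l) * (if i < N \<and> l < N then v else 0)) *
           (of_real (\<Prod>p\<leftarrow>L. ?c p) * (LINT \<omega>|M. mono_deriv ?x (l, i) L \<omega>))"
        unfolding GUE_wick(2)[OF GUE v] by (simp add: mult_ac)
      also have "of_real (\<Prod>p\<leftarrow>L. ?c p) * (LINT \<omega>|M. mono_deriv ?x (l, i) L \<omega>) =
          of_real (?c (l, i)) * (LINT \<omega>|M. mono_deriv (band_entry N b X) (l, i) L \<omega>)"
        unfolding be by (subst (1 2) integral_mult_right_zero[symmetric]) (simp only: mono_deriv_weighted)
      finally show ?thesis unfolding s c_sym by (simp add: mult_ac)
    qed
    show "(\<Sum>l<N. ?s i l) = v" if "i < N" for i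
    proof -
      have "(\<Sum>l<N. ?s i l) = (\<Sum>l\<in>{l \<in> {..<N}. periodic_dist N i l \<le> int b}. ?\<kappa>)"
        using that by (subst sum.inter_filter) (auto intro!: sum.cong)
      then show ?thesis using card_periodic_band[OF that, of b] \<xi> by (simp add: band_variance_def)
    qed
  qed (use \<kappa> v in \<open>auto simp: band_entry_def gue_entry_def\<close>)
qed

lemma band_variance_tendsto:
  fixes b :: "nat \<Rightarrow> nat"
  assumes b: "filterlim (\<lambda>N. real (b N) / sqrt (real N)) at_top sequentially" and v: "0 < v"
  shows "(\<lambda>N. band_variance v N (b N)) \<longlonglongrightarrow> 0" "(\<lambda>N. real N * (band_variance v N (b N))\<^sup>2) \<longlonglongrightarrow> 0"
proof -
  let ?r = "\<lambda>N. real (b N) / sqrt (real N)"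
  have r: "(\<lambda>N. inverse (?r N)) \<longlonglongrightarrow> 0"
    using b by (rule tendsto_inverse_0_at_top)
  have "(\<lambda>N. v\<^sup>2 * ((inverse (?r N))\<^sup>2 + 1 / real N)) \<longlonglongrightarrow> v\<^sup>2 * (0\<^sup>2 + 0)"
    by (intro tendsto_intros r lim_1_over_n)
  then have lim: "(\<lambda>N. v\<^sup>2 * ((inverse (?r N))\<^sup>2 + 1 / real N)) \<longlonglongrightarrow> 0" by simp
  have bound: "eventually (\<lambda>N. norm (real N * (band_variance v N (b N))\<^sup>2) \<le> v\<^sup>2 * ((inverse (?r N))\<^sup>2 + 1 / real N)) sequentially"
    using eventually_ge_at_top[of 1] filterlim_at_top_dense[THEN iffD1, OF b, rule_format, of 0]
  proof eventually_elim
    case (elim N)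
    then have N: "N \<ge> 1" and bp: "b N > 0" by (auto simp: zero_less_divide_iff)
    have eq: "real N * (band_variance v N (b N))\<^sup>2 = v\<^sup>2 * (real N / (real (min (2 * b N + 1) N))\<^sup>2)"
      by (simp add: band_variance_def power_divide)
    \<comment> \<open>If the band does not fill the row, compare with the square of
      \<open>sqrt N / b\<close>; otherwise all variances are \<open>v / N\<close>.\<close>
    have "real N / (real (min (2 * b N + 1) N))\<^sup>2 \<le> (inverse (?r N))\<^sup>2 + 1 / real N"
    proof (cases "2 * b N + 1 \<le> N")
      case True
      have "real N / (real (2 * b N + 1))\<^sup>2 \<le> real N / (real (b N))\<^sup>2"
        using bp N by (intro divide_left_mono power_mono mult_pos_pos zero_less_power) auto
      also have "\<dots> = (inverse (?r N))\<^sup>2" using N by (simp add: power_divide power_inverse)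
      finally show ?thesis using True by (simp add: min_def add_increasing2)
    next
      case False
      have "real N / (real N)\<^sup>2 = 1 / real N" using N by (simp add: power2_eq_square)
      then show ?thesis using False by (simp add: min_def)
    qed
    then have "v\<^sup>2 * (real N / (real (min (2 * b N + 1) N))\<^sup>2) \<le> v\<^sup>2 * ((inverse (?r N))\<^sup>2 + 1 / real N)"
      by (intro mult_left_mono) auto
    then show ?case unfolding eq by (simp only: real_norm_def abs_of_nonneg mult_nonneg_nonneg zero_le_power2 divide_nonneg_nonneg of_nat_0_le_iff)
  qed
  show 1: "(\<lambda>N. real N * (band_variance v N (b N))\<^sup>2) \<longlonglongrightarrow> 0"
    using bound lim by (rule Lim_null_comparison)
  \<comment> \<open>The first limit follows from the second, as the square is at most
    \<open>N\<close> times itself.\<close>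
  have "eventually (\<lambda>N. norm ((band_variance v N (b N))\<^sup>2) \<le> real N * (band_variance v N (b N))\<^sup>2) sequentially"
    using eventually_ge_at_top[of 1]
    by eventually_elim (simp add: mult_le_cancel_right1)
  from Lim_null_comparison[OF this 1] have "(\<lambda>N. (band_variance v N (b N))\<^sup>2) \<longlonglongrightarrow> 0" .
  from tendsto_real_sqrt[OF this] show "(\<lambda>N. band_variance v N (b N)) \<longlonglongrightarrow> 0"
    by (simp add: tendsto_rabs_zero_iff)
qed

section \<open>The deformed matrix as a perturbation of finite rank\<close>

lemma deformed_entry:
  fixes \<theta> :: "nat \<Rightarrow> real"
  assumes "i < N" "j < N" "X \<omega> \<in> carrier_mat N N"
  shows "(band_matrix N b (X \<omega>) + deformation N0 \<theta> N) $$ (i, j) = band_entry N b X (i, j) \<omega> +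
     of_real (\<Sum>e\<le>N0. \<theta> (Suc e) * (uvec N0 N e i * uvec N0 N e j))"
proof -
  have "(\<Sum>e\<le>N0. \<theta> (Suc e) * (uvec N0 N e i * uvec N0 N e j)) =
     (\<Sum>e<N0. \<theta> (Suc e) * of_bool (i = e \<and> j = e)) + \<theta> (Suc N0) / real N"
    using assms by (simp add: lessThan_Suc_atMost[symmetric] uvec_def of_bool_conj)
  \<comment> \<open>The shift \<open>e = j - 1\<close> undoes the numbering of the spikes from
    1.\<close>
  also have "(\<Sum>e<N0. \<theta> (Suc e) * of_bool (i = e \<and> j = e)) = (\<Sum>e=1..N0. \<theta> e * of_bool (i = e - 1 \<and> j = e - 1))"
    by (rule sum.reindex_bij_witness[of _ "\<lambda>e. e - 1" Suc]) auto
  finally have D: "(\<Sum>e\<le>N0. \<theta> (Suc e) * (uvec N0 N e i * uvec N0 N e j)) =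
     (\<Sum>e=1..N0. \<theta> e * of_bool (i = e - 1 \<and> j = e - 1)) + \<theta> (Suc N0) / real N" .
  have "deformation N0 \<theta> N $$ (i, j) = of_real ((\<Sum>e=1..N0. \<theta> e * of_bool (i = e - 1 \<and> j = e - 1)) + \<theta> (Suc N0) / real N)"
    using assms by (simp add: deformation_def mat_unit_def all_ones_mat_def of_bool_def if_distrib[of complex_of_real] cong: if_cong)
  moreover have "band_matrix N b (X \<omega>) $$ (i, j) = band_entry N b X (i, j) \<omega>"
    using assms by (simp add: band_matrix_def band_entry_def band_weight_def gue_entry_def)
  ultimately show ?thesis
    unfolding D using assms by (simp add: deformation_def all_ones_mat_def)
qed

lemma deformed_carrier: "band_matrix N b A + deformation N0 \<theta> N \<in> carrier_mat N N"
  by (intro carrier_matI) (simp_all add: deformation_def all_ones_mat_def)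

lemma mat_trace_poly:
  assumes "A \<in> carrier_mat N N"
  shows "mat_trace (mat_poly P A) = (\<Sum>k\<le>degree P. coeff P k * (\<Sum>i<N. (A ^\<^sub>m k) $$ (i, i)))"
proof -
  have "mat_trace (mat_poly P A) = (\<Sum>i<N. \<Sum>k\<le>degree P. coeff P k * (A ^\<^sub>m k) $$ (i, i))"
    using assms by (simp add: mat_trace_def mat_poly_def)
  also have "\<dots> = (\<Sum>k\<le>degree P. \<Sum>i<N. coeff P k * (A ^\<^sub>m k) $$ (i, i))"
    by (rule sum.swap)
  finally show ?thesis by (simp only: sum_distrib_left)
qed

lemma mat_adjointI:
  assumes "A \<in> carrier_mat N N" "\<And>i j. i < N \<Longrightarrow> j < N \<Longrightarrow> cnj (A $$ (i, j)) = A $$ (j, i)"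
  shows "mat_adjoint A = A"
  by (rule eq_matI) (use assms in \<open>auto simp: mat_adjoint_def mat_of_rows_def\<close>)

text \<open>The first-order correction to the \<open>k\<close>-th moment when \<open>m\<close> are the moments of the undeformed limit: the trace of
  \<open>(X + D)\<^sup>k\<close> is expanded at the first factor \<open>D\<close>.\<close>

definition correction :: "(nat \<Rightarrow> real) \<Rightarrow> (nat \<Rightarrow> real) \<Rightarrow> nat \<Rightarrow> nat \<Rightarrow> real" where
  "correction m h n k =
     (\<Sum>q<k. \<Sum>e\<le>n. h e * perturbed (\<lambda>c k d. of_bool (c = d) * m k) h n e (k - 1 - q) q e)"

text \<open>The sequence \<open>m\<close> enters only through its recursion; that it consists of the
  semicircle moments is supplied by the analytic side.\<close>

theorem deformed_band_functionals:
  fixes \<sigma> :: real and b :: "nat \<Rightarrow> nat" and N0 :: nat and \<theta> :: "nat \<Rightarrow> real"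
    and M :: "nat \<Rightarrow> 'a measure" and X :: "nat \<Rightarrow> 'a \<Rightarrow> complex mat" and m :: "nat \<Rightarrow> real"
  assumes \<sigma>: "\<sigma> > 0"
    and b: "filterlim (\<lambda>N. real (b N) / sqrt (real N)) at_top sequentially"
    and GUE: "\<And>N. N \<ge> 1 \<Longrightarrow> GUE (M N) N (\<sigma>\<^sup>2) (X N)"
    and m: "m 0 = 1" "\<And>k. m (Suc k) = \<sigma>\<^sup>2 * (\<Sum>c<k. m c * m (k - 1 - c))"
  shows "type_B_functionals M (\<lambda>N \<omega>. band_matrix N (b N) (X N \<omega>) + deformation N0 \<theta> N)
     (\<lambda>P. \<Sum>k\<le>degree P. coeff P k * of_real (m k))
     (\<lambda>P. \<Sum>k\<le>degree P. coeff P k * of_real (correction m (\<lambda>e. \<theta> (Suc e)) N0 k))"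
proof -
  let ?h = "\<lambda>e. \<theta> (Suc e)"
  let ?A = "\<lambda>N \<omega>. band_matrix N (b N) (X N \<omega>) + deformation N0 \<theta> N"
  let ?x = "\<lambda>N. band_entry N (b N) (X N)"
  let ?s = "\<lambda>N i l. if i < N \<and> l < N \<and> periodic_dist N i l \<le> int (b N) then band_variance (\<sigma>\<^sup>2) N (b N) else 0"
  have v: "0 < \<sigma>\<^sup>2" using \<sigma> by simp
  interpret S: wick_sequence M ?x ?s "\<sigma>\<^sup>2" "\<lambda>N. band_variance (\<sigma>\<^sup>2) N (b N)" m
  proof (rule wick_sequence.intro)
    show "wick_matrix (M N) (?x N) (?s N) N (\<sigma>\<^sup>2) (band_variance (\<sigma>\<^sup>2) N (b N))" if "N \<ge> 1" for N
      using that by (intro band_wick_matrix GUE v)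
  qed (fact band_variance_tendsto[OF b v] m)+
  have carr: "X N \<omega> \<in> carrier_mat N N" "mat_adjoint (X N \<omega>) = X N \<omega>" if "N \<ge> 1" "\<omega> \<in> space (M N)" for N \<omega>
    using GUE[OF that(1)] that(2) by (auto simp: GUE_def random_selfadjoint_matrix_def)
  let ?d = "\<lambda>N i j. \<Sum>e\<le>N0. ?h e * (uvec N0 N e i * uvec N0 N e j)"
  have entry: "?A N \<omega> $$ (i, j) = ?x N (i, j) \<omega> + of_real (?d N i j)"
    if "N \<ge> 1" "\<omega> \<in> space (M N)" "i < N" "j < N" for N \<omega> i j
    using that carr by (intro deformed_entry) auto
  have cnj_x: "cnj (?x N (i, j) \<omega>) = ?x N (j, i) \<omega>"
    if "N \<ge> 1" "\<omega> \<in> space (M N)" "i < N" "j < N" for N \<omega> i j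
    using mat_adjoint_entry[OF carr[OF that(1,2)] that(3,4)] that
    by (simp add: band_entry_def band_weight_def gue_entry_def periodic_dist_commute)
  have d_sym: "?d N i j = ?d N j i" for N i j by (simp add: mult.commute)
  have cnj_A: "cnj (?A N \<omega> $$ (i, j)) = ?A N \<omega> $$ (j, i)"
    if "N \<ge> 1" "\<omega> \<in> space (M N)" "i < N" "j < N" for N \<omega> i j
    using that by (simp add: entry cnj_x d_sym[of _ i j])
  have sa: "random_selfadjoint_matrix (M N) N (?A N)" if N: "N \<ge> 1" for N
    unfolding random_selfadjoint_matrix_def
  proof (intro conjI ballI allI impI)
    show "prob_space (M N)" using GUE[OF N] by (simp add: GUE_def random_selfadjoint_matrix_def)
  next
    fix \<omega> assume \<omega>: "\<omega> \<in> space (M N)"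
    show "?A N \<omega> \<in> carrier_mat N N" by (rule deformed_carrier)
    show "mat_adjoint (?A N \<omega>) = ?A N \<omega>"
      by (rule mat_adjointI[OF deformed_carrier]) (rule cnj_A[OF N \<omega>])
  next
    fix i j assume ij: "i < N" "j < N"
    interpret wick_matrix "M N" "?x N" "?s N" N "\<sigma>\<^sup>2" "band_variance (\<sigma>\<^sup>2) N (b N)" using N by (rule S.ensemble)
    have "?x N (i, j) \<in> borel_measurable (M N)"
      using borel_measurable_integrable[OF integrable_mono[of "[(i, j)]"]] by (simp add: mono_val_def[abs_def])
    then have "(\<lambda>\<omega>. ?x N (i, j) \<omega> + of_real (?d N i j)) \<in> borel_measurable (M N)" by measurable
    then show "(\<lambda>\<omega>. ?A N \<omega> $$ (i, j)) \<in> borel_measurable (M N)"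
      using entry[OF N _ ij] by (simp cong: measurable_cong)
  qed
  have mom: "entries_have_all_moments (M N) N (?A N)" if N: "N \<ge> 1" for N
    unfolding entries_have_all_moments_def
  proof (intro allI impI)
    fix i j k assume ij: "i < N" "j < N"
    interpret wick_matrix "M N" "?x N" "?s N" N "\<sigma>\<^sup>2" "band_variance (\<sigma>\<^sup>2) N (b N)" using N by (rule S.ensemble)
    let ?z = "\<lambda>i j \<omega>. ?x N (i, j) \<omega> + of_real (?d N i j)"
    have pz: "rv_poly (?x N) UNIV (?z i j)" for i j
    proof (rule poly_add)
      show "rv_poly (?x N) UNIV (\<lambda>\<omega>. ?x N (i, j) \<omega>)"
        using poly_var[OF poly_const[of 1 UNIV "?x N"], of "(i, j)"] by simp
    qed (rule poly_const, simp)
    have pk: "rv_poly (?x N) UNIV (\<lambda>\<omega>. ?z i j \<omega> ^ k)" for i j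
    proof (induction k)
      case 0
      show ?case using poly_const[of 1 UNIV "?x N"] by simp
    next
      case (Suc k)
      show ?case unfolding power_Suc by (intro poly_mult pz Suc) auto
    qed
    have "integrable (M N) (\<lambda>\<omega>. norm (?z i j \<omega> ^ k * ?z j i \<omega> ^ k))"
      by (intro integrable_norm integrable_poly poly_mult pk) auto
    then have int: "integrable (M N) (\<lambda>\<omega>. 1 + norm (?z i j \<omega> ^ k * ?z j i \<omega> ^ k))"
      by (rule Bochner_Integration.integrable_add[OF integrable_const])
    have meas: "(\<lambda>\<omega>. norm (?A N \<omega> $$ (i, j)) ^ k) \<in> borel_measurable (M N)"
    proof -
      have "(\<lambda>\<omega>. ?A N \<omega> $$ (i, j)) \<in> borel_measurable (M N)"
        using sa[OF N] ij unfolding random_selfadjoint_matrix_def by blast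
      then show ?thesis by (intro borel_measurable_power measurable_compose[OF _ borel_measurable_norm])
    qed
    \<comment> \<open>Powers of the norm need not be polynomials in the entries. The bound
      \<open>t \<le> 1 + t\<^sup>2\<close> leads to a square, which is the modulus of a polynomial
      since the transposed entry is the conjugate.\<close>
    have bound: "norm (?A N \<omega> $$ (i, j)) ^ k \<le> 1 + norm (?z i j \<omega> ^ k * ?z j i \<omega> ^ k)" if \<omega>: "\<omega> \<in> space (M N)" for \<omega>
    proof -
      let ?t = "norm (?A N \<omega> $$ (i, j)) ^ k"
      have "norm (?z j i \<omega>) = norm (?z i j \<omega>)"
        using arg_cong[OF cnj_A[OF N \<omega> ij], of norm]
        unfolding entry[OF N \<omega> ij] entry[OF N \<omega> ij(2,1)] complex_mod_cnj by (rule sym)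
      then have "norm (?z i j \<omega> ^ k * ?z j i \<omega> ^ k) = ?t\<^sup>2"
        using entry[OF N \<omega> ij] by (simp add: norm_mult norm_power power2_eq_square)
      moreover have "2 * ?t \<le> 1 + ?t\<^sup>2" using sum_squares_bound[of 1 ?t] by simp
      moreover have "0 \<le> ?t" by simp
      ultimately show ?thesis by linarith
    qed
    show "integrable (M N) (\<lambda>\<omega>. norm (?A N \<omega> $$ (i, j)) ^ k)"
    proof (rule Bochner_Integration.integrable_bound[OF int meas], rule AE_I2)
      fix \<omega> assume "\<omega> \<in> space (M N)"
      from bound[OF this] show "norm (norm (?A N \<omega> $$ (i, j)) ^ k) \<le> norm (1 + norm (?z i j \<omega> ^ k * ?z j i \<omega> ^ k))"
        by (simp only: real_norm_def abs_of_nonneg add_nonneg_nonneg zero_le_one norm_ge_zero zero_le_power)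
    qed
  qed
  let ?T = "\<lambda>N k. S.E N (S.deformed_trace N0 ?h N k)"
  have mean: "of_nat N * mean_distribution (M N) N (?A N) P = (\<Sum>k\<le>degree P. coeff P k * of_real (?T N k))"
    if N: "N \<ge> 1" for N P
  proof -
    interpret wick_matrix "M N" "?x N" "?s N" N "\<sigma>\<^sup>2" "band_variance (\<sigma>\<^sup>2) N (b N)" using N by (rule S.ensemble)
    have op: "(mat_op N (\<lambda>i j. ?A N \<omega> $$ (i, j)) ^^ k) f i = (S.deformed_op N0 ?h N \<omega> ^^ k) f i"
      if "\<omega> \<in> space (M N)" "i < N" for \<omega> f k i
      using that(2)
    proof (induction k arbitrary: i)
      case (Suc k)
      have "(mat_op N (\<lambda>i j. ?A N \<omega> $$ (i, j)) ^^ Suc k) f i =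
          (\<Sum>l<N. ?A N \<omega> $$ (i, l) * (mat_op N (\<lambda>i j. ?A N \<omega> $$ (i, j)) ^^ k) f l)"
        by (simp add: mat_op_def)
      also have "\<dots> = (\<Sum>l<N. (?x N (i, l) \<omega> + of_real (?d N i l)) * (S.deformed_op N0 ?h N \<omega> ^^ k) f l)"
        using Suc by (intro sum.cong refl arg_cong2[where f = "(*)"] entry[OF N that(1)]) auto
      also have "\<dots> = (S.deformed_op N0 ?h N \<omega> ^^ Suc k) f i"
        by (simp add: S.deformed_op_def mat_op_def)
      finally show ?case .
    qed simp
    have "mat_trace (mat_poly P (?A N \<omega>)) = (\<Sum>k\<le>degree P. coeff P k * S.deformed_trace N0 ?h N k \<omega>)"
      if "\<omega> \<in> space (M N)" for \<omega>
      unfolding mat_trace_poly[OF deformed_carrier] S.deformed_trace_def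
      by (intro sum.cong refl arg_cong2[where f = "(*)"])
         (use that in \<open>simp add: mat_pow_mat_op[OF deformed_carrier] op\<close>)
    then have "(LINT \<omega>|M N. mat_trace (mat_poly P (?A N \<omega>))) =
        (LINT \<omega>|M N. (\<Sum>k\<le>degree P. coeff P k * S.deformed_trace N0 ?h N k \<omega>))"
      by (intro Bochner_Integration.integral_cong) auto
    also have "\<dots> = (\<Sum>k\<le>degree P. coeff P k * of_real (?T N k))"
      using S.poly_deformed_trace[OF N] by (simp add: integrable_poly integral_eq_ev)
    finally show ?thesis using N by (simp add: mean_distribution_def)
  qed
  let ?m = "\<lambda>P. \<Sum>k\<le>degree P. coeff P k * of_real (m k)"
  let ?\<psi> = "\<lambda>P. \<Sum>k\<le>degree P. coeff P k * of_real (correction m ?h N0 k)"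
  have 1: "(\<lambda>N. of_nat N * (mean_distribution (M N) N (?A N) P - ?m P)) \<longlonglongrightarrow> ?\<psi> P" for P
  proof -
    have "(\<lambda>N. \<Sum>k\<le>degree P. coeff P k * of_real (?T N k - real N * m k)) \<longlonglongrightarrow> ?\<psi> P"
      using S.deformed_trace_tendsto[of N0 ?h]
      by (intro tendsto_sum tendsto_mult_left tendsto_of_real) (simp add: correction_def S.Y_lim_def[abs_def])
    moreover have "eventually (\<lambda>N. (\<Sum>k\<le>degree P. coeff P k * of_real (?T N k - real N * m k)) =
        of_nat N * (mean_distribution (M N) N (?A N) P - ?m P)) sequentially"
      using eventually_ge_at_top[of 1]
      by eventually_elim (simp add: right_diff_distrib mean sum_subtractf sum_distrib_left mult_ac)
    ultimately show ?thesis by (rule Lim_transform_eventually)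
  qed
  have 2: "(\<lambda>N. mean_distribution (M N) N (?A N) P) \<longlonglongrightarrow> ?m P" for P
  proof -
    \<comment> \<open>The rescaled difference converges, so dividing it by \<open>N\<close> yields
      the limit of the moments themselves.\<close>
    have "(\<lambda>N. of_real (1 / real N) * (of_nat N * (mean_distribution (M N) N (?A N) P - ?m P)) + ?m P) \<longlonglongrightarrow> of_real 0 * ?\<psi> P + ?m P"
      by (intro tendsto_intros 1 lim_1_over_n)
    moreover have "eventually (\<lambda>N. of_real (1 / real N) * (of_nat N * (mean_distribution (M N) N (?A N) P - ?m P)) + ?m P
         = mean_distribution (M N) N (?A N) P) sequentially"
      using eventually_ge_at_top[of 1] by eventually_elim simp
    ultimately show ?thesis by (simp add: Lim_transform_eventually)
  qed
  show ?thesis unfolding type_B_functionals_def using sa mom 1 2 by blast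
qed

text \<open>Distinct vectors are orthogonal in the limit, so the sum over \<open>e\<close> decouples
  and each spike obeys a scalar recursion. Its inhomogeneity \<open>k * m (k - 1)\<close> stems from
  the \<open>k\<close> positions that a single occurrence of the spike can take.\<close>

lemma correction_eq_sum:
  fixes m h :: "nat \<Rightarrow> real"
  assumes \<beta>: "\<And>e k. e \<le> n \<Longrightarrow> \<beta> e k = h e * real k * m (k - 1) + h e * (\<Sum>q<k. m q * \<beta> e (k - 1 - q))"
  shows "correction m h n k = (\<Sum>e\<le>n. \<beta> e k)"
proof -
  let ?Y = "\<lambda>c k d. of_bool (c = d) * m k"
  define G where "G p t e = perturbed ?Y h n e p t e" for p t e
  have G: "G p t e = m (p + t) + h e * (\<Sum>q<p. m q * G (p - 1 - q) t e)" if "e \<le> n" for p t e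
  proof -
    have "G p t e = m (p + t) + (\<Sum>q<p. \<Sum>e'\<le>n. h e' * ((of_bool (e = e') * m q) * perturbed ?Y h n e' (p - 1 - q) t e))"
      unfolding G_def by (subst perturbed.simps) simp
    also have "\<dots> = m (p + t) + (\<Sum>q<p. \<Sum>e'\<le>n. if e' = e then h e * (m q * G (p - 1 - q) t e) else 0)"
      by (intro arg_cong2[where f = "(+)"] sum.cong refl) (simp add: G_def)
    finally show ?thesis using that by (simp add: sum_distrib_left)
  qed
  define b where "b e k = h e * (\<Sum>q<k. G (k - 1 - q) q e)" for e k
  have b_rec: "b e k = h e * real k * m (k - 1) + h e * (\<Sum>q<k. m q * b e (k - 1 - q))" if e: "e \<le> n" for e k
  proof -
    have "(\<Sum>q<k. G (k - 1 - q) q e) = (\<Sum>q<k. m (k - 1) + h e * (\<Sum>r<k - 1 - q. m r * G (k - 1 - q - 1 - r) q e))"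
      by (intro sum.cong refl, subst G[OF e]) auto
    also have "\<dots> = real k * m (k - 1) + h e * (\<Sum>q<k. \<Sum>r<k - 1 - q. m r * G (k - 1 - q - 1 - r) q e)"
      by (simp add: sum.distrib sum_distrib_left)
    \<comment> \<open>The triangle \<open>q + r < k - 1\<close> is padded to a square so that the
      two sums can be exchanged; this pulls the gap after the first spike to the front.\<close>
    also have "(\<Sum>q<k. \<Sum>r<k - 1 - q. m r * G (k - 1 - q - 1 - r) q e) =
        (\<Sum>q<k. \<Sum>r<k. if q + r < k - 1 then m r * G (k - 1 - q - 1 - r) q e else 0)"
      by (intro sum.cong refl sum.mono_neutral_cong_left) auto
    also have "\<dots> = (\<Sum>r<k. \<Sum>q<k. if q + r < k - 1 then m r * G (k - 1 - q - 1 - r) q e else 0)"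
      by (rule sum.swap)
    also have "\<dots> = (\<Sum>r<k. \<Sum>q<k - 1 - r. m r * G (k - 1 - r - 1 - q) q e)"
    proof (rule sum.cong[OF refl])
      fix r
      have "k - 1 - q - 1 - r = k - 1 - r - 1 - q" for q by simp
      then show "(\<Sum>q<k. if q + r < k - 1 then m r * G (k - 1 - q - 1 - r) q e else 0) =
          (\<Sum>q<k - 1 - r. m r * G (k - 1 - r - 1 - q) q e)"
        by (intro sum.mono_neutral_cong_right) auto
    qed
    finally show ?thesis by (simp add: b_def sum_distrib_left algebra_simps)
  qed
  have "b e k = \<beta> e k" if e: "e \<le> n" for e k
  proof (induction k rule: less_induct)
    case (less k)
    have "(\<Sum>q<k. m q * b e (k - 1 - q)) = (\<Sum>q<k. m q * \<beta> e (k - 1 - q))"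
      by (intro sum.cong refl) (simp add: less)
    then show ?case unfolding b_rec[OF e, of k] \<beta>[OF e, of k] by simp
  qed
  moreover have "correction m h n k = (\<Sum>e\<le>n. b e k)"
    unfolding correction_def b_def G_def sum_distrib_left by (rule sum.swap)
  ultimately show ?thesis by simp
qed

section \<open>Signed measures as combinations of finite measures\<close>

definition finite_borel :: "real measure \<Rightarrow> bool" where
  "finite_borel \<mu> \<longleftrightarrow> finite_measure \<mu> \<and> sets \<mu> = sets borel"

text \<open>The explicit signed measures are finite linear combinations of finite measures. Fixing
  such a list makes their integrals linear by construction, independently of a Jordan
  decomposition.\<close>

definition comb :: "(real \<times> real measure) list \<Rightarrow> real set \<Rightarrow> real" where
  "comb L A = (\<Sum>(c, \<mu>)\<leftarrow>L. c * measure \<mu> A)"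

definition comb_int :: "(real \<times> real measure) list \<Rightarrow> (real \<Rightarrow> 'b) \<Rightarrow> 'b::{banach, second_countable_topology}" where
  "comb_int L f = (\<Sum>(c, \<mu>)\<leftarrow>L. c *\<^sub>R (LINT t|\<mu>. f t))"

lemma comb_simps [simp]:
  "comb [] A = 0" "comb ((c, \<mu>) # L) A = c * measure \<mu> A + comb L A" "comb (L @ L') A = comb L A + comb L' A"
  by (simp_all add: comb_def)

lemma comb_int_simps [simp]:
  "comb_int [] f = 0" "comb_int ((c, \<mu>) # L) f = c *\<^sub>R (LINT t|\<mu>. f t) + comb_int L f"
  "comb_int (L @ L') f = comb_int L f + comb_int L' f"
  by (simp_all add: comb_int_def)

lemma comb_uminus: "comb (map (\<lambda>(c, \<mu>). (- c, \<mu>)) L) A = - comb L A"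
  by (induction L) auto

lemma comb_int_uminus: "comb_int (map (\<lambda>(c, \<mu>). (- c, \<mu>)) L) f = - comb_int L f"
  by (induction L) auto

abbreviation borels :: "(real \<times> real measure) list \<Rightarrow> bool" where
  "borels L \<equiv> \<forall>(c, \<mu>)\<in>set L. finite_borel \<mu>"

lemma finite_borel_space: "finite_borel \<mu> \<Longrightarrow> space \<mu> = UNIV"
  unfolding finite_borel_def by (metis sets_eq_imp_space_eq space_borel)

lemma finite_borel_measurable: "finite_borel \<mu> \<Longrightarrow> measurable \<mu> N = measurable borel N"
  unfolding finite_borel_def by (intro measurable_cong_sets) auto

lemma finite_borel_integrable:
  fixes f :: "real \<Rightarrow> 'b::{banach, second_countable_topology}"
  assumes "finite_borel \<mu>" "f \<in> borel_measurable borel" "\<And>t. norm (f t) \<le> B"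
  shows "integrable \<mu> f"
proof -
  interpret finite_measure \<mu> using assms by (simp add: finite_borel_def)
  show ?thesis
    by (rule integrable_const_bound[where B = B]) (use assms finite_borel_measurable in auto)
qed

lemma borel_prob_finite_borel: "borel_prob \<mu> \<Longrightarrow> finite_borel \<mu>"
  by (simp add: borel_prob_def finite_borel_def prob_space_def)

lemma finite_borel_return [simp]: "finite_borel (return borel x)"
  by (simp add: finite_borel_def prob_space.finite_measure prob_space_return)

lemma comb_int_eq_0_nonneg:
  fixes f :: "real \<Rightarrow> real"
  assumes L: "borels L" and zero: "\<And>A. A \<in> sets borel \<Longrightarrow> comb L A = 0"
    and f: "f \<in> borel_measurable borel" "\<And>t. 0 \<le> f t" "\<And>t. f t \<le> B"
  shows "comb_int L f = 0"
proof -
  have fin: "finite_borel \<mu>" if "(c, \<mu>) \<in> set L" for c \<mu> using L that by auto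
  have int: "integrable \<mu> u" if "(c, \<mu>) \<in> set L" "u \<in> borel_measurable borel" "\<And>t. 0 \<le> u t" "\<And>t. u t \<le> B"
    for c \<mu> B and u :: "real \<Rightarrow> real"
    using fin[OF that(1)] that(2-4) by (intro finite_borel_integrable[where B = B]) auto
  \<comment> \<open>Boundedness is part of the induction statement, since the integrals of the
    intermediate functions have to exist.\<close>
  have "\<forall>B. (\<forall>t. f t \<le> B) \<longrightarrow> comb_int L f = 0"
    using f(1,2)
  proof (induction rule: borel_measurable_induct_real)
    case (set A)
    have "comb_int L (indicator A) = comb L A"
      unfolding comb_int_def comb_def
      by (intro arg_cong[where f = sum_list] map_cong refl) (auto dest!: fin simp: finite_borel_space)
    then show ?case using zero[of A] set by simp
  next
    case (mult u c)
    show ?case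
    proof (intro allI impI)
      fix B assume "\<forall>t. c * u t \<le> B"
      then have "\<forall>t. u t \<le> B / c" if "c \<noteq> 0" using mult(1) that by (simp add: field_simps)
      then have "c * comb_int L u = 0" using mult by auto
      then show "comb_int L (\<lambda>t. c * u t) = 0"
        by (simp add: comb_int_def sum_list_const_mult[symmetric] case_prod_unfold mult_ac)
    qed
  next
    case (add u v)
    show ?case
    proof (intro allI impI)
      fix B assume B: "\<forall>t. v t + u t \<le> B"
      have b: "u t \<le> B" "v t \<le> B" for t
        using B[rule_format, of t] add.hyps(2)[of t] add.hyps(4)[of t] by auto
      then have "comb_int L u = 0" "comb_int L v = 0" using add.IH by auto
      moreover have "comb_int L (\<lambda>t. v t + u t) = comb_int L v + comb_int L u"
        unfolding comb_int_def sum_list_addf[symmetric]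
        by (intro arg_cong[where f = sum_list] map_cong refl)
           (use int[OF _ add.hyps(1,2) b(1)] int[OF _ add.hyps(3,4) b(2)] in \<open>auto simp: algebra_simps\<close>)
      ultimately show "comb_int L (\<lambda>t. v t + u t) = 0" by simp
    qed
  next
    case (seq U)
    show ?case
    proof (intro allI impI)
      fix B assume B: "\<forall>t. f t \<le> B"
      have le: "U i t \<le> f t" for i t
        using seq by (intro incseq_le[of "\<lambda>i. U i t"]) (auto simp: incseq_def le_fun_def)
      then have "U i t \<le> B" for i t using B order_trans by blast
      then have z: "comb_int L (U i) = 0" for i using seq.IH by blast
      have "(\<lambda>i. comb_int L (U i)) \<longlonglongrightarrow> comb_int L f"
      proof -
        have "(\<lambda>i. \<Sum>(c, \<mu>)\<leftarrow>L'. c *\<^sub>R (LINT t|\<mu>. U i t)) \<longlonglongrightarrow> (\<Sum>(c, \<mu>)\<leftarrow>L'. c *\<^sub>R (LINT t|\<mu>. f t))"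
          if "set L' \<subseteq> set L" for L'
          using that
        proof (induction L')
          case (Cons p L')
          obtain c \<mu> where p: "p = (c, \<mu>)" by (cases p)
          have \<mu>: "(c, \<mu>) \<in> set L" using Cons.prems by (auto simp: p)
          note meas = finite_borel_measurable[OF fin[OF \<mu>]]
          have "(\<lambda>i. LINT t|\<mu>. U i t) \<longlonglongrightarrow> (LINT t|\<mu>. f t)"
          proof (rule integral_dominated_convergence[where w = f])
            show "integrable \<mu> f" using B f by (intro int[OF \<mu>]) auto
          qed (use seq f le in \<open>auto simp: meas\<close>)
          then show ?case using Cons by (auto simp: p intro!: tendsto_intros)
        qed simp
        then show ?thesis by (simp add: comb_int_def)
      qed
      then show "comb_int L f = 0" using z by (simp add: LIMSEQ_const_iff)
    qed
  qed
  then show ?thesis using f(3) by blast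
qed

lemma comb_int_eq_0:
  fixes f :: "real \<Rightarrow> complex"
  assumes L: "borels L" and zero: "\<And>A. A \<in> sets borel \<Longrightarrow> comb L A = 0"
    and f: "f \<in> borel_measurable borel" "\<And>t. norm (f t) \<le> B"
  shows "comb_int L f = 0"
proof -
  have B: "0 \<le> B" using norm_ge_zero[of "f 0"] f(2)[of 0] by linarith
  have real: "comb_int L g = 0" if g: "g \<in> borel_measurable borel" "\<And>t. \<bar>g t\<bar> \<le> B" for g :: "real \<Rightarrow> real"
  proof -
    have "0 \<le> g t + B" "g t + B \<le> 2 * B" for t using g(2)[of t] by linarith+
    then have "comb_int L (\<lambda>t. g t + B) = 0"
      using g(1) by (intro comb_int_eq_0_nonneg[OF L zero, where B = "2 * B"]) auto
    moreover have "comb_int L (\<lambda>_. B) = 0" using B by (intro comb_int_eq_0_nonneg[OF L zero]) auto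
    moreover have "comb_int L (\<lambda>t. g t + B) = comb_int L g + comb_int L (\<lambda>_. B)"
      unfolding comb_int_def sum_list_addf[symmetric]
    proof (intro arg_cong[where f = sum_list] map_cong refl, clarify)
      fix c \<mu> assume "(c, \<mu>) \<in> set L"
      then have \<mu>: "finite_borel \<mu>" using L by auto
      have "integrable \<mu> g" "integrable \<mu> (\<lambda>_. B)"
        using g by (auto intro!: finite_borel_integrable[OF \<mu>, where B = B] simp: B)
      then show "c *\<^sub>R (LINT t|\<mu>. g t + B) = c *\<^sub>R (LINT t|\<mu>. g t) + c *\<^sub>R (LINT t|\<mu>. B)"
        by (subst Bochner_Integration.integral_add) (auto simp: algebra_simps)
    qed
    ultimately show ?thesis by simp
  qed
  have Re: "comb_int L (\<lambda>t. Re (f t)) = 0"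
    using f(1) order_trans[OF abs_Re_le_cmod f(2)] by (intro real) auto
  have Im: "comb_int L (\<lambda>t. Im (f t)) = 0"
    using f(1) order_trans[OF abs_Im_le_cmod f(2)] by (intro real) auto
  have "comb_int L f = of_real (comb_int L (\<lambda>t. Re (f t))) + \<i> * of_real (comb_int L (\<lambda>t. Im (f t)))"
  proof -
    have "Re (LINT t|\<mu>. f t) = (LINT t|\<mu>. Re (f t))" "Im (LINT t|\<mu>. f t) = (LINT t|\<mu>. Im (f t))"
      if "(c, \<mu>) \<in> set L" for c \<mu>
      using finite_borel_integrable[OF _ f, of \<mu>] L that by auto
    then have *: "(LINT t|\<mu>. f t) = of_real (LINT t|\<mu>. Re (f t)) + \<i> * of_real (LINT t|\<mu>. Im (f t))"
      if "(c, \<mu>) \<in> set L" for c \<mu>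
      using that by (auto simp: complex_eq_iff)
    have "comb_int L' f = of_real (comb_int L' (\<lambda>t. Re (f t))) + \<i> * of_real (comb_int L' (\<lambda>t. Im (f t)))"
      if "set L' \<subseteq> set L" for L'
      using that
    proof (induction L')
      case (Cons p L')
      then show ?case using *[of "fst p" "snd p"] by (cases p) (auto simp: scaleR_conv_of_real algebra_simps)
    qed simp
    then show ?thesis by blast
  qed
  then show ?thesis using Re Im by simp
qed

text \<open>Whichever Jordan decomposition the choice operator picks, its parts together with the
  negated list form a combination that vanishes on all Borel sets, hence on bounded functions. The
  set \<open>K\<close> admits integrands such as polynomials, which are bounded only on a compact
  support.\<close>

lemma signed_integral_comb:
  fixes f :: "real \<Rightarrow> complex"
  assumes J: "\<exists>P Q. jordan_decomposition \<nu> P Q"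
    and \<nu>: "\<And>A. A \<in> sets borel \<Longrightarrow> \<nu> A = comb L A" and L: "borels L"
    and K: "K \<in> sets borel" "\<And>c \<mu>. (c, \<mu>) \<in> set L \<Longrightarrow> measure \<mu> (- K) = 0"
    and f: "f \<in> borel_measurable borel" "\<And>t. t \<in> K \<Longrightarrow> norm (f t) \<le> B"
  shows "signed_integral \<nu> f = comb_int L f"
proof -
  define PQ where "PQ = (SOME (P, Q). jordan_decomposition \<nu> P Q)"
  obtain P Q where PQ: "PQ = (P, Q)" by (cases PQ)
  have "case PQ of (P, Q) \<Rightarrow> jordan_decomposition \<nu> P Q"
    unfolding PQ_def using J by (intro someI_ex[of "\<lambda>(P, Q). jordan_decomposition \<nu> P Q"]) auto
  then have jd: "jordan_decomposition \<nu> P Q" by (simp add: PQ)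
  then have PQb: "finite_borel P" "finite_borel Q" by (auto simp: jordan_decomposition_def finite_borel_def)
  obtain D where D: "D \<in> sets borel" "measure P (- D) = 0" "measure Q D = 0"
      and \<nu>PQ: "\<And>A. A \<in> sets borel \<Longrightarrow> \<nu> A = measure P A - measure Q A"
    using jd by (auto simp: jordan_decomposition_def)
  have null: "measure \<mu> A = 0" if "finite_borel \<mu>" "measure \<mu> B = 0" "A \<subseteq> B" "B \<in> sets borel" for \<mu> A B
  proof -
    have "measure \<mu> A \<le> measure \<mu> B"
      using that by (intro finite_measure.finite_measure_mono) (simp_all add: finite_borel_def)
    then show ?thesis using that(2) measure_nonneg[of \<mu> A] by linarith
  qed
  have \<nu>0: "\<nu> A = 0" if "A \<in> sets borel" "A \<subseteq> - K" for A
  proof -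
    have "comb L' A = 0" if "set L' \<subseteq> set L" for L'
      using that
    proof (induction L')
      case (Cons p L')
      obtain c \<mu> where p: "p = (c, \<mu>)" by (cases p)
      have mem: "(c, \<mu>) \<in> set L" using Cons.prems by (simp add: p)
      have "finite_borel \<mu>" using L mem by blast
      then have "measure \<mu> A = 0"
        by (rule null[OF _ K(2)[OF mem]]) (use \<open>A \<subseteq> - K\<close> K(1) in auto)
      then show ?case using Cons by (simp add: p)
    qed simp
    then show ?thesis using \<nu> that by auto
  qed
  \<comment> \<open>Cancellation between \<open>P\<close> and \<open>Q\<close> outside
    \<open>K\<close> is excluded by their mutual singularity: on \<open>D\<close> only
    \<open>P\<close> has mass, and there it coincides with \<open>\<nu>\<close>.\<close>
  have P0: "measure P (- K) = 0"
  proof -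
    have sD: "- K \<inter> D \<in> sets borel" "- K \<inter> - D \<in> sets borel" using K D by auto
    have "measure P (- K \<inter> D) = \<nu> (- K \<inter> D)"
      using \<nu>PQ[OF sD(1)] null[OF PQb(2) D(3), where A = "- K \<inter> D"] D by auto
    also have "\<dots> = 0" using sD by (intro \<nu>0) auto
    finally have "measure P (- K \<inter> D) = 0" .
    moreover have "measure P (- K \<inter> - D) = 0" using null[OF PQb(1) D(2)] D by auto
    moreover have "measure P (- K) = measure P (- K \<inter> D) + measure P (- K \<inter> - D)"
      using finite_measure.finite_measure_Union[of P "- K \<inter> D" "- K \<inter> - D"] sD PQb(1)
      by (auto simp: finite_borel_def Int_Un_distrib[symmetric])
    ultimately show ?thesis by simp
  qed
  have Q0: "measure Q (- K) = 0"
    using \<nu>PQ[of "- K"] \<nu>0[of "- K"] K P0 by simp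
  let ?g = "\<lambda>t. indicator K t *\<^sub>R f t"
  have g: "?g \<in> borel_measurable borel" "norm (?g t) \<le> max B 0" for t
    using f K by (auto simp: indicator_def le_max_iff_disj)
  have int_eq: "(LINT t|\<mu>. f t) = (LINT t|\<mu>. ?g t)" if \<mu>: "finite_borel \<mu>" "measure \<mu> (- K) = 0" for \<mu>
  proof (rule integral_cong_AE)
    have "- K \<in> null_sets \<mu>"
      using \<mu> K by (auto simp: finite_borel_def null_sets_def finite_measure.emeasure_eq_measure)
    then show "AE t in \<mu>. f t = ?g t" by (rule AE_I') (auto simp: indicator_def)
  qed (use f g finite_borel_measurable[OF \<mu>(1)] in auto)
  have "comb_int ((1, P) # (-1, Q) # map (\<lambda>(c, \<mu>). (- c, \<mu>)) L) ?g = 0"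
  proof (rule comb_int_eq_0[OF _ _ g])
    show "comb ((1, P) # (-1, Q) # map (\<lambda>(c, \<mu>). (- c, \<mu>)) L) A = 0" if "A \<in> sets borel" for A
      using \<nu>[OF that] \<nu>PQ[OF that] by (simp add: comb_uminus)
  qed (use L PQb in auto)
  then have "(LINT t|P. ?g t) - (LINT t|Q. ?g t) = comb_int L ?g"
    unfolding comb_int_simps comb_int_uminus by (simp add: algebra_simps)
  also have "comb_int L ?g = comb_int L f"
    unfolding comb_int_def by (intro arg_cong[where f = sum_list] map_cong refl) (use L K int_eq in \<open>auto split: prod.splits\<close>)
  finally have "(LINT t|P. f t) - (LINT t|Q. f t) = comb_int L f"
    by (simp add: int_eq PQb P0 Q0)
  then show ?thesis by (simp add: signed_integral_def PQ_def[symmetric] PQ)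
qed

lemma finite_signed_measure_measure:
  assumes "finite_borel \<mu>"
  shows "finite_signed_measure (measure \<mu>)"
proof -
  interpret finite_measure \<mu> using assms by (simp add: finite_borel_def)
  show ?thesis using assms finite_measure_UNION
    by (auto simp: finite_signed_measure_def finite_borel_def measure_notin_sets)
qed

lemma finite_signed_measure_add:
  "finite_signed_measure \<nu> \<Longrightarrow> finite_signed_measure \<nu>' \<Longrightarrow> finite_signed_measure (\<lambda>A. \<nu> A + \<nu>' A)"
  by (simp add: finite_signed_measure_def sums_add)

lemma finite_signed_measure_scale:
  "finite_signed_measure \<nu> \<Longrightarrow> finite_signed_measure (\<lambda>A. c * \<nu> A)"
  by (simp add: finite_signed_measure_def sums_mult)

lemma finite_signed_measure_comb:
  assumes "borels L"
  shows "finite_signed_measure (comb L)"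
  using assms
proof (induction L)
  case Nil
  then show ?case by (simp add: finite_signed_measure_def comb_def)
next
  case (Cons p L)
  obtain c \<mu> where p: "p = (c, \<mu>)" by (cases p)
  have "finite_signed_measure (\<lambda>A. c * measure \<mu> A + comb L A)"
    using Cons by (intro finite_signed_measure_add finite_signed_measure_scale finite_signed_measure_measure) (auto simp: p)
  then show ?case by (simp add: p comb_def[abs_def])
qed

section \<open>Continuity, boundedness and Hahn decomposition of signed measures\<close>

lemma finite_signed_measureD:
  assumes "finite_signed_measure \<nu>"
  shows "A \<notin> sets borel \<Longrightarrow> \<nu> A = 0" "\<nu> {} = 0"
    "range F \<subseteq> sets borel \<Longrightarrow> disjoint_family F \<Longrightarrow> (\<lambda>i::nat. \<nu> (F i)) sums \<nu> (\<Union>i. F i)"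
  using assms by (auto simp: finite_signed_measure_def)

lemma signed_Un:
  assumes \<nu>: "finite_signed_measure \<nu>" and "A \<in> sets borel" "B \<in> sets borel" "A \<inter> B = {}"
  shows "\<nu> (A \<union> B) = \<nu> A + \<nu> B"
proof -
  have "(\<lambda>i. \<nu> (binaryset A B i)) sums \<nu> (\<Union>i. binaryset A B i)"
    using assms by (intro finite_signed_measureD(3)[OF \<nu>])
      (auto simp: range_binaryset_eq disjoint_family_on_def binaryset_def)
  moreover have "(\<lambda>i. \<nu> (binaryset A B i)) sums (\<nu> A + \<nu> B)"
    by (intro binaryset_sums finite_signed_measureD(2)[OF \<nu>])
  ultimately show ?thesis by (simp add: UN_binaryset_eq sums_unique2)
qed

lemma signed_Diff:
  assumes "finite_signed_measure \<nu>" "A \<in> sets borel" "B \<in> sets borel" "B \<subseteq> A"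
  shows "\<nu> (A - B) = \<nu> A - \<nu> B"
  using signed_Un[OF assms(1), of B "A - B"] assms by (auto simp: Un_absorb1)

lemma signed_incseq:
  assumes \<nu>: "finite_signed_measure \<nu>" and A: "range A \<subseteq> sets borel" "incseq A"
  shows "(\<lambda>n. \<nu> (A n)) \<longlonglongrightarrow> \<nu> (\<Union>n. A n)"
proof -
  have dm: "disjointed A i \<in> sets borel" for i
    using sets.range_disjointed_sets[OF A(1)] by auto
  have "(\<lambda>i. \<nu> (disjointed A i)) sums \<nu> (\<Union>i. disjointed A i)"
    using dm by (intro finite_signed_measureD(3)[OF \<nu>] disjoint_family_disjointed) auto
  then have "(\<lambda>n. \<Sum>i<Suc n. \<nu> (disjointed A i)) \<longlonglongrightarrow> \<nu> (\<Union>n. A n)"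
    unfolding UN_disjointed_eq sums_def by (rule LIMSEQ_Suc)
  moreover have "(\<Sum>i<Suc n. \<nu> (disjointed A i)) = \<nu> (A n)" for n
  proof (induction n)
    case 0
    then show ?case by (simp add: disjointed_def)
  next
    case (Suc n)
    have "disjointed A (Suc n) = A (Suc n) - A n" using A(2) by (rule disjointed_mono)
    then have "\<nu> (disjointed A (Suc n)) = \<nu> (A (Suc n)) - \<nu> (A n)"
      using A incseq_SucD[OF A(2), of n] by (auto intro!: signed_Diff[OF \<nu>])
    with Suc show ?case by simp
  qed
  ultimately show ?thesis by simp
qed

lemma signed_decseq:
  assumes \<nu>: "finite_signed_measure \<nu>" and A: "range A \<subseteq> sets borel" "decseq A"
  shows "(\<lambda>n. \<nu> (A n)) \<longlonglongrightarrow> \<nu> (\<Inter>n. A n)"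
proof -
  have C: "\<nu> (UNIV - B) = \<nu> UNIV - \<nu> B" if "B \<in> sets borel" for B
    using that by (intro signed_Diff[OF \<nu>]) auto
  have "(\<lambda>n. \<nu> (UNIV - A n)) \<longlonglongrightarrow> \<nu> (\<Union>n. UNIV - A n)"
    using A by (intro signed_incseq[OF \<nu>]) (auto simp: incseq_def decseq_def)
  also have "(\<Union>n. UNIV - A n) = UNIV - (\<Inter>n. A n)" by auto
  finally have "(\<lambda>n. \<nu> UNIV - \<nu> (A n)) \<longlonglongrightarrow> \<nu> UNIV - \<nu> (\<Inter>n. A n)"
    using A by (subst (asm) (1 2) C) auto
  from tendsto_diff[OF tendsto_const[of "\<nu> UNIV"] this] show ?thesis by simp
qed

text \<open>If \<open>\<nu>\<close> is unbounded on the subsets of \<open>S\<close>, then one can split off a part of mass at least 1 such that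
  it is still unbounded on the rest; iterating this contradicts the convergence of the resulting series.\<close>

lemma signed_bounded:
  assumes \<nu>: "finite_signed_measure \<nu>"
  shows "\<exists>B. \<forall>A\<in>sets borel. \<bar>\<nu> A\<bar> \<le> B"
proof (rule ccontr)
  define U where "U S \<longleftrightarrow> (\<forall>r. \<exists>A\<in>sets borel. A \<subseteq> S \<and> \<bar>\<nu> A\<bar> > r)" for S
  assume "\<nexists>B. \<forall>A\<in>sets borel. \<bar>\<nu> A\<bar> \<le> B"
  then have U0: "U UNIV" by (force simp: U_def not_le)
  have step: "\<exists>T. (T \<in> sets borel \<and> U T) \<and> T \<subseteq> S \<and> \<bar>\<nu> (S - T)\<bar> \<ge> 1" if S: "S \<in> sets borel" "U S" for S
  proof -
    \<comment> \<open>The margin \<open>\<bar>\<nu> S\<bar>\<close> ensures that both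
      \<open>A\<close> and \<open>S - A\<close> have mass above 1 in absolute value, so either may
      be split off.\<close>
    obtain A where A: "A \<in> sets borel" "A \<subseteq> S" "\<bar>\<nu> A\<bar> > 1 + \<bar>\<nu> S\<bar>"
      using S(2) unfolding U_def by meson
    have SA: "\<nu> (S - A) = \<nu> S - \<nu> A" using A S by (intro signed_Diff[OF \<nu>])
    have "U A \<or> U (S - A)"
    proof (rule ccontr)
      assume "\<not> (U A \<or> U (S - A))"
      then obtain r r' where r: "\<And>B. B \<in> sets borel \<Longrightarrow> B \<subseteq> A \<Longrightarrow> \<bar>\<nu> B\<bar> \<le> r"
          "\<And>B. B \<in> sets borel \<Longrightarrow> B \<subseteq> S - A \<Longrightarrow> \<bar>\<nu> B\<bar> \<le> r'"
        unfolding U_def by (meson not_le)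
      obtain B where B: "B \<in> sets borel" "B \<subseteq> S" "\<bar>\<nu> B\<bar> > r + r'"
        using S(2) unfolding U_def by meson
      have "\<nu> B = \<nu> (B \<inter> A) + \<nu> (B - A)"
        using signed_Un[OF \<nu>, of "B \<inter> A" "B - A"] A B by (auto simp: Int_Diff_Un)
      moreover have "\<bar>\<nu> (B \<inter> A)\<bar> \<le> r" "\<bar>\<nu> (B - A)\<bar> \<le> r'"
        using A B by (auto intro!: r)
      ultimately show False using B(3) by linarith
    qed
    then show ?thesis
    proof
      assume "U A"
      then show ?thesis using A SA by (intro exI[of _ A]) auto
    next
      assume "U (S - A)"
      moreover have "S - (S - A) = A" using A by auto
      ultimately show ?thesis using A S by (intro exI[of _ "S - A"]) auto
    qed
  qed
  have "\<exists>T. \<forall>n. (T n \<in> sets borel \<and> U (T n)) \<and> (T (Suc n) \<subseteq> T n \<and> \<bar>\<nu> (T n - T (Suc n))\<bar> \<ge> 1)"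
    by (rule dependent_nat_choice) (use U0 step in auto)
  then obtain T where T: "\<And>n. T n \<in> sets borel" "\<And>n. T (Suc n) \<subseteq> T n" "\<And>n::nat. \<bar>\<nu> (T n - T (Suc n))\<bar> \<ge> 1"
    by blast
  have dec: "T n \<subseteq> T m" if "m \<le> n" for m n
    using T(2) that by (rule lift_Suc_antimono_le)
  have "disjoint_family (\<lambda>n. T n - T (Suc n))"
    unfolding disjoint_family_on_def
  proof (intro ballI impI)
    fix m n :: nat assume "m \<noteq> n"
    then show "(T m - T (Suc m)) \<inter> (T n - T (Suc n)) = {}"
      using dec[of "Suc m" n] dec[of "Suc n" m] by (cases m n rule: linorder_cases) auto
  qed
  then have "(\<lambda>n. \<nu> (T n - T (Suc n))) sums \<nu> (\<Union>n. T n - T (Suc n))"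
    using T by (intro finite_signed_measureD(3)[OF \<nu>]) auto
  then have "(\<lambda>n. \<nu> (T n - T (Suc n))) \<longlonglongrightarrow> 0"
    by (intro summable_LIMSEQ_zero sums_summable)
  then have "eventually (\<lambda>n. \<bar>\<nu> (T n - T (Suc n))\<bar> < 1) sequentially"
    by (auto dest!: tendstoD[of _ _ _ 1])
  then show False using T(3) by (auto simp: eventually_sequentially not_less[symmetric])
qed

text \<open>A maximiser of \<open>\<nu>\<close> is a limit inferior of sets whose deficits are summable.\<close>

lemma signed_Hahn:
  assumes \<nu>: "finite_signed_measure \<nu>"
  shows "\<exists>D\<in>sets borel. (\<forall>A\<in>sets borel. 0 \<le> \<nu> (A \<inter> D)) \<and> (\<forall>A\<in>sets borel. \<nu> (A - D) \<le> 0)"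
proof -
  obtain B where B: "\<And>A. A \<in> sets borel \<Longrightarrow> \<bar>\<nu> A\<bar> \<le> B" using signed_bounded[OF \<nu>] by blast
  have "\<nu> A \<le> B" if "A \<in> sets borel" for A using B[OF that] by linarith
  then have bdd: "bdd_above (\<nu> ` sets borel)" by (auto intro!: bdd_aboveI)
  define s where "s = (SUP A\<in>sets borel. \<nu> A)"
  have le_s: "\<nu> A \<le> s" if "A \<in> sets borel" for A
    unfolding s_def using bdd that by (rule cSUP_upper2) simp
  have "\<exists>A\<in>sets borel. \<nu> A > s - (1/2) ^ n" for n :: nat
    using less_cSUP_iff[OF _ bdd, of "s - (1/2)^n"] by (auto simp: s_def)
  then obtain A where A: "\<And>n. A n \<in> sets borel" "\<And>n::nat. \<nu> (A n) > s - (1/2) ^ n" by metis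
  define I where "I m k = (\<Inter>n\<in>{m..m+k}. A n)" for m k
  have I: "I m k \<in> sets borel" for m k unfolding I_def using A by (intro sets.finite_INT) auto
  \<comment> \<open>Unions have mass at most \<open>s\<close>, so by inclusion-exclusion the
    deficits of intersected sets add up; the bound is the geometric sum of the deficits from
    \<open>m\<close> to \<open>m + k\<close>.\<close>
  have I_ge: "\<nu> (I m k) \<ge> s - (2 * (1/2) ^ m - (1/2) ^ (m + k))" for m k
  proof (induction k)
    case 0
    then show ?case using A(2)[of m] by (simp add: I_def)
  next
    case (Suc k)
    let ?J = "A (m + Suc k)"
    have "I m (Suc k) = I m k \<inter> ?J" by (auto simp: I_def atLeastAtMostSuc_conv)
    then have "\<nu> (I m (Suc k)) = \<nu> (I m k \<inter> ?J)" by (rule arg_cong)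
    moreover have "\<nu> (I m k \<union> ?J) = \<nu> (I m k - ?J) + \<nu> ?J"
      using signed_Un[OF \<nu>, of "I m k - ?J" ?J] I A by auto
    moreover have "\<nu> (I m k) = \<nu> (I m k - ?J) + \<nu> (I m k \<inter> ?J)"
      using signed_Un[OF \<nu>, of "I m k - ?J" "I m k \<inter> ?J"] I A by (auto simp: Un_Diff_Int)
    moreover have "\<nu> (I m k \<union> ?J) \<le> s" using I A by (intro le_s) auto
    moreover have "(1/2) ^ (m + k) = 2 * (1/2::real) ^ (m + Suc k)" by simp
    ultimately show ?case using Suc A(2)[of "m + Suc k"] by linarith
  qed
  define E where "E m = (\<Inter>k. I m k)" for m
  have E: "E m \<in> sets borel" for m unfolding E_def using I by (intro sets.countable_INT) auto
  have E_ge: "\<nu> (E m) \<ge> s - 2 * (1/2) ^ m" for m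
  proof (rule LIMSEQ_le_const)
    show "(\<lambda>k. \<nu> (I m k)) \<longlonglongrightarrow> \<nu> (E m)"
      unfolding E_def using I by (intro signed_decseq[OF \<nu>]) (auto simp: decseq_def I_def)
    have "s - 2 * (1/2) ^ m \<le> \<nu> (I m k)" for k
      using I_ge[of m k] zero_le_power[of "1/2::real" "m + k"] by linarith
    then show "\<exists>N. \<forall>k\<ge>N. s - 2 * (1/2) ^ m \<le> \<nu> (I m k)" by blast
  qed
  define D where "D = (\<Union>m. E m)"
  have D: "D \<in> sets borel" unfolding D_def using E by auto
  have E_eq: "E m = (\<Inter>n\<in>{m..}. A n)" for m
    unfolding E_def I_def
  proof (intro equalityI subsetI INT_I)
    fix x n assume x: "x \<in> (\<Inter>k. \<Inter>n\<in>{m..m + k}. A n)" and n: "n \<in> {m..}"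
    from x have "x \<in> (\<Inter>n\<in>{m..m + (n - m)}. A n)" by blast
    then show "x \<in> A n" using n by auto
  qed auto
  have "incseq E" unfolding E_eq by (auto simp: incseq_def)
  then have lim: "(\<lambda>m. \<nu> (E m)) \<longlonglongrightarrow> \<nu> D"
    unfolding D_def using E by (intro signed_incseq[OF \<nu>]) auto
  have "(\<lambda>m. s - 2 * (1/2::real) ^ m) \<longlonglongrightarrow> s - 2 * 0"
    by (intro tendsto_intros LIMSEQ_power_zero) auto
  from LIMSEQ_le[OF this lim] E_ge have "s \<le> \<nu> D" by auto
  then have \<nu>D: "\<nu> D = s" using le_s[OF D] by simp
  show ?thesis
  proof (intro bexI[OF _ D] conjI ballI)
    fix A :: "real set" assume A: "A \<in> sets borel"
    have "\<nu> (D - A \<inter> D) = \<nu> D - \<nu> (A \<inter> D)" using A D by (intro signed_Diff[OF \<nu>]) auto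
    moreover have "\<nu> (D - A \<inter> D) \<le> s" using A D by (intro le_s) auto
    ultimately show "0 \<le> \<nu> (A \<inter> D)" using \<nu>D by simp
    have "\<nu> (D \<union> (A - D)) = \<nu> D + \<nu> (A - D)" using A D by (intro signed_Un[OF \<nu>]) auto
    moreover have "\<nu> (D \<union> (A - D)) \<le> s" using A D by (intro le_s) auto
    ultimately show "\<nu> (A - D) \<le> 0" using \<nu>D by simp
  qed
qed

lemma signed_nonneg_measure:
  assumes \<nu>: "finite_signed_measure \<nu>" and nonneg: "\<And>A. A \<in> sets borel \<Longrightarrow> 0 \<le> \<nu> A"
  shows "\<exists>\<mu>. finite_borel \<mu> \<and> (\<forall>A\<in>sets borel. measure \<mu> A = \<nu> A)"
proof -
  define \<mu> where "\<mu> = measure_of (space borel) (sets borel) (\<lambda>A. ennreal (\<nu> A))"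
  have sets: "sets \<mu> = sets borel"
    unfolding \<mu>_def by (rule sets.sets_measure_of_eq)
  have em: "emeasure \<mu> A = ennreal (\<nu> A)" if "A \<in> sets borel" for A
    unfolding \<mu>_def
  proof (rule emeasure_measure_of_sigma)
    show "sigma_algebra (space borel) (sets (borel :: real measure))" by (rule sets.sigma_algebra_axioms)
    show "positive (sets borel) (\<lambda>A. ennreal (\<nu> A))"
      by (simp add: positive_def finite_signed_measureD(2)[OF \<nu>])
    show "countably_additive (sets borel) (\<lambda>A. ennreal (\<nu> A))"
      unfolding countably_additive_def
    proof (intro allI impI)
      fix F :: "nat \<Rightarrow> real set" assume F: "range F \<subseteq> sets borel" "disjoint_family F"
      then have "0 \<le> \<nu> (F i)" for i by (intro nonneg) auto
      with finite_signed_measureD(3)[OF \<nu> F] show "(\<Sum>i. ennreal (\<nu> (F i))) = ennreal (\<nu> (\<Union>i. F i))"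
        by (intro suminf_ennreal_eq)
    qed
  qed fact
  have "space \<mu> = UNIV" using sets by (metis sets_eq_imp_space_eq space_borel)
  then have "finite_measure \<mu>" using em by (intro finite_measureI) simp
  then show ?thesis using sets em nonneg by (intro exI[of _ \<mu>]) (auto simp: finite_borel_def measure_def)
qed

lemma jordan_decomposition_exists:
  assumes \<nu>: "finite_signed_measure \<nu>"
  shows "\<exists>P Q. jordan_decomposition \<nu> P Q"
proof -
  obtain D where D: "D \<in> sets borel" "\<And>A. A \<in> sets borel \<Longrightarrow> 0 \<le> \<nu> (A \<inter> D)" "\<And>A. A \<in> sets borel \<Longrightarrow> \<nu> (A - D) \<le> 0"
    using signed_Hahn[OF \<nu>] by blast
  have restr: "finite_signed_measure (\<lambda>A. if A \<in> sets borel then c * \<nu> (A \<inter> E) else 0)" if E: "E \<in> sets borel" for c E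
    unfolding finite_signed_measure_def
  proof (intro conjI allI impI)
    fix F :: "nat \<Rightarrow> real set" assume F: "range F \<subseteq> sets borel" "disjoint_family F"
    have "(\<lambda>i. \<nu> (F i \<inter> E)) sums \<nu> (\<Union>i. F i \<inter> E)"
      using F E by (intro finite_signed_measureD(3)[OF \<nu>]) (auto simp: disjoint_family_on_def)
    also have "(\<Union>i. F i \<inter> E) = (\<Union>i. F i) \<inter> E" by auto
    finally have "(\<lambda>i. c * \<nu> (F i \<inter> E)) sums (c * \<nu> ((\<Union>i. F i) \<inter> E))" by (rule sums_mult)
    moreover have "F i \<in> sets borel" "(\<Union>i. F i) \<in> sets borel" for i using F by auto
    ultimately show "(\<lambda>i. if F i \<in> sets borel then c * \<nu> (F i \<inter> E) else 0) sums
        (if (\<Union>i. F i) \<in> sets borel then c * \<nu> ((\<Union>i. F i) \<inter> E) else 0)" by simp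
  qed (simp_all add: finite_signed_measureD(2)[OF \<nu>])
  obtain P where P: "finite_borel P" "\<And>A. A \<in> sets borel \<Longrightarrow> measure P A = \<nu> (A \<inter> D)"
    using signed_nonneg_measure[OF restr[OF D(1), of 1]] D by auto
  have D': "- D \<in> sets borel" using D by auto
  have "0 \<le> - 1 * \<nu> (A \<inter> - D)" if "A \<in> sets borel" for A
    using D(3)[OF that] by (simp add: Diff_eq)
  then obtain Q where Q: "finite_borel Q" "\<And>A. A \<in> sets borel \<Longrightarrow> measure Q A = - \<nu> (A - D)"
    using signed_nonneg_measure[OF restr[OF D', of "-1"]] by (auto simp: Diff_eq)
  have "\<nu> A = measure P A - measure Q A" if "A \<in> sets borel" for A
    using signed_Un[OF \<nu>, of "A \<inter> D" "A - D"] that D P Q by (auto simp: Int_Diff_Un)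
  moreover have "measure P (- D) = 0" "measure Q D = 0"
    using P(2)[OF D'] Q(2)[OF D(1)] by (simp_all add: finite_signed_measureD(2)[OF \<nu>])
  ultimately show ?thesis
    using P(1) Q(1) D(1) unfolding jordan_decomposition_def finite_borel_def by blast
qed

section \<open>Stieltjes inversion\<close>

lemma comb_int_tendsto:
  fixes f :: "nat \<Rightarrow> real \<Rightarrow> real"
  assumes L: "borels L" and f: "\<And>n. f n \<in> borel_measurable borel" "\<And>n t. \<bar>f n t\<bar> \<le> B"
    and g: "g \<in> borel_measurable borel" "\<And>t. (\<lambda>n. f n t) \<longlonglongrightarrow> g t"
  shows "(\<lambda>n. comb_int L (f n)) \<longlonglongrightarrow> comb_int L g"
  using L
proof (induction L)
  case (Cons p L)
  obtain c \<mu> where p: "p = (c, \<mu>)" by (cases p)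
  then have \<mu>: "finite_borel \<mu>" using Cons.prems by auto
  have "(\<lambda>n. LINT t|\<mu>. f n t) \<longlonglongrightarrow> (LINT t|\<mu>. g t)"
    by (rule integral_dominated_convergence[where w = "\<lambda>_. B"])
       (use f g finite_borel_integrable[OF \<mu>, of "\<lambda>_. B" "\<bar>B\<bar>"] in \<open>auto simp: finite_borel_measurable[OF \<mu>]\<close>)
  then show ?case using Cons by (auto simp: p intro!: tendsto_intros)
qed simp

lemma comb_int_mult:
  fixes c :: "'a::{real_normed_field, banach, second_countable_topology}"
  shows "comb_int L (\<lambda>t. c * f t) = c * comb_int L f"
  by (induction L) (auto simp: algebra_simps)

lemma comb_int_Im:
  fixes f :: "real \<Rightarrow> complex"
  assumes L: "borels L" and f: "f \<in> borel_measurable borel" "\<And>t. norm (f t) \<le> B"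
  shows "Im (comb_int L f) = comb_int L (\<lambda>t. Im (f t))"
  using L
proof (induction L)
  case (Cons p L)
  obtain c \<mu> where p: "p = (c, \<mu>)" by (cases p)
  then have "integrable \<mu> f" using Cons.prems by (intro finite_borel_integrable[OF _ f]) auto
  then show ?case using Cons by (simp add: p)
qed simp

lemma cauchy_kernel_measurable: "(\<lambda>t. 1 / (z - complex_of_real t)) \<in> borel_measurable borel"
  by measurable

lemma cauchy_kernel_bound:
  assumes "Im z > 0"
  shows "norm (1 / (z - complex_of_real t)) \<le> 1 / Im z"
proof -
  have "Im z \<le> norm (z - of_real t)" using abs_Im_le_cmod[of "z - of_real t"] by simp
  then show ?thesis using assms by (auto simp: norm_divide intro!: frac_le)
qed

text \<open>The Poisson kernel integrated over \<open>x\<close> from \<open>a\<close> to \<open>b\<close>, via Fubini.\<close>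

lemma comb_int_poisson:
  fixes a b y :: real
  assumes L: "borels L" and y: "0 < y" and ab: "a \<le> b"
    and zero: "\<And>x. comb_int L (\<lambda>t. y / ((x - t)\<^sup>2 + y\<^sup>2)) = 0"
  shows "comb_int L (\<lambda>t. arctan ((b - t) / y) - arctan ((a - t) / y)) = 0"
proof -
  let ?k = "\<lambda>x t. y / ((x - t)\<^sup>2 + y\<^sup>2)"
  let ?R = "restrict_space lborel {a..b}"
  have k_bound: "\<bar>?k x t\<bar> \<le> 1 / y" for x t
  proof -
    have "?k x t \<le> y / y\<^sup>2" using y by (intro divide_left_mono) (auto intro!: mult_pos_pos add_nonneg_pos)
    then show ?thesis using y by (simp add: power2_eq_square)
  qed
  have finR: "finite_measure ?R"
    by (intro finite_measureI) (simp add: emeasure_restrict_space space_restrict_space emeasure_lborel_Icc[OF ab])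
  have FTC: "(LINT x|?R. ?k x t) = arctan ((b - t) / y) - arctan ((a - t) / y)" for t
  proof -
    have "((\<lambda>x. arctan ((x - t) / y)) has_real_derivative ?k x t) (at x within {a..b})" for x
      using y by (auto intro!: derivative_eq_intros simp: field_simps power2_eq_square add_nonneg_pos)
        (metis add_pos_nonneg mult_pos_pos not_sum_power2_lt_zero power2_eq_square)?
    then have "(LINT x|lborel. indicator {a..b} x *\<^sub>R ?k x t) = arctan ((b - t) / y) - arctan ((a - t) / y)"
      using y by (intro integral_FTC_Icc[OF ab])
        (auto simp: has_real_derivative_iff_has_vector_derivative[symmetric] sum_power2_eq_zero_iff intro!: continuous_intros)
    then show ?thesis by (simp add: integral_restrict_space)
  qed
  have *: "(LINT t|\<mu>. LINT x|?R. ?k x t) = (LINT x|?R. LINT t|\<mu>. ?k x t) \<and> integrable ?R (\<lambda>x. LINT t|\<mu>. ?k x t)"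
    if \<mu>: "finite_borel \<mu>" for \<mu>
  proof -
    have [measurable_cong]: "sets \<mu> = sets borel" using \<mu> by (simp add: finite_borel_def)
    interpret mu: finite_measure \<mu> using \<mu> by (simp add: finite_borel_def)
    interpret R: finite_measure ?R by (rule finR)
    interpret pair_sigma_finite ?R \<mu> by unfold_locales
    interpret P: finite_measure "?R \<Otimes>\<^sub>M \<mu>"
      by (intro finite_measure_pair_measure mu.finite_measure_axioms R.finite_measure_axioms)
    have [measurable]: "(\<lambda>p. ?k (fst p) (snd p)) \<in> borel_measurable (?R \<Otimes>\<^sub>M \<mu>)"
    proof -
      have [measurable]: "fst \<in> ?R \<Otimes>\<^sub>M \<mu> \<rightarrow>\<^sub>M borel"
        by (rule measurable_compose[OF measurable_fst]) (auto intro!: measurable_restrict_space1)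
      have [measurable]: "snd \<in> ?R \<Otimes>\<^sub>M \<mu> \<rightarrow>\<^sub>M borel"
        by (rule measurable_compose[OF measurable_snd]) auto
      show ?thesis by measurable
    qed
    have int: "integrable (?R \<Otimes>\<^sub>M \<mu>) (case_prod ?k)"
      by (rule P.integrable_const_bound[where B = "1 / y"])
         (use k_bound in \<open>auto simp: case_prod_unfold\<close>)
    show ?thesis using Fubini_integral[OF int] integrable_fst[OF int] by simp
  qed
  have "comb_int L (\<lambda>t. LINT x|?R. ?k x t) = (LINT x|?R. comb_int L (?k x)) \<and> integrable ?R (\<lambda>x. comb_int L (?k x))"
    using L
  proof (induction L)
    case (Cons p L)
    then show ?case using *[of "snd p"] by (cases p) auto
  qed simp
  then show ?thesis by (simp add: zero FTC)
qed

lemma sgn_measurable_diff: "(\<lambda>t::real. sgn (b - t)) \<in> borel_measurable borel"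
  unfolding sgn_real_def by measurable

text \<open>The imaginary part of the kernel is minus the Poisson kernel. Integrated over an
  interval, it tends to a difference of signs as the height goes to 0, which counts boundary points
  by half. Shifting the right end by \<open>1 / n\<close> removes this defect, and the half-lines
  generate the Borel sets.\<close>

lemma stieltjes_uniqueness:
  assumes L: "borels L" and zero: "\<And>z. Im z > 0 \<Longrightarrow> comb_int L (\<lambda>t. 1 / (z - complex_of_real t)) = 0"
    and A: "A \<in> sets borel"
  shows "comb L A = 0"
proof -
  have poisson: "comb_int L (\<lambda>t. y / ((x - t)\<^sup>2 + y\<^sup>2)) = 0" if y: "0 < y" for x y
  proof -
    have "Im (1 / (Complex x y - of_real t)) = - (y / ((x - t)\<^sup>2 + y\<^sup>2))" for t
      by (simp add: Im_divide)
    then have "comb_int L (\<lambda>t. - (y / ((x - t)\<^sup>2 + y\<^sup>2))) = Im (comb_int L (\<lambda>t. 1 / (Complex x y - of_real t)))"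
      using comb_int_Im[OF L cauchy_kernel_measurable cauchy_kernel_bound, of "Complex x y"] y by simp
    also have "\<dots> = 0" using zero[of "Complex x y"] y by simp
    finally show ?thesis using comb_int_mult[of L "-1" "\<lambda>t. y / ((x - t)\<^sup>2 + y\<^sup>2)"] by simp
  qed
  have sgn_ab: "comb_int L (\<lambda>t. sgn (b - t) - sgn (a - t)) = 0" if ab: "a \<le> b" for a b
  proof -
    let ?f = "\<lambda>n t. arctan ((b - t) / (1 / real (Suc n))) - arctan ((a - t) / (1 / real (Suc n)))"
    have at: "(\<lambda>n. arctan (u / (1 / real (Suc n)))) \<longlonglongrightarrow> pi / 2 * sgn u" for u :: real
    proof (cases u "0::real" rule: linorder_cases)
      case greater
      have "filterlim (\<lambda>n. u * real (Suc n)) at_top sequentially"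
        using greater by (intro filterlim_tendsto_pos_mult_at_top[OF tendsto_const]
            filterlim_compose[OF filterlim_real_sequentially filterlim_Suc]) auto
      from filterlim_compose[OF tendsto_arctan_at_top this] show ?thesis using greater by simp
    next
      case less
      have "filterlim (\<lambda>n. u * real (Suc n)) at_bot sequentially"
        using less by (intro filterlim_tendsto_neg_mult_at_bot[OF tendsto_const]
            filterlim_compose[OF filterlim_real_sequentially filterlim_Suc]) auto
      from filterlim_compose[OF tendsto_arctan_at_bot this] show ?thesis using less by simp
    qed simp
    have "(\<lambda>n. comb_int L (?f n)) \<longlonglongrightarrow> comb_int L (\<lambda>t. pi / 2 * sgn (b - t) - pi / 2 * sgn (a - t))"
    proof (rule comb_int_tendsto[OF L])
      show "\<bar>?f n t\<bar> \<le> 2 * pi" for n t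
        using arctan_bounded[of "(b - t) / (1 / real (Suc n))"] arctan_bounded[of "(a - t) / (1 / real (Suc n))"] by arith
      show "(\<lambda>n. ?f n t) \<longlonglongrightarrow> pi / 2 * sgn (b - t) - pi / 2 * sgn (a - t)" for t
        by (intro tendsto_diff at)
      show "(\<lambda>t. pi / 2 * sgn (b - t) - pi / 2 * sgn (a - t)) \<in> borel_measurable borel"
        using sgn_measurable_diff by (intro borel_measurable_diff borel_measurable_times) auto
      show "?f n \<in> borel_measurable borel" for n
        by (intro borel_measurable_continuous_onI continuous_intros) auto
    qed
    moreover have "comb_int L (?f n) = 0" for n
      by (intro comb_int_poisson[OF L _ ab] poisson) auto
    ultimately have "comb_int L (\<lambda>t. pi / 2 * sgn (b - t) - pi / 2 * sgn (a - t)) = 0"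
      by (simp add: LIMSEQ_const_iff)
    moreover have "comb_int L (\<lambda>t. pi / 2 * sgn (b - t) - pi / 2 * sgn (a - t)) = pi / 2 * comb_int L (\<lambda>t. sgn (b - t) - sgn (a - t))"
      by (simp only: right_diff_distrib[symmetric] comb_int_mult)
    ultimately show ?thesis by simp
  qed
  have sgn1: "comb_int L (\<lambda>t. sgn (b - t) + 1) = 0" for b
  proof -
    \<comment> \<open>The left end goes to minus infinity; the minimum keeps it below
      \<open>b\<close>.\<close>
    let ?f = "\<lambda>n t. sgn (b - t) - sgn (min b (- real n) - t)"
    have "(\<lambda>n. comb_int L (?f n)) \<longlonglongrightarrow> comb_int L (\<lambda>t. sgn (b - t) + 1)"
    proof (rule comb_int_tendsto[OF L])
      show "\<bar>?f n t\<bar> \<le> 2" for n t by (auto simp: sgn_real_def)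
      show "(\<lambda>n. ?f n t) \<longlonglongrightarrow> sgn (b - t) + 1" for t
      proof (rule tendsto_eventually)
        have "eventually (\<lambda>n. real n > - t) sequentially"
          using filterlim_real_sequentially by (auto simp: filterlim_at_top_dense)
        then show "eventually (\<lambda>n. ?f n t = sgn (b - t) + 1) sequentially"
          by eventually_elim (auto simp: sgn_real_def min_def)
      qed
      show "(\<lambda>t. sgn (b - t) + 1) \<in> borel_measurable borel"
        by (intro borel_measurable_add sgn_measurable_diff) auto
      show "?f n \<in> borel_measurable borel" for n
        by (intro borel_measurable_diff sgn_measurable_diff)
    qed
    moreover have "comb_int L (?f n) = 0" for n by (rule sgn_ab) auto
    ultimately show ?thesis by (simp add: LIMSEQ_const_iff)
  qed
  have ind: "comb_int L (indicator A :: real \<Rightarrow> real) = comb L A" if "A \<in> sets borel" for A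
    unfolding comb_int_def comb_def
    by (intro arg_cong[where f = sum_list] map_cong refl) (use L finite_borel_space in auto)
  have atMost: "comb L {..b} = 0" for b
  proof -
    \<comment> \<open>Approaching \<open>b\<close> from the right gives the point \<open>b\<close>
      full instead of half weight.\<close>
    let ?f = "\<lambda>n t. sgn (b + 1 / real (Suc n) - t) + 1"
    have "(\<lambda>n. comb_int L (?f n)) \<longlonglongrightarrow> comb_int L (\<lambda>t. 2 * indicator {..b} t)"
    proof (rule comb_int_tendsto[OF L])
      show "\<bar>?f n t\<bar> \<le> 2" for n t by (auto simp: sgn_real_def)
      show "(\<lambda>n. ?f n t) \<longlonglongrightarrow> 2 * indicator {..b} t" for t
      proof (cases "t \<le> b")
        case True
        then have "b + 1 / real (Suc n) - t > 0" for n by (smt (verit) divide_pos_pos of_nat_0_less_iff zero_less_Suc)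
        then show ?thesis using True by simp
      next
        case False
        have "(\<lambda>n. 1 / real (Suc n)) \<longlonglongrightarrow> 0" by (rule lim_1_over_n[THEN LIMSEQ_Suc])
        then have "eventually (\<lambda>n. 1 / real (Suc n) < t - b) sequentially"
          using False by (intro order_tendstoD(2)) auto
        then have "eventually (\<lambda>n. ?f n t = 2 * indicator {..b} t) sequentially"
          by eventually_elim (use False in \<open>auto simp: sgn_real_def\<close>)
        then show ?thesis by (rule tendsto_eventually)
      qed
      show "?f n \<in> borel_measurable borel" for n
        by (intro borel_measurable_add sgn_measurable_diff) auto
    qed auto
    then have "comb_int L (\<lambda>t. 2 * indicator {..b} t :: real) = 0" by (simp add: sgn1 LIMSEQ_const_iff)
    then have "comb_int L (indicator {..b} :: real \<Rightarrow> real) = 0" by (simp add: comb_int_mult)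
    then show ?thesis by (simp add: ind)
  qed
  have UNIV0: "comb L UNIV = 0"
  proof -
    have "(\<lambda>n. comb_int L (indicator {..real n} :: real \<Rightarrow> real)) \<longlonglongrightarrow> comb_int L (indicator UNIV :: real \<Rightarrow> real)"
    proof (rule comb_int_tendsto[OF L])
      show "(\<lambda>n. indicator {..real n} t) \<longlonglongrightarrow> (indicator UNIV t :: real)" for t
      proof (rule tendsto_eventually)
        have "eventually (\<lambda>n. real n > t) sequentially"
          using filterlim_real_sequentially by (auto simp: filterlim_at_top_dense)
        then show "eventually (\<lambda>n. indicator {..real n} t = (indicator UNIV t :: real)) sequentially"
          by eventually_elim auto
      qed
      show "\<bar>indicator {..real n} t\<bar> \<le> (1::real)" for n t by (auto split: split_indicator)
    qed auto
    then show ?thesis by (simp add: ind atMost LIMSEQ_const_iff del: indicator_UNIV)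
  qed
  have fsm: "finite_signed_measure (comb L)" using L by (rule finite_signed_measure_comb)
  have A': "A \<in> sigma_sets UNIV (range atMost)"
    using A unfolding borel_eq_atMost by (subst (asm) sets_measure_of) auto
  have st: "Int_stable (range (atMost :: real \<Rightarrow> real set))"
    by (auto simp: Int_stable_def)
  have cl: "range (atMost :: real \<Rightarrow> real set) \<subseteq> Pow UNIV" by auto
  from st cl A' show ?thesis
  proof (induction rule: sigma_sets_induct_disjoint)
    case (basic A)
    then show ?case using atMost by auto
  next
    case empty
    then show ?case by (simp add: finite_signed_measureD(2)[OF fsm])
  next
    case (compl A)
    then have "A \<in> sets borel" unfolding borel_eq_atMost by (subst sets_measure_of) auto
    then show ?case using compl UNIV0 by (subst signed_Diff[OF fsm]) auto
  next
    case (union F)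
    then have "range F \<subseteq> sets borel" unfolding borel_eq_atMost by (subst sets_measure_of) auto
    from finite_signed_measureD(3)[OF fsm this union(1)] show ?case
      using union(3) by (simp add: sums_unique2[OF _ sums_zero])
  qed
qed

section \<open>The arcsine and the semicircle law\<close>

text \<open>The antiderivative \<open>?K\<close> is explicit. Its logarithms stay off the branch cut
  because \<open>1 + w * u\<close> has positive real part when \<open>norm u = 1\<close>; at 0 and
  at \<open>pi\<close> the two exponentials coincide and the logarithms cancel.\<close>

lemma poisson_kernel_integral:
  fixes w :: complex
  assumes w: "norm w < 1"
  shows "(LINT \<phi>|lborel. indicator {0..pi} \<phi> *\<^sub>R ((1 - w\<^sup>2) / (1 + 2 * w * of_real (cos \<phi>) + w\<^sup>2))) = of_real pi"
proof -
  define E where "E \<phi> = exp (\<i> * complex_of_real \<phi>)" for \<phi>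
  define E' where "E' \<phi> = exp (- \<i> * complex_of_real \<phi>)" for \<phi>
  let ?K = "\<lambda>\<phi>. of_real \<phi> + \<i> * (Ln (1 + w * E \<phi>) - Ln (1 + w * E' \<phi>))"
  have EE': "E \<phi> * E' \<phi> = 1" for \<phi> by (simp add: E_def E'_def exp_minus)
  have norm: "norm (E \<phi>) = 1" "norm (E' \<phi>) = 1" for \<phi> by (simp_all add: E_def E'_def)
  have sum: "E \<phi> + E' \<phi> = 2 * of_real (cos \<phi>)" for \<phi>
    by (simp add: E_def E'_def cos_of_real[symmetric] cos_exp_eq)
  have small: "Re (1 + w * u) > 0" "1 + w * u \<noteq> 0" "1 + w * u \<notin> \<real>\<^sub>\<le>\<^sub>0" if "norm u = 1" for u
  proof -
    have "norm (w * u) < 1" using w that by (simp add: norm_mult)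
    then show 1: "Re (1 + w * u) > 0" using abs_Re_le_cmod[of "w * u"] by (simp add: abs_if split: if_splits)
    then show "1 + w * u \<noteq> 0" by (metis less_irrefl zero_complex.simps(1))
    show "1 + w * u \<notin> \<real>\<^sub>\<le>\<^sub>0" using 1 by (simp add: complex_nonpos_Reals_iff)
  qed
  have denom: "1 + 2 * w * of_real (cos \<phi>) + w\<^sup>2 = (1 + w * E \<phi>) * (1 + w * E' \<phi>)" for \<phi>
  proof -
    have "(1 + w * E \<phi>) * (1 + w * E' \<phi>) = 1 + w * (E \<phi> + E' \<phi>) + w\<^sup>2 * (E \<phi> * E' \<phi>)"
      by (simp add: algebra_simps power2_eq_square)
    then show ?thesis by (simp add: EE' sum)
  qed
  have nz: "1 + 2 * w * of_real (cos \<phi>) + w\<^sup>2 \<noteq> 0" for \<phi>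
    unfolding denom using small(2) norm by simp
  have deriv: "(?K has_vector_derivative (1 - w\<^sup>2) / (1 + 2 * w * of_real (cos \<phi>) + w\<^sup>2)) (at \<phi> within S)" for \<phi> S
  proof -
    have "((\<lambda>z. z + \<i> * (Ln (1 + w * exp (\<i> * z)) - Ln (1 + w * exp (- \<i> * z)))) has_field_derivative
        1 + \<i> * (w * (E \<phi> * \<i>) / (1 + w * E \<phi>) - w * (E' \<phi> * (- \<i>)) / (1 + w * E' \<phi>))) (at (of_real \<phi>))"
      using small(3)[OF norm(1)[of \<phi>]] small(3)[OF norm(2)[of \<phi>]]
      by (auto intro!: derivative_eq_intros simp: E_def E'_def divide_inverse)
    moreover have "1 + \<i> * (w * (E \<phi> * \<i>) / (1 + w * E \<phi>) - w * (E' \<phi> * (- \<i>)) / (1 + w * E' \<phi>)) =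
        (1 - w\<^sup>2) / (1 + 2 * w * of_real (cos \<phi>) + w\<^sup>2)"
    proof -
      have "1 + \<i> * (w * (u * \<i>) / (1 + w * u) - w * (u' * (- \<i>)) / (1 + w * u')) = (1 - w\<^sup>2 * (u * u')) / ((1 + w * u) * (1 + w * u'))"
        if "1 + w * u \<noteq> 0" "1 + w * u' \<noteq> 0" for u u'
        using that by (simp add: divide_simps) (simp add: algebra_simps power2_eq_square)
      from this[OF small(2)[OF norm(1)] small(2)[OF norm(2)]] show ?thesis unfolding denom by (simp add: EE')
    qed
    ultimately show ?thesis
      unfolding E_def E'_def by (intro has_vector_derivative_real_field[THEN has_vector_derivative_at_within]) simp
  qed
  have "(LINT \<phi>|lborel. indicator {0..pi} \<phi> *\<^sub>R ((1 - w\<^sup>2) / (1 + 2 * w * of_real (cos \<phi>) + w\<^sup>2))) = ?K pi - ?K 0"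
    by (intro integral_FTC_Icc deriv continuous_intros) (auto simp: nz)
  also have "\<dots> = of_real pi" by (simp add: E_def E'_def exp_minus)
  finally show ?thesis .
qed

text \<open>The image of the uniform law on \<open>{0..pi}\<close>; the sign makes the map
  increasing, as the substitution rule demands. The semicircle law and the measures
  \<open>\<nu>\<close> are treated as weights relative to this law.\<close>

definition arcsine :: "real \<Rightarrow> real measure" where
  "arcsine \<sigma> = distr (density lborel (\<lambda>\<phi>. ennreal (indicator {0..pi} \<phi> / pi))) borel (\<lambda>\<phi>. - 2 * \<sigma> * cos \<phi>)"

definition arcsine_density :: "real \<Rightarrow> real \<Rightarrow> real" where
  "arcsine_density \<sigma> t = indicator {-2*\<sigma>..2*\<sigma>} t / (pi * sqrt (4 * \<sigma>\<^sup>2 - t\<^sup>2))"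

lemma arcsine_density_nonneg: "0 \<le> arcsine_density \<sigma> t"
proof (cases "t \<in> {-2*\<sigma>..2*\<sigma>}")
  case True
  then have "\<bar>t\<bar> \<le> \<bar>2 * \<sigma>\<bar>" by auto
  then have "t\<^sup>2 \<le> (2 * \<sigma>)\<^sup>2" by (rule abs_le_square_iff[THEN iffD1])
  then show ?thesis by (simp add: arcsine_density_def power_mult_distrib)
qed (simp add: arcsine_density_def)

lemma arcsine_density_measurable [measurable]: "arcsine_density \<sigma> \<in> borel_measurable borel"
  unfolding arcsine_density_def by measurable

lemma arcsine_integral:
  fixes f :: "real \<Rightarrow> 'b::{banach, second_countable_topology}"
  assumes [measurable]: "f \<in> borel_measurable borel"
  shows "(LINT t|arcsine \<sigma>. f t) = (LINT \<phi>|lborel. (indicator {0..pi} \<phi> / pi) *\<^sub>R f (- 2 * \<sigma> * cos \<phi>))"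
  unfolding arcsine_def by (subst integral_distr) (auto simp: integral_density)

lemma arcsine_prob: "borel_prob (arcsine \<sigma>)"
proof -
  have "emeasure (density lborel (\<lambda>\<phi>. ennreal (indicator {0..pi} \<phi> / pi))) UNIV = 1"
  proof -
    have "(\<integral>\<^sup>+\<phi>. ennreal (indicator {0..pi} \<phi> / pi) \<partial>lborel) = (\<integral>\<^sup>+\<phi>. ennreal (1 / pi) * indicator {0..pi} \<phi> \<partial>lborel)"
      by (intro nn_integral_cong) (auto split: split_indicator)
    also have "\<dots> = ennreal (1 / pi) * ennreal pi"
      by (subst nn_integral_cmult_indicator) auto
    also have "\<dots> = 1" by (simp add: ennreal_mult[symmetric])
    finally show ?thesis by (simp add: emeasure_density)
  qed
  then have "prob_space (density lborel (\<lambda>\<phi>. ennreal (indicator {0..pi} \<phi> / pi)))"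
    by (intro prob_spaceI) simp
  then have "prob_space (arcsine \<sigma>)"
    unfolding arcsine_def by (rule prob_space.prob_space_distr) measurable
  then show ?thesis by (simp add: borel_prob_def arcsine_def)
qed

lemma arcsine_eq_density:
  assumes \<sigma>: "0 < \<sigma>"
  shows "arcsine \<sigma> = density lborel (\<lambda>t. ennreal (arcsine_density \<sigma> t))"
proof (rule measure_eqI)
  fix A assume "A \<in> sets (arcsine \<sigma>)"
  then have A [measurable]: "A \<in> sets borel" by (simp add: arcsine_def)
  let ?g = "\<lambda>\<phi>. - 2 * \<sigma> * cos \<phi>" and ?f = "\<lambda>t. indicator A t / (pi * sqrt (4 * \<sigma>\<^sup>2 - t\<^sup>2))"
  have sq: "sqrt (4 * \<sigma>\<^sup>2 - (?g \<phi>)\<^sup>2) = 2 * \<sigma> * sin \<phi>" if "\<phi> \<in> {0..pi}" for \<phi>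
  proof -
    have "4 * \<sigma>\<^sup>2 - (?g \<phi>)\<^sup>2 = (2 * \<sigma> * sin \<phi>)\<^sup>2"
      by (simp add: power_mult_distrib sin_squared_eq algebra_simps)
    then show ?thesis using that \<sigma> sin_ge_zero[of \<phi>] by (simp only: real_sqrt_abs) simp
  qed
  have "emeasure (density lborel (\<lambda>t. ennreal (arcsine_density \<sigma> t))) A = (\<integral>\<^sup>+t. ennreal (arcsine_density \<sigma> t) * indicator A t \<partial>lborel)"
    by (subst emeasure_density) auto
  also have "\<dots> = (\<integral>\<^sup>+t. ennreal (?f t * indicator {?g 0..?g pi} t) \<partial>lborel)"
    by (intro nn_integral_cong) (auto simp: arcsine_density_def split: split_indicator)
  also have "\<dots> = (\<integral>\<^sup>+\<phi>. ennreal (?f (?g \<phi>) * (2 * \<sigma> * sin \<phi>) * indicator {0..pi} \<phi>) \<partial>lborel)"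
  proof (rule nn_integral_substitution)
    show "set_borel_measurable borel {?g 0..?g pi} ?f"
      unfolding set_borel_measurable_def by measurable
    show "(?g has_real_derivative 2 * \<sigma> * sin \<phi>) (at \<phi>)" for \<phi>
      by (auto intro!: derivative_eq_intros)
    show "0 \<le> 2 * \<sigma> * sin \<phi>" if "\<phi> \<in> {0..pi}" for \<phi> using that \<sigma> sin_ge_zero[of \<phi>] by simp
  qed (auto intro!: continuous_intros)
  also have "\<dots> = (\<integral>\<^sup>+\<phi>. ennreal (indicator {0..pi} \<phi> / pi) * indicator (?g -` A) \<phi> \<partial>lborel)"
  proof (rule nn_integral_cong_AE)
    have "AE \<phi> in lborel. \<phi> \<noteq> 0" "AE \<phi> in lborel. \<phi> \<noteq> pi" by (rule AE_lborel_singleton)+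
    then show "AE \<phi> in lborel. ennreal (?f (?g \<phi>) * (2 * \<sigma> * sin \<phi>) * indicator {0..pi} \<phi>) =
        ennreal (indicator {0..pi} \<phi> / pi) * indicator (?g -` A) \<phi>"
    proof eventually_elim
      case (elim \<phi>)
      show ?case
      proof (cases "\<phi> \<in> {0..pi}")
        case True
        with elim have "0 < sin \<phi>" by (intro sin_gt_zero) auto
        then show ?thesis using \<sigma> True by (auto simp: sq[OF True, simplified] split: split_indicator)
      qed simp
    qed
  qed
  also have "\<dots> = emeasure (arcsine \<sigma>) A"
    using measurable_sets[of ?g borel borel A] unfolding arcsine_def by (subst emeasure_distr) (auto simp: emeasure_density)
  finally show "emeasure (arcsine \<sigma>) A = emeasure (density lborel (\<lambda>t. ennreal (arcsine_density \<sigma> t))) A" ..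
qed (simp add: arcsine_def)

text \<open>The interval is open because the denominator of \<open>nu_density\<close> may vanish at
  its ends.\<close>

lemma arcsine_AE:
  assumes "0 < \<sigma>"
  shows "AE t in arcsine \<sigma>. t \<in> {-2*\<sigma><..<2*\<sigma>}"
proof -
  have "AE t in lborel. t \<noteq> 2*\<sigma>" "AE t in lborel. t \<noteq> -2*\<sigma>" by (rule AE_lborel_singleton)+
  then have "AE t in lborel. 0 < arcsine_density \<sigma> t \<longrightarrow> t \<in> {-2*\<sigma><..<2*\<sigma>}"
    by eventually_elim (auto simp: arcsine_density_def indicator_def split: if_splits)
  then show ?thesis
    unfolding arcsine_eq_density[OF assms] by (subst AE_density) (simp_all del: greaterThanLessThan_iff)
qed

lemma arcsine_integrable:
  fixes f :: "real \<Rightarrow> 'b::{banach, second_countable_topology}"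
  assumes \<sigma>: "0 < \<sigma>" and f: "f \<in> borel_measurable borel" "\<And>t. t \<in> {-2*\<sigma>..2*\<sigma>} \<Longrightarrow> norm (f t) \<le> B"
  shows "integrable (arcsine \<sigma>) f"
proof -
  interpret prob_space "arcsine \<sigma>" using arcsine_prob by (simp add: borel_prob_def)
  show ?thesis
  proof (rule integrable_const_bound[where B = B])
    show "AE t in arcsine \<sigma>. norm (f t) \<le> B"
      using arcsine_AE[OF \<sigma>] by eventually_elim (auto intro: f)
    show "f \<in> borel_measurable (arcsine \<sigma>)"
      using f arcsine_prob[of \<sigma>] by (simp add: finite_borel_measurable borel_prob_finite_borel)
  qed
qed

text \<open>The two solutions \<open>w\<close> have product 1. If neither lies inside the unit disc,
  they are conjugate points of the unit circle, and \<open>z\<close> would lie on the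
  segment.\<close>

lemma joukowski:
  fixes z :: complex
  assumes \<sigma>: "0 < \<sigma>" and z: "z \<notin> of_real ` {-2*\<sigma>..2*\<sigma>}"
  shows "\<exists>w. w \<noteq> 0 \<and> norm w < 1 \<and> z = of_real \<sigma> * (w + 1 / w)"
proof -
  define d where "d = csqrt ((z / of_real \<sigma>)\<^sup>2 - 4)"
  have d: "d\<^sup>2 = (z / of_real \<sigma>)\<^sup>2 - 4" by (simp add: d_def)
  define w1 w2 where "w1 = (z / of_real \<sigma> + d) / 2" and "w2 = (z / of_real \<sigma> - d) / 2"
  have "w1 * w2 = ((z / of_real \<sigma>)\<^sup>2 - d\<^sup>2) / 4" by (simp add: w1_def w2_def algebra_simps power2_eq_square)
  then have prod: "w1 * w2 = 1" by (simp add: d)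
  have sum: "z = of_real \<sigma> * (w1 + w2)" using \<sigma> by (simp add: w1_def w2_def field_simps)
  have nz: "w1 \<noteq> 0" "w2 \<noteq> 0" using prod by auto
  have inv: "1 / w1 = w2" "1 / w2 = w1" using prod nz by (auto simp: field_simps)
  consider "norm w1 < 1" | "norm w2 < 1" | "norm w1 = 1"
  proof -
    have "norm w1 * norm w2 = 1" using prod by (simp flip: norm_mult)
    then have "norm w2 = 1 / norm w1" using nz by (simp add: field_simps)
    then have "norm w1 < 1 \<or> norm w2 < 1 \<or> norm w1 = 1"
      by (cases "norm w1" "1::real" rule: linorder_cases) (auto simp: divide_less_eq_1)
    then show ?thesis using that by blast
  qed
  then show ?thesis
  proof cases
    case 1
    then show ?thesis using sum nz inv by (intro exI[of _ w1]) auto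
  next
    case 2
    then show ?thesis using sum nz inv by (intro exI[of _ w2]) (auto simp: add.commute)
  next
    case 3
    have "w1 * cnj w1 = 1" using complex_norm_square[of w1] \<open>norm w1 = 1\<close> by simp
    then have "w1 * cnj w1 = w1 * w2" using prod by simp
    then have "w2 = cnj w1" using nz(1) by simp
    then have "z = of_real (2 * \<sigma> * Re w1)" using sum by (simp add: complex_eq_iff)
    moreover have "2 * \<sigma> * Re w1 \<in> {-2*\<sigma>..2*\<sigma>}"
    proof -
      have "-1 \<le> Re w1" "Re w1 \<le> 1" using abs_Re_le_cmod[of w1] 3 by (simp_all add: abs_le_iff)
      then show ?thesis
        using mult_left_mono[of "-1" "Re w1" \<sigma>] mult_left_mono[of "Re w1" 1 \<sigma>] \<sigma> by simp
    qed
    ultimately show ?thesis using z by blast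
  qed
qed

lemma joukowski_props:
  fixes z w :: complex
  assumes \<sigma>: "0 < \<sigma>" and w: "w \<noteq> 0" "norm w < 1" "z = of_real \<sigma> * (w + 1 / w)"
  shows "1 - w\<^sup>2 \<noteq> 0" "z \<notin> of_real ` {-2*\<sigma>..2*\<sigma>}" "Im z > 0 \<longleftrightarrow> Im w < 0"
proof -
  have n2: "norm (w\<^sup>2) < 1" using w by (simp add: norm_power power_less_one_iff)
  then show "1 - w\<^sup>2 \<noteq> 0" by (metis eq_iff_diff_eq_0 less_irrefl norm_one)
  have nw: "0 < (norm w)\<^sup>2" "(norm w)\<^sup>2 < 1" using w by (simp_all add: power_less_one_iff)
  have inv: "1 / w = cnj w / of_real ((norm w)\<^sup>2)"
    unfolding complex_norm_square using w(1) by simp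
  have Im: "Im z = \<sigma> * Im w * (1 - 1 / (norm w)\<^sup>2)"
    unfolding w(3) inv by (simp add: algebra_simps)
  have neg: "1 - 1 / (norm w)\<^sup>2 < 0" using nw by simp
  show Im_iff: "Im z > 0 \<longleftrightarrow> Im w < 0"
    unfolding Im using \<sigma> neg by (simp add: zero_less_mult_iff mult_less_0_iff)
  show "z \<notin> of_real ` {-2*\<sigma>..2*\<sigma>}"
  proof
    assume "z \<in> of_real ` {-2*\<sigma>..2*\<sigma>}"
    then obtain r where r: "z = of_real r" "\<bar>r\<bar> \<le> 2 * \<sigma>" by auto
    then have "Im w = 0" using Im \<sigma> neg by (metis Im_complex_of_real less_irrefl mult_eq_0_iff)
    then obtain q where q: "w = of_real q" by (metis complex_is_Real_iff Reals_cases)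
    have "z = of_real (\<sigma> * (q + 1 / q))" unfolding w(3) q by simp
    then have "r = \<sigma> * (q + 1 / q)" unfolding r(1) by (simp only: of_real_eq_iff)
    moreover have "q \<noteq> 0" "\<bar>q\<bar> < 1" using w(1,2) unfolding q by simp_all
    ultimately have q': "q \<noteq> 0" "\<bar>q\<bar> < 1" "r = \<sigma> * (q + 1 / q)" by simp_all
    then have "\<sigma> * \<bar>q + 1 / q\<bar> \<le> \<sigma> * 2" using r(2) \<sigma> by (simp add: abs_mult)
    then have "\<bar>q + 1 / q\<bar> \<le> 2" using \<sigma> by simp
    then have "\<bar>q + 1 / q\<bar> * \<bar>q\<bar> \<le> 2 * \<bar>q\<bar>" by (intro mult_right_mono) auto
    moreover have "\<bar>q + 1 / q\<bar> * \<bar>q\<bar> = q\<^sup>2 + 1"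
      using q'(1) by (simp add: abs_mult[symmetric] distrib_right power2_eq_square)
    ultimately have "(1 - \<bar>q\<bar>)\<^sup>2 \<le> 0" by (simp add: power2_eq_square algebra_simps abs_if split: if_splits)
    then show False using q'(2) by simp
  qed
qed

lemma off_segment_bound:
  fixes z :: complex
  assumes "z \<notin> of_real ` {-2*\<sigma>..2*\<sigma>}"
  shows "\<exists>B. \<forall>t\<in>{-2*\<sigma>..2*\<sigma>}. norm (1 / (z - complex_of_real t)) \<le> B"
proof -
  have "continuous_on {-2*\<sigma>..2*\<sigma>} (\<lambda>t. 1 / (z - complex_of_real t))"
    using assms by (intro continuous_intros) auto
  then have "bounded ((\<lambda>t. 1 / (z - complex_of_real t)) ` {-2*\<sigma>..2*\<sigma>})"
    by (intro compact_imp_bounded compact_continuous_image) auto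
  then show ?thesis by (auto simp: bounded_iff)
qed

text \<open>In the parametrisation by the angle, \<open>z - t\<close> becomes
  \<open>\<sigma> / w\<close> times the denominator of the Poisson kernel.\<close>

lemma arcsine_cauchy:
  fixes z w :: complex
  assumes \<sigma>: "0 < \<sigma>" and w: "w \<noteq> 0" "norm w < 1" "z = of_real \<sigma> * (w + 1 / w)"
  shows "cauchy_transform (arcsine \<sigma>) z = w / (of_real \<sigma> * (1 - w\<^sup>2))"
proof -
  have nz: "1 - w\<^sup>2 \<noteq> 0" using joukowski_props[OF \<sigma> w] by blast
  have eq: "(indicator {0..pi} \<phi> / pi) *\<^sub>R (1 / (z - of_real (- 2 * \<sigma> * cos \<phi>))) =
      (w / (of_real (pi * \<sigma>) * (1 - w\<^sup>2))) * (indicator {0..pi} \<phi> *\<^sub>R ((1 - w\<^sup>2) / (1 + 2 * w * of_real (cos \<phi>) + w\<^sup>2)))" for \<phi>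
  proof -
    have "z - of_real (- 2 * \<sigma> * cos \<phi>) = of_real \<sigma> / w * (1 + 2 * w * of_real (cos \<phi>) + w\<^sup>2)"
      using w(1) unfolding w(3) by (simp add: field_simps power2_eq_square)
    then have "1 / (z - of_real (- 2 * \<sigma> * cos \<phi>)) =
        w / (of_real \<sigma> * (1 - w\<^sup>2)) * ((1 - w\<^sup>2) / (1 + 2 * w * of_real (cos \<phi>) + w\<^sup>2))"
      using nz by simp
    then show ?thesis by (simp only: scaleR_conv_of_real of_real_mult of_real_divide) (simp add: mult_ac)
  qed
  have "cauchy_transform (arcsine \<sigma>) z =
      (LINT \<phi>|lborel. (w / (of_real (pi * \<sigma>) * (1 - w\<^sup>2))) * (indicator {0..pi} \<phi> *\<^sub>R ((1 - w\<^sup>2) / (1 + 2 * w * of_real (cos \<phi>) + w\<^sup>2))))"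
    unfolding cauchy_transform_def by (subst arcsine_integral) (simp_all only: eq cauchy_kernel_measurable)
  also have "\<dots> = (w / (of_real (pi * \<sigma>) * (1 - w\<^sup>2))) * of_real pi"
    by (simp only: integral_mult_right_zero poisson_kernel_integral[OF w(2)])
  also have "\<dots> = w / (of_real \<sigma> * (1 - w\<^sup>2))" using nz \<sigma> by simp
  finally show ?thesis .
qed

lemma arcsine_mean: "(LINT t|arcsine \<sigma>. t) = 0"
proof -
  have "(LINT \<phi>|lborel. indicator {0..pi} \<phi> *\<^sub>R cos \<phi>) = sin pi - sin 0"
    by (intro integral_FTC_Icc) (auto intro!: continuous_intros derivative_eq_intros
         simp: has_real_derivative_iff_has_vector_derivative[symmetric])
  then have "(LINT \<phi>|lborel. (- 2 * \<sigma> / pi) * (indicator {0..pi} \<phi> *\<^sub>R cos \<phi>)) = 0" by simp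
  moreover have "(indicator {0..pi} \<phi> / pi) *\<^sub>R (- 2 * \<sigma> * cos \<phi>) = (- 2 * \<sigma> / pi) * (indicator {0..pi} \<phi> *\<^sub>R cos \<phi>)" for \<phi>
    by simp
  moreover have "(LINT t|arcsine \<sigma>. t) = (LINT \<phi>|lborel. (indicator {0..pi} \<phi> / pi) *\<^sub>R (- 2 * \<sigma> * cos \<phi>))"
    by (rule arcsine_integral) measurable
  ultimately show ?thesis by (simp only:)
qed

text \<open>Reduces semicircle integrals to the arcsine law, whose Cauchy transform is a Poisson
  integral.\<close>

lemma semicircle_eq_density:
  assumes \<sigma>: "0 < \<sigma>"
  shows "semicircle \<sigma> = density (arcsine \<sigma>) (\<lambda>t. ennreal ((4 * \<sigma>\<^sup>2 - t\<^sup>2) / (2 * \<sigma>\<^sup>2)))"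
proof -
  have "density (arcsine \<sigma>) (\<lambda>t. ennreal ((4 * \<sigma>\<^sup>2 - t\<^sup>2) / (2 * \<sigma>\<^sup>2))) =
      density lborel (\<lambda>t. ennreal (arcsine_density \<sigma> t) * ennreal ((4 * \<sigma>\<^sup>2 - t\<^sup>2) / (2 * \<sigma>\<^sup>2)))"
    unfolding arcsine_eq_density[OF \<sigma>] by (rule density_density_eq) measurable
  also have "(\<lambda>t. ennreal (arcsine_density \<sigma> t) * ennreal ((4 * \<sigma>\<^sup>2 - t\<^sup>2) / (2 * \<sigma>\<^sup>2))) =
      (\<lambda>t. ennreal (indicator {-2*\<sigma>..2*\<sigma>} t * (1 / (2 * pi * \<sigma>\<^sup>2) * sqrt (4 * \<sigma>\<^sup>2 - t\<^sup>2))))"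
  proof
    fix t
    have "arcsine_density \<sigma> t * ((4 * \<sigma>\<^sup>2 - t\<^sup>2) / (2 * \<sigma>\<^sup>2)) = indicator {-2*\<sigma>..2*\<sigma>} t * (1 / (2 * pi * \<sigma>\<^sup>2) * sqrt (4 * \<sigma>\<^sup>2 - t\<^sup>2))"
    proof (cases "t \<in> {-2*\<sigma>..2*\<sigma>}")
      case True
      then have "\<bar>t\<bar> \<le> \<bar>2 * \<sigma>\<bar>" by auto
      then have "t\<^sup>2 \<le> (2 * \<sigma>)\<^sup>2" by (rule abs_le_square_iff[THEN iffD1])
      then have q: "0 \<le> 4 * \<sigma>\<^sup>2 - t\<^sup>2" by (simp add: power_mult_distrib)
      then have "4 * \<sigma>\<^sup>2 - t\<^sup>2 = sqrt (4 * \<sigma>\<^sup>2 - t\<^sup>2) * sqrt (4 * \<sigma>\<^sup>2 - t\<^sup>2)" by simp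
      then have "(4 * \<sigma>\<^sup>2 - t\<^sup>2) / sqrt (4 * \<sigma>\<^sup>2 - t\<^sup>2) = sqrt (4 * \<sigma>\<^sup>2 - t\<^sup>2)" by (metis nonzero_mult_div_cancel_right div_by_0)
      moreover have "arcsine_density \<sigma> t * ((4 * \<sigma>\<^sup>2 - t\<^sup>2) / (2 * \<sigma>\<^sup>2)) =
          1 / (2 * pi * \<sigma>\<^sup>2) * ((4 * \<sigma>\<^sup>2 - t\<^sup>2) / sqrt (4 * \<sigma>\<^sup>2 - t\<^sup>2))"
        using True by (simp add: arcsine_density_def)
      ultimately show ?thesis using True by simp
    qed (simp add: arcsine_density_def)
    then show "ennreal (arcsine_density \<sigma> t) * ennreal ((4 * \<sigma>\<^sup>2 - t\<^sup>2) / (2 * \<sigma>\<^sup>2)) =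
        ennreal (indicator {-2*\<sigma>..2*\<sigma>} t * (1 / (2 * pi * \<sigma>\<^sup>2) * sqrt (4 * \<sigma>\<^sup>2 - t\<^sup>2)))"
      by (simp only: ennreal_mult'[OF arcsine_density_nonneg, symmetric])
  qed
  finally show ?thesis by (simp add: semicircle_def)
qed

lemma semicircle_integral:
  fixes f :: "real \<Rightarrow> 'b::{banach, second_countable_topology}"
  assumes \<sigma>: "0 < \<sigma>" and [measurable]: "f \<in> borel_measurable borel"
  shows "(LINT t|semicircle \<sigma>. f t) = (LINT t|arcsine \<sigma>. ((4 * \<sigma>\<^sup>2 - t\<^sup>2) / (2 * \<sigma>\<^sup>2)) *\<^sub>R f t)"
  unfolding semicircle_eq_density[OF \<sigma>]
proof (rule integral_density)
  have [measurable_cong]: "sets (arcsine \<sigma>) = sets borel" by (simp add: arcsine_def)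
  show "f \<in> borel_measurable (arcsine \<sigma>)" "(\<lambda>t. (4 * \<sigma>\<^sup>2 - t\<^sup>2) / (2 * \<sigma>\<^sup>2)) \<in> borel_measurable (arcsine \<sigma>)"
    by measurable
  show "AE t in arcsine \<sigma>. 0 \<le> (4 * \<sigma>\<^sup>2 - t\<^sup>2) / (2 * \<sigma>\<^sup>2)"
    using arcsine_AE[OF \<sigma>]
  proof eventually_elim
    case (elim t)
    then have "\<bar>t\<bar> \<le> \<bar>2 * \<sigma>\<bar>" by auto
    then have "t\<^sup>2 \<le> (2 * \<sigma>)\<^sup>2" by (rule abs_le_square_iff[THEN iffD1])
    then show ?case by (simp add: power_mult_distrib)
  qed
qed

lemma semicircle_cauchy:
  fixes z w :: complex
  assumes \<sigma>: "0 < \<sigma>" and w: "w \<noteq> 0" "norm w < 1" "z = of_real \<sigma> * (w + 1 / w)"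
  shows "cauchy_transform (semicircle \<sigma>) z = w / of_real \<sigma>"
proof -
  note props = joukowski_props[OF \<sigma> w]
  interpret prob_space "arcsine \<sigma>" using arcsine_prob by (simp add: borel_prob_def)
  obtain B where B: "\<And>t. t \<in> {-2*\<sigma>..2*\<sigma>} \<Longrightarrow> norm (1 / (z - complex_of_real t)) \<le> B"
    using off_segment_bound[OF props(2)] by blast
  have i1: "integrable (arcsine \<sigma>) (\<lambda>t. 1 / (z - complex_of_real t))"
    by (rule arcsine_integrable[OF \<sigma> cauchy_kernel_measurable B])
  have i2: "integrable (arcsine \<sigma>) (\<lambda>t. complex_of_real t)"
    by (rule arcsine_integrable[OF \<sigma>, where B = "2 * \<sigma>"]) auto
  have "cauchy_transform (semicircle \<sigma>) z = (LINT t|arcsine \<sigma>. ((4 * \<sigma>\<^sup>2 - t\<^sup>2) / (2 * \<sigma>\<^sup>2)) *\<^sub>R (1 / (z - of_real t)))"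
    unfolding cauchy_transform_def by (rule semicircle_integral[OF \<sigma> cauchy_kernel_measurable])
  \<comment> \<open>Division of \<open>4 * \<sigma>\<^sup>2 - t\<^sup>2\<close> by
    \<open>z - t\<close>: the remainder gives the arcsine transform, and the quotient
    \<open>z + t\<close> has mean \<open>z\<close>.\<close>
  also have "\<dots> = (LINT t|arcsine \<sigma>. (1 / (2 * (of_real \<sigma>)\<^sup>2)) * ((4 * (of_real \<sigma>)\<^sup>2 - z\<^sup>2) * (1 / (z - of_real t)) + (z + of_real t)))"
  proof (rule integral_cong_AE)
    show "AE t in arcsine \<sigma>. ((4 * \<sigma>\<^sup>2 - t\<^sup>2) / (2 * \<sigma>\<^sup>2)) *\<^sub>R (1 / (z - of_real t)) =
        (1 / (2 * (of_real \<sigma>)\<^sup>2)) * ((4 * (of_real \<sigma>)\<^sup>2 - z\<^sup>2) * (1 / (z - of_real t)) + (z + of_real t))"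
      using arcsine_AE[OF \<sigma>]
    proof eventually_elim
      case (elim t)
      then have "z - of_real t \<noteq> 0" using props(2) by auto
      then show ?case using \<sigma> by (simp add: scaleR_conv_of_real divide_simps) (simp add: algebra_simps power2_eq_square)
    qed
  qed (use i1 i2 in \<open>auto simp: finite_borel_measurable[OF borel_prob_finite_borel[OF arcsine_prob]]\<close>)
  also have "\<dots> = (1 / (2 * (of_real \<sigma>)\<^sup>2)) * ((4 * (of_real \<sigma>)\<^sup>2 - z\<^sup>2) * cauchy_transform (arcsine \<sigma>) z + z)"
  proof -
    have "(LINT t|arcsine \<sigma>. K * (1 / (z - of_real t)) + (z + of_real t)) =
        K * (LINT t|arcsine \<sigma>. 1 / (z - of_real t)) + (LINT t|arcsine \<sigma>. z + of_real t)" for K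
      by (subst Bochner_Integration.integral_add[OF integrable_mult_right[OF i1]])
         (use i2 in \<open>auto simp only: integral_mult_right_zero intro!: Bochner_Integration.integrable_add integrable_const\<close>)
    moreover have "(LINT t|arcsine \<sigma>. z + of_real t) = z"
      using i2 by (simp add: arcsine_mean prob_space)
    ultimately show ?thesis by (simp only: cauchy_transform_def integral_mult_right_zero)
  qed
  also have "\<dots> = w / of_real \<sigma>"
  proof -
    have "(4 * s\<^sup>2 - (s * (w + 1 / w))\<^sup>2) * (w / (s * (1 - w\<^sup>2))) + s * (w + 1 / w) = 2 * s * w" if "s \<noteq> 0" for s
    proof -
      have "4 * s\<^sup>2 - (s * (w + 1 / w))\<^sup>2 = - (s\<^sup>2 * (1 - w\<^sup>2)\<^sup>2 / w\<^sup>2)"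
        using w(1) by (simp add: field_simps power2_eq_square)
      then have "(4 * s\<^sup>2 - (s * (w + 1 / w))\<^sup>2) * (w / (s * (1 - w\<^sup>2))) = - (s * (1 - w\<^sup>2) / w)"
        using w(1) props(1) that by (simp add: power2_eq_square)
      then show ?thesis using w(1) by (simp add: field_simps power2_eq_square)
    qed
    from this[of "of_real \<sigma>"] show ?thesis
      unfolding arcsine_cauchy[OF \<sigma> w] unfolding w(3) using \<sigma> by (simp add: power2_eq_square)
  qed
  finally show ?thesis .
qed

section \<open>The measures nu as weights relative to the arcsine law\<close>

definition nu_weight :: "real \<Rightarrow> real \<Rightarrow> real \<Rightarrow> real" where
  "nu_weight \<sigma> \<theta> t = \<theta> * (t - 2 * \<theta>) / (2 * (\<theta> * (t - \<theta>) - \<sigma>\<^sup>2))"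

text \<open>\<open>ennreal\<close> truncates negative values to 0, so for a weight of varying sign
  this is only the positive part; the negative part comes from the weight
  \<open>- g\<close>.\<close>

definition weighted_arcsine :: "real \<Rightarrow> (real \<Rightarrow> real) \<Rightarrow> real measure" where
  "weighted_arcsine \<sigma> g = density (arcsine \<sigma>) (\<lambda>t. ennreal (g t))"

lemma nu_density_eq: "nu_density \<sigma> \<theta> t = arcsine_density \<sigma> t * nu_weight \<sigma> \<theta> t"
  unfolding nu_density_def arcsine_density_def nu_weight_def
  by (simp only: times_divide_eq_left times_divide_eq_right divide_divide_eq_left mult_1_left mult_1_right mult_ac)

lemma nu_weight_measurable [measurable]: "nu_weight \<sigma> \<theta> \<in> borel_measurable borel"
  unfolding nu_weight_def by measurable

text \<open>Since \<open>\<bar>t\<bar> \<le> 2 * \<sigma>\<close>, completing the square bounds the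
  denominator of the density; it can vanish only if
  \<open>\<bar>\<theta>\<bar> = \<sigma>\<close>.\<close>

lemma nu_denominator:
  fixes \<sigma> \<theta> t :: real
  assumes "t \<in> {-2*\<sigma>..2*\<sigma>}"
  shows "\<theta> * (t - \<theta>) - \<sigma>\<^sup>2 \<le> - ((\<bar>\<theta>\<bar> - \<sigma>)\<^sup>2)"
proof -
  have "\<theta> * t \<le> \<bar>\<theta>\<bar> * \<bar>t\<bar>" using abs_ge_self[of "\<theta> * t"] by (simp only: abs_mult)
  also have "\<dots> \<le> \<bar>\<theta>\<bar> * (2 * \<sigma>)" using assms by (intro mult_left_mono) auto
  finally have "\<theta> * t \<le> 2 * \<bar>\<theta>\<bar> * \<sigma>" by (simp only: mult_ac)
  moreover have "(\<bar>\<theta>\<bar> - \<sigma>)\<^sup>2 = \<theta>\<^sup>2 + \<sigma>\<^sup>2 - 2 * \<bar>\<theta>\<bar> * \<sigma>" by (simp add: power2_diff)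
  moreover have "\<theta> * (t - \<theta>) = \<theta> * t - \<theta>\<^sup>2" by (simp add: right_diff_distrib power2_eq_square)
  ultimately show ?thesis by linarith
qed

text \<open>Partial fractions in \<open>t\<close>, with the pole at the outlier when
  \<open>\<theta> \<noteq> 0\<close>. For \<open>\<bar>\<theta>\<bar> = \<sigma>\<close> only the
  constant 1/2 survives.\<close>

lemma nu_weight_eq:
  assumes "\<theta> * (t - \<theta>) - \<sigma>\<^sup>2 \<noteq> 0"
  shows "nu_weight \<sigma> \<theta> t = 1 / 2 + (\<theta>\<^sup>2 - \<sigma>\<^sup>2) / (2 * (\<sigma>\<^sup>2 + \<theta>\<^sup>2 - \<theta> * t))"
proof -
  have "\<sigma>\<^sup>2 + \<theta>\<^sup>2 - \<theta> * t = - (\<theta> * (t - \<theta>) - \<sigma>\<^sup>2)" by (simp add: algebra_simps power2_eq_square)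
  then have "1 / 2 + (\<theta>\<^sup>2 - \<sigma>\<^sup>2) / (2 * (\<sigma>\<^sup>2 + \<theta>\<^sup>2 - \<theta> * t)) = 1 / 2 - (\<theta>\<^sup>2 - \<sigma>\<^sup>2) / (2 * (\<theta> * (t - \<theta>) - \<sigma>\<^sup>2))"
    by (simp only: mult_minus_right minus_divide_right[symmetric] add_uminus_conv_diff)
  also have "\<dots> = ((\<theta> * (t - \<theta>) - \<sigma>\<^sup>2) - (\<theta>\<^sup>2 - \<sigma>\<^sup>2)) / (2 * (\<theta> * (t - \<theta>) - \<sigma>\<^sup>2))"
  proof -
    have "1 / 2 - E / (2 * D) = (D - E) / (2 * D)" if "D \<noteq> 0" for D E :: real
      using that by (simp add: field_simps)
    from this[OF assms] show ?thesis .
  qed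
  also have "(\<theta> * (t - \<theta>) - \<sigma>\<^sup>2) - (\<theta>\<^sup>2 - \<sigma>\<^sup>2) = \<theta> * (t - 2 * \<theta>)"
    by (simp add: algebra_simps power2_eq_square)
  finally show ?thesis by (simp add: nu_weight_def)
qed

lemma nu_denominator_nonzero:
  fixes \<sigma> \<theta> t :: real
  assumes "0 < \<sigma>" "t \<in> {-2*\<sigma><..<2*\<sigma>}"
  shows "\<theta> * (t - \<theta>) - \<sigma>\<^sup>2 < 0"
proof (cases "\<bar>\<theta>\<bar> = \<sigma>")
  case False
  then have "0 < (\<bar>\<theta>\<bar> - \<sigma>)\<^sup>2" by simp
  moreover have "t \<in> {-2*\<sigma>..2*\<sigma>}" using assms by auto
  ultimately show ?thesis using nu_denominator[of t \<sigma> \<theta>] by linarith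
next
  case True
  then have "\<theta> * t < 2 * \<sigma> * \<sigma>" using assms
    by (auto simp: abs_if split: if_splits)
  moreover have "\<theta> * \<theta> = \<sigma> * \<sigma>" using True by (metis abs_mult_self_eq)
  ultimately show ?thesis by (simp add: algebra_simps power2_eq_square)
qed

lemma nu_weight_bounded:
  assumes \<sigma>: "0 < \<sigma>"
  shows "\<exists>B. \<forall>t\<in>{-2*\<sigma>..2*\<sigma>}. \<bar>nu_weight \<sigma> \<theta> t\<bar> \<le> B"
proof (cases "\<bar>\<theta>\<bar> = \<sigma>")
  case False
  then have "0 < (\<bar>\<theta>\<bar> - \<sigma>)\<^sup>2" by simp
  then have "\<theta> * (t - \<theta>) - \<sigma>\<^sup>2 \<noteq> 0" if "t \<in> {-2*\<sigma>..2*\<sigma>}" for t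
    using nu_denominator[OF that, of \<theta>] by auto
  then have "continuous_on {-2*\<sigma>..2*\<sigma>} (nu_weight \<sigma> \<theta>)"
    unfolding nu_weight_def by (intro continuous_intros) auto
  then have "bounded (nu_weight \<sigma> \<theta> ` {-2*\<sigma>..2*\<sigma>})"
    by (intro compact_imp_bounded compact_continuous_image) auto
  then show ?thesis by (auto simp: bounded_iff)
next
  case True
  then have "\<theta>\<^sup>2 = \<sigma>\<^sup>2" by (metis power2_abs)
  then have "\<bar>nu_weight \<sigma> \<theta> t\<bar> \<le> 1 / 2" for t
  \<comment> \<open>Where the denominator vanishes, division by 0 makes the weight 0.\<close>
  proof (cases "\<theta> * (t - \<theta>) - \<sigma>\<^sup>2 = 0")
    case True
    then have "nu_weight \<sigma> \<theta> t = 0" unfolding nu_weight_def by (simp only:) simp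
    then show ?thesis by simp
  next
    case False
    then have "nu_weight \<sigma> \<theta> t = 1 / 2" unfolding nu_weight_eq[OF False] \<open>\<theta>\<^sup>2 = \<sigma>\<^sup>2\<close> by simp
    then show ?thesis by simp
  qed
  then show ?thesis by blast
qed

context
  fixes \<sigma> :: real and g :: "real \<Rightarrow> real" and B :: real
  assumes \<sigma>: "0 < \<sigma>" and g [measurable]: "g \<in> borel_measurable borel"
    and gB: "\<And>t. t \<in> {-2*\<sigma>..2*\<sigma>} \<Longrightarrow> \<bar>g t\<bar> \<le> B"
begin

lemma weighted_arcsine_finite: "finite_borel (weighted_arcsine \<sigma> g)"
proof -
  interpret prob_space "arcsine \<sigma>" using arcsine_prob by (simp add: borel_prob_def)
  have [measurable_cong]: "sets (arcsine \<sigma>) = sets borel" by (simp add: arcsine_def)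
  have "emeasure (weighted_arcsine \<sigma> g) (space (weighted_arcsine \<sigma> g)) = (\<integral>\<^sup>+t. ennreal (g t) \<partial>arcsine \<sigma>)"
    unfolding weighted_arcsine_def by (subst emeasure_density) (auto intro!: nn_integral_cong)
  also have "\<dots> \<le> (\<integral>\<^sup>+t. ennreal B \<partial>arcsine \<sigma>)"
  proof (rule nn_integral_mono_AE)
    show "AE t in arcsine \<sigma>. ennreal (g t) \<le> ennreal B"
      using arcsine_AE[OF \<sigma>]
    proof eventually_elim
      case (elim t)
      then show ?case using gB[of t] by (intro ennreal_leI) auto
    qed
  qed
  also have "\<dots> < \<infinity>" by (simp add: emeasure_space_1)
  finally have "finite_measure (weighted_arcsine \<sigma> g)" by (intro finite_measureI) simp
  then show ?thesis by (simp add: finite_borel_def weighted_arcsine_def arcsine_def)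
qed

lemma weighted_arcsine_integral:
  fixes f :: "real \<Rightarrow> 'b::{banach, second_countable_topology}"
  assumes [measurable]: "f \<in> borel_measurable borel"
  shows "(LINT t|weighted_arcsine \<sigma> g. f t) = (LINT t|arcsine \<sigma>. max 0 (g t) *\<^sub>R f t)"
proof -
  have [measurable_cong]: "sets (arcsine \<sigma>) = sets borel" by (simp add: arcsine_def)
  have eq: "(\<lambda>t. ennreal (g t)) = (\<lambda>t. ennreal (max 0 (g t)))"
    by (auto simp: fun_eq_iff max_def ennreal_neg)
  show ?thesis unfolding weighted_arcsine_def eq by (rule integral_density) auto
qed

lemma weighted_arcsine_outside:
  assumes "{-2*\<sigma>..2*\<sigma>} \<subseteq> K" "K \<in> sets borel"
  shows "measure (weighted_arcsine \<sigma> g) (- K) = 0"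
proof -
  have [measurable_cong]: "sets (arcsine \<sigma>) = sets borel" by (simp add: arcsine_def)
  have K: "- K \<in> sets (arcsine \<sigma>)" using assms by (simp add: arcsine_def)
  have "emeasure (weighted_arcsine \<sigma> g) (- K) = (\<integral>\<^sup>+t. ennreal (g t) * indicator (- K) t \<partial>arcsine \<sigma>)"
    unfolding weighted_arcsine_def using K by (subst emeasure_density) auto
  also have "\<dots> = (\<integral>\<^sup>+t. 0 \<partial>arcsine \<sigma>)"
  proof (rule nn_integral_cong_AE)
    show "AE t in arcsine \<sigma>. ennreal (g t) * indicator (- K) t = 0"
      using arcsine_AE[OF \<sigma>] by eventually_elim (use assms in \<open>auto simp: subset_eq split: split_indicator\<close>)
  qed
  finally show ?thesis by (simp add: measure_def)
qed

end

lemma weighted_arcsine_comb_int: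
  fixes f :: "real \<Rightarrow> 'b::{banach, second_countable_topology}"
  assumes \<sigma>: "0 < \<sigma>" and g: "g \<in> borel_measurable borel" "\<And>t. t \<in> {-2*\<sigma>..2*\<sigma>} \<Longrightarrow> \<bar>g t\<bar> \<le> B"
    and f: "f \<in> borel_measurable borel" "\<And>t. t \<in> {-2*\<sigma>..2*\<sigma>} \<Longrightarrow> norm (f t) \<le> B'"
  shows "comb_int [(1, weighted_arcsine \<sigma> g), (-1, weighted_arcsine \<sigma> (\<lambda>t. - g t))] f = (LINT t|arcsine \<sigma>. g t *\<^sub>R f t)"
proof -
  note [measurable] = g(1) f(1)
  have B: "0 \<le> B" "0 \<le> B'" using g(2)[of 0] f(2)[of 0] \<sigma> order_trans[OF norm_ge_zero] by fastforce+
  have int: "integrable (arcsine \<sigma>) (\<lambda>t. max 0 (g' t) *\<^sub>R f t)"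
    if [measurable]: "g' \<in> borel_measurable borel" and "\<And>t. t \<in> {-2*\<sigma>..2*\<sigma>} \<Longrightarrow> \<bar>g' t\<bar> \<le> B" for g'
  proof (rule arcsine_integrable[OF \<sigma>, where B = "B * B'"])
    fix t assume t: "t \<in> {-2*\<sigma>..2*\<sigma>}"
    have "\<bar>max 0 (g' t)\<bar> \<le> B" using that(2)[OF t] B by (auto simp: max_def)
    then show "norm (max 0 (g' t) *\<^sub>R f t) \<le> B * B'"
      using f(2)[OF t] B by (auto intro!: mult_mono)
  qed measurable
  have "(LINT t|arcsine \<sigma>. max 0 (g t) *\<^sub>R f t) - (LINT t|arcsine \<sigma>. max 0 (- g t) *\<^sub>R f t) =
      (LINT t|arcsine \<sigma>. max 0 (g t) *\<^sub>R f t - max 0 (- g t) *\<^sub>R f t)"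
    using int[of g] int[of "\<lambda>t. - g t"] g by (subst Bochner_Integration.integral_diff) auto
  also have "\<dots> = (LINT t|arcsine \<sigma>. g t *\<^sub>R f t)"
    by (intro Bochner_Integration.integral_cong refl) (auto simp: max_def scaleR_left_diff_distrib[symmetric])
  finally have "(LINT t|arcsine \<sigma>. max 0 (g t) *\<^sub>R f t) - (LINT t|arcsine \<sigma>. max 0 (- g t) *\<^sub>R f t) =
      (LINT t|arcsine \<sigma>. g t *\<^sub>R f t)" .
  moreover have "(LINT t|weighted_arcsine \<sigma> g. f t) = (LINT t|arcsine \<sigma>. max 0 (g t) *\<^sub>R f t)"
    by (rule weighted_arcsine_integral[OF \<sigma> g f(1)])
  moreover have "(LINT t|weighted_arcsine \<sigma> (\<lambda>t. - g t). f t) = (LINT t|arcsine \<sigma>. max 0 (- g t) *\<^sub>R f t)"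
    by (rule weighted_arcsine_integral[OF \<sigma>, where B = B]) (use g f in auto)
  ultimately show ?thesis by simp
qed

lemma signed_density_arcsine:
  assumes \<sigma>: "0 < \<sigma>" and g [measurable]: "g \<in> borel_measurable borel"
  shows "signed_density (\<lambda>t. arcsine_density \<sigma> t * g t) A = (if A \<in> sets borel then LINT t|arcsine \<sigma>. g t * indicator A t else 0)"
proof (cases "A \<in> sets borel")
  case True
  then have [measurable]: "A \<in> sets borel" .
  have "(LINT t|arcsine \<sigma>. g t * indicator A t) = (LINT t|lborel. arcsine_density \<sigma> t *\<^sub>R (g t * indicator A t))"
    unfolding arcsine_eq_density[OF \<sigma>] by (intro integral_density) (auto simp: arcsine_density_nonneg)
  also have "\<dots> = (LINT t:A|lborel. arcsine_density \<sigma> t * g t)"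
    by (simp add: set_lebesgue_integral_def mult_ac)
  finally show ?thesis using True by (simp add: signed_density_def)
qed (simp add: signed_density_def)

lemma signed_density_comb:
  assumes \<sigma>: "0 < \<sigma>" and g: "g \<in> borel_measurable borel" "\<And>t. t \<in> {-2*\<sigma>..2*\<sigma>} \<Longrightarrow> \<bar>g t\<bar> \<le> B"
  shows "signed_density (\<lambda>t. arcsine_density \<sigma> t * g t) = comb [(1, weighted_arcsine \<sigma> g), (-1, weighted_arcsine \<sigma> (\<lambda>t. - g t))]"
proof
  fix A
  have fin: "finite_borel (weighted_arcsine \<sigma> g)" "finite_borel (weighted_arcsine \<sigma> (\<lambda>t. - g t))"
    using g by (auto intro!: weighted_arcsine_finite[OF \<sigma>, where B = B])
  show "signed_density (\<lambda>t. arcsine_density \<sigma> t * g t) A = comb [(1, weighted_arcsine \<sigma> g), (-1, weighted_arcsine \<sigma> (\<lambda>t. - g t))] A"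
  proof (cases "A \<in> sets borel")
    case True
    have "comb_int [(1, weighted_arcsine \<sigma> g), (-1, weighted_arcsine \<sigma> (\<lambda>t. - g t))] (indicator A :: real \<Rightarrow> real) = (LINT t|arcsine \<sigma>. g t *\<^sub>R indicator A t)"
      using True by (intro weighted_arcsine_comb_int[OF \<sigma> g, where B' = 1]) (auto split: split_indicator)
    then show ?thesis
      using True fin by (simp add: signed_density_arcsine[OF \<sigma> g(1)] finite_borel_space)
  next
    case False
    then show ?thesis using fin by (simp add: signed_density_def finite_borel_def measure_notin_sets)
  qed
qed

definition nu_rep :: "real \<Rightarrow> real \<Rightarrow> (real \<times> real measure) list" where
  "nu_rep \<sigma> \<theta> = [(1, weighted_arcsine \<sigma> (nu_weight \<sigma> \<theta>)), (-1, weighted_arcsine \<sigma> (\<lambda>t. - nu_weight \<sigma> \<theta> t))]"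

text \<open>The contribution of one spike to the second component of the limit. The weight of the
  atom equals the mass of \<open>\<nu>\<close>, so the total mass is 0 for every
  \<open>\<theta>\<close>.\<close>

definition outlier_rep :: "real \<Rightarrow> real \<Rightarrow> (real \<times> real measure) list" where
  "outlier_rep \<sigma> \<theta> = (if \<bar>\<theta>\<bar> \<ge> \<sigma> then [(outlier_weight \<sigma> \<theta>, return borel (\<theta> + \<sigma>\<^sup>2 / \<theta>))] else []) @
     map (\<lambda>(c, \<mu>). (- c, \<mu>)) (nu_rep \<sigma> \<theta>)"

lemma nu_eq_comb:
  assumes \<sigma>: "0 < \<sigma>"
  shows "nu \<sigma> \<theta> = comb (nu_rep \<sigma> \<theta>)"
proof -
  obtain B where B: "\<And>t. t \<in> {-2*\<sigma>..2*\<sigma>} \<Longrightarrow> \<bar>nu_weight \<sigma> \<theta> t\<bar> \<le> B" using nu_weight_bounded[OF \<sigma>] by blast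
  show ?thesis
    unfolding nu_def nu_rep_def nu_density_eq[abs_def] by (rule signed_density_comb[OF \<sigma> nu_weight_measurable B])
qed

lemma borels_nu_rep: "0 < \<sigma> \<Longrightarrow> borels (nu_rep \<sigma> \<theta>)"
  using nu_weight_bounded[of \<sigma> \<theta>] by (auto simp: nu_rep_def intro!: weighted_arcsine_finite)

lemma borels_outlier_rep: "0 < \<sigma> \<Longrightarrow> borels (outlier_rep \<sigma> \<theta>)"
  using borels_nu_rep[of \<sigma> \<theta>] by (auto simp: outlier_rep_def)

lemma nu_rep_integral:
  fixes f :: "real \<Rightarrow> 'b::{banach, second_countable_topology}"
  assumes \<sigma>: "0 < \<sigma>" and f: "f \<in> borel_measurable borel" "\<And>t. t \<in> {-2*\<sigma>..2*\<sigma>} \<Longrightarrow> norm (f t) \<le> B'"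
  shows "comb_int (nu_rep \<sigma> \<theta>) f = (LINT t|arcsine \<sigma>. nu_weight \<sigma> \<theta> t *\<^sub>R f t)"
proof -
  obtain B where "\<And>t. t \<in> {-2*\<sigma>..2*\<sigma>} \<Longrightarrow> \<bar>nu_weight \<sigma> \<theta> t\<bar> \<le> B" using nu_weight_bounded[OF \<sigma>] by blast
  then show ?thesis unfolding nu_rep_def by (intro weighted_arcsine_comb_int[OF \<sigma> _ _ f]) auto
qed

text \<open>With \<open>f\<close> constant this gives the mass of \<open>\<nu>\<close>, with
  \<open>f\<close> a resolvent its Cauchy transform; both reduce to values of the arcsine
  transform.\<close>

lemma nu_rep_cauchy_aux:
  fixes f :: "real \<Rightarrow> complex"
  assumes \<sigma>: "0 < \<sigma>" and \<theta>: "\<theta> \<noteq> 0" and f: "f \<in> borel_measurable borel" "\<And>t. t \<in> {-2*\<sigma>..2*\<sigma>} \<Longrightarrow> norm (f t) \<le> B'"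
  shows "comb_int (nu_rep \<sigma> \<theta>) f = (1 / 2) * (LINT t|arcsine \<sigma>. f t) +
     of_real ((\<theta>\<^sup>2 - \<sigma>\<^sup>2) / (2 * \<theta>)) * (LINT t|arcsine \<sigma>. f t / (of_real (\<theta> + \<sigma>\<^sup>2 / \<theta>) - of_real t))"
proof (cases "\<bar>\<theta>\<bar> = \<sigma>")
  case True
  then have eq: "\<theta>\<^sup>2 = \<sigma>\<^sup>2" by (metis power2_abs)
  have "(LINT t|arcsine \<sigma>. nu_weight \<sigma> \<theta> t *\<^sub>R f t) = (LINT t|arcsine \<sigma>. (1 / 2) * f t)"
  proof (rule integral_cong_AE)
    show "AE t in arcsine \<sigma>. nu_weight \<sigma> \<theta> t *\<^sub>R f t = (1 / 2) * f t"
      using arcsine_AE[OF \<sigma>]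
    proof eventually_elim
      case (elim t)
      have D: "\<theta> * (t - \<theta>) - \<sigma>\<^sup>2 \<noteq> 0" using nu_denominator_nonzero[OF \<sigma> elim, of \<theta>] by simp
      have nw: "nu_weight \<sigma> \<theta> t = 1 / 2" unfolding nu_weight_eq[OF D] eq by simp
      show ?case unfolding nw by (simp add: scaleR_conv_of_real)
    qed
  qed (use f(1) in \<open>auto simp: finite_borel_measurable[OF borel_prob_finite_borel[OF arcsine_prob]]\<close>)
  moreover have "comb_int (nu_rep \<sigma> \<theta>) f = (LINT t|arcsine \<sigma>. nu_weight \<sigma> \<theta> t *\<^sub>R f t)"
    by (rule nu_rep_integral[OF \<sigma> f])
  ultimately show ?thesis by (simp add: eq)
next
  case False
  let ?\<rho> = "\<theta> + \<sigma>\<^sup>2 / \<theta>"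
  have D: "\<theta> * (t - \<theta>) - \<sigma>\<^sup>2 \<noteq> 0" "\<theta> * (?\<rho> - t) = - (\<theta> * (t - \<theta>) - \<sigma>\<^sup>2)" "?\<rho> - t \<noteq> 0" if "t \<in> {-2*\<sigma>..2*\<sigma>}" for t
  proof -
    have "0 < (\<bar>\<theta>\<bar> - \<sigma>)\<^sup>2" using False by simp
    then show 1: "\<theta> * (t - \<theta>) - \<sigma>\<^sup>2 \<noteq> 0" using nu_denominator[OF that, of \<theta>] by auto
    show 2: "\<theta> * (?\<rho> - t) = - (\<theta> * (t - \<theta>) - \<sigma>\<^sup>2)" using \<theta> by (simp add: field_simps power2_eq_square)
    show "?\<rho> - t \<noteq> 0" using 1 2 by auto
  qed
  have "complex_of_real ?\<rho> \<notin> of_real ` {-2*\<sigma>..2*\<sigma>}" using D(3) by (auto simp: image_iff simp del: of_real_add)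
  from off_segment_bound[OF this] obtain B where B: "\<And>t. t \<in> {-2*\<sigma>..2*\<sigma>} \<Longrightarrow> norm (1 / (of_real ?\<rho> - complex_of_real t)) \<le> B"
    by blast
  have i1: "integrable (arcsine \<sigma>) f" using f by (intro arcsine_integrable[OF \<sigma>])
  have i2: "integrable (arcsine \<sigma>) (\<lambda>t. f t / (of_real ?\<rho> - of_real t))"
  proof (rule arcsine_integrable[OF \<sigma>, where B = "B' * B"])
    show "norm (f t / (of_real ?\<rho> - of_real t)) \<le> B' * B" if "t \<in> {-2*\<sigma>..2*\<sigma>}" for t
    proof -
      have "norm (f t) * norm (1 / (of_real ?\<rho> - complex_of_real t)) \<le> B' * B"
        using f(2)[OF that] B[OF that] order_trans[OF norm_ge_zero f(2)[OF that]] by (intro mult_mono) auto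
      then show ?thesis by (simp add: norm_divide)
    qed
  qed (use f(1) in measurable)
  have "(LINT t|arcsine \<sigma>. nu_weight \<sigma> \<theta> t *\<^sub>R f t) = (LINT t|arcsine \<sigma>. (1 / 2) * f t +
      of_real ((\<theta>\<^sup>2 - \<sigma>\<^sup>2) / (2 * \<theta>)) * (f t / (of_real ?\<rho> - of_real t)))"
  proof (rule integral_cong_AE)
    show "AE t in arcsine \<sigma>. nu_weight \<sigma> \<theta> t *\<^sub>R f t = (1 / 2) * f t +
      of_real ((\<theta>\<^sup>2 - \<sigma>\<^sup>2) / (2 * \<theta>)) * (f t / (of_real ?\<rho> - of_real t))"
      using arcsine_AE[OF \<sigma>]
    proof eventually_elim
      case (elim t)
      then have t: "t \<in> {-2*\<sigma>..2*\<sigma>}" by auto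
      have "\<sigma>\<^sup>2 + \<theta>\<^sup>2 - \<theta> * t = \<theta> * (?\<rho> - t)" using \<theta> by (simp add: field_simps power2_eq_square)
      then have "nu_weight \<sigma> \<theta> t = 1 / 2 + (\<theta>\<^sup>2 - \<sigma>\<^sup>2) / (2 * \<theta>) * (1 / (?\<rho> - t))"
        using nu_weight_eq[OF D(1)[OF t]] by simp
      then have "complex_of_real (nu_weight \<sigma> \<theta> t) = 1 / 2 + of_real ((\<theta>\<^sup>2 - \<sigma>\<^sup>2) / (2 * \<theta>)) * (1 / (of_real ?\<rho> - of_real t))"
        by (simp only: of_real_add of_real_mult of_real_divide of_real_1 of_real_numeral of_real_diff)
      then show ?case by (simp only: scaleR_conv_of_real) (simp add: algebra_simps)
    qed
  qed (use f(1) i2 in \<open>auto simp: finite_borel_measurable[OF borel_prob_finite_borel[OF arcsine_prob]]\<close>)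
  also have "\<dots> = (1 / 2) * (LINT t|arcsine \<sigma>. f t) +
     of_real ((\<theta>\<^sup>2 - \<sigma>\<^sup>2) / (2 * \<theta>)) * (LINT t|arcsine \<sigma>. f t / (of_real ?\<rho> - of_real t))"
    by (subst Bochner_Integration.integral_add[OF integrable_mult_right[OF i1] integrable_mult_right[OF i2]])
       (simp only: integral_mult_right_zero)
  finally have "(LINT t|arcsine \<sigma>. nu_weight \<sigma> \<theta> t *\<^sub>R f t) = (1 / 2) * (LINT t|arcsine \<sigma>. f t) +
     of_real ((\<theta>\<^sup>2 - \<sigma>\<^sup>2) / (2 * \<theta>)) * (LINT t|arcsine \<sigma>. f t / (of_real ?\<rho> - of_real t))" .
  moreover have "comb_int (nu_rep \<sigma> \<theta>) f = (LINT t|arcsine \<sigma>. nu_weight \<sigma> \<theta> t *\<^sub>R f t)"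
    by (rule nu_rep_integral[OF \<sigma> f])
  ultimately show ?thesis by (simp only:)
qed

text \<open>The outlier is the Joukowski image of both \<open>\<theta> / \<sigma>\<close> and
  \<open>\<sigma> / \<theta>\<close>; the formula for the arcsine transform needs the one inside the
  unit disc, hence the two cases.\<close>

lemma arcsine_cauchy_outlier:
  assumes \<sigma>: "0 < \<sigma>" and \<theta>: "\<theta> \<noteq> 0" "\<bar>\<theta>\<bar> \<noteq> \<sigma>"
  shows "cauchy_transform (arcsine \<sigma>) (of_real (\<theta> + \<sigma>\<^sup>2 / \<theta>)) =
     of_real (if \<bar>\<theta>\<bar> < \<sigma> then \<theta> / (\<sigma>\<^sup>2 - \<theta>\<^sup>2) else \<theta> / (\<theta>\<^sup>2 - \<sigma>\<^sup>2))"
    and "complex_of_real (\<theta> + \<sigma>\<^sup>2 / \<theta>) \<notin> of_real ` {-2*\<sigma>..2*\<sigma>}"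
proof -
  have sq: "\<theta>\<^sup>2 \<noteq> \<sigma>\<^sup>2" using \<theta>(2) \<sigma> by (metis abs_of_pos power2_eq_iff abs_minus_cancel)
  define q where "q = (if \<bar>\<theta>\<bar> < \<sigma> then \<theta> / \<sigma> else \<sigma> / \<theta>)"
  have q: "q \<noteq> 0" "\<bar>q\<bar> < 1" "\<theta> + \<sigma>\<^sup>2 / \<theta> = \<sigma> * (q + 1 / q)"
    using \<sigma> \<theta> by (auto simp: q_def abs_divide field_simps power2_eq_square)
  have w: "complex_of_real q \<noteq> 0" "norm (complex_of_real q) < 1"
      "complex_of_real (\<theta> + \<sigma>\<^sup>2 / \<theta>) = of_real \<sigma> * (of_real q + 1 / of_real q)"
    using q(1,2) unfolding q(3) by simp_all
  show "complex_of_real (\<theta> + \<sigma>\<^sup>2 / \<theta>) \<notin> of_real ` {-2*\<sigma>..2*\<sigma>}" using joukowski_props[OF \<sigma> w] by blast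
  have "cauchy_transform (arcsine \<sigma>) (of_real (\<theta> + \<sigma>\<^sup>2 / \<theta>)) = of_real (q / (\<sigma> * (1 - q\<^sup>2)))"
    unfolding arcsine_cauchy[OF \<sigma> w] by simp
  also have "q / (\<sigma> * (1 - q\<^sup>2)) = (if \<bar>\<theta>\<bar> < \<sigma> then \<theta> / (\<sigma>\<^sup>2 - \<theta>\<^sup>2) else \<theta> / (\<theta>\<^sup>2 - \<sigma>\<^sup>2))"
    using \<sigma> \<theta>(1) sq by (auto simp: q_def field_simps power2_eq_square)
  finally show "cauchy_transform (arcsine \<sigma>) (of_real (\<theta> + \<sigma>\<^sup>2 / \<theta>)) =
     of_real (if \<bar>\<theta>\<bar> < \<sigma> then \<theta> / (\<sigma>\<^sup>2 - \<theta>\<^sup>2) else \<theta> / (\<theta>\<^sup>2 - \<sigma>\<^sup>2))" .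
qed

text \<open>For \<open>\<theta> \<noteq> 0\<close> the mass is 1/2 plus a multiple of the arcsine
  transform at the outlier. That second term is -1/2 below the threshold and 1/2 above it, because
  the transform changes branch there; at the threshold its coefficient is 0.\<close>

lemma nu_rep_mass:
  assumes \<sigma>: "0 < \<sigma>"
  shows "comb (nu_rep \<sigma> \<theta>) UNIV = (if \<bar>\<theta>\<bar> < \<sigma> then 0 else outlier_weight \<sigma> \<theta>)"
proof -
  interpret prob_space "arcsine \<sigma>" using arcsine_prob by (simp add: borel_prob_def)
  have "comb_int (nu_rep \<sigma> \<theta>) (\<lambda>_. 1 :: complex) = of_real (comb (nu_rep \<sigma> \<theta>) UNIV)"
    using borels_nu_rep[OF \<sigma>, of \<theta>] by (auto simp: nu_rep_def finite_borel_space scaleR_conv_of_real)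
  moreover have "comb_int (nu_rep \<sigma> \<theta>) (\<lambda>_. 1 :: complex) = of_real (if \<bar>\<theta>\<bar> < \<sigma> then 0 else outlier_weight \<sigma> \<theta>)"
  proof (cases "\<theta> = 0")
    case True
    then show ?thesis using \<sigma> by (subst nu_rep_integral[OF \<sigma>, where B' = 1]) (auto simp: nu_weight_def)
  next
    case False
    have "comb_int (nu_rep \<sigma> \<theta>) (\<lambda>_. 1 :: complex) = 1 / 2 +
       of_real ((\<theta>\<^sup>2 - \<sigma>\<^sup>2) / (2 * \<theta>)) * cauchy_transform (arcsine \<sigma>) (of_real (\<theta> + \<sigma>\<^sup>2 / \<theta>))"
      by (subst nu_rep_cauchy_aux[OF \<sigma> False, where B' = 1]) (auto simp: cauchy_transform_def prob_space)
    also have "\<dots> = of_real (if \<bar>\<theta>\<bar> < \<sigma> then 0 else outlier_weight \<sigma> \<theta>)"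
    proof (cases "\<bar>\<theta>\<bar> = \<sigma>")
      case True
      then have "\<theta>\<^sup>2 = \<sigma>\<^sup>2" by (metis power2_abs)
      then show ?thesis using True by (simp add: outlier_weight_def)
    next
      case neq: False
      have sq: "\<theta>\<^sup>2 \<noteq> \<sigma>\<^sup>2" using neq \<sigma> by (metis abs_of_pos power2_eq_iff abs_minus_cancel)
      have real: "1 / 2 + (\<theta>\<^sup>2 - \<sigma>\<^sup>2) / (2 * \<theta>) * (if \<bar>\<theta>\<bar> < \<sigma> then \<theta> / (\<sigma>\<^sup>2 - \<theta>\<^sup>2) else \<theta> / (\<theta>\<^sup>2 - \<sigma>\<^sup>2)) =
          (if \<bar>\<theta>\<bar> < \<sigma> then 0 else outlier_weight \<sigma> \<theta>)"
        using sq False neq by (auto simp: outlier_weight_def divide_simps) (simp add: algebra_simps)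
      show ?thesis
        unfolding arcsine_cauchy_outlier(1)[OF \<sigma> False neq] real[symmetric] by simp
    qed
    finally show ?thesis .
  qed
  ultimately show ?thesis by (simp only: of_real_eq_iff)
qed

text \<open>Partial fractions in \<open>t\<close>, followed by the Joukowski substitution \<open>z = \<sigma> (w + 1 / w)\<close>, under which the
  outlier \<open>\<theta> + \<sigma>\<^sup>2 / \<theta>\<close> corresponds to \<open>w = \<theta> / \<sigma>\<close> and to \<open>w = \<sigma> / \<theta>\<close>.\<close>

lemma outlier_rep_cauchy:
  fixes z w :: complex
  assumes \<sigma>: "0 < \<sigma>" and w: "w \<noteq> 0" "norm w < 1" "z = of_real \<sigma> * (w + 1 / w)"
    and z\<rho>: "\<theta> \<noteq> 0 \<Longrightarrow> z \<noteq> of_real (\<theta> + \<sigma>\<^sup>2 / \<theta>)"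
  shows "comb_int (outlier_rep \<sigma> \<theta>) (\<lambda>t. 1 / (z - complex_of_real t)) =
     of_real \<theta> * w\<^sup>2 / (of_real \<sigma> * (1 - w\<^sup>2) * (of_real \<sigma> - of_real \<theta> * w))"
proof -
  let ?k = "\<lambda>t. 1 / (z - complex_of_real t)"
  let ?s = "complex_of_real \<sigma>" and ?t = "complex_of_real \<theta>"
  note props = joukowski_props[OF \<sigma> w]
  obtain B where B: "\<And>t. t \<in> {-2*\<sigma>..2*\<sigma>} \<Longrightarrow> norm (?k t) \<le> B"
    using off_segment_bound[OF props(2)] by blast
  have i1: "integrable (arcsine \<sigma>) ?k"
    by (rule arcsine_integrable[OF \<sigma> cauchy_kernel_measurable B])
  have s0: "?s \<noteq> 0" using \<sigma> by simp
  show ?thesis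
  proof (cases "\<theta> = 0")
    case True
    have "comb_int (nu_rep \<sigma> \<theta>) ?k = 0"
      using nu_rep_integral[OF \<sigma> cauchy_kernel_measurable B, of \<theta>] True by (simp add: nu_weight_def)
    then show ?thesis using \<sigma> True by (simp add: outlier_rep_def comb_int_uminus)
  next
    case False
    let ?\<rho> = "\<theta> + \<sigma>\<^sup>2 / \<theta>"
    have t0: "?t \<noteq> 0" using False by simp
    have z\<rho>': "z \<noteq> of_real ?\<rho>" using z\<rho> False by blast
    have \<rho>: "complex_of_real ?\<rho> = ?t + ?s\<^sup>2 / ?t" by simp
    \<comment> \<open>The zeros in \<open>w\<close> are the two preimages of the outlier.\<close>
    have fact: "of_real ?\<rho> - z = (?t - ?s * w) * (?t * w - ?s) / (?t * w)"
      unfolding \<rho> w(3) using w(1) t0 by (simp add: field_simps power2_eq_square)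
    then have nz: "?t - ?s * w \<noteq> 0" "?s - ?t * w \<noteq> 0"
      using z\<rho>' w(1) t0 by auto
    show ?thesis
    \<comment> \<open>In the critical case the outlier is an edge of the spectrum, out of reach of
      \<open>arcsine_cauchy_outlier\<close>, and \<open>\<nu>\<close> is half the arcsine
      law.\<close>
    proof (cases "\<bar>\<theta>\<bar> = \<sigma>")
      case True
      then have sq: "\<theta>\<^sup>2 = \<sigma>\<^sup>2" by (metis power2_abs)
      then have sqc: "?t\<^sup>2 = ?s\<^sup>2" by (metis of_real_power)
      have "?\<rho> = 2 * \<theta>" using sq False by (simp add: field_simps power2_eq_square)
      moreover have "comb_int (nu_rep \<sigma> \<theta>) ?k = (1 / 2) * cauchy_transform (arcsine \<sigma>) z"
        using nu_rep_cauchy_aux[OF \<sigma> False cauchy_kernel_measurable B] sq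
        by (simp add: cauchy_transform_def)
      then have "comb_int (nu_rep \<sigma> \<theta>) ?k = (1 / 2) * (w / (?s * (1 - w\<^sup>2)))"
        unfolding arcsine_cauchy[OF \<sigma> w] .
      ultimately have "comb_int (outlier_rep \<sigma> \<theta>) ?k = (1 / 2) * (1 / (z - 2 * ?t)) - (1 / 2) * (w / (?s * (1 - w\<^sup>2)))"
        unfolding outlier_rep_def using True
        by (simp add: comb_int_uminus outlier_weight_def integral_return scaleR_conv_of_real)
      also have "z - 2 * ?t = (?s - ?t * w)\<^sup>2 / (?s * w)"
        unfolding w(3) using w(1) s0 sqc by (simp add: field_simps power2_eq_square)
      also have "(1 / 2) * (1 / ((?s - ?t * w)\<^sup>2 / (?s * w))) - (1 / 2) * (w / (?s * (1 - w\<^sup>2))) =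
          ?t * w\<^sup>2 / (?s * (1 - w\<^sup>2) * (?s - ?t * w))"
      proof -
        have "?s\<^sup>2 * (1 - w\<^sup>2) - (?s - ?t * w)\<^sup>2 = 2 * ?t * w * (?s - ?t * w)"
          using sqc by (simp add: algebra_simps power2_eq_square)
        moreover have "(1 / 2) * (1 / (d\<^sup>2 / (s * w))) - (1 / 2) * (w / (s * e)) = w * (s\<^sup>2 * e - d\<^sup>2) / (2 * s * e * d\<^sup>2)"
          if "d \<noteq> 0" "e \<noteq> 0" "s \<noteq> 0" for d e s :: complex
          using that w(1) by (simp add: field_simps power2_eq_square)
        ultimately have "(1 / 2) * (1 / ((?s - ?t * w)\<^sup>2 / (?s * w))) - (1 / 2) * (w / (?s * (1 - w\<^sup>2))) =
            w * (2 * ?t * w * (?s - ?t * w)) / (2 * ?s * (1 - w\<^sup>2) * (?s - ?t * w)\<^sup>2)"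
          using nz(2) props(1) s0 by metis
        also have "\<dots> = ?t * w\<^sup>2 / (?s * (1 - w\<^sup>2) * (?s - ?t * w))"
        proof -
          have "w * (2 * t * w * d) / (2 * s * e * d\<^sup>2) = t * w\<^sup>2 / (s * e * d)"
            if "d \<noteq> 0" "e \<noteq> 0" "s \<noteq> 0" for d e s t :: complex
            using that by (simp add: field_simps power2_eq_square)
          then show ?thesis using nz(2) props(1) s0 by blast
        qed
        finally show ?thesis .
      qed
      finally show ?thesis .
    next
      case neq: False
      have sq: "\<theta>\<^sup>2 \<noteq> \<sigma>\<^sup>2" using neq \<sigma> by (metis abs_of_pos power2_eq_iff abs_minus_cancel)
      note out = arcsine_cauchy_outlier[OF \<sigma> False neq]
      obtain B' where B': "\<And>t. t \<in> {-2*\<sigma>..2*\<sigma>} \<Longrightarrow> norm (1 / (of_real ?\<rho> - complex_of_real t)) \<le> B'"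
        using off_segment_bound[OF out(2)] by blast
      have i2: "integrable (arcsine \<sigma>) (\<lambda>t. 1 / (of_real ?\<rho> - complex_of_real t))"
        by (rule arcsine_integrable[OF \<sigma> cauchy_kernel_measurable B'])
      let ?Gz = "cauchy_transform (arcsine \<sigma>) z" and ?G\<rho> = "cauchy_transform (arcsine \<sigma>) (of_real ?\<rho>)"
      \<comment> \<open>Partial fractions between the resolvents at \<open>z\<close> and at the
        outlier.\<close>
      have "(LINT t|arcsine \<sigma>. ?k t / (of_real ?\<rho> - of_real t)) =
          (LINT t|arcsine \<sigma>. (1 / (of_real ?\<rho> - z)) * (?k t - 1 / (of_real ?\<rho> - of_real t)))"
      proof (rule integral_cong_AE)
        show "AE t in arcsine \<sigma>. ?k t / (of_real ?\<rho> - of_real t) = (1 / (of_real ?\<rho> - z)) * (?k t - 1 / (of_real ?\<rho> - of_real t))"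
          using arcsine_AE[OF \<sigma>]
        proof eventually_elim
          case (elim t)
          then have t: "z - of_real t \<noteq> 0" "complex_of_real ?\<rho> - of_real t \<noteq> 0"
            using props(2) out(2) by (auto simp del: of_real_add)
          have eq: "(complex_of_real ?\<rho> - of_real t) - (z - of_real t) = of_real ?\<rho> - z" by simp
          then have "(complex_of_real ?\<rho> - of_real t) - (z - of_real t) \<noteq> 0"
            using z\<rho>' by (auto simp del: of_real_add)
          moreover have "1 / a / b = 1 / (b - a) * (1 / a - 1 / b)" if "a \<noteq> 0" "b \<noteq> 0" "b - a \<noteq> 0" for a b :: complex
            using that by (simp add: field_simps)
          ultimately show ?case using t unfolding eq[symmetric] by blast
        qed
      qed (use i1 i2 in \<open>auto simp: finite_borel_measurable[OF borel_prob_finite_borel[OF arcsine_prob]]\<close>)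
      also have "\<dots> = (1 / (of_real ?\<rho> - z)) * (?Gz - ?G\<rho>)"
        unfolding integral_mult_right_zero cauchy_transform_def
        by (subst Bochner_Integration.integral_diff[OF i1 i2]) (rule refl)
      finally have I: "(LINT t|arcsine \<sigma>. ?k t / (of_real ?\<rho> - of_real t)) = (1 / (of_real ?\<rho> - z)) * (?Gz - ?G\<rho>)" .
      have nuk: "comb_int (nu_rep \<sigma> \<theta>) ?k = (1 / 2) * ?Gz + of_real ((\<theta>\<^sup>2 - \<sigma>\<^sup>2) / (2 * \<theta>)) * ((1 / (of_real ?\<rho> - z)) * (?Gz - ?G\<rho>))"
        using nu_rep_cauchy_aux[OF \<sigma> False cauchy_kernel_measurable B] unfolding I cauchy_transform_def .
      have sqc: "?t\<^sup>2 \<noteq> ?s\<^sup>2" using sq by (metis of_real_eq_iff of_real_power)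
      have wt: "comb_int (outlier_rep \<sigma> \<theta>) ?k = (if \<bar>\<theta>\<bar> < \<sigma> then 0 else - (1 / (of_real ?\<rho> - z))) - comb_int (nu_rep \<sigma> \<theta>) ?k"
      proof -
        have "1 / (z - complex_of_real ?\<rho>) = - (1 / (of_real ?\<rho> - z))" by (metis minus_diff_eq minus_divide_right)
        then show ?thesis
          unfolding outlier_rep_def using neq
          by (simp add: comb_int_uminus outlier_weight_def integral_return del: of_real_add)
      qed
      define e where "e = 1 - w\<^sup>2"
      have e: "e \<noteq> 0" "w\<^sup>2 = 1 - e" using props(1) by (simp_all add: e_def)
      have Gz: "?Gz = w / (?s * e)" unfolding e_def by (rule arcsine_cauchy[OF \<sigma> w])
      define r where "r = ?t * w / ((?t - ?s * w) * (?t * w - ?s))"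
      have r: "1 / (of_real ?\<rho> - z) = r" unfolding fact r_def by simp
      have cancel: "D / (2 * t) * (r * (w / (s * e) - t / D')) = r * (D * w / (2 * t * s * e) - D / (2 * D'))"
        if "t \<noteq> 0" "e \<noteq> 0" "s \<noteq> 0" "D' \<noteq> 0" for D D' t s e :: complex
        using that by (simp add: field_simps)
      \<comment> \<open>The atom present for \<open>\<bar>\<theta>\<bar> > \<sigma>\<close>
        compensates the change of sign of \<open>?G\<rho>\<close>, so both cases end in the same
        rational function of \<open>w\<close>.\<close>
      show ?thesis
      proof (cases "\<bar>\<theta>\<bar> < \<sigma>")
        case True
        then have G\<rho>: "?G\<rho> = ?t / (?s\<^sup>2 - ?t\<^sup>2)" using out(1) by simp
        have "comb_int (outlier_rep \<sigma> \<theta>) ?k = - ((1 / 2) * (w / (?s * e)) + (?t\<^sup>2 - ?s\<^sup>2) / (2 * ?t) * (r * (w / (?s * e) - ?t / (?s\<^sup>2 - ?t\<^sup>2))))"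
          unfolding wt nuk r Gz G\<rho> using True by simp
        also have "\<dots> = - ((1 / 2) * (w / (?s * e)) + r * ((?t\<^sup>2 - ?s\<^sup>2) * w / (2 * ?t * ?s * e) + 1 / 2))"
        proof -
          have "(?t\<^sup>2 - ?s\<^sup>2) / (2 * ?t) * (r * (w / (?s * e) - ?t / (?s\<^sup>2 - ?t\<^sup>2))) = r * ((?t\<^sup>2 - ?s\<^sup>2) * w / (2 * ?t * ?s * e) - (?t\<^sup>2 - ?s\<^sup>2) / (2 * (?s\<^sup>2 - ?t\<^sup>2)))"
            using t0 e(1) s0 sqc by (intro cancel) auto
          moreover have "(?t\<^sup>2 - ?s\<^sup>2) / (2 * (?s\<^sup>2 - ?t\<^sup>2)) = - (1 / 2)"
            using sqc by (simp add: divide_simps)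
          ultimately show ?thesis by simp
        qed
        also have "\<dots> = ?t * w\<^sup>2 / (?s * (1 - w\<^sup>2) * (?s - ?t * w))"
          using nz s0 t0 e(1) w(1) unfolding r_def e_def[symmetric]
          by (simp add: divide_simps) (simp add: e_def algebra_simps power2_eq_square)
        finally show ?thesis .
      next
        case ge: False
        then have G\<rho>: "?G\<rho> = ?t / (?t\<^sup>2 - ?s\<^sup>2)" using out(1) by simp
        have "comb_int (outlier_rep \<sigma> \<theta>) ?k = - r - ((1 / 2) * (w / (?s * e)) + (?t\<^sup>2 - ?s\<^sup>2) / (2 * ?t) * (r * (w / (?s * e) - ?t / (?t\<^sup>2 - ?s\<^sup>2))))"
          unfolding wt nuk r Gz G\<rho> using ge by simp
        also have "\<dots> = - ((1 / 2) * (w / (?s * e)) + r * ((?t\<^sup>2 - ?s\<^sup>2) * w / (2 * ?t * ?s * e) + 1 / 2))"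
        proof -
          have "(?t\<^sup>2 - ?s\<^sup>2) / (2 * ?t) * (r * (w / (?s * e) - ?t / (?t\<^sup>2 - ?s\<^sup>2))) = r * ((?t\<^sup>2 - ?s\<^sup>2) * w / (2 * ?t * ?s * e) - (?t\<^sup>2 - ?s\<^sup>2) / (2 * (?t\<^sup>2 - ?s\<^sup>2)))"
            using t0 e(1) s0 sqc by (intro cancel) auto
          moreover have "(?t\<^sup>2 - ?s\<^sup>2) / (2 * (?t\<^sup>2 - ?s\<^sup>2)) = 1 / 2"
            using sqc by simp
          moreover have "- r - (h + X) = - (h + r * (a + 1 / 2))"
            if "X = r * (a - E)" "E = 1 / 2" for X E a h :: complex
            using that by (simp add: algebra_simps)
          ultimately show ?thesis by blast
        qed
        also have "\<dots> = ?t * w\<^sup>2 / (?s * (1 - w\<^sup>2) * (?s - ?t * w))"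
          using nz s0 t0 e(1) w(1) unfolding r_def e_def[symmetric]
          by (simp add: divide_simps) (simp add: e_def algebra_simps power2_eq_square)
        finally show ?thesis .
      qed
    qed
  qed
qed

section \<open>Type B convolution with point masses\<close>

lemma signed_cauchy_comb:
  assumes L: "borels L" and z: "Im z > 0"
  shows "signed_cauchy_transform (comb L) z = comb_int L (\<lambda>t. 1 / (z - complex_of_real t))"
  unfolding signed_cauchy_transform_def
  by (rule signed_integral_comb[where K = UNIV and B = "1 / Im z"])
     (use L jordan_decomposition_exists[OF finite_signed_measure_comb[OF L]] cauchy_kernel_bound[OF z] in auto)

lemma signed_cauchy_unique:
  assumes \<nu>: "finite_signed_measure \<nu>" and L: "borels L"
    and eq: "\<And>z. Im z > 0 \<Longrightarrow> signed_cauchy_transform \<nu> z = comb_int L (\<lambda>t. 1 / (z - complex_of_real t))"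
  shows "\<nu> = comb L"
proof -
  obtain P Q where "jordan_decomposition \<nu> P Q" using jordan_decomposition_exists[OF \<nu>] by blast
  then have PQ: "finite_borel P" "finite_borel Q" "\<And>A. A \<in> sets borel \<Longrightarrow> \<nu> A = measure P A - measure Q A"
    by (auto simp: jordan_decomposition_def finite_borel_def)
  have \<nu>': "\<nu> = comb [(1, P), (-1, Q)]"
  proof
    fix A show "\<nu> A = comb [(1, P), (-1, Q)] A"
      using PQ finite_signed_measureD(1)[OF \<nu>, of A]
      by (cases "A \<in> sets borel") (auto simp: finite_borel_def measure_notin_sets)
  qed
  let ?L = "[(1, P), (-1, Q)] @ map (\<lambda>(c, \<mu>). (- c, \<mu>)) L"
  have L': "borels ?L" using L PQ by auto
  have "comb_int ?L (\<lambda>t. 1 / (z - complex_of_real t)) = 0" if z: "Im z > 0" for z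
  proof -
    have "comb_int [(1, P), (-1, Q)] (\<lambda>t. 1 / (z - complex_of_real t)) = signed_cauchy_transform \<nu> z"
      unfolding \<nu>' by (rule signed_cauchy_comb[symmetric]) (use PQ z in auto)
    then show ?thesis unfolding comb_int_simps(3) comb_int_uminus eq[OF z] by simp
  qed
  from stieltjes_uniqueness[OF L' this] have eqA: "comb ?L A = 0" if "A \<in> sets borel" for A using that by blast
  show ?thesis
  proof
    fix A show "\<nu> A = comb L A"
    proof (cases "A \<in> sets borel")
      case True
      show ?thesis using eqA[OF True] unfolding \<nu>' comb_simps(3) comb_uminus by simp
    next
      case False
      then show ?thesis
        using finite_signed_measureD(1)[OF \<nu>] finite_signed_measureD(1)[OF finite_signed_measure_comb[OF L]] by simp
    qed
  qed
qed

lemma cauchy_unique: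
  assumes \<mu>: "borel_prob \<mu>" "borel_prob \<mu>'"
    and eq: "\<And>z. Im z > 0 \<Longrightarrow> cauchy_transform \<mu> z = cauchy_transform \<mu>' z"
  shows "\<mu> = \<mu>'"
proof (rule measure_eqI)
  show "sets \<mu> = sets \<mu>'" using \<mu> by (simp add: borel_prob_def)
  note fin = \<mu>[THEN borel_prob_finite_borel]
  fix A assume "A \<in> sets \<mu>"
  then have A: "A \<in> sets borel" using \<mu> by (simp add: borel_prob_def)
  have "comb [(1, \<mu>), (-1, \<mu>')] A = 0"
    using fin eq A by (intro stieltjes_uniqueness) (auto simp: cauchy_transform_def)
  then show "emeasure \<mu> A = emeasure \<mu>' A"
    using fin by (simp add: finite_borel_def finite_measure.emeasure_eq_measure)
qed

text \<open>The root is taken of \<open>4 * \<sigma>\<^sup>2 - z\<^sup>2\<close>, which avoids the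
  nonpositive reals on the whole upper half-plane, whereas the principal root of
  \<open>z\<^sup>2 - 4 * \<sigma>\<^sup>2\<close> has its cut along the imaginary axis. The sign
  selects the solution inside the unit disc.\<close>

definition joukowski_inv :: "real \<Rightarrow> complex \<Rightarrow> complex" where
  "joukowski_inv \<sigma> z = (z - \<i> * csqrt (4 * (of_real \<sigma>)\<^sup>2 - z\<^sup>2)) / (2 * of_real \<sigma>)"

lemma joukowski_inv_branch:
  assumes "0 < \<sigma>" "Im z > 0"
  shows "4 * (of_real \<sigma>)\<^sup>2 - z\<^sup>2 \<notin> \<real>\<^sub>\<le>\<^sub>0"
proof
  assume a: "4 * (of_real \<sigma>)\<^sup>2 - z\<^sup>2 \<in> \<real>\<^sub>\<le>\<^sub>0"
  have Im: "Im (4 * (of_real \<sigma>)\<^sup>2 - z\<^sup>2) = - (2 * Re z * Im z)" by (simp add: power2_eq_square)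
  have Re: "Re (4 * (of_real \<sigma>)\<^sup>2 - z\<^sup>2) = 4 * \<sigma>\<^sup>2 - ((Re z)\<^sup>2 - (Im z)\<^sup>2)" by (simp add: power2_eq_square)
  from a have "Re z = 0" "4 * \<sigma>\<^sup>2 - ((Re z)\<^sup>2 - (Im z)\<^sup>2) \<le> 0"
    unfolding complex_nonpos_Reals_iff Im Re using assms by auto
  then have "4 * \<sigma>\<^sup>2 + (Im z)\<^sup>2 \<le> 0" by simp
  moreover have "0 < \<sigma>\<^sup>2" using assms by simp
  ultimately show False using zero_le_power2[of "Im z"] by linarith
qed

lemma joukowski_inv:
  assumes \<sigma>: "0 < \<sigma>" and z: "Im z > 0"
  shows "joukowski_inv \<sigma> z \<noteq> 0" "norm (joukowski_inv \<sigma> z) < 1"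
    "z = of_real \<sigma> * (joukowski_inv \<sigma> z + 1 / joukowski_inv \<sigma> z)" "Im (joukowski_inv \<sigma> z) < 0"
proof -
  let ?s = "complex_of_real \<sigma>"
  define r where "r = csqrt (4 * ?s\<^sup>2 - z\<^sup>2)"
  have s0: "?s \<noteq> 0" using \<sigma> by simp
  have r2: "r\<^sup>2 = 4 * ?s\<^sup>2 - z\<^sup>2" by (simp add: r_def)
  have "0 \<le> Re r" unfolding r_def using csqrt_principal by (metis less_eq_real_def)
  define w1 w2 where "w1 = (z - \<i> * r) / (2 * ?s)" and "w2 = (z + \<i> * r) / (2 * ?s)"
  have w1: "joukowski_inv \<sigma> z = w1" by (simp add: joukowski_inv_def w1_def r_def)
  have "w1 * w2 = (z\<^sup>2 - (\<i> * r)\<^sup>2) / (4 * ?s\<^sup>2)"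
    by (simp add: w1_def w2_def algebra_simps power2_eq_square)
  also have "\<dots> = (z\<^sup>2 + r\<^sup>2) / (4 * ?s\<^sup>2)" by (simp add: power_mult_distrib)
  also have "\<dots> = 1" using s0 by (simp add: r2)
  finally have prod: "w1 * w2 = 1" .
  have nz: "w1 \<noteq> 0" "w2 \<noteq> 0" using prod by auto
  have inv: "1 / w1 = w2" "w1 = 1 / w2" using prod nz by (auto simp: field_simps)
  have sum: "z = ?s * (w1 + w2)" using s0 by (simp add: w1_def w2_def field_simps)
  have "w2 = (z + \<i> * r) / of_real (2 * \<sigma>)" by (simp add: w2_def)
  then have "Im w2 = (Im z + Re r) / (2 * \<sigma>)" by (simp only: Im_divide_of_real) simp
  \<comment> \<open>The principal root has nonnegative real part, which puts \<open>w2\<close> in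
    the upper half-plane and its inverse \<open>w1\<close> in the lower one.\<close>
  then have "Im w2 > 0" using \<open>0 \<le> Re r\<close> z \<sigma> by simp
  moreover have "Im w1 = - Im w2 / (norm w2)\<^sup>2"
    unfolding inv(2) by (simp add: Im_divide cmod_power2)
  moreover have "0 < (norm w2)\<^sup>2" using nz by simp
  ultimately have Im1: "Im w1 < 0" by (simp add: divide_neg_pos)
  have z_eq: "z = ?s * (w1 + 1 / w1)" using sum inv by simp
  \<comment> \<open>\<open>Im z\<close> is a positive multiple of
    \<open>Im w1 * (1 - 1 / (norm w1)\<^sup>2)\<close>; as \<open>Im w1 < 0\<close>, the second
    factor must be negative.\<close>
  have "norm w1 < 1"
  proof -
    have nw: "0 < (norm w1)\<^sup>2" using nz by simp
    have lin: "Im (?s * (a + b)) = \<sigma> * (Im a + Im b)" for a b by simp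
    have "Im (1 / w1) = - Im w1 / (norm w1)\<^sup>2" by (simp add: Im_divide cmod_power2)
    then have "Im z = \<sigma> * Im w1 * (1 - 1 / (norm w1)\<^sup>2)"
      using lin[of w1 "1 / w1"] unfolding z_eq[symmetric] by (simp add: algebra_simps)
    then have "0 < \<sigma> * Im w1 * (1 - 1 / (norm w1)\<^sup>2)" using z by simp
    moreover have "\<sigma> * Im w1 < 0" using \<sigma> Im1 by (simp add: mult_pos_neg)
    ultimately have "1 - 1 / (norm w1)\<^sup>2 < 0"
      using mult_nonpos_nonneg[of "\<sigma> * Im w1" "1 - 1 / (norm w1)\<^sup>2"] by linarith
    then have "(norm w1)\<^sup>2 < 1" using nw by (simp add: field_simps)
    then show ?thesis by (simp add: power_less_one_iff)
  qed
  then show "joukowski_inv \<sigma> z \<noteq> 0" "norm (joukowski_inv \<sigma> z) < 1"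
    "z = of_real \<sigma> * (joukowski_inv \<sigma> z + 1 / joukowski_inv \<sigma> z)" "Im (joukowski_inv \<sigma> z) < 0"
    unfolding w1 using nz Im1 z_eq by auto
qed

lemma open_upper_half_plane: "open upper_half_plane"
  unfolding upper_half_plane_def by (intro open_halfspace_Im_gt)

lemma joukowski_inv_holomorphic:
  assumes "0 < \<sigma>"
  shows "joukowski_inv \<sigma> holomorphic_on upper_half_plane"
  unfolding joukowski_inv_def[abs_def]
  using joukowski_inv_branch[OF assms] assms by (intro holomorphic_intros) (auto simp: upper_half_plane_def)

lemma semicircle_cauchy_upper:
  assumes "0 < \<sigma>" "Im z > 0"
  shows "cauchy_transform (semicircle \<sigma>) z = joukowski_inv \<sigma> z / of_real \<sigma>"
  by (rule semicircle_cauchy[OF assms(1) joukowski_inv(1-3)[OF assms]])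

lemma reciprocal_semicircle:
  assumes "0 < \<sigma>" "Im z > 0"
  shows "reciprocal_cauchy_transform (semicircle \<sigma>) z = of_real \<sigma> / joukowski_inv \<sigma> z"
  unfolding reciprocal_cauchy_transform_def semicircle_cauchy_upper[OF assms] by simp

lemma reciprocal_semicircle_holomorphic:
  assumes "0 < \<sigma>"
  shows "reciprocal_cauchy_transform (semicircle \<sigma>) holomorphic_on upper_half_plane"
proof -
  have "(\<lambda>z. of_real \<sigma> / joukowski_inv \<sigma> z) holomorphic_on upper_half_plane"
    using joukowski_inv(1)[OF assms] joukowski_inv_holomorphic[OF assms]
    by (intro holomorphic_intros) (auto simp: upper_half_plane_def)
  then show ?thesis
    by (rule holomorphic_transform) (auto simp: reciprocal_semicircle[OF assms] upper_half_plane_def)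
qed

text \<open>Implicit differentiation of \<open>z = \<sigma> * (w + 1 / w)\<close> yields the
  derivative of \<open>w\<close>, and the function in question is
  \<open>\<sigma> / w\<close>.\<close>

lemma deriv_reciprocal_semicircle:
  assumes \<sigma>: "0 < \<sigma>" and z: "Im z > 0"
  shows "deriv (reciprocal_cauchy_transform (semicircle \<sigma>)) z = 1 / (1 - (joukowski_inv \<sigma> z)\<^sup>2)"
proof -
  let ?w = "joukowski_inv \<sigma>" and ?s = "complex_of_real \<sigma>"
  have zU: "z \<in> upper_half_plane" using z by (simp add: upper_half_plane_def)
  note w = joukowski_inv[OF \<sigma> z]
  have s0: "?s \<noteq> 0" using \<sigma> by simp
  define d where "d = deriv ?w z"
  have D: "(?w has_field_derivative d) (at z)"
    unfolding d_def by (rule holomorphic_derivI[OF joukowski_inv_holomorphic[OF \<sigma>] open_upper_half_plane zU])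
  have "((\<lambda>z. ?s * (?w z + 1 / ?w z)) has_field_derivative ?s * (d - d / (?w z)\<^sup>2)) (at z)"
    using D w(1) by (auto intro!: derivative_eq_intros simp: power2_eq_square)
  moreover have "((\<lambda>z. ?s * (?w z + 1 / ?w z)) has_field_derivative 1) (at z)"
    by (rule has_field_derivative_transform_within_open[OF DERIV_ident open_upper_half_plane zU])
       (use joukowski_inv(3)[OF \<sigma>] in \<open>auto simp: upper_half_plane_def\<close>)
  ultimately have one: "?s * (d - d / (?w z)\<^sup>2) = 1" by (rule DERIV_unique)
  have "((\<lambda>z. ?s / ?w z) has_field_derivative - (?s * d / (?w z)\<^sup>2)) (at z)"
    using D w(1) by (auto intro!: derivative_eq_intros simp: power2_eq_square)
  then have "(reciprocal_cauchy_transform (semicircle \<sigma>) has_field_derivative - (?s * d / (?w z)\<^sup>2)) (at z)"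
    by (rule has_field_derivative_transform_within_open[OF _ open_upper_half_plane zU])
       (auto simp: reciprocal_semicircle[OF \<sigma>] upper_half_plane_def)
  then have "deriv (reciprocal_cauchy_transform (semicircle \<sigma>)) z = - (?s * d / (?w z)\<^sup>2)" by (rule DERIV_imp_deriv)
  also have "\<dots> = 1 / (1 - (?w z)\<^sup>2)"
  proof -
    have nz: "1 - (?w z)\<^sup>2 \<noteq> 0" using joukowski_props(1)[OF \<sigma> w(1-3)] .
    have "?s * (d - d / (?w z)\<^sup>2) = - (?s * d / (?w z)\<^sup>2) * (1 - (?w z)\<^sup>2)"
      using w(1) by (simp add: field_simps)
    then show ?thesis using one nz by (simp add: eq_divide_eq)
  qed
  finally show ?thesis .
qed

section \<open>Subordination for a point mass at 0\<close>

lemma cauchy_delta0: "cauchy_transform (return borel 0) z = 1 / z"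
  unfolding cauchy_transform_def by (subst integral_return) auto

text \<open>For \<open>\<mu>2 = \<delta>\<^sub>0\<close> the equations reduce to \<open>\<omega>2 = F \<circ> \<omega>1\<close> and hence \<open>\<omega>1 = id\<close>.\<close>

lemma subordination_delta0:
  assumes \<sigma>: "0 < \<sigma>"
  shows "subordination_functions (semicircle \<sigma>) (return borel 0) (\<lambda>z. z) (reciprocal_cauchy_transform (semicircle \<sigma>))"
  unfolding subordination_functions_def
proof (intro conjI ballI)
  let ?F = "reciprocal_cauchy_transform (semicircle \<sigma>)"
  show "(\<lambda>z. z) analytic_on upper_half_plane" by (rule analytic_on_ident)
  show "?F analytic_on upper_half_plane"
    using reciprocal_semicircle_holomorphic[OF \<sigma>] open_upper_half_plane by (simp add: analytic_on_open)
  show "?F ` upper_half_plane \<subseteq> upper_half_plane"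
  proof clarify
    fix z assume "z \<in> upper_half_plane"
    then have z: "Im z > 0" by (simp add: upper_half_plane_def)
    let ?w = "joukowski_inv \<sigma> z"
    have "Im (?F z) = - (\<sigma> * Im ?w) / (norm ?w)\<^sup>2"
      unfolding reciprocal_semicircle[OF \<sigma> z] by (simp add: Im_divide cmod_power2)
    moreover have "\<sigma> * Im ?w < 0" "0 < (norm ?w)\<^sup>2"
      using \<sigma> joukowski_inv[OF \<sigma> z] by (simp_all add: mult_pos_neg)
    ultimately show "?F z \<in> upper_half_plane" by (simp add: upper_half_plane_def divide_neg_pos)
  qed
  show "cauchy_transform (semicircle \<sigma>) z = cauchy_transform (return borel 0) (?F z)" for z
    by (simp add: cauchy_delta0 reciprocal_cauchy_transform_def)
qed simp_all

lemma subordination_delta0_unique: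
  assumes S: "subordination_functions (semicircle \<sigma>) (return borel 0) \<omega>1 \<omega>2" and z: "Im z > 0"
  shows "\<omega>1 z = z" "\<omega>2 z = reciprocal_cauchy_transform (semicircle \<sigma>) z"
proof -
  have "z \<in> upper_half_plane" using z by (simp add: upper_half_plane_def)
  then have eq: "cauchy_transform (semicircle \<sigma>) (\<omega>1 z) = 1 / \<omega>2 z"
      "\<omega>1 z + \<omega>2 z = z + reciprocal_cauchy_transform (semicircle \<sigma>) (\<omega>1 z)"
    using S by (auto simp: subordination_functions_def cauchy_delta0)
  then have "reciprocal_cauchy_transform (semicircle \<sigma>) (\<omega>1 z) = \<omega>2 z"
    by (simp add: reciprocal_cauchy_transform_def)
  with eq(2) show "\<omega>1 z = z" by simp
  with \<open>reciprocal_cauchy_transform (semicircle \<sigma>) (\<omega>1 z) = \<omega>2 z\<close>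
  show "\<omega>2 z = reciprocal_cauchy_transform (semicircle \<sigma>) z" by simp
qed

lemma semicircle_weighted_arcsine:
  "0 < \<sigma> \<Longrightarrow> semicircle \<sigma> = weighted_arcsine \<sigma> (\<lambda>t. (4 * \<sigma>\<^sup>2 - t\<^sup>2) / (2 * \<sigma>\<^sup>2))"
  unfolding weighted_arcsine_def by (rule semicircle_eq_density)

lemma semicircle_weight_bound:
  fixes \<sigma> t :: real
  assumes "0 < \<sigma>" "t \<in> {-2*\<sigma>..2*\<sigma>}"
  shows "\<bar>(4 * \<sigma>\<^sup>2 - t\<^sup>2) / (2 * \<sigma>\<^sup>2)\<bar> \<le> 2"
proof -
  have "\<bar>t\<bar> \<le> \<bar>2 * \<sigma>\<bar>" using assms by auto
  then have "t\<^sup>2 \<le> (2 * \<sigma>)\<^sup>2" by (rule abs_le_square_iff[THEN iffD1])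
  then have "0 \<le> 4 * \<sigma>\<^sup>2 - t\<^sup>2" "4 * \<sigma>\<^sup>2 - t\<^sup>2 \<le> 2 * (2 * \<sigma>\<^sup>2)"
    by (simp_all add: power_mult_distrib)
  then show ?thesis using assms(1) by (simp add: divide_le_eq)
qed

lemma semicircle_prob:
  assumes \<sigma>: "0 < \<sigma>"
  shows "borel_prob (semicircle \<sigma>)"
proof -
  interpret A: prob_space "arcsine \<sigma>" using arcsine_prob by (simp add: borel_prob_def)
  let ?g = "\<lambda>t. (4 * \<sigma>\<^sup>2 - t\<^sup>2) / (2 * \<sigma>\<^sup>2)"
  have fin: "finite_borel (semicircle \<sigma>)"
    unfolding semicircle_weighted_arcsine[OF \<sigma>]
    by (rule weighted_arcsine_finite[OF \<sigma> _ semicircle_weight_bound[OF \<sigma>]]) auto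
  then interpret finite_measure "semicircle \<sigma>" by (simp add: finite_borel_def)
  have "measure (semicircle \<sigma>) (space (semicircle \<sigma>)) = (LINT t|semicircle \<sigma>. 1)" by simp
  also have "\<dots> = (LINT t|arcsine \<sigma>. ?g t *\<^sub>R (1::real))" by (rule semicircle_integral[OF \<sigma>]) simp
  also have "\<dots> = 1"
  proof -
    have sin2: "(LINT \<phi>|lborel. indicator {0..pi} \<phi> *\<^sub>R (sin \<phi>)\<^sup>2) = (pi / 2 - sin pi * cos pi / 2) - (0 / 2 - sin 0 * cos 0 / 2)"
    proof (rule integral_FTC_Icc)
      fix \<phi> :: real
      have "((\<lambda>\<phi>. \<phi> / 2 - sin \<phi> * cos \<phi> / 2) has_real_derivative (sin \<phi>)\<^sup>2) (at \<phi> within {0..pi})"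
        by (auto intro!: derivative_eq_intros simp: power2_eq_square[symmetric] cos_squared_eq field_simps)
      then show "((\<lambda>\<phi>. \<phi> / 2 - sin \<phi> * cos \<phi> / 2) has_vector_derivative (sin \<phi>)\<^sup>2) (at \<phi> within {0..pi})"
        by (simp add: has_real_derivative_iff_has_vector_derivative)
    qed (auto intro!: continuous_intros)
    have "(indicator {0..pi} \<phi> / pi) *\<^sub>R (?g (- 2 * \<sigma> * cos \<phi>) *\<^sub>R (1::real)) = (2 / pi) * (indicator {0..pi} \<phi> *\<^sub>R (sin \<phi>)\<^sup>2)" for \<phi>
      using \<sigma> by (simp add: power_mult_distrib sin_squared_eq field_simps)
    moreover have "(LINT t|arcsine \<sigma>. ?g t *\<^sub>R (1::real)) = (LINT \<phi>|lborel. (indicator {0..pi} \<phi> / pi) *\<^sub>R (?g (- 2 * \<sigma> * cos \<phi>) *\<^sub>R (1::real)))"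
      by (rule arcsine_integral) measurable
    ultimately show ?thesis using sin2 by simp
  qed
  finally have "emeasure (semicircle \<sigma>) (space (semicircle \<sigma>)) = 1" by (simp add: emeasure_eq_measure)
  then show ?thesis using fin by (auto simp: borel_prob_def finite_borel_def intro!: prob_spaceI)
qed

lemma free_convolution_delta0:
  assumes \<sigma>: "0 < \<sigma>"
  shows "semicircle \<sigma> \<boxplus> return borel 0 = semicircle \<sigma>"
  unfolding free_convolution_def
proof (rule the_equality)
  show "borel_prob (semicircle \<sigma>) \<and> (\<exists>\<omega>1 \<omega>2. subordination_functions (semicircle \<sigma>) (return borel 0) \<omega>1 \<omega>2 \<and>
        (\<forall>z\<in>upper_half_plane. cauchy_transform (semicircle \<sigma>) z = cauchy_transform (semicircle \<sigma>) (\<omega>1 z)))"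
    using semicircle_prob[OF \<sigma>] subordination_delta0[OF \<sigma>] by blast
next
  fix \<mu> assume "borel_prob \<mu> \<and> (\<exists>\<omega>1 \<omega>2. subordination_functions (semicircle \<sigma>) (return borel 0) \<omega>1 \<omega>2 \<and>
        (\<forall>z\<in>upper_half_plane. cauchy_transform \<mu> z = cauchy_transform (semicircle \<sigma>) (\<omega>1 z)))"
  then obtain \<omega>1 \<omega>2 where \<mu>: "borel_prob \<mu>" "subordination_functions (semicircle \<sigma>) (return borel 0) \<omega>1 \<omega>2"
    "\<And>z. z \<in> upper_half_plane \<Longrightarrow> cauchy_transform \<mu> z = cauchy_transform (semicircle \<sigma>) (\<omega>1 z)" by blast
  show "\<mu> = semicircle \<sigma>"
    using \<mu>(3) subordination_delta0_unique(1)[OF \<mu>(2)]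
    by (intro cauchy_unique \<mu>(1) semicircle_prob[OF \<sigma>]) (simp add: upper_half_plane_def)
qed

text \<open>The subordination functions have derivatives 1 and \<open>1 / (1 - w\<^sup>2)\<close>,
  which turns the defining equation into \<open>eq\<close>. The descriptions by \<open>THE\<close>
  are resolved by uniqueness both of the subordination functions on the upper half-plane and of a
  measure with given Cauchy transform.\<close>

lemma type_B_convolution_delta0:
  assumes \<sigma>: "0 < \<sigma>" and L: "borels L" "borels L1" "borels L2"
    and eq: "\<And>z. Im z > 0 \<Longrightarrow> comb_int L (\<lambda>t. 1 / (z - complex_of_real t)) =
       comb_int L1 (\<lambda>t. 1 / (z - complex_of_real t)) +
       comb_int L2 (\<lambda>t. 1 / (reciprocal_cauchy_transform (semicircle \<sigma>) z - complex_of_real t)) / (1 - (joukowski_inv \<sigma> z)\<^sup>2)"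
  shows "(semicircle \<sigma>, comb L1) \<boxplus>\<^sub>B (return borel 0, comb L2) = (semicircle \<sigma>, comb L)"
proof -
  let ?F = "reciprocal_cauchy_transform (semicircle \<sigma>)"
  let ?Q = "\<lambda>\<nu>. finite_signed_measure \<nu> \<and> (\<exists>\<omega>1 \<omega>2. subordination_functions (semicircle \<sigma>) (return borel 0) \<omega>1 \<omega>2 \<and>
           (\<forall>z\<in>upper_half_plane. signed_cauchy_transform \<nu> z =
              signed_cauchy_transform (comb L1) (\<omega>1 z) * deriv \<omega>1 z +
              signed_cauchy_transform (comb L2) (\<omega>2 z) * deriv \<omega>2 z))"
  have rhs: "signed_cauchy_transform (comb L1) (\<omega>1 z) * deriv \<omega>1 z + signed_cauchy_transform (comb L2) (\<omega>2 z) * deriv \<omega>2 z =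
      comb_int L (\<lambda>t. 1 / (z - complex_of_real t))"
    if S: "subordination_functions (semicircle \<sigma>) (return borel 0) \<omega>1 \<omega>2" and z: "Im z > 0" for \<omega>1 \<omega>2 z
  proof -
    have zU: "z \<in> upper_half_plane" using z by (simp add: upper_half_plane_def)
    note u = subordination_delta0_unique[OF S]
    have ev: "eventually (\<lambda>z. z \<in> upper_half_plane) (nhds z)"
      using open_upper_half_plane zU by (rule eventually_nhds_in_open)
    have "deriv \<omega>1 z = deriv (\<lambda>z. z) z"
      by (rule deriv_cong_ev[OF eventually_mono[OF ev]]) (auto simp: u upper_half_plane_def)
    moreover have "deriv \<omega>2 z = deriv ?F z"
      by (rule deriv_cong_ev[OF eventually_mono[OF ev]]) (auto simp: u upper_half_plane_def)
    moreover have "Im (?F z) > 0"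
      using subordination_delta0[OF \<sigma>] zU by (auto simp: subordination_functions_def upper_half_plane_def image_subset_iff)
    ultimately show ?thesis
      using eq[OF z] by (simp add: u[OF z] signed_cauchy_comb L z deriv_reciprocal_semicircle[OF \<sigma> z])
  qed
  have "(THE \<nu>. ?Q \<nu>) = comb L"
  proof (rule the_equality)
    have "signed_cauchy_transform (comb L) z = comb_int L (\<lambda>t. 1 / (z - complex_of_real t))" if "Im z > 0" for z
      by (rule signed_cauchy_comb[OF L(1) that])
    then show "?Q (comb L)"
      using rhs[OF subordination_delta0[OF \<sigma>]] finite_signed_measure_comb[OF L(1)] subordination_delta0[OF \<sigma>]
      by (intro conjI exI ballI) (auto simp: upper_half_plane_def)
  next
    fix \<nu> assume "?Q \<nu>"
    then obtain \<omega>1 \<omega>2 where \<nu>: "finite_signed_measure \<nu>" and S: "subordination_functions (semicircle \<sigma>) (return borel 0) \<omega>1 \<omega>2"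
      and G: "\<And>z. z \<in> upper_half_plane \<Longrightarrow> signed_cauchy_transform \<nu> z =
              signed_cauchy_transform (comb L1) (\<omega>1 z) * deriv \<omega>1 z + signed_cauchy_transform (comb L2) (\<omega>2 z) * deriv \<omega>2 z"
      by blast
    show "\<nu> = comb L"
      using G rhs[OF S] by (intro signed_cauchy_unique[OF \<nu> L(1)]) (simp add: upper_half_plane_def)
  qed
  then show ?thesis by (simp add: type_B_convolution_def free_convolution_delta0[OF \<sigma>])
qed

text \<open>At \<open>\<sigma> / w\<close> the difference of the two resolvents is a rational
  function of \<open>w\<close>; divided by \<open>1 - w\<^sup>2\<close> it is the one found in
  \<open>outlier_rep_cauchy\<close>. The denominator \<open>\<sigma> - \<theta> * w\<close> is
  nonzero because \<open>w\<close> is not real.\<close>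

lemma outlier_rep_subordination:
  assumes \<sigma>: "0 < \<sigma>" and z: "Im z > 0"
  shows "comb_int (outlier_rep \<sigma> \<theta>) (\<lambda>t. 1 / (z - complex_of_real t)) =
    comb_int [(1, return borel \<theta>), (-1, return borel 0)] (\<lambda>t. 1 / (reciprocal_cauchy_transform (semicircle \<sigma>) z - complex_of_real t))
      / (1 - (joukowski_inv \<sigma> z)\<^sup>2)"
proof -
  let ?w = "joukowski_inv \<sigma> z" and ?s = "complex_of_real \<sigma>" and ?t = "complex_of_real \<theta>"
  note w = joukowski_inv[OF \<sigma> z]
  have s0: "?s \<noteq> 0" using \<sigma> by simp
  have nz: "1 - ?w\<^sup>2 \<noteq> 0" using joukowski_props(1)[OF \<sigma> w(1-3)] .
  have tw: "?s - ?t * ?w \<noteq> 0"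
  proof
    assume "?s - ?t * ?w = 0"
    then have "Im (?s - ?t * ?w) = 0" "Re (?s - ?t * ?w) = 0" by simp_all
    then have "\<theta> * Im ?w = 0" "\<sigma> = \<theta> * Re ?w" by simp_all
    then show False using w(4) \<sigma> by auto
  qed
  have "comb_int (outlier_rep \<sigma> \<theta>) (\<lambda>t. 1 / (z - complex_of_real t)) = ?t * ?w\<^sup>2 / (?s * (1 - ?w\<^sup>2) * (?s - ?t * ?w))"
    using z by (intro outlier_rep_cauchy[OF \<sigma> w(1-3)]) (auto simp: complex_eq_iff)
  moreover have "comb_int [(1, return borel \<theta>), (-1, return borel 0)] (\<lambda>t. 1 / (?s / ?w - complex_of_real t)) = 1 / (?s / ?w - ?t) - 1 / (?s / ?w)"
    by (simp add: integral_return)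
  moreover have "1 / (?s / ?w - ?t) - 1 / (?s / ?w) = ?t * ?w\<^sup>2 / (?s * (?s - ?t * ?w))"
  proof -
    have "1 / (?s / ?w - ?t) = ?w / (?s - ?t * ?w)" using w(1) tw by (simp add: field_simps)
    then have "1 / (?s / ?w - ?t) - 1 / (?s / ?w) = ?w / (?s - ?t * ?w) - ?w / ?s" by simp
    also have "\<dots> = (?w * ?s - ?w * (?s - ?t * ?w)) / ((?s - ?t * ?w) * ?s)"
      using tw s0 by (rule diff_frac_eq)
    also have "?w * ?s - ?w * (?s - ?t * ?w) = ?t * ?w\<^sup>2" by (simp add: algebra_simps power2_eq_square)
    finally show ?thesis by (simp add: mult.commute)
  qed
  ultimately show ?thesis unfolding reciprocal_semicircle[OF \<sigma> z] by (simp add: mult_ac)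
qed

section \<open>Moments of the limits\<close>

abbreviation supported_in :: "real \<Rightarrow> (real \<times> real measure) list \<Rightarrow> bool" where
  "supported_in R L \<equiv> \<forall>(c, \<mu>)\<in>set L. measure \<mu> (- {-R..R}) = 0"

lemma moments_sums:
  fixes x :: complex
  assumes \<mu>: "finite_borel \<mu>" "measure \<mu> (- {-R..R}) = 0" and x: "norm x * R < 1" and R: "0 \<le> R"
  shows "(\<lambda>k. (LINT t|\<mu>. complex_of_real t ^ k) * x ^ k) sums (LINT t|\<mu>. 1 / (1 - x * complex_of_real t))"
proof -
  interpret finite_measure \<mu> using \<mu> by (simp add: finite_borel_def)
  have [measurable_cong]: "sets \<mu> = sets borel" using \<mu> by (simp add: finite_borel_def)
  define q where "q = norm x * R"
  have q: "0 \<le> q" "q < 1" using x R by (simp_all add: q_def)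
  have K: "- {-R..R} \<in> sets \<mu>" using \<mu> by (simp add: finite_borel_def)
  have AE: "AE t in \<mu>. t \<in> {-R..R}"
    by (rule AE_I[OF _ _ K]) (use \<mu>(2) in \<open>auto simp: emeasure_eq_measure\<close>)
  have norm: "norm (complex_of_real t * x) \<le> q" if "t \<in> {-R..R}" for t
  proof -
    have "\<bar>t\<bar> * norm x \<le> R * norm x" using that by (intro mult_right_mono) auto
    then show ?thesis by (simp add: norm_mult q_def mult.commute)
  qed
  have bound: "AE t in \<mu>. norm (complex_of_real t ^ k * x ^ k) \<le> q ^ k" for k
    using AE
  proof eventually_elim
    case (elim t)
    then show ?case unfolding power_mult_distrib[symmetric] norm_power by (intro power_mono norm) auto
  qed
  have int: "integrable \<mu> (\<lambda>t. complex_of_real t ^ k * x ^ k)" for k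
    by (rule integrable_const_bound[OF bound]) measurable
  have "(\<lambda>k. LINT t|\<mu>. complex_of_real t ^ k * x ^ k) sums (LINT t|\<mu>. (\<Sum>k. complex_of_real t ^ k * x ^ k))"
  proof (rule sums_integral[OF int])
    show "AE t in \<mu>. summable (\<lambda>k. norm (complex_of_real t ^ k * x ^ k))"
      using AE
    proof eventually_elim
      case (elim t)
      have "summable (\<lambda>k. norm (complex_of_real t * x) ^ k)"
        using norm[OF elim] q by (intro summable_geometric) simp
      then show ?case by (simp only: power_mult_distrib[symmetric] norm_power)
    qed
    show "summable (\<lambda>k. LINT t|\<mu>. norm (complex_of_real t ^ k * x ^ k))"
    proof (rule summable_comparison_test')
      show "summable (\<lambda>k. q ^ k * measure \<mu> (space \<mu>))"
        using q by (intro summable_mult2 summable_geometric) simp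
      fix k
      have "(LINT t|\<mu>. norm (complex_of_real t ^ k * x ^ k)) \<le> (LINT t|\<mu>. q ^ k)"
        by (rule integral_mono_AE[OF integrable_norm[OF int] _ bound]) simp
      moreover have "0 \<le> (LINT t|\<mu>. norm (complex_of_real t ^ k * x ^ k))" by simp
      ultimately show "norm (LINT t|\<mu>. norm (complex_of_real t ^ k * x ^ k)) \<le> q ^ k * measure \<mu> (space \<mu>)"
        by (simp add: mult.commute)
    qed
  qed
  also have "(LINT t|\<mu>. (\<Sum>k. complex_of_real t ^ k * x ^ k)) = (LINT t|\<mu>. 1 / (1 - x * complex_of_real t))"
  proof (rule integral_cong_AE)
    show "AE t in \<mu>. (\<Sum>k. complex_of_real t ^ k * x ^ k) = 1 / (1 - x * complex_of_real t)"
      using AE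
    proof eventually_elim
      case (elim t)
      have "norm (complex_of_real t * x) < 1" using norm[OF elim] q by linarith
      from suminf_geometric[OF this] show ?case by (simp add: power_mult_distrib mult.commute)
    qed
  qed measurable
  finally show ?thesis by (simp only: integral_mult_left_zero)
qed

lemma eventually_norm_mult_less:
  assumes "0 < R"
  shows "\<forall>\<^sub>F x :: complex in nhds 0. norm x * R < 1"
proof -
  have "\<forall>\<^sub>F x :: complex in nhds 0. x \<in> ball 0 (1 / R)"
    by (rule eventually_nhds_in_open) (use assms in auto)
  then show ?thesis by (rule eventually_mono) (use assms in \<open>auto simp: field_simps\<close>)
qed

lemma moments_fps_expansion:
  assumes L: "borels L" "supported_in R L" and R: "0 < R"
  shows "(\<lambda>x. comb_int L (\<lambda>t. 1 / (1 - x * complex_of_real t))) has_fps_expansion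
     Abs_fps (\<lambda>k. comb_int L (\<lambda>t. complex_of_real t ^ k))"
proof (rule has_fps_expansionI)
  have "(\<lambda>k. comb_int L (\<lambda>t. complex_of_real t ^ k) * x ^ k) sums comb_int L (\<lambda>t. 1 / (1 - x * complex_of_real t))"
    if x: "norm x * R < 1" for x
    using L
  proof (induction L)
    case (Cons a L)
    obtain c \<mu> where a: "a = (c, \<mu>)" by (cases a)
    have "(\<lambda>k. c *\<^sub>R ((LINT t|\<mu>. complex_of_real t ^ k) * x ^ k) + comb_int L (\<lambda>t. complex_of_real t ^ k) * x ^ k) sums
        (c *\<^sub>R (LINT t|\<mu>. 1 / (1 - x * complex_of_real t)) + comb_int L (\<lambda>t. 1 / (1 - x * complex_of_real t)))"
      by (rule sums_add[OF sums_scaleR_right[OF moments_sums[OF _ _ x]]])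
         (use Cons a R in auto)
    then show ?case by (simp add: a scaleR_conv_of_real algebra_simps)
  qed simp
  moreover have "\<forall>\<^sub>F x :: complex in nhds 0. norm x * R < 1"
    by (rule eventually_norm_mult_less[OF R])
  ultimately show "\<forall>\<^sub>F x in nhds 0. (\<lambda>k. fps_nth (Abs_fps (\<lambda>k. comb_int L (\<lambda>t. complex_of_real t ^ k))) k * x ^ k) sums
      comb_int L (\<lambda>t. 1 / (1 - x * complex_of_real t))"
    by (auto elim: eventually_mono)
qed

lemma comb_int_of_real: "comb_int L (\<lambda>t. complex_of_real (f t)) = complex_of_real (comb_int L f)"
  by (induction L) (auto simp: scaleR_conv_of_real)

lemma comb_int_rescale:
  fixes x :: complex
  assumes "x \<noteq> 0"
  shows "x * comb_int L (\<lambda>t. 1 / (1 - x * complex_of_real t)) = comb_int L (\<lambda>t. 1 / (1 / x - complex_of_real t))"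
proof -
  have "1 / (1 / x - complex_of_real t) = x * (1 / (1 - x * complex_of_real t))" for t
  proof -
    have "1 / x - complex_of_real t = (1 - x * complex_of_real t) / x" using assms by (simp add: field_simps)
    then show ?thesis by simp
  qed
  then show ?thesis by (simp only: comb_int_mult)
qed

lemma semicircle_supported:
  assumes \<sigma>: "0 < \<sigma>" and R: "2 * \<sigma> \<le> R"
  shows "measure (semicircle \<sigma>) (- {-R..R}) = 0"
  unfolding semicircle_weighted_arcsine[OF \<sigma>]
  by (rule weighted_arcsine_outside[OF \<sigma> _ semicircle_weight_bound[OF \<sigma>]]) (use R in auto)

lemma outlier_rep_supported:
  assumes \<sigma>: "0 < \<sigma>" and R: "2 * \<sigma> \<le> R" "\<bar>\<theta> + \<sigma>\<^sup>2 / \<theta>\<bar> \<le> R"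
  shows "supported_in R (outlier_rep \<sigma> \<theta>)"
proof -
  obtain B where B: "\<And>t. t \<in> {-2*\<sigma>..2*\<sigma>} \<Longrightarrow> \<bar>nu_weight \<sigma> \<theta> t\<bar> \<le> B" using nu_weight_bounded[OF \<sigma>] by blast
  then have B': "\<And>t. t \<in> {-2*\<sigma>..2*\<sigma>} \<Longrightarrow> \<bar>- nu_weight \<sigma> \<theta> t\<bar> \<le> B" by simp
  have K: "{-2*\<sigma>..2*\<sigma>} \<subseteq> {-R..R}" using R by auto
  have "measure (weighted_arcsine \<sigma> (nu_weight \<sigma> \<theta>)) (- {-R..R}) = 0"
    by (rule weighted_arcsine_outside[OF \<sigma> nu_weight_measurable B K]) auto
  moreover have "measure (weighted_arcsine \<sigma> (\<lambda>t. - nu_weight \<sigma> \<theta> t)) (- {-R..R}) = 0"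
    by (rule weighted_arcsine_outside[OF \<sigma> _ B' K]) auto
  moreover have "measure (return borel (\<theta> + \<sigma>\<^sup>2 / \<theta>)) (- {-R..R}) = 0"
    using R(2) by (subst measure_return) (auto simp: abs_le_iff)
  ultimately show ?thesis by (auto simp: outlier_rep_def nu_rep_def)
qed

text \<open>Written without denominators in the variable \<open>x = 1 / z\<close>, so that the
  identities extend to \<open>x = 0\<close> and carry over to power series. The bound on
  \<open>x\<close> keeps \<open>z\<close> away from the spectrum and the outlier.\<close>

lemma resolvent_identities:
  fixes x :: complex
  assumes \<sigma>: "0 < \<sigma>" and R: "2 * \<sigma> \<le> R" "\<bar>\<theta> + \<sigma>\<^sup>2 / \<theta>\<bar> \<le> R" and x: "norm x * R < 1"
  defines "g \<equiv> x * comb_int [(1, semicircle \<sigma>)] (\<lambda>t. 1 / (1 - x * complex_of_real t))"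
    and "p \<equiv> x * comb_int (outlier_rep \<sigma> \<theta>) (\<lambda>t. 1 / (1 - x * complex_of_real t))"
  shows "g = x * (1 + (of_real \<sigma>)\<^sup>2 * g\<^sup>2)"
    and "(1 - of_real \<theta> * g) * (1 - (of_real \<sigma>)\<^sup>2 * g\<^sup>2) * p = of_real \<theta> * g\<^sup>2"
proof -
  let ?s = "complex_of_real \<sigma>" and ?t = "complex_of_real \<theta>"
  have "g = x * (1 + ?s\<^sup>2 * g\<^sup>2) \<and> (1 - ?t * g) * (1 - ?s\<^sup>2 * g\<^sup>2) * p = ?t * g\<^sup>2"
  proof (cases "x = 0")
    case True
    then show ?thesis by (simp add: g_def p_def)
  next
    case False
    define z where "z = 1 / x"
    have z: "norm z > R" using x False by (simp add: z_def norm_divide field_simps)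
    have "z \<noteq> of_real r" if "\<bar>r\<bar> \<le> R" for r using z that by auto
    moreover have "\<bar>r\<bar> \<le> R" if "r \<in> {-2*\<sigma>..2*\<sigma>}" for r using that R(1) by auto
    ultimately have z': "z \<notin> of_real ` {-2*\<sigma>..2*\<sigma>}" "z \<noteq> of_real (\<theta> + \<sigma>\<^sup>2 / \<theta>)"
      using R(2) by blast+
    obtain w where w: "w \<noteq> 0" "norm w < 1" "z = of_real \<sigma> * (w + 1 / w)"
      using joukowski[OF \<sigma> z'(1)] by blast
    have s0: "?s \<noteq> 0" using \<sigma> by simp
    have w2: "1 - w\<^sup>2 \<noteq> 0" using joukowski_props(1)[OF \<sigma> w] .
    have g: "g = w / ?s"
      using semicircle_cauchy[OF \<sigma> w] unfolding g_def comb_int_rescale[OF False] z_def[symmetric]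
      by (simp add: cauchy_transform_def)
    have p: "p = ?t * w\<^sup>2 / (?s * (1 - w\<^sup>2) * (?s - ?t * w))"
      unfolding p_def comb_int_rescale[OF False] z_def[symmetric]
      by (rule outlier_rep_cauchy[OF \<sigma> w z'(2)])
    have sg: "?s\<^sup>2 * g\<^sup>2 = w\<^sup>2" using s0 by (simp add: g power_divide)
    have nz: "?s - ?t * w \<noteq> 0"
    proof
      assume a: "?s - ?t * w = 0"
      then have "?t \<noteq> 0" using s0 by auto
      moreover from a this have ws: "w = ?s / ?t" by (simp add: field_simps)
      ultimately have "?s * (?s / ?t + 1 / (?s / ?t)) = of_real (\<theta> + \<sigma>\<^sup>2 / \<theta>)"
        using s0 by (simp add: field_simps power2_eq_square)
      then have "z = of_real (\<theta> + \<sigma>\<^sup>2 / \<theta>)" unfolding w(3) ws .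
      then show False using z'(2) by blast
    qed
    have cancel: "(1 - t * (w / s)) * e * (t * w\<^sup>2 / (s * e * (s - t * w))) = t * (w / s)\<^sup>2"
      if "s \<noteq> 0" "e \<noteq> 0" "s - t * w \<noteq> 0" for s t e :: complex
    proof -
      have "1 - t * (w / s) = (s - t * w) / s" using that by (simp add: diff_divide_distrib)
      then show ?thesis using that by (simp add: power_divide power2_eq_square)
    qed
    have "(1 - ?t * g) * (1 - ?s\<^sup>2 * g\<^sup>2) * p = ?t * g\<^sup>2"
      unfolding sg unfolding p g by (rule cancel[OF s0 w2 nz])
    moreover have "g = x * (1 + ?s\<^sup>2 * g\<^sup>2)"
    proof -
      have "x * z = 1" using False by (simp add: z_def)
      have "(1 + w\<^sup>2) = z * (w / ?s)" unfolding w(3) using w(1) s0 by (simp add: field_simps power2_eq_square)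
      then have "x * (1 + w\<^sup>2) = (x * z) * (w / ?s)" by (simp only: mult.assoc)
      then show ?thesis unfolding sg unfolding \<open>x * z = 1\<close> g by simp
    qed
    ultimately show ?thesis by blast
  qed
  then show "g = x * (1 + (of_real \<sigma>)\<^sup>2 * g\<^sup>2)"
    and "(1 - of_real \<theta> * g) * (1 - (of_real \<sigma>)\<^sup>2 * g\<^sup>2) * p = of_real \<theta> * g\<^sup>2" by blast+
qed

section \<open>Generating functions of the moments\<close>

definition semicircle_moment :: "real \<Rightarrow> nat \<Rightarrow> real" where
  "semicircle_moment \<sigma> k = (LINT t|semicircle \<sigma>. t ^ k)"

definition outlier_moment :: "real \<Rightarrow> real \<Rightarrow> nat \<Rightarrow> real" where
  "outlier_moment \<sigma> \<theta> k = comb_int (outlier_rep \<sigma> \<theta>) (\<lambda>t. t ^ k)"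

lemma moment_fps_identities:
  fixes \<sigma> \<theta> :: real
  assumes \<sigma>: "0 < \<sigma>"
  defines "S \<equiv> Abs_fps (\<lambda>k. complex_of_real (semicircle_moment \<sigma> k))"
    and "\<Psi> \<equiv> Abs_fps (\<lambda>k. complex_of_real (outlier_moment \<sigma> \<theta> k))"
    and "c \<equiv> fps_const ((complex_of_real \<sigma>)\<^sup>2)" and "t \<equiv> fps_const (complex_of_real \<theta>)"
  shows "fps_X * S = fps_X * (1 + c * (fps_X * S)\<^sup>2)"
    and "(1 - t * (fps_X * S)) * (1 - c * (fps_X * S)\<^sup>2) * (fps_X * \<Psi>) = t * (fps_X * S)\<^sup>2"
proof -
  define R where "R = max (2 * \<sigma>) \<bar>\<theta> + \<sigma>\<^sup>2 / \<theta>\<bar>"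
  have R: "2 * \<sigma> \<le> R" "\<bar>\<theta> + \<sigma>\<^sup>2 / \<theta>\<bar> \<le> R" "0 < R" using \<sigma> by (auto simp: R_def)
  let ?s = "\<lambda>x. comb_int [(1, semicircle \<sigma>)] (\<lambda>t. 1 / (1 - x * complex_of_real t))"
  let ?p = "\<lambda>x. comb_int (outlier_rep \<sigma> \<theta>) (\<lambda>t. 1 / (1 - x * complex_of_real t))"
  have bs: "borels [(1, semicircle \<sigma>)]" "supported_in R [(1, semicircle \<sigma>)]"
    using borel_prob_finite_borel[OF semicircle_prob[OF \<sigma>]] semicircle_supported[OF \<sigma> R(1)] by auto
  have "S = Abs_fps (\<lambda>k. comb_int [(1, semicircle \<sigma>)] (\<lambda>t. complex_of_real t ^ k))"
    by (simp add: S_def semicircle_moment_def flip: of_real_power)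
  then have S: "?s has_fps_expansion S"
    using moments_fps_expansion[OF bs R(3)] by (simp only:)
  have "\<Psi> = Abs_fps (\<lambda>k. comb_int (outlier_rep \<sigma> \<theta>) (\<lambda>t. complex_of_real t ^ k))"
    by (simp add: \<Psi>_def outlier_moment_def comb_int_of_real flip: of_real_power)
  then have P: "?p has_fps_expansion \<Psi>"
    using moments_fps_expansion[OF borels_outlier_rep[OF \<sigma>] outlier_rep_supported[OF \<sigma> R(1,2)] R(3)] by (simp only:)
  have ev: "\<forall>\<^sub>F x :: complex in nhds 0. norm x * R < 1"
    by (rule eventually_norm_mult_less[OF R(3)])
  let ?g = "\<lambda>x. x * ?s x"
  have G: "?g has_fps_expansion fps_X * S" by (intro fps_expansion_intros S)
  have "(\<lambda>x. x * (1 + (of_real \<sigma>)\<^sup>2 * (?g x)\<^sup>2)) has_fps_expansion fps_X * (1 + c * (fps_X * S)\<^sup>2)"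
    unfolding c_def by (intro fps_expansion_intros G)
  moreover have "?g has_fps_expansion F \<longleftrightarrow> (\<lambda>x. x * (1 + (of_real \<sigma>)\<^sup>2 * (?g x)\<^sup>2)) has_fps_expansion F" for F
    by (rule has_fps_expansion_cong[OF eventually_mono[OF ev] refl]) (rule resolvent_identities(1)[OF \<sigma> R(1,2)])
  ultimately have "?g has_fps_expansion fps_X * (1 + c * (fps_X * S)\<^sup>2)" by blast
  with G show "fps_X * S = fps_X * (1 + c * (fps_X * S)\<^sup>2)" by (rule fps_expansion_unique_complex)
  have "(\<lambda>x. (1 - of_real \<theta> * ?g x) * (1 - (of_real \<sigma>)\<^sup>2 * (?g x)\<^sup>2) * (x * ?p x)) has_fps_expansion
      (1 - t * (fps_X * S)) * (1 - c * (fps_X * S)\<^sup>2) * (fps_X * \<Psi>)"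
    unfolding c_def t_def by (intro fps_expansion_intros G P)
  moreover have "(\<lambda>x. of_real \<theta> * (?g x)\<^sup>2) has_fps_expansion t * (fps_X * S)\<^sup>2"
    unfolding t_def by (intro fps_expansion_intros G)
  moreover have "(\<lambda>x. (1 - of_real \<theta> * ?g x) * (1 - (of_real \<sigma>)\<^sup>2 * (?g x)\<^sup>2) * (x * ?p x)) has_fps_expansion F \<longleftrightarrow>
      (\<lambda>x. of_real \<theta> * (?g x)\<^sup>2) has_fps_expansion F" for F
    by (rule has_fps_expansion_cong[OF eventually_mono[OF ev] refl]) (rule resolvent_identities(2)[OF \<sigma> R(1,2)])
  ultimately show "(1 - t * (fps_X * S)) * (1 - c * (fps_X * S)\<^sup>2) * (fps_X * \<Psi>) = t * (fps_X * S)\<^sup>2"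
    using fps_expansion_unique_complex by blast
qed

text \<open>Differentiating \<open>G = X (1 + c G\<^sup>2)\<close> gives \<open>X\<^sup>2 (1 - c G\<^sup>2) G' = G\<^sup>2\<close>.\<close>

lemma fps_outlier_equation:
  fixes S \<Psi> :: "complex fps" and s \<theta> :: complex
  defines "c \<equiv> fps_const s" and "t \<equiv> fps_const \<theta>" and "G \<equiv> fps_X * S"
  assumes 1: "G = fps_X * (1 + c * G\<^sup>2)"
    and 2: "(1 - t * G) * (1 - c * G\<^sup>2) * (fps_X * \<Psi>) = t * G\<^sup>2"
  shows "\<Psi> = t * (fps_X * fps_deriv G) + t * (fps_X * (S * \<Psi>))"
proof -
  let ?D = "fps_deriv G"
  have "?D = fps_deriv (fps_X * (1 + c * G\<^sup>2))" using 1 by (rule arg_cong)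
  also have "\<dots> = 1 + c * G\<^sup>2 + 2 * c * fps_X * G * ?D"
    by (simp add: c_def power2_eq_square algebra_simps)
  finally have "fps_X * ?D = fps_X * (1 + c * G\<^sup>2 + 2 * c * fps_X * G * ?D)" by (rule arg_cong)
  also have "\<dots> = fps_X * (1 + c * G\<^sup>2) + 2 * c * fps_X\<^sup>2 * G * ?D"
    by (simp add: algebra_simps power2_eq_square)
  finally have XD: "fps_X * ?D = G + 2 * c * fps_X\<^sup>2 * G * ?D" unfolding 1[symmetric] .
  have cG: "fps_X * c * G\<^sup>2 = G - fps_X" using 1 by (simp add: algebra_simps)
  have "fps_X\<^sup>2 * (1 - c * G\<^sup>2) * ?D = fps_X * (fps_X - fps_X * c * G\<^sup>2) * ?D"
    by (simp add: algebra_simps power2_eq_square)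
  also have "\<dots> = 2 * fps_X\<^sup>2 * ?D - fps_X * G * ?D"
    unfolding cG by (simp add: algebra_simps power2_eq_square)
  also have "\<dots> = G\<^sup>2"
  proof -
    have "G * (fps_X * ?D) = G\<^sup>2 + 2 * (fps_X * c * G\<^sup>2) * (fps_X * ?D)"
      by (subst XD) (simp add: algebra_simps power2_eq_square)
    then show ?thesis unfolding cG by (simp add: algebra_simps power2_eq_square)
  qed
  finally have "t * G\<^sup>2 = t * (fps_X\<^sup>2 * (1 - c * G\<^sup>2) * ?D)" by simp
  then have "(fps_X * (1 - c * G\<^sup>2)) * ((1 - t * G) * \<Psi>) = (fps_X * (1 - c * G\<^sup>2)) * (t * (fps_X * ?D))"
    using 2 by (simp add: mult_ac power2_eq_square)
  \<comment> \<open>The constant coefficient 1 makes this factor nonzero, hence cancellable.\<close>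
  moreover have "fps_nth (1 - c * G\<^sup>2) 0 = 1" by (simp add: G_def power2_eq_square)
  then have "1 - c * G\<^sup>2 \<noteq> 0" by (metis fps_zero_nth zero_neq_one)
  ultimately have "(1 - t * G) * \<Psi> = t * (fps_X * ?D)" by simp
  then show ?thesis by (simp add: G_def algebra_simps)
qed

lemma fps_mult_nth_lessThan: "fps_nth (F * G) k = (\<Sum>i<Suc k. fps_nth F i * fps_nth G (k - i))"
  by (simp add: fps_mult_nth atLeast0AtMost lessThan_Suc_atMost)

lemma semicircle_moment_recursion:
  assumes \<sigma>: "0 < \<sigma>"
  shows "semicircle_moment \<sigma> 0 = 1"
    and "semicircle_moment \<sigma> (Suc k) = \<sigma>\<^sup>2 * (\<Sum>c<k. semicircle_moment \<sigma> c * semicircle_moment \<sigma> (k - 1 - c))"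
proof -
  define S where "S = Abs_fps (\<lambda>k. complex_of_real (semicircle_moment \<sigma> k))"
  let ?c = "fps_const ((complex_of_real \<sigma>)\<^sup>2)"
  have "fps_X * S = fps_X * (1 + ?c * (fps_X * S)\<^sup>2)"
    unfolding S_def by (rule moment_fps_identities(1)[OF \<sigma>])
  then have eq: "S = 1 + ?c * (fps_X * (fps_X * (S * S)))" by (simp add: power2_eq_square mult_ac)
  have "fps_nth S 0 = 1" by (subst eq) simp
  then show "semicircle_moment \<sigma> 0 = 1" by (simp add: S_def)
  have "fps_nth S (Suc k) = (of_real \<sigma>)\<^sup>2 * (\<Sum>c<k. fps_nth S c * fps_nth S (k - 1 - c))"
    by (subst eq) (cases k; simp add: fps_mult_nth_lessThan[of S S])
  also have "\<dots> = of_real (\<sigma>\<^sup>2 * (\<Sum>c<k. semicircle_moment \<sigma> c * semicircle_moment \<sigma> (k - 1 - c)))"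
    by (simp add: S_def)
  finally have "complex_of_real (semicircle_moment \<sigma> (Suc k)) =
      of_real (\<sigma>\<^sup>2 * (\<Sum>c<k. semicircle_moment \<sigma> c * semicircle_moment \<sigma> (k - 1 - c)))" by (simp only: S_def fps_nth_Abs_fps)
  then show "semicircle_moment \<sigma> (Suc k) = \<sigma>\<^sup>2 * (\<Sum>c<k. semicircle_moment \<sigma> c * semicircle_moment \<sigma> (k - 1 - c))"
    by (simp only: of_real_eq_iff)
qed

text \<open>This is the recursion demanded by \<open>correction_eq_sum\<close>; it identifies the
  combinatorial correction of one spike with the moments of its outlier measure.\<close>

lemma outlier_moment_recursion:
  assumes \<sigma>: "0 < \<sigma>"
  shows "outlier_moment \<sigma> \<theta> k = \<theta> * real k * semicircle_moment \<sigma> (k - 1) +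
     \<theta> * (\<Sum>q<k. semicircle_moment \<sigma> q * outlier_moment \<sigma> \<theta> (k - 1 - q))"
proof -
  define S where "S = Abs_fps (\<lambda>k. complex_of_real (semicircle_moment \<sigma> k))"
  define \<Psi> where "\<Psi> = Abs_fps (\<lambda>k. complex_of_real (outlier_moment \<sigma> \<theta> k))"
  have eq: "\<Psi> = fps_const (of_real \<theta>) * (fps_X * fps_deriv (fps_X * S)) + fps_const (of_real \<theta>) * (fps_X * (S * \<Psi>))"
    unfolding S_def \<Psi>_def by (rule fps_outlier_equation[OF moment_fps_identities[OF \<sigma>]])
  have "fps_nth \<Psi> k = of_real \<theta> * of_nat k * fps_nth S (k - 1) + of_real \<theta> * (\<Sum>q<k. fps_nth S q * fps_nth \<Psi> (k - 1 - q))"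
    by (subst eq) (cases k; simp add: fps_mult_nth_lessThan[of S \<Psi>] mult.assoc distrib_right)
  also have "\<dots> = of_real (\<theta> * real k * semicircle_moment \<sigma> (k - 1) +
     \<theta> * (\<Sum>q<k. semicircle_moment \<sigma> q * outlier_moment \<sigma> \<theta> (k - 1 - q)))"
    by (simp add: S_def \<Psi>_def)
  finally have "complex_of_real (outlier_moment \<sigma> \<theta> k) = of_real (\<theta> * real k * semicircle_moment \<sigma> (k - 1) +
     \<theta> * (\<Sum>q<k. semicircle_moment \<sigma> q * outlier_moment \<sigma> \<theta> (k - 1 - q)))" by (simp only: \<Psi>_def fps_nth_Abs_fps)
  then show ?thesis by (simp only: of_real_eq_iff)
qed

section \<open>All spikes together\<close>

lemma comb_concat: "comb (concat (map F [1..<Suc n])) A = (\<Sum>j = 1..n. comb (F j) A)"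
proof -
  have "comb (concat (map F xs)) A = (\<Sum>j\<leftarrow>xs. comb (F j) A)" for xs :: "nat list" by (induction xs) auto
  then show ?thesis
    by (simp add: interv_sum_list_conv_sum_set_nat atLeastLessThanSuc_atLeastAtMost del: upt_Suc)
qed

lemma comb_int_concat: "comb_int (concat (map F [1..<Suc n])) f = (\<Sum>j = 1..n. comb_int (F j) f)"
proof -
  have "comb_int (concat (map F xs)) f = (\<Sum>j\<leftarrow>xs. comb_int (F j) f)" for xs :: "nat list" by (induction xs) auto
  then show ?thesis
    by (simp add: interv_sum_list_conv_sum_set_nat atLeastLessThanSuc_atLeastAtMost del: upt_Suc)
qed

definition outlier_list :: "real \<Rightarrow> (nat \<Rightarrow> real) \<Rightarrow> nat \<Rightarrow> (real \<times> real measure) list" where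
  "outlier_list \<sigma> \<theta> n = concat (map (\<lambda>j. outlier_rep \<sigma> (\<theta> j)) [1..<Suc n])"

lemma borels_outlier_list: "0 < \<sigma> \<Longrightarrow> borels (outlier_list \<sigma> \<theta> n)"
  using borels_outlier_rep[of \<sigma>] unfolding outlier_list_def by fastforce

text \<open>The first component remains the semicircle law, so both convolutions use the same
  \<open>F\<close>, and \<open>\<omega>1 = id\<close> leaves the outliers already present unchanged;
  contributions of spikes simply add.\<close>

lemma type_B_convolution_outliers:
  assumes \<sigma>: "0 < \<sigma>"
  shows "(semicircle \<sigma>, \<lambda>_. 0)
          \<boxplus>\<^sub>B (return borel 0, \<lambda>A. (\<Sum>j=1..n. dirac (\<theta> j) A) - real n * dirac 0 A)
          \<boxplus>\<^sub>B (return borel 0, \<lambda>A. dirac (\<theta> (n + 1)) A - dirac 0 A) = (semicircle \<sigma>, comb (outlier_list \<sigma> \<theta> (n + 1)))"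
proof -
  define atoms where "atoms x = [(1 :: real, return borel x), (-1, return borel (0 :: real))]" for x
  define L2 where "L2 = concat (map (\<lambda>j. atoms (\<theta> j)) [1..<Suc n])"
  have L2: "borels L2" by (auto simp: L2_def atoms_def)
  have "(semicircle \<sigma>, comb []) \<boxplus>\<^sub>B (return borel 0, comb L2) = (semicircle \<sigma>, comb (outlier_list \<sigma> \<theta> n))"
  proof (rule type_B_convolution_delta0[OF \<sigma> borels_outlier_list[OF \<sigma>] _ L2])
    fix z :: complex assume z: "Im z > 0"
    show "comb_int (outlier_list \<sigma> \<theta> n) (\<lambda>t. 1 / (z - complex_of_real t)) = comb_int [] (\<lambda>t. 1 / (z - complex_of_real t)) +
       comb_int L2 (\<lambda>t. 1 / (reciprocal_cauchy_transform (semicircle \<sigma>) z - complex_of_real t)) / (1 - (joukowski_inv \<sigma> z)\<^sup>2)"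
      unfolding outlier_list_def L2_def comb_int_concat outlier_rep_subordination[OF \<sigma> z] atoms_def[symmetric] sum_divide_distrib
      by (simp only: comb_int_simps(1) add_0_left)
  qed simp
  moreover have "comb [] = (\<lambda>_. 0)" by (simp add: fun_eq_iff)
  moreover have "comb L2 = (\<lambda>A. (\<Sum>j=1..n. dirac (\<theta> j) A) - real n * dirac 0 A)"
    unfolding L2_def comb_concat[abs_def] by (simp add: fun_eq_iff atoms_def sum_subtractf)
  ultimately have first: "(semicircle \<sigma>, \<lambda>_. 0) \<boxplus>\<^sub>B (return borel 0, \<lambda>A. (\<Sum>j=1..n. dirac (\<theta> j) A) - real n * dirac 0 A) =
      (semicircle \<sigma>, comb (outlier_list \<sigma> \<theta> n))" by (simp only:)
  have "(semicircle \<sigma>, comb (outlier_list \<sigma> \<theta> n)) \<boxplus>\<^sub>B (return borel 0, comb (atoms (\<theta> (n + 1)))) =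
      (semicircle \<sigma>, comb (outlier_list \<sigma> \<theta> (n + 1)))"
  proof (rule type_B_convolution_delta0[OF \<sigma> borels_outlier_list[OF \<sigma>] borels_outlier_list[OF \<sigma>]])
    show "borels (atoms (\<theta> (n + 1)))" by (simp add: atoms_def)
    fix z :: complex assume z: "Im z > 0"
    show "comb_int (outlier_list \<sigma> \<theta> (n + 1)) (\<lambda>t. 1 / (z - complex_of_real t)) = comb_int (outlier_list \<sigma> \<theta> n) (\<lambda>t. 1 / (z - complex_of_real t)) +
       comb_int (atoms (\<theta> (n + 1))) (\<lambda>t. 1 / (reciprocal_cauchy_transform (semicircle \<sigma>) z - complex_of_real t)) / (1 - (joukowski_inv \<sigma> z)\<^sup>2)"
      unfolding atoms_def outlier_rep_subordination[OF \<sigma> z, symmetric]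
      by (simp add: outlier_list_def del: upt_Suc) (simp add: upt_Suc_append)
  qed
  moreover have "comb (atoms (\<theta> (n + 1))) = (\<lambda>A. dirac (\<theta> (n + 1)) A - dirac 0 A)"
    by (simp add: fun_eq_iff atoms_def)
  ultimately show ?thesis unfolding first by (simp only:)
qed

lemma comb_outlier_list:
  assumes \<sigma>: "0 < \<sigma>"
  shows "comb (outlier_list \<sigma> \<theta> n) =
     (\<lambda>A. (\<Sum>j | j \<in> {1..n} \<and> \<bar>\<theta> j\<bar> \<ge> \<sigma>. outlier_weight \<sigma> (\<theta> j) * dirac (\<theta> j + \<sigma>\<^sup>2 / \<theta> j) A) - (\<Sum>j\<in>{1..n}. nu \<sigma> (\<theta> j) A))"
proof
  fix A
  have "comb (outlier_rep \<sigma> \<theta>) A = (if \<bar>\<theta>\<bar> \<ge> \<sigma> then outlier_weight \<sigma> \<theta> * dirac (\<theta> + \<sigma>\<^sup>2 / \<theta>) A else 0) - nu \<sigma> \<theta> A" for \<theta>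
    unfolding outlier_rep_def nu_eq_comb[OF \<sigma>] by (simp add: comb_uminus)
  then show "comb (outlier_list \<sigma> \<theta> n) A =
     (\<Sum>j | j \<in> {1..n} \<and> \<bar>\<theta> j\<bar> \<ge> \<sigma>. outlier_weight \<sigma> (\<theta> j) * dirac (\<theta> j + \<sigma>\<^sup>2 / \<theta> j) A) - (\<Sum>j\<in>{1..n}. nu \<sigma> (\<theta> j) A)"
    unfolding outlier_list_def comb_concat by (simp only: sum_subtractf sum.inter_filter[OF finite_atLeastAtMost])
qed

lemma comb_outside:
  assumes L: "borels L" "supported_in R L" and A: "A \<in> sets borel" "A \<inter> {-R..R} = {}"
  shows "comb L A = 0"
  using L
proof (induction L)
  case (Cons a L)
  obtain c \<mu> where a: "a = (c, \<mu>)" by (cases a)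
  have \<mu>: "finite_measure \<mu>" "sets \<mu> = sets borel" "measure \<mu> (- {-R..R}) = 0" using Cons.prems by (auto simp: a finite_borel_def)
  have "measure \<mu> A \<le> measure \<mu> (- {-R..R})"
    by (rule finite_measure.finite_measure_mono[OF \<mu>(1)]) (use A \<mu>(2) in auto)
  then have "measure \<mu> A = 0" using \<mu>(3) measure_nonneg[of \<mu> A] by linarith
  then show ?case using Cons by (simp add: a)
qed simp

lemma comb_int_poly:
  assumes L: "borels L" "supported_in R L" and R: "0 \<le> R"
  shows "comb_int L (\<lambda>t. poly P (complex_of_real t)) = (\<Sum>k\<le>degree P. coeff P k * of_real (comb_int L (\<lambda>t. t ^ k)))"
  using L
proof (induction L)
  case (Cons a L)
  obtain c \<mu> where a: "a = (c, \<mu>)" by (cases a)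
  interpret finite_measure \<mu> using Cons.prems by (simp add: a finite_borel_def)
  have sets [measurable_cong]: "sets \<mu> = sets borel" using Cons.prems by (simp add: a finite_borel_def)
  have K: "- {-R..R} \<in> sets \<mu>" by (simp add: sets)
  have AE: "AE t in \<mu>. t \<in> {-R..R}"
    by (rule AE_I[OF _ _ K]) (use Cons.prems in \<open>auto simp: a emeasure_eq_measure\<close>)
  have bound: "AE t in \<mu>. norm (complex_of_real t ^ k) \<le> R ^ k" for k
    using AE
  proof eventually_elim
    case (elim t)
    then show ?case by (auto simp: norm_power intro!: power_mono)
  qed
  have int: "integrable \<mu> (\<lambda>t. complex_of_real t ^ k)" for k
    by (rule integrable_const_bound[OF bound]) measurable
  have "(LINT t|\<mu>. poly P (complex_of_real t)) = (\<Sum>k\<le>degree P. coeff P k * (LINT t|\<mu>. complex_of_real t ^ k))"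
    unfolding poly_altdef by (subst Bochner_Integration.integral_sum) (auto intro!: int)
  also have "\<dots> = (\<Sum>k\<le>degree P. coeff P k * of_real (LINT t|\<mu>. t ^ k))"
    by (simp flip: of_real_power)
  finally have "(LINT t|\<mu>. poly P (complex_of_real t)) = (\<Sum>k\<le>degree P. coeff P k * of_real (LINT t|\<mu>. t ^ k))" .
  then show ?case using Cons
    by (simp add: a scaleR_conv_of_real sum_distrib_left sum.distrib algebra_simps)
qed simp

lemma has_type_B_distribution_outliers:
  fixes M :: "nat \<Rightarrow> 'a measure"
  assumes \<sigma>: "0 < \<sigma>" and A: "type_B_functionals M A
     (\<lambda>P. \<Sum>k\<le>degree P. coeff P k * of_real (semicircle_moment \<sigma> k))
     (\<lambda>P. \<Sum>k\<le>degree P. coeff P k * of_real (\<Sum>j = 1..n. outlier_moment \<sigma> (\<theta> j) k))"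
  shows "has_type_B_distribution M A (semicircle \<sigma>, comb (outlier_list \<sigma> \<theta> n))"
proof -
  let ?L = "outlier_list \<sigma> \<theta> n"
  \<comment> \<open>A common radius for the semicircle law and all outliers.\<close>
  define R where "R = 2 * \<sigma> + (\<Sum>j = 1..n. \<bar>\<theta> j + \<sigma>\<^sup>2 / \<theta> j\<bar>)"
  have "0 \<le> (\<Sum>j = 1..n. \<bar>\<theta> j + \<sigma>\<^sup>2 / \<theta> j\<bar>)" by (intro sum_nonneg) simp
  then have R: "2 * \<sigma> \<le> R" "0 \<le> R" using \<sigma> by (simp_all add: R_def)
  have "\<bar>\<theta> j + \<sigma>\<^sup>2 / \<theta> j\<bar> \<le> R" if "j \<in> {1..n}" for j
    using member_le_sum[OF that, of "\<lambda>j. \<bar>\<theta> j + \<sigma>\<^sup>2 / \<theta> j\<bar>"] \<sigma> by (simp add: R_def)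
  then have "supported_in R (outlier_rep \<sigma> (\<theta> j))" if "j \<in> {1..n}" for j
    using that by (intro outlier_rep_supported[OF \<sigma> R(1)])
  then have sup: "supported_in R ?L" unfolding outlier_list_def set_concat by fastforce
  note L = borels_outlier_list[OF \<sigma>, of \<theta> n]
  note sc = borel_prob_finite_borel[OF semicircle_prob[OF \<sigma>]]
  have sc_sup: "measure (semicircle \<sigma>) (- {-R..R}) = 0" by (rule semicircle_supported[OF \<sigma> R(1)])
  have cont: "continuous_on UNIV (\<lambda>t. poly P (complex_of_real t))" for P by (intro continuous_intros)
  have poly: "signed_integral (comb ?L) (\<lambda>t. poly P (complex_of_real t)) =
     (\<Sum>k\<le>degree P. coeff P k * of_real (\<Sum>j = 1..n. outlier_moment \<sigma> (\<theta> j) k))" for P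
  proof -
    have "compact ((\<lambda>t. poly P (complex_of_real t)) ` {-R..R})"
      by (rule compact_continuous_image[OF continuous_on_subset[OF cont]]) auto
    then obtain B where B: "\<And>t. t \<in> {-R..R} \<Longrightarrow> norm (poly P (complex_of_real t)) \<le> B"
      using compact_imp_bounded by (metis bounded_iff imageI)
    have "signed_integral (comb ?L) (\<lambda>t. poly P (complex_of_real t)) = comb_int ?L (\<lambda>t. poly P (complex_of_real t))"
      by (rule signed_integral_comb[where K = "{-R..R}", OF jordan_decomposition_exists[OF finite_signed_measure_comb[OF L]] refl L _ _
            borel_measurable_continuous_onI[OF cont] B])
         (use sup in auto)
    also have "\<dots> = (\<Sum>k\<le>degree P. coeff P k * of_real (comb_int ?L (\<lambda>t. t ^ k)))"
      by (rule comb_int_poly[OF L sup R(2)])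
    also have "\<dots> = (\<Sum>k\<le>degree P. coeff P k * of_real (\<Sum>j = 1..n. outlier_moment \<sigma> (\<theta> j) k))"
      by (simp only: outlier_list_def comb_int_concat outlier_moment_def)
    finally show ?thesis .
  qed
  have sc_poly: "(LINT t|semicircle \<sigma>. poly P (complex_of_real t)) =
     (\<Sum>k\<le>degree P. coeff P k * of_real (semicircle_moment \<sigma> k))" for P
    using comb_int_poly[of "[(1, semicircle \<sigma>)]" R P] sc sc_sup R(2) by (simp add: semicircle_moment_def)
  have "comb ?L UNIV = 0"
  proof -
    have "comb (outlier_rep \<sigma> \<theta>) UNIV = 0" for \<theta>
      using nu_rep_mass[OF \<sigma>, of \<theta>] by (simp add: outlier_rep_def comb_uminus measure_return)
    then show ?thesis unfolding outlier_list_def comb_concat by simp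
  qed
  moreover have "compactly_supported (semicircle \<sigma>)"
    unfolding compactly_supported_def using sc sc_sup
    by (intro exI[of _ "{-R..R}"]) (auto simp: finite_borel_def finite_measure.emeasure_eq_measure)
  moreover have "signed_compactly_supported (comb ?L)"
    unfolding signed_compactly_supported_def using comb_outside[OF L sup]
    by (intro exI[of _ "{-R..R}"]) auto
  ultimately show ?thesis
    unfolding has_type_B_distribution_def prod.case poly sc_poly
    using A semicircle_prob[OF \<sigma>] finite_signed_measure_comb[OF L] by blast
qed

section \<open>Sign, mass and Jordan decomposition of the individual measures nu\<close>

lemma measure_weighted_arcsine:
  assumes \<sigma>: "0 < \<sigma>" and g: "g \<in> borel_measurable borel" "\<And>t. t \<in> {-2*\<sigma>..2*\<sigma>} \<Longrightarrow> \<bar>g t\<bar> \<le> B" and A: "A \<in> sets borel"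
  shows "measure (weighted_arcsine \<sigma> g) A = (LINT t|arcsine \<sigma>. max 0 (g t) * indicator A t)"
proof -
  have "space (weighted_arcsine \<sigma> g) = UNIV"
    by (rule finite_borel_space[OF weighted_arcsine_finite[OF \<sigma> g]])
  then have "measure (weighted_arcsine \<sigma> g) A = (LINT t|weighted_arcsine \<sigma> g. indicator A t)" by simp
  also have "\<dots> = (LINT t|arcsine \<sigma>. max 0 (g t) *\<^sub>R indicator A t)"
    by (rule weighted_arcsine_integral[OF \<sigma> g]) (use A in measurable)
  finally show ?thesis by simp
qed

lemma arcsine_integral_cong:
  fixes f g :: "real \<Rightarrow> real"
  assumes \<sigma>: "0 < \<sigma>" and "f \<in> borel_measurable borel" "g \<in> borel_measurable borel"
    and "\<And>t. t \<in> {-2*\<sigma><..<2*\<sigma>} \<Longrightarrow> f t = g t"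
  shows "(LINT t|arcsine \<sigma>. f t) = (LINT t|arcsine \<sigma>. g t)"
  using assms(2-3) eventually_mono[OF arcsine_AE[OF \<sigma>] assms(4)]
  by (intro integral_cong_AE) (simp_all add: arcsine_def)

lemma nu_arcsine:
  assumes \<sigma>: "0 < \<sigma>"
  shows "nu \<sigma> \<theta> A = (if A \<in> sets borel then LINT t|arcsine \<sigma>. nu_weight \<sigma> \<theta> t * indicator A t else 0)"
  unfolding nu_def nu_density_eq[abs_def] by (rule signed_density_arcsine[OF \<sigma> nu_weight_measurable])

text \<open>The denominator is negative inside the interval, so the numerator alone decides the
  sign.\<close>

lemma nu_weight_nonneg_iff:
  assumes \<sigma>: "0 < \<sigma>" and t: "t \<in> {-2*\<sigma><..<2*\<sigma>}"
  shows "0 \<le> nu_weight \<sigma> \<theta> t \<longleftrightarrow> \<theta> * (t - 2 * \<theta>) \<le> 0"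
proof -
  have "\<theta> * (t - \<theta>) - \<sigma>\<^sup>2 < 0" by (rule nu_denominator_nonzero[OF \<sigma> t])
  moreover have "0 \<le> x / (2 * y) \<longleftrightarrow> x \<le> 0" if "y < 0" for x y :: real
    using that by (auto simp: zero_le_divide_iff)
  ultimately show ?thesis unfolding nu_weight_def by blast
qed

lemma nu_density_integrable:
  assumes \<sigma>: "0 < \<sigma>"
  shows "integrable lborel (nu_density \<sigma> \<theta>)"
proof -
  obtain B where B: "\<And>t. t \<in> {-2*\<sigma>..2*\<sigma>} \<Longrightarrow> \<bar>nu_weight \<sigma> \<theta> t\<bar> \<le> B" using nu_weight_bounded[OF \<sigma>] by blast
  have "integrable (arcsine \<sigma>) (nu_weight \<sigma> \<theta>)"
    by (rule arcsine_integrable[OF \<sigma> nu_weight_measurable]) (use B in auto)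
  then show ?thesis
    unfolding arcsine_eq_density[OF \<sigma>] nu_density_eq[abs_def]
    by (subst (asm) integrable_density) (auto simp: arcsine_density_nonneg)
qed

lemma nu_prob:
  assumes \<sigma>: "0 < \<sigma>" and \<theta>: "\<sigma> < \<bar>\<theta>\<bar>"
  shows "\<exists>P. borel_prob P \<and> nu \<sigma> \<theta> = measure P"
proof -
  obtain B where B: "\<And>t. t \<in> {-2*\<sigma>..2*\<sigma>} \<Longrightarrow> \<bar>nu_weight \<sigma> \<theta> t\<bar> \<le> B" using nu_weight_bounded[OF \<sigma>] by blast
  let ?P = "weighted_arcsine \<sigma> (nu_weight \<sigma> \<theta>)"
  have fin: "finite_borel ?P" by (rule weighted_arcsine_finite[OF \<sigma> nu_weight_measurable B])
  then interpret finite_measure ?P by (simp add: finite_borel_def)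
  \<comment> \<open>Here \<open>\<bar>t\<bar> < 2 * \<sigma> < 2 * \<bar>\<theta>\<bar>\<close>, so
    the numerator \<open>\<theta> * (t - 2 * \<theta>)\<close> does not change sign.\<close>
  have pos: "0 \<le> nu_weight \<sigma> \<theta> t" if t: "t \<in> {-2*\<sigma><..<2*\<sigma>}" for t
  proof -
    have "\<theta> * t \<le> \<bar>\<theta>\<bar> * \<bar>t\<bar>" using abs_ge_self[of "\<theta> * t"] by (simp only: abs_mult)
    also have "\<dots> \<le> \<bar>\<theta>\<bar> * (2 * \<bar>\<theta>\<bar>)" using t \<theta> by (intro mult_left_mono) auto
    also have "\<dots> = 2 * (\<theta> * \<theta>)" by (simp add: abs_mult_self_eq)
    finally show ?thesis unfolding nu_weight_nonneg_iff[OF \<sigma> t] by (simp add: algebra_simps)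
  qed
  have eq: "nu \<sigma> \<theta> = measure ?P"
  proof
    fix A
    show "nu \<sigma> \<theta> A = measure ?P A"
    proof (cases "A \<in> sets borel")
      case True
      then have [measurable]: "A \<in> sets borel" .
      have "(LINT t|arcsine \<sigma>. nu_weight \<sigma> \<theta> t * indicator A t) = (LINT t|arcsine \<sigma>. max 0 (nu_weight \<sigma> \<theta> t) * indicator A t)"
        by (rule arcsine_integral_cong[OF \<sigma>]) (use pos in auto)
      then show ?thesis
        using True measure_weighted_arcsine[OF \<sigma> nu_weight_measurable B True] by (simp add: nu_arcsine[OF \<sigma>])
    next
      case False
      then show ?thesis using fin by (simp add: nu_arcsine[OF \<sigma>] finite_borel_def measure_notin_sets)
    qed
  qed
  have "measure ?P UNIV = 1"
    using nu_rep_mass[OF \<sigma>, of \<theta>] \<theta> unfolding eq[symmetric] nu_eq_comb[OF \<sigma>] by (simp add: outlier_weight_def)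
  then have "borel_prob ?P"
    unfolding borel_prob_def using fin
    by (auto intro!: prob_spaceI simp: finite_borel_space[OF fin] emeasure_eq_measure finite_borel_def)
  with eq show ?thesis by blast
qed

lemma nu_critical:
  assumes \<sigma>: "0 < \<sigma>" and \<theta>: "\<bar>\<theta>\<bar> = \<sigma>"
  shows "nu \<sigma> \<theta> = (\<lambda>A. measure (arcsine \<sigma>) A / 2)"
proof
  fix A
  show "nu \<sigma> \<theta> A = measure (arcsine \<sigma>) A / 2"
  proof (cases "A \<in> sets borel")
    case True
    then have [measurable]: "A \<in> sets borel" .
    have "\<theta>\<^sup>2 = \<sigma>\<^sup>2" using \<theta> by (metis power2_abs)
    then have "nu_weight \<sigma> \<theta> t = 1 / 2" if "t \<in> {-2*\<sigma><..<2*\<sigma>}" for t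
      using nu_weight_eq[of \<theta> t \<sigma>] nu_denominator_nonzero[OF \<sigma> that, of \<theta>] by simp
    then have "(LINT t|arcsine \<sigma>. nu_weight \<sigma> \<theta> t * indicator A t) = (LINT t|arcsine \<sigma>. 1 / 2 * indicator A t)"
      by (intro arcsine_integral_cong[OF \<sigma>]) auto
    also have "\<dots> = 1 / 2 * (LINT t|arcsine \<sigma>. indicator A t)" by (rule integral_mult_right_zero)
    also have "\<dots> = measure (arcsine \<sigma>) A / 2"
      using finite_borel_space[OF borel_prob_finite_borel[OF arcsine_prob]] by simp
    finally show ?thesis using True by (simp add: nu_arcsine[OF \<sigma>])
  next
    case False
    then show ?thesis by (simp add: nu_arcsine[OF \<sigma>] measure_notin_sets arcsine_def)
  qed
qed

lemma nu_jordan_decomposition: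
  assumes \<sigma>: "0 < \<sigma>"
  shows "jordan_decomposition (nu \<sigma> \<theta>) (weighted_arcsine \<sigma> (nu_weight \<sigma> \<theta>)) (weighted_arcsine \<sigma> (\<lambda>t. - nu_weight \<sigma> \<theta> t))"
proof -
  obtain B where B: "\<And>t. t \<in> {-2*\<sigma>..2*\<sigma>} \<Longrightarrow> \<bar>nu_weight \<sigma> \<theta> t\<bar> \<le> B" using nu_weight_bounded[OF \<sigma>] by blast
  then have B': "\<And>t. t \<in> {-2*\<sigma>..2*\<sigma>} \<Longrightarrow> \<bar>- nu_weight \<sigma> \<theta> t\<bar> \<le> B" by simp
  have m: "(\<lambda>t. - nu_weight \<sigma> \<theta> t) \<in> borel_measurable borel" by measurable
  note fin = weighted_arcsine_finite[OF \<sigma> nu_weight_measurable B] weighted_arcsine_finite[OF \<sigma> m B']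
  let ?D = "{t. 0 < nu_weight \<sigma> \<theta> t}"
  have D: "?D \<in> sets borel" by measurable
  then have D': "- ?D \<in> sets borel" by simp
  have "(\<lambda>t. max 0 (nu_weight \<sigma> \<theta> t) * indicator (- ?D) t) = (\<lambda>_. 0)"
    by (auto simp: fun_eq_iff split: split_indicator)
  moreover have "measure (weighted_arcsine \<sigma> (nu_weight \<sigma> \<theta>)) (- ?D) =
      (LINT t|arcsine \<sigma>. max 0 (nu_weight \<sigma> \<theta> t) * indicator (- ?D) t)"
    by (rule measure_weighted_arcsine[OF \<sigma> nu_weight_measurable B D'])
  ultimately have "measure (weighted_arcsine \<sigma> (nu_weight \<sigma> \<theta>)) (- ?D) = 0" by (simp only: integral_zero)
  moreover have "measure (weighted_arcsine \<sigma> (\<lambda>t. - nu_weight \<sigma> \<theta> t)) ?D = 0"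
  proof -
    have "(\<lambda>t. max 0 (- nu_weight \<sigma> \<theta> t) * indicator ?D t) = (\<lambda>_. 0)"
      by (auto simp: fun_eq_iff split: split_indicator)
    moreover have "measure (weighted_arcsine \<sigma> (\<lambda>t. - nu_weight \<sigma> \<theta> t)) ?D =
        (LINT t|arcsine \<sigma>. max 0 (- nu_weight \<sigma> \<theta> t) * indicator ?D t)"
      by (rule measure_weighted_arcsine[OF \<sigma> m B' D])
    ultimately show ?thesis by (simp only: integral_zero)
  qed
  moreover have "nu \<sigma> \<theta> A = measure (weighted_arcsine \<sigma> (nu_weight \<sigma> \<theta>)) A - measure (weighted_arcsine \<sigma> (\<lambda>t. - nu_weight \<sigma> \<theta> t)) A" for A
    by (simp add: nu_eq_comb[OF \<sigma>] nu_rep_def)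
  ultimately show ?thesis
    unfolding jordan_decomposition_def using fin D unfolding finite_borel_def by blast
qed

text \<open>The set \<open>S\<close> has to describe the sign only inside the open interval, up to a
  null set of the arcsine law; thus one argument serves the half-intervals of both signs of
  \<open>\<theta>\<close>.\<close>

lemma measure_nu_positive_part:
  assumes \<sigma>: "0 < \<sigma>" and S: "S \<in> sets borel"
    and sign: "\<And>t. t \<in> {-2*\<sigma><..<2*\<sigma>} \<Longrightarrow> t \<in> S \<longleftrightarrow> \<theta> * (t - 2 * \<theta>) \<le> 0"
  shows "measure (weighted_arcsine \<sigma> (nu_weight \<sigma> \<theta>)) = signed_density (\<lambda>t. indicator S t * nu_density \<sigma> \<theta> t)"
proof
  fix A
  note [measurable] = S
  obtain B where B: "\<And>t. t \<in> {-2*\<sigma>..2*\<sigma>} \<Longrightarrow> \<bar>nu_weight \<sigma> \<theta> t\<bar> \<le> B" using nu_weight_bounded[OF \<sigma>] by blast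
  have fin: "finite_borel (weighted_arcsine \<sigma> (nu_weight \<sigma> \<theta>))" by (rule weighted_arcsine_finite[OF \<sigma> nu_weight_measurable B])
  have "(\<lambda>t. indicator S t * nu_density \<sigma> \<theta> t) = (\<lambda>t. arcsine_density \<sigma> t * (indicator S t * nu_weight \<sigma> \<theta> t))"
    by (simp add: nu_density_eq mult_ac)
  moreover have "(\<lambda>t. indicator S t * nu_weight \<sigma> \<theta> t) \<in> borel_measurable borel" by measurable
  ultimately have sd: "signed_density (\<lambda>t. indicator S t * nu_density \<sigma> \<theta> t) A =
      (if A \<in> sets borel then LINT t|arcsine \<sigma>. (indicator S t * nu_weight \<sigma> \<theta> t) * indicator A t else 0)"
    by (simp only: signed_density_arcsine[OF \<sigma>])
  show "measure (weighted_arcsine \<sigma> (nu_weight \<sigma> \<theta>)) A = signed_density (\<lambda>t. indicator S t * nu_density \<sigma> \<theta> t) A"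
  proof (cases "A \<in> sets borel")
    case True
    then have [measurable]: "A \<in> sets borel" .
    have "max 0 (nu_weight \<sigma> \<theta> t) = indicator S t * nu_weight \<sigma> \<theta> t" if "t \<in> {-2*\<sigma><..<2*\<sigma>}" for t
      using sign[OF that] nu_weight_nonneg_iff[OF \<sigma> that, of \<theta>] by (auto split: split_indicator)
    then have "(LINT t|arcsine \<sigma>. max 0 (nu_weight \<sigma> \<theta> t) * indicator A t) =
        (LINT t|arcsine \<sigma>. (indicator S t * nu_weight \<sigma> \<theta> t) * indicator A t)"
      by (intro arcsine_integral_cong[OF \<sigma>]) auto
    moreover have "measure (weighted_arcsine \<sigma> (nu_weight \<sigma> \<theta>)) A = (LINT t|arcsine \<sigma>. max 0 (nu_weight \<sigma> \<theta> t) * indicator A t)"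
      by (rule measure_weighted_arcsine[OF \<sigma> nu_weight_measurable B True])
    ultimately show ?thesis unfolding sd using True by simp
  next
    case False
    then show ?thesis unfolding sd using fin by (simp add: finite_borel_def measure_notin_sets)
  qed
qed

lemma nu_properties:
  assumes \<sigma>: "0 < \<sigma>"
  shows "integrable lborel (nu_density \<sigma> \<theta>) \<and> finite_signed_measure (nu \<sigma> \<theta>) \<and>
          (\<bar>\<theta>\<bar> > \<sigma> \<longrightarrow> (\<exists>P. borel_prob P \<and> nu \<sigma> \<theta> = measure P)) \<and>
          (\<bar>\<theta>\<bar> = \<sigma> \<longrightarrow> (\<exists>P. borel_prob P \<and> nu \<sigma> \<theta> = (\<lambda>A. measure P A / 2))) \<and>
          (\<bar>\<theta>\<bar> < \<sigma> \<longrightarrow> nu \<sigma> \<theta> UNIV = 0 \<and>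
             (\<exists>\<nu>p \<nu>m. jordan_decomposition (nu \<sigma> \<theta>) \<nu>p \<nu>m \<and>
                (\<theta> > 0 \<longrightarrow>
                   measure \<nu>p = signed_density (\<lambda>t. indicator {-2*\<sigma>..2*\<theta>} t * nu_density \<sigma> \<theta> t)) \<and>
                (\<theta> < 0 \<longrightarrow>
                   measure \<nu>p = signed_density (\<lambda>t. indicator {2*\<theta>..2*\<sigma>} t * nu_density \<sigma> \<theta> t))))"
proof -
  let ?p = "weighted_arcsine \<sigma> (nu_weight \<sigma> \<theta>)"
  have "finite_signed_measure (nu \<sigma> \<theta>)"
    unfolding nu_eq_comb[OF \<sigma>] by (rule finite_signed_measure_comb[OF borels_nu_rep[OF \<sigma>]])
  moreover have "nu \<sigma> \<theta> UNIV = 0" if "\<bar>\<theta>\<bar> < \<sigma>"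
    using nu_rep_mass[OF \<sigma>, of \<theta>] that by (simp add: nu_eq_comb[OF \<sigma>])
  moreover have "measure ?p = signed_density (\<lambda>t. indicator {-2*\<sigma>..2*\<theta>} t * nu_density \<sigma> \<theta> t)"
    if "\<theta> > 0" using that by (intro measure_nu_positive_part[OF \<sigma>]) (auto simp: mult_le_0_iff)
  moreover have "measure ?p = signed_density (\<lambda>t. indicator {2*\<theta>..2*\<sigma>} t * nu_density \<sigma> \<theta> t)"
    if "\<theta> < 0" using that by (intro measure_nu_positive_part[OF \<sigma>]) (auto simp: mult_le_0_iff)
  ultimately show ?thesis
    using nu_density_integrable[OF \<sigma>] nu_prob[OF \<sigma>, of \<theta>] nu_critical[OF \<sigma>, of \<theta>] arcsine_prob[of \<sigma>]
      nu_jordan_decomposition[OF \<sigma>, of \<theta>]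
    by blast
qed

theorem corollary1p19:
  fixes \<sigma> :: real and b :: "nat \<Rightarrow> nat" and N0 :: nat and \<theta> :: "nat \<Rightarrow> real"
    and M :: "nat \<Rightarrow> 'a measure" and X :: "nat \<Rightarrow> 'a \<Rightarrow> complex mat"
  assumes "\<sigma> > 0"
    and "filterlim (\<lambda>N. real (b N) / sqrt (real N)) at_top sequentially"
    and "\<And>N. N \<ge> 1 \<Longrightarrow> GUE (M N) N (\<sigma>\<^sup>2) (X N)"
  shows
    "has_type_B_distribution M (\<lambda>N \<omega>. band_matrix N (b N) (X N \<omega>) + deformation N0 \<theta> N)
       ((semicircle \<sigma>, \<lambda>_. 0)
          \<boxplus>\<^sub>B (return borel 0, \<lambda>A. (\<Sum>j=1..N0. dirac (\<theta> j) A) - real N0 * dirac 0 A)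
          \<boxplus>\<^sub>B (return borel 0, \<lambda>A. dirac (\<theta> (N0 + 1)) A - dirac 0 A))
     \<and> (semicircle \<sigma>, \<lambda>_. 0)
          \<boxplus>\<^sub>B (return borel 0, \<lambda>A. (\<Sum>j=1..N0. dirac (\<theta> j) A) - real N0 * dirac 0 A)
          \<boxplus>\<^sub>B (return borel 0, \<lambda>A. dirac (\<theta> (N0 + 1)) A - dirac 0 A)
       = (semicircle \<sigma>,
          \<lambda>A. (\<Sum>j | j \<in> {1..N0 + 1} \<and> \<bar>\<theta> j\<bar> \<ge> \<sigma>.
                 outlier_weight \<sigma> (\<theta> j) * dirac (\<theta> j + \<sigma>\<^sup>2 / \<theta> j) A)
              - (\<Sum>j\<in>{1..N0 + 1}. nu \<sigma> (\<theta> j) A))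
     \<and> (\<forall>j\<in>{1..N0 + 1}.
          integrable lborel (nu_density \<sigma> (\<theta> j)) \<and> finite_signed_measure (nu \<sigma> (\<theta> j)) \<and>
          (\<bar>\<theta> j\<bar> > \<sigma> \<longrightarrow> (\<exists>P. borel_prob P \<and> nu \<sigma> (\<theta> j) = measure P)) \<and>
          (\<bar>\<theta> j\<bar> = \<sigma> \<longrightarrow> (\<exists>P. borel_prob P \<and> nu \<sigma> (\<theta> j) = (\<lambda>A. measure P A / 2))) \<and>
          (\<bar>\<theta> j\<bar> < \<sigma> \<longrightarrow> nu \<sigma> (\<theta> j) UNIV = 0 \<and>
             (\<exists>\<nu>p \<nu>m. jordan_decomposition (nu \<sigma> (\<theta> j)) \<nu>p \<nu>m \<and>
                (\<theta> j > 0 \<longrightarrow>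
                   measure \<nu>p = signed_density (\<lambda>t. indicator {-2*\<sigma>..2*\<theta> j} t * nu_density \<sigma> (\<theta> j) t)) \<and>
                (\<theta> j < 0 \<longrightarrow>
                   measure \<nu>p = signed_density (\<lambda>t. indicator {2*\<theta> j..2*\<sigma>} t * nu_density \<sigma> (\<theta> j) t)))))"
proof -
  let ?D = "(semicircle \<sigma>, \<lambda>_. 0)
          \<boxplus>\<^sub>B (return borel 0, \<lambda>A. (\<Sum>j=1..N0. dirac (\<theta> j) A) - real N0 * dirac 0 A)
          \<boxplus>\<^sub>B (return borel 0, \<lambda>A. dirac (\<theta> (N0 + 1)) A - dirac 0 A)"
  let ?m = "semicircle_moment \<sigma>"
  have D: "?D = (semicircle \<sigma>, comb (outlier_list \<sigma> \<theta> (N0 + 1)))"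
    by (rule type_B_convolution_outliers[OF assms(1)])
  have "correction ?m (\<lambda>e. \<theta> (Suc e)) N0 k = (\<Sum>j = 1..N0 + 1. outlier_moment \<sigma> (\<theta> j) k)" for k
  proof -
    have "correction ?m (\<lambda>e. \<theta> (Suc e)) N0 k = (\<Sum>e\<le>N0. outlier_moment \<sigma> (\<theta> (Suc e)) k)"
      by (rule correction_eq_sum) (rule outlier_moment_recursion[OF assms(1)])
    also have "\<dots> = (\<Sum>j = 1..N0 + 1. outlier_moment \<sigma> (\<theta> j) k)"
      by (simp add: sum.atLeast_Suc_atMost_Suc_shift atLeast0AtMost del: sum.cl_ivl_Suc)
    finally show ?thesis .
  qed
  note correction = this
  have "type_B_functionals M (\<lambda>N \<omega>. band_matrix N (b N) (X N \<omega>) + deformation N0 \<theta> N)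
     (\<lambda>P. \<Sum>k\<le>degree P. coeff P k * of_real (?m k))
     (\<lambda>P. \<Sum>k\<le>degree P. coeff P k * of_real (correction ?m (\<lambda>e. \<theta> (Suc e)) N0 k))"
    by (rule deformed_band_functionals[OF assms(1,2) _ semicircle_moment_recursion[OF assms(1)]]) (rule assms(3))
  from this[unfolded correction]
  have "has_type_B_distribution M (\<lambda>N \<omega>. band_matrix N (b N) (X N \<omega>) + deformation N0 \<theta> N) ?D"
    unfolding D by (rule has_type_B_distribution_outliers[OF assms(1)])
  moreover have "?D = (semicircle \<sigma>,
          \<lambda>A. (\<Sum>j | j \<in> {1..N0 + 1} \<and> \<bar>\<theta> j\<bar> \<ge> \<sigma>.
                 outlier_weight \<sigma> (\<theta> j) * dirac (\<theta> j + \<sigma>\<^sup>2 / \<theta> j) A)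
              - (\<Sum>j\<in>{1..N0 + 1}. nu \<sigma> (\<theta> j) A))"
    unfolding D comb_outlier_list[OF assms(1)] ..
  ultimately show ?thesis by (intro conjI ballI nu_properties[OF assms(1)])
qed

end
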